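(* Let $M$ be a two-dimensional manifold with a complete real analytic Riemannian metric $g$ with Gauss curvature $\sigma$, and let $R\in(0,\infty]$. If the adapted complex structure of $g$ is defined on $T^RM$, then on $M$ $$32\,\sigma^3+6\,\Delta(\sigma^2)+\left(3\,\Delta\sigma+48\,\sigma^2\right)\frac{\pi^2}{R^2}+18\,\sigma\,\frac{\pi^4}{R^4}+2\,\frac{\pi^6}{R^6}\;\ge\;27\,\|\operatorname{Grad}\sigma\|^2 ,$$ where for $R=\infty$ the terms containing powers of $\pi/R$ are $0$.
   Context: $T^RM=\{\mathrm{v}\in TM : \sqrt{g(\mathrm{v},\mathrm{v})}<R\}$. The adapted complex structure on $T^RM$ (Lempert–Szőke) is the complex structure such that for every unit-speed geodesic $\gamma\colon\mathbb{R}\to M$ the map $x+\sqrt{-1}\,y\mapsto y\,\dot\gamma(x)$ is holomorphic from $\{|y|<R\}\subset\mathbb{C}$ to $T^RM$. $\Delta$ is the Laplacian of $g$ (trace of the Hessian) and $\operatorname{Grad}$ is the gradient. *)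

theory Defs
  imports "HOL-Analysis.Analysis"
begin

section \<open>Regularity of functions on Euclidean domains\<close>

abbreviation deriv_at :: "('a::real_normed_vector \<Rightarrow> 'b::real_normed_vector) \<Rightarrow> 'a \<Rightarrow> 'a \<Rightarrow> 'b"
  where "deriv_at f x \<equiv> frechet_derivative f (at x)"

definition partial :: "'n::finite \<Rightarrow> (real^'n \<Rightarrow> real) \<Rightarrow> real^'n \<Rightarrow> real"
  where "partial i f x = deriv_at f x (axis i 1)"

primrec Ck_on :: "nat \<Rightarrow> ('a::real_normed_vector \<Rightarrow> 'b::real_normed_vector) \<Rightarrow> 'a set \<Rightarrow> bool"
  where
    "Ck_on 0 f S \<longleftrightarrow> continuous_on S f"
  | "Ck_on (Suc k) f S \<longleftrightarrow>
       (\<forall>x\<in>S. f differentiable (at x)) \<and> (\<forall>v. Ck_on k (\<lambda>x. deriv_at f x v) S)"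

definition smooth_on :: "('a::real_normed_vector \<Rightarrow> 'b::real_normed_vector) \<Rightarrow> 'a set \<Rightarrow> bool"
  where "smooth_on f S \<longleftrightarrow> open S \<and> (\<forall>k. Ck_on k f S)"

text \<open>Local expansion at every point into a power series in several variables; the
  coefficients are indexed by multi-indices \<open>\<alpha> :: 'n \<Rightarrow> nat\<close>, the sum being unconditional.\<close>

definition real_analytic_on :: "(real^'n \<Rightarrow> real) \<Rightarrow> (real^'n) set \<Rightarrow> bool"
  where "real_analytic_on f S \<longleftrightarrow> open S \<and>
    (\<forall>p\<in>S. \<exists>r>0. \<exists>a :: ('n \<Rightarrow> nat) \<Rightarrow> real. \<forall>h. norm h < r \<longrightarrow>
       ((\<lambda>\<alpha>. a \<alpha> * (\<Prod>i\<in>UNIV. (h $ i) ^ \<alpha> i)) has_sum f (p + h)) UNIV)"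

definition complex_differentiable_at :: "(complex^'n \<Rightarrow> complex^'m) \<Rightarrow> complex^'n \<Rightarrow> bool"
  where "complex_differentiable_at f z \<longleftrightarrow>
    (\<exists>D. (f has_derivative D) (at z) \<and> (\<forall>c v. D (c *s v) = c *s D v))"

section \<open>Real analytic manifolds\<close>

text \<open>A chart is its domain together with its coordinate map.  The underlying topological space
  of the manifold is a type, required in the theorem to be Hausdorff and second countable.\<close>

type_synonym ('a, 'n) chart = "'a set \<times> ('a \<Rightarrow> real^'n)"

abbreviation dom_of :: "('a, 'n::finite) chart \<Rightarrow> 'a set"
  where "dom_of c \<equiv> fst c"

abbreviation map_of_chart :: "('a, 'n::finite) chart \<Rightarrow> 'a \<Rightarrow> real^'n"
  where "map_of_chart c \<equiv> snd c"

definition inv_chart :: "('a, 'n::finite) chart \<Rightarrow> real^'n \<Rightarrow> 'a"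
  where "inv_chart c = inv_into (dom_of c) (map_of_chart c)"

definition transition :: "('a, 'n::finite) chart \<Rightarrow> ('a, 'n) chart \<Rightarrow> real^'n \<Rightarrow> real^'n"
  where "transition c d = map_of_chart d \<circ> inv_chart c"

definition analytic_atlas :: "('a::topological_space, 'n::finite) chart set \<Rightarrow> bool"
  where "analytic_atlas A \<longleftrightarrow>
    (\<Union>c\<in>A. dom_of c) = UNIV \<and>
    (\<forall>c\<in>A. open (dom_of c) \<and> open (map_of_chart c ` dom_of c) \<and>
        homeomorphism (dom_of c) (map_of_chart c ` dom_of c) (map_of_chart c) (inv_chart c)) \<and>
    (\<forall>c\<in>A. \<forall>d\<in>A. \<forall>i. real_analytic_on (\<lambda>x. transition c d x $ i)
        (map_of_chart c ` (dom_of c \<inter> dom_of d)))"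

definition chart_at :: "('a, 'n::finite) chart set \<Rightarrow> 'a \<Rightarrow> ('a, 'n) chart"
  where "chart_at A p = (SOME c. c \<in> A \<and> p \<in> dom_of c)"

section \<open>The tangent bundle\<close>

text \<open>A tangent vector is a base point together with the family of its components in all charts
  of the atlas around that point, the components in two charts being related by the derivative of
  the transition map.  The component family is \<open>0\<close> at pairs that are not such charts, so that a
  tangent vector has exactly one representation.\<close>

type_synonym ('a, 'n) tvec = "'a \<times> (('a, 'n) chart \<Rightarrow> real^'n)"

definition tangent_bundle :: "('a, 'n::finite) chart set \<Rightarrow> ('a, 'n) tvec set"
  where "tangent_bundle A = {(p, v).
    (\<forall>c\<in>A. \<forall>d\<in>A. p \<in> dom_of c \<and> p \<in> dom_of d \<longrightarrow>
        v d = deriv_at (transition c d) (map_of_chart c p) (v c)) \<and>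
    (\<forall>c. \<not> (c \<in> A \<and> p \<in> dom_of c) \<longrightarrow> v c = 0)}"

definition tscale :: "real \<Rightarrow> ('a, 'n::finite) tvec \<Rightarrow> ('a, 'n) tvec"
  where "tscale a v = (fst v, \<lambda>c. a *\<^sub>R snd v c)"

definition tchart_dom :: "('a, 'n::finite) chart set \<Rightarrow> ('a, 'n) chart \<Rightarrow> ('a, 'n) tvec set"
  where "tchart_dom A c = {v \<in> tangent_bundle A. fst v \<in> dom_of c}"

definition tchart_map :: "('a, 'n::finite) chart \<Rightarrow> ('a, 'n) tvec \<Rightarrow> (real^'n) \<times> (real^'n)"
  where "tchart_map c v = (map_of_chart c (fst v), snd v c)"

text \<open>The manifold topology of the tangent bundle.\<close>

definition open_in_tangent :: "('a, 'n::finite) chart set \<Rightarrow> ('a, 'n) tvec set \<Rightarrow> bool"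
  where "open_in_tangent A W \<longleftrightarrow> W \<subseteq> tangent_bundle A \<and>
    (\<forall>c\<in>A. open (tchart_map c ` (W \<inter> tchart_dom A c)))"

section \<open>Riemannian metrics\<close>

text \<open>A metric is given by its component matrix in each chart \<open>c\<close>, as a function of the
  coordinates, subject to the transformation law of covariant 2-tensors.\<close>

type_synonym ('a, 'n) metric = "('a, 'n) chart \<Rightarrow> real^'n \<Rightarrow> real^'n^'n"

definition analytic_metric :: "('a, 'n::finite) chart set \<Rightarrow> ('a, 'n) metric \<Rightarrow> bool"
  where "analytic_metric A g \<longleftrightarrow>
    (\<forall>c\<in>A.
       (\<forall>i j. real_analytic_on (\<lambda>x. g c x $ i $ j) (map_of_chart c ` dom_of c)) \<and>
       (\<forall>x\<in>map_of_chart c ` dom_of c.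
          transpose (g c x) = g c x \<and> (\<forall>u. u \<noteq> 0 \<longrightarrow> u \<bullet> (g c x *v u) > 0))) \<and>
    (\<forall>c\<in>A. \<forall>d\<in>A. \<forall>p\<in>dom_of c \<inter> dom_of d. \<forall>u w.
       let x = map_of_chart c p; D = deriv_at (transition c d) x
       in u \<bullet> (g c x *v w) = D u \<bullet> (g d (map_of_chart d p) *v D w))"

text \<open>The inner product of tangent vectors at the same point.  By the transformation law the
  choice of the chart is immaterial.\<close>

definition metric_inner ::
    "('a, 'n::finite) chart set \<Rightarrow> ('a, 'n) metric \<Rightarrow> ('a, 'n) tvec \<Rightarrow> ('a, 'n) tvec \<Rightarrow> real"
  where "metric_inner A g v w =
    (let c = chart_at A (fst v) in snd v c \<bullet> (g c (map_of_chart c (fst v)) *v snd w c))"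

definition tnorm ::
    "('a, 'n::finite) chart set \<Rightarrow> ('a, 'n) metric \<Rightarrow> ('a, 'n) tvec \<Rightarrow> real"
  where "tnorm A g v = sqrt (metric_inner A g v v)"

subsection \<open>Coordinate expressions for a metric \<open>G\<close> on a domain of Euclidean space\<close>

text \<open>\<open>christoffel G k i j\<close> has the upper index \<open>k\<close>.\<close>

definition christoffel ::
    "(real^'n \<Rightarrow> real^'n^'n) \<Rightarrow> 'n::finite \<Rightarrow> 'n \<Rightarrow> 'n \<Rightarrow> real^'n \<Rightarrow> real"
  where "christoffel G k i j x = (1/2) * (\<Sum>l\<in>UNIV. matrix_inv (G x) $ k $ l *
    (partial i (\<lambda>y. G y $ j $ l) x + partial j (\<lambda>y. G y $ i $ l) x
      - partial l (\<lambda>y. G y $ i $ j) x))"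

text \<open>The component along the \<open>l\<close>-th coordinate field of
  \<open>\<nabla>\<^sub>i \<nabla>\<^sub>j \<partial>\<^sub>k - \<nabla>\<^sub>j \<nabla>\<^sub>i \<partial>\<^sub>k\<close>.\<close>

definition riemann ::
    "(real^'n \<Rightarrow> real^'n^'n) \<Rightarrow> 'n::finite \<Rightarrow> 'n \<Rightarrow> 'n \<Rightarrow> 'n \<Rightarrow> real^'n \<Rightarrow> real"
  where "riemann G l i j k x =
    partial i (christoffel G l j k) x - partial j (christoffel G l i k) x
    + (\<Sum>m\<in>UNIV. christoffel G m j k x * christoffel G l i m x
              - christoffel G m i k x * christoffel G l j m x)"

definition hessian ::
    "(real^'n \<Rightarrow> real^'n^'n) \<Rightarrow> (real^'n \<Rightarrow> real) \<Rightarrow> 'n::finite \<Rightarrow> 'n \<Rightarrow> real^'n \<Rightarrow> real"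
  where "hessian G f i j x =
    partial i (partial j f) x - (\<Sum>k\<in>UNIV. christoffel G k i j x * partial k f x)"

subsection \<open>Gauss curvature, Laplacian and gradient\<close>

text \<open>The curvature and the Laplacian at \<open>p\<close> are evaluated in a chosen chart around \<open>p\<close>; by
  tensoriality their values do not depend on this choice.\<close>

text \<open>\<open>g(R(\<partial>\<^sub>1,\<partial>\<^sub>2)\<partial>\<^sub>2, \<partial>\<^sub>1) / det g\<close>, which is \<open>1\<close> for the unit sphere.\<close>

definition gauss_curvature :: "('a, 2) chart set \<Rightarrow> ('a, 2) metric \<Rightarrow> 'a \<Rightarrow> real"
  where "gauss_curvature A g p =
    (let c = chart_at A p; G = g c; x = map_of_chart c p
     in (\<Sum>l\<in>UNIV. G x $ 1 $ l * riemann G l 1 2 2 x) / det (G x))"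

definition laplacian ::
    "('a, 'n::finite) chart set \<Rightarrow> ('a, 'n) metric \<Rightarrow> ('a \<Rightarrow> real) \<Rightarrow> 'a \<Rightarrow> real"
  where "laplacian A g f p =
    (let c = chart_at A p; x = map_of_chart c p
     in \<Sum>i\<in>UNIV. \<Sum>j\<in>UNIV. matrix_inv (g c x) $ i $ j * hessian (g c) (f \<circ> inv_chart c) i j x)"

definition grad ::
    "('a, 'n::finite) chart set \<Rightarrow> ('a, 'n) metric \<Rightarrow> ('a \<Rightarrow> real) \<Rightarrow> 'a \<Rightarrow> ('a, 'n) tvec"
  where "grad A g f p = (p, \<lambda>c. if c \<in> A \<and> p \<in> dom_of c
    then matrix_inv (g c (map_of_chart c p)) *v
           (\<chi> j. partial j (f \<circ> inv_chart c) (map_of_chart c p))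
    else 0)"

subsection \<open>Geodesics and completeness\<close>

definition velocity ::
    "('a, 'n::finite) chart set \<Rightarrow> (real \<Rightarrow> 'a) \<Rightarrow> real \<Rightarrow> ('a, 'n) tvec"
  where "velocity A \<gamma> t = (\<gamma> t, \<lambda>c. if c \<in> A \<and> \<gamma> t \<in> dom_of c
    then vector_derivative (map_of_chart c \<circ> \<gamma>) (at t) else 0)"

definition geodesic ::
    "('a::topological_space, 'n::finite) chart set \<Rightarrow> ('a, 'n) metric \<Rightarrow> (real \<Rightarrow> 'a) \<Rightarrow> bool"
  where "geodesic A g \<gamma> \<longleftrightarrow> continuous_on UNIV \<gamma> \<and>
    (\<forall>c\<in>A. \<forall>t. \<gamma> t \<in> dom_of c \<longrightarrow>
      (let u = map_of_chart c \<circ> \<gamma>; u' = (\<lambda>s. vector_derivative u (at s))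
       in u differentiable (at t) \<and>
          (u' has_vector_derivative
             (\<chi> k. - (\<Sum>i\<in>UNIV. \<Sum>j\<in>UNIV. christoffel (g c) k i j (u t) * u' t $ i * u' t $ j)))
            (at t)))"

definition unit_speed_geodesic ::
    "('a::topological_space, 'n::finite) chart set \<Rightarrow> ('a, 'n) metric \<Rightarrow> (real \<Rightarrow> 'a) \<Rightarrow> bool"
  where "unit_speed_geodesic A g \<gamma> \<longleftrightarrow>
    geodesic A g \<gamma> \<and> (\<forall>t. tnorm A g (velocity A \<gamma> t) = 1)"

definition complete_metric ::
    "('a::topological_space, 'n::finite) chart set \<Rightarrow> ('a, 'n) metric \<Rightarrow> bool"
  where "complete_metric A g \<longleftrightarrow>
    (\<forall>v\<in>tangent_bundle A. \<exists>\<gamma>. geodesic A g \<gamma> \<and> velocity A \<gamma> 0 = v)"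

section \<open>The adapted complex structure\<close>

definition tangent_tube ::
    "('a, 'n::finite) chart set \<Rightarrow> ('a, 'n) metric \<Rightarrow> ereal \<Rightarrow> ('a, 'n) tvec set"
  where "tangent_tube A g R = {v \<in> tangent_bundle A. ereal (tnorm A g v) < R}"

type_synonym ('a, 'n) cchart = "('a, 'n) tvec set \<times> (('a, 'n) tvec \<Rightarrow> complex^'n)"

text \<open>A complex structure on \<open>X\<close>, given by an atlas of complex charts: each one is a
  \<open>C\<^sup>\<infinity>\<close> diffeomorphism from an open subset of \<open>X\<close> (with the smooth structure of the tangent
  bundle) onto an open subset of complex Euclidean space, and the coordinate changes are
  holomorphic.\<close>

definition complex_atlas ::
    "('a, 'n::finite) chart set \<Rightarrow> ('a, 'n) tvec set \<Rightarrow> ('a, 'n) cchart set \<Rightarrow> bool"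
  where "complex_atlas A X \<C> \<longleftrightarrow>
    (\<Union>(W, \<Phi>)\<in>\<C>. W) = X \<and>
    (\<forall>(W, \<Phi>)\<in>\<C>. open_in_tangent A W \<and> inj_on \<Phi> W \<and> open (\<Phi> ` W) \<and>
       (\<forall>c\<in>A.
          smooth_on (\<Phi> \<circ> inv_into (tchart_dom A c) (tchart_map c))
            (tchart_map c ` (W \<inter> tchart_dom A c)) \<and>
          smooth_on (tchart_map c \<circ> inv_into W \<Phi>) (\<Phi> ` (W \<inter> tchart_dom A c)))) \<and>
    (\<forall>(W, \<Phi>)\<in>\<C>. \<forall>(V, \<Psi>)\<in>\<C>. \<forall>z\<in>\<Phi> ` (W \<inter> V).
       complex_differentiable_at (\<Psi> \<circ> inv_into W \<Phi>) z)"

text \<open>Holomorphy of a map from an open set of complex numbers to \<open>X\<close>.  Openness of the preimages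
  of all chart domains, together with holomorphy in the charts, entails continuity.\<close>

definition holomorphic_curve ::
    "('a, 'n::finite) tvec set \<Rightarrow> ('a, 'n) cchart set \<Rightarrow> (complex \<Rightarrow> ('a, 'n) tvec) \<Rightarrow>
      complex set \<Rightarrow> bool"
  where "holomorphic_curve X \<C> F S \<longleftrightarrow> F ` S \<subseteq> X \<and>
    (\<forall>(W, \<Phi>)\<in>\<C>. open (S \<inter> F -` W) \<and> (\<forall>i. (\<lambda>z. \<Phi> (F z) $ i) holomorphic_on (S \<inter> F -` W)))"

definition adapted_complex_structure ::
    "('a::topological_space, 'n::finite) chart set \<Rightarrow> ('a, 'n) metric \<Rightarrow> ereal \<Rightarrow>
      ('a, 'n) cchart set \<Rightarrow> bool"
  where "adapted_complex_structure A g R \<C> \<longleftrightarrow>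
    complex_atlas A (tangent_tube A g R) \<C> \<and>
    (\<forall>\<gamma>. unit_speed_geodesic A g \<gamma> \<longrightarrow>
       holomorphic_curve (tangent_tube A g R) \<C>
         (\<lambda>z. tscale (Im z) (velocity A \<gamma> (Re z))) {z. ereal \<bar>Im z\<bar> < R})"

definition pi_over :: "ereal \<Rightarrow> real"
  where "pi_over R = (if R = \<infinity> then 0 else pi / real_of_ereal R)"

end

theory Submission
  imports Defs "HOL-Complex_Analysis.Complex_Analysis"
begin

no_notation fps_nth (infixl \<open>$\<close> 75)

text \<open>Let \<open>\<gamma>\<close> be a unit speed geodesic and let \<open>j\<close>, \<open>j2\<close> be the solutions of the Jacobi equation
  \<open>y'' = - \<sigma>(\<gamma>) y\<close> with initial values \<open>(1, 0)\<close> and \<open>(0, 1)\<close>.  They are the normal components of two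
  variations of \<open>\<gamma>\<close> through geodesics.  Each variation induces a variation of the leaf
  \<open>x + i y \<mapsto> y \<gamma>'(x)\<close>, which is holomorphic along the leaf since all leaves are; modulo the tangent
  of the leaf, the ratio of the two is a meromorphic continuation of \<open>j2 / j\<close> to the strip
  \<open>\<bar>Im z\<bar> < R\<close>.  Off the real axis it is neither real nor infinite, because a real linear relation
  between the two variations there would force \<open>j\<close> and \<open>j2\<close> to be dependent.  So \<open>j2 / j\<close> is a
  Pick function on \<open>0 < Im z < R\<close> that is real on the real axis near \<open>0\<close>.

  If \<open>F\<close> is such a function with \<open>F 0 = 0\<close> and \<open>p = \<pi> / R\<close>, then \<open>- 1 / F + (p/2) coth (p z / 2) / F' 0\<close>
  is again one, by the minimum principle (a boundary Schwarz lemma).  Two such steps and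
  \<open>deriv \<ge> 0\<close> at \<open>0\<close> bound the Taylor coefficients of order up to 5, which for \<open>j2 / j\<close> are
  polynomials in the curvature and its first two derivatives along \<open>\<gamma>\<close>.  The theorem is the sum of
  these inequalities over two orthogonal directions.\<close>

section \<open>Pick functions on a strip\<close>

text \<open>The constants come from the case of constant curvature -p^2/4: there j2 / j is (2/p)
  tanh (p z / 2), the added term is exactly its reciprocal, the step returns 0, and the final
  inequality is an equality. The function (p/2) coth (p z / 2) has the pole 1/z at 0 and is real on
  both boundary lines of the strip, so it removes the pole of - 1 / F without disturbing the
  boundary values. Each step lowers the order of a Taylor coefficient by two, so the derivative
  after two steps reaches order 5, that is, two derivatives of the curvature. The obstacle that
  shapes the geometric half: completeness gives one geodesic for each initial vector separately,
  with no smoothness in that vector. Variations are therefore sequences, and only convergence of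
  their difference quotients is shown, uniformly on short time intervals, by Gronwall's inequality.
  This suffices for the leaves, since uniform limits of holomorphic functions are
  holomorphic.\<close>

lemma Im_zero_at_0:
  fixes G :: "complex \<Rightarrow> complex"
  assumes "isCont G 0" "0 < s" "\<And>x::real. \<bar>x\<bar> < s \<Longrightarrow> x \<noteq> 0 \<Longrightarrow> Im (G (of_real x)) = 0"
  shows "Im (G 0) = 0"
proof -
  have "((\<lambda>x::real. complex_of_real x) \<longlongrightarrow> 0) (at 0)"
    by (rule tendsto_eq_rhs[OF tendsto_of_real[OF tendsto_ident_at]]) simp
  then have "((\<lambda>x::real. Im (G (of_real x))) \<longlongrightarrow> Im (G 0)) (at 0)"
    by (intro tendsto_Im isCont_tendsto_compose[OF assms(1)])
  moreover have "eventually (\<lambda>x::real. Im (G (of_real x)) = 0) (at 0)"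
    unfolding eventually_at using assms by (intro exI[of _ s]) (auto simp: dist_norm)
  ultimately show ?thesis
    by (rule tendsto_unique[OF at_neq_bot _ tendsto_eventually])
qed

text \<open>Approach 0 along the positive imaginary axis: since \<open>G 0\<close> is real, the real
  part of the difference quotient at \<i> x is Im (G (\<i> x)) / x, which is nonnegative.\<close>

lemma pick_deriv_nonneg:
  fixes G :: "complex \<Rightarrow> complex"
  assumes hol: "G holomorphic_on ball 0 s" and s: "0 < s"
    and pos: "\<And>t::real. 0 < t \<Longrightarrow> t < s \<Longrightarrow> Im (G (\<i> * of_real t)) \<ge> 0"
    and real: "\<And>x::real. \<bar>x\<bar> < s \<Longrightarrow> Im (G (of_real x)) = 0"
  shows "Re (deriv G 0) \<ge> 0"
proof -
  have "(G has_field_derivative deriv G 0) (at 0)"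
    using hol s by (metis centre_in_ball holomorphic_derivI open_ball)
  then have l: "((\<lambda>h. (G h - G 0) / h) \<longlongrightarrow> deriv G 0) (at 0)"
    by (simp add: has_field_derivative_iff)
  have f: "filterlim (\<lambda>x::real. \<i> * complex_of_real x) (at 0) (at_right 0)"
    unfolding filterlim_at by (auto simp: eventually_at_filter intro!: tendsto_eq_intros)
  have G0: "Im (G 0) = 0" using real[of 0] s by simp
  have "((\<lambda>x::real. Re ((G (\<i> * of_real x) - G 0) / (\<i> * of_real x))) \<longlongrightarrow> Re (deriv G 0)) (at_right 0)"
    by (intro tendsto_Re) (rule filterlim_compose[OF l f])
  moreover have "eventually (\<lambda>x::real. Re ((G (\<i> * of_real x) - G 0) / (\<i> * of_real x)) \<ge> 0) (at_right 0)"
  proof (rule eventually_at_rightI[of 0 s])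
    fix x :: real assume "x \<in> {0<..<s}"
    moreover have "w / (\<i> * of_real x) = - \<i> * w / of_real x" for w
      by (cases "x = 0") (simp_all add: field_simps)
    ultimately show "Re ((G (\<i> * of_real x) - G 0) / (\<i> * of_real x)) \<ge> 0"
      using pos[of x] G0 by simp
  qed (use s in auto)
  ultimately show "Re (deriv G 0) \<ge> 0"
    by (rule tendsto_lowerbound) simp
qed

text \<open>The parameter p plays the role of pi / R. With this height exp (p z) maps the strip onto
  the upper half-plane and its two boundary lines to the positive and the negative reals.\<close>

definition strip :: "real \<Rightarrow> complex set"
  where "strip p = {z. 0 < Im z \<and> Im z < pi / p}"

lemma open_strip: "open (strip p)"
  unfolding strip_def by (intro open_Collect_conj open_Collect_less continuous_intros)

lemma connected_strip: "connected (strip p)"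
proof -
  have "strip p = {z. Im z > 0} \<inter> {z. Im z < pi / p}" by (auto simp: strip_def)
  then show ?thesis
    by (auto intro!: convex_connected convex_Int convex_halfspace_Im_gt convex_halfspace_Im_lt)
qed

lemma exp_strip:
  assumes "z \<in> strip p" "0 < p"
  shows "Im (exp (of_real p * z)) > 0" "exp (of_real p * z) \<noteq> 1"
proof -
  have "0 < p * Im z" "p * Im z < pi" using assms by (auto simp: strip_def field_simps)
  then show "Im (exp (of_real p * z)) > 0" by (auto simp: Im_exp sin_gt_zero)
  then show "exp (of_real p * z) \<noteq> 1" by auto
qed

text \<open>\<open>(p/2) (w+1)/(w-1)\<close> with \<open>w = exp (p z)\<close> plays the role of \<open>1/z\<close> on the strip: it is real on
  the boundary, except for the pole at \<open>0\<close>, so its imaginary part is small off a compact set.\<close>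

lemma barrier_compact:
  fixes p \<mu> r :: real
  assumes "0 < p" "0 < \<mu>" "0 < r"
  defines "K \<equiv> {z. 0 \<le> Im z \<and> Im z \<le> pi / p \<and> r \<le> norm z \<and>
      \<mu> * (norm (exp (of_real p * z) - 1))\<^sup>2 \<le> Im (exp (of_real p * z))}"
  shows "compact K" "K \<subseteq> strip p"
proof -
  have cl: "closed K"
    unfolding K_def by (intro closed_Collect_conj closed_Collect_le continuous_intros)
  have "bounded K"
  proof -
    \<comment> \<open>On K, \<mu> (|w| - 1)^2 \<le> \<mu> |w - 1|^2 \<le> Im w \<le> |w| with |w| =
      exp (p Re z). This says that \<open>f (Re z)\<close> is not positive, but \<open>f\<close>
      tends to infinity on the right and to \<mu> > 0 on the left, so Re z is bounded.\<close>
    define f :: "real \<Rightarrow> real" where "f X = \<mu> * (exp (p * X) - 1)\<^sup>2 - exp (p * X)" for X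
    have "filterlim f at_top at_top" "\<forall>\<^sub>F X in at_bot. f X > 0"
      unfolding f_def using assms by real_asymp+
    then obtain B1 B2 where B1: "\<And>X. X \<ge> B1 \<Longrightarrow> f X > 0" and B2: "\<And>X. X \<le> B2 \<Longrightarrow> f X > 0"
      unfolding filterlim_at_top_dense eventually_at_top_linorder eventually_at_bot_linorder by metis
    have "norm z \<le> \<bar>B1\<bar> + \<bar>B2\<bar> + pi / p" if z: "z \<in> K" for z
    proof -
      define w where "w = exp (of_real p * z)"
      have nw: "norm w = exp (p * Re z)" unfolding w_def by simp
      have "\<bar>norm w - 1\<bar> \<le> norm (w - 1)"
        by (metis norm_one norm_triangle_ineq3)
      then have "(norm w - 1)\<^sup>2 \<le> (norm (w - 1))\<^sup>2" by (metis abs_le_square_iff abs_norm_cancel)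
      then have "\<mu> * (norm w - 1)\<^sup>2 \<le> norm w"
        using z assms abs_Im_le_cmod[of w] unfolding K_def w_def
        by (smt (verit, best) mem_Collect_eq mult_left_mono nw)
      then have "\<not> f (Re z) > 0" by (simp add: f_def nw)
      then have "\<bar>Re z\<bar> \<le> \<bar>B1\<bar> + \<bar>B2\<bar>" using B1[of "Re z"] B2[of "Re z"] by linarith
      moreover have "\<bar>Im z\<bar> \<le> pi / p" using z by (auto simp: K_def)
      ultimately show ?thesis using cmod_le[of z] by linarith
    qed
    then show ?thesis by (rule boundedI)
  qed
  then show "compact K" using cl compact_eq_bounded_closed by blast
  show "K \<subseteq> strip p"
  proof
    fix z assume z: "z \<in> K"
    define w where "w = exp (of_real p * z)"
    \<comment> \<open>In the closed strip w = 1 occurs only at z = 0, which the bound r on the norm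
      excludes. On the boundary lines Im w = 0, so the inequality defining K would force w = 1;
      hence K avoids them.\<close>
    have w1: "w \<noteq> 1" if "Im w = 0"
      using that
    proof -
      have False if w: "w = 1" "Im z = 0 \<or> Im z = pi / p"
      proof (cases "Im z = 0")
        case True
        then have "norm w = exp (p * Re z)" unfolding w_def by simp
        then have "exp (p * Re z) = 1" using w(1) by simp
        then have "Re z = 0" using assms by simp
        with True have "z = 0" by (simp add: complex_eq_iff)
        with z assms show False by (simp add: K_def)
      next
        case False
        then have "Im z = pi / p" using w by simp
        then have "Re (exp (of_real p * z)) = - exp (p * Re z)" using assms(1) unfolding Re_exp by simp
        then have "Re w = - exp (p * Re z)" by (simp only: w_def)
        with w show False by (metis exp_gt_zero neg_less_0_iff_less one_complex.sel(1) order_less_asym zero_less_one)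
      qed
      moreover have "\<not> w = 1" if "0 < Im z" "Im z < pi / p"
        using exp_strip[of z p] that assms by (auto simp: strip_def w_def)
      ultimately show "w \<noteq> 1" using z by (force simp: K_def)
    qed
    have "Im w \<noteq> 0"
    proof
      assume 0: "Im w = 0"
      then have "\<mu> * (norm (w - 1))\<^sup>2 \<le> 0" using z by (auto simp: K_def w_def)
      with w1[OF 0] assms show False by (simp add: mult_le_0_iff)
    qed
    then have "sin (p * Im z) \<noteq> 0" by (simp add: w_def Im_exp)
    then have "Im z \<noteq> 0" "Im z \<noteq> pi / p" using assms by auto
    then show "z \<in> strip p" using z by (auto simp: K_def strip_def)
  qed
qed

lemma Im_barrier: "Im ((w + 1) / (w - 1)) = - 2 * Im w / (norm (w - 1))\<^sup>2"
  by (simp add: Im_divide cmod_power2 field_simps)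

text \<open>Since Im (- 1 / F) > 0, a value of Im G as low as m < 0 requires the barrier term to be
  at most m, which happens only on a compact subset of the open strip once a neighbourhood of 0 is
  excluded. So a negative infimum would be attained inside, and Im G would be constant, against its
  smallness near 0.\<close>

lemma barrier_minimum_principle:
  fixes F G :: "complex \<Rightarrow> complex"
  assumes p: "0 < p" and c: "0 < c" and hol: "G holomorphic_on strip p"
    and F: "\<And>z. z \<in> strip p \<Longrightarrow> Im (F z) > 0"
    and G: "\<And>z. z \<in> strip p \<Longrightarrow> G z = - 1 / F z +
        of_real c * ((exp (of_real p * z) + 1) / (exp (of_real p * z) - 1))"
    and near: "\<And>e. 0 < e \<Longrightarrow> \<exists>r>0. \<forall>z\<in>strip p. norm z < r \<longrightarrow> \<bar>Im (G z)\<bar> < e"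
    and z0: "z0 \<in> strip p"
  shows "Im (G z0) \<ge> 0"
proof (rule ccontr)
  assume neg: "\<not> ?thesis"
  define m where "m = Im (G z0)"
  have m: "m < 0" using neg by (simp add: m_def)
  obtain r where r: "0 < r" "\<And>z. z \<in> strip p \<Longrightarrow> norm z < r \<Longrightarrow> \<bar>Im (G z)\<bar> < - m"
    using near[of "- m"] m by auto
  \<comment> \<open>With this value, the barrier contribution - 2 c Im w / |w - 1|^2 is at most m
    exactly when \<mu> |w - 1|^2 \<le> Im w.\<close>
  define \<mu> where "\<mu> = - m / (2 * c)"
  have \<mu>: "0 < \<mu>" using m c by (auto simp: \<mu>_def field_simps)
  define K where "K = {z. 0 \<le> Im z \<and> Im z \<le> pi / p \<and> r \<le> norm z \<and>
      \<mu> * (norm (exp (of_real p * z) - 1))\<^sup>2 \<le> Im (exp (of_real p * z))}"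
  have K: "compact K" "K \<subseteq> strip p"
    using barrier_compact[OF p \<mu> r(1)] by (simp_all add: K_def)
  have outside: "z \<in> K" if z: "z \<in> strip p" and le: "Im (G z) \<le> m" for z
  proof -
    define w where "w = exp (of_real p * z)"
    have w: "Im w > 0" "w \<noteq> 1" using exp_strip[OF z p] by (auto simp: w_def)
    have "norm z \<ge> r" using r(2)[OF z] le m by (metis abs_of_neg leI less_le_not_le neg_less_iff_less order_le_less_trans)
    have "Im (- 1 / F z) > 0"
      using F[OF z] by (auto simp: Im_divide intro!: divide_pos_pos add_nonneg_pos)
    moreover have "Im (G z) = Im (- 1 / F z) - c * (2 * Im w / (norm (w - 1))\<^sup>2)"
    proof -
      have "Im (of_real c * ((w + 1) / (w - 1))) = c * Im ((w + 1) / (w - 1))"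
        by (simp only: times_complex.sel Re_complex_of_real Im_complex_of_real mult_zero_left add_0_right)
      then show ?thesis using G[OF z] unfolding w_def[symmetric] Im_barrier by simp
    qed
    ultimately have "c * (2 * Im w / (norm (w - 1))\<^sup>2) \<ge> - m" using le by linarith
    then have "\<mu> * (norm (w - 1))\<^sup>2 \<le> Im w"
      using w c by (simp add: \<mu>_def field_simps)
    then show ?thesis using z \<open>norm z \<ge> r\<close> by (auto simp: K_def strip_def w_def)
  qed
  have z0K: "z0 \<in> K" using outside[OF z0] by (simp add: m_def)
  have "continuous_on K (\<lambda>z. Im (G z))"
    using holomorphic_on_imp_continuous_on[OF hol] K(2) continuous_on_subset by (intro continuous_intros) blast
  then obtain z1 where z1: "z1 \<in> K" "\<And>z. z \<in> K \<Longrightarrow> Im (G z1) \<le> Im (G z)"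
    using continuous_attains_inf[OF K(1)] z0K by blast
  have gmin: "Im (G z1) \<le> Im (G z)" if "z \<in> strip p" for z
    using outside[OF that] z1(2)[OF z0K] z1(2)[of z] by (force simp: m_def)
  \<comment> \<open>The modulus of exp (\<i> G) is exp (- Im G), so a minimum of Im G is a maximum
    of this modulus.\<close>
  have "(\<lambda>z. exp (\<i> * G z)) constant_on strip p"
    by (rule maximum_modulus_principle[of _ _ "strip p" z1])
       (use hol gmin z1 K in \<open>auto intro!: holomorphic_intros open_strip connected_strip\<close>)
  then have const: "Im (G z) = Im (G z1)" if "z \<in> strip p" for z
  proof -
    obtain k where k: "\<And>z. z \<in> strip p \<Longrightarrow> exp (\<i> * G z) = k"
      using \<open>_ constant_on _\<close> unfolding constant_on_def by blast
    have "exp (\<i> * G z) = exp (\<i> * G z1)" using k that z1 K by blast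
    then have "norm (exp (\<i> * G z)) = norm (exp (\<i> * G z1))" by simp
    then show ?thesis by simp
  qed
  define t where "t = min (r / 2) (pi / p / 2)"
  have t: "0 < t" "t < r" "t < pi / p" 
  proof -
    have "0 < pi / p" using p by simp
    then show "0 < t" "t < r" "t < pi / p" using r(1) by (auto simp: t_def min_less_iff_disj)
  qed
  have it: "\<i> * of_real t \<in> strip p" "norm (\<i> * complex_of_real t) < r"
    using t by (simp_all add: strip_def norm_mult)
  have "\<bar>Im (G z1)\<bar> < - m" using r(2)[OF it] unfolding const[OF it(1)] .
  moreover have "Im (G z1) \<le> m" using z1(2)[OF z0K] by (simp add: m_def)
  ultimately show False by linarith
qed

text \<open>G is - 1 / F + (p / (2 b)) coth (p z / 2): the residues at 0 are - 1/b and (p / (2 b))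
  (2 / p) = 1/b, so the pole cancels. The identity on the ball has its denominators cleared, so that
  it also holds at 0 and can be compared coefficient by coefficient.\<close>

lemma julia_step:
  fixes F :: "complex \<Rightarrow> complex"
  assumes p: "0 < p" and r: "0 < r" and b: "0 < b"
    and hol: "F holomorphic_on strip p \<union> ball 0 r"
    and pos: "\<And>z. z \<in> strip p \<Longrightarrow> Im (F z) > 0"
    and real: "\<And>x::real. \<bar>x\<bar> < r \<Longrightarrow> Im (F (of_real x)) = 0"
    and F0: "F 0 = 0" and F1: "deriv F 0 = of_real b"
  obtains s G where "0 < s" "s \<le> r" "G holomorphic_on strip p \<union> ball 0 s"
    "\<And>z. z \<in> strip p \<Longrightarrow> Im (G z) \<ge> 0"
    "\<And>x::real. \<bar>x\<bar> < s \<Longrightarrow> Im (G (of_real x)) = 0"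
    "\<And>z. z \<in> ball 0 s \<Longrightarrow> G z * F z * (exp (of_real p * z) - 1) * of_real b =
        - (exp (of_real p * z) - 1) * of_real b +
        F z * of_real (p / 2) * ((exp (of_real p * z) - 1) + 2)"
proof -
  have holF: "F holomorphic_on ball 0 r" "F holomorphic_on strip p"
    using hol by (auto elim: holomorphic_on_subset)
  obtain P where P: "P holomorphic_on ball 0 r" "\<And>z. norm z < r \<Longrightarrow> F z = z * P z" "deriv F 0 = P 0"
    using Schwarz3[OF holF(1) F0] by blast
  define e where "e z = exp (of_real p * z) - 1" for z :: complex
  have e_hol: "e holomorphic_on X" for X unfolding e_def by (intro holomorphic_intros)
  have de: "deriv e 0 = of_real p"
    unfolding e_def by (rule DERIV_imp_deriv) (auto intro!: derivative_eq_intros)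
  obtain E where E: "E holomorphic_on ball 0 r" "\<And>z. norm z < r \<Longrightarrow> e z = z * E z" "deriv e 0 = E 0"
  proof -
    have "e 0 = 0" by (simp add: e_def)
    from Schwarz3[OF e_hol this] show thesis using that by blast
  qed
  \<comment> \<open>With F = z P and e = z E, the quotient to be extended is N / (z P E b). At 0, N
    is - p b + b (p/2) 2 = 0, so N = z M and the last factor z cancels too.\<close>
  define N where "N z = - E z * of_real b + P z * of_real (p / 2) * (e z + 2)" for z
  have N: "N holomorphic_on ball 0 r" unfolding N_def by (intro holomorphic_intros P E e_hol)
  have "N 0 = 0" using P(3) E(3) de F1 by (simp add: N_def e_def)
  then obtain M where M: "M holomorphic_on ball 0 r" "\<And>z. norm z < r \<Longrightarrow> N z = z * M z"
    using Schwarz3[OF N] by blast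
  have "continuous_on (ball 0 r) (\<lambda>z. P z * E z)"
    by (intro continuous_intros holomorphic_on_imp_continuous_on P E)
  moreover have "P 0 * E 0 \<noteq> 0" using P(3) E(3) de F1 p b by auto
  ultimately obtain s where s: "0 < s" "s \<le> r" "\<And>z. norm z < s \<Longrightarrow> P z * E z \<noteq> 0"
  proof -
    assume a: "continuous_on (ball 0 r) (\<lambda>z. P z * E z)" "P 0 * E 0 \<noteq> 0"
      and *: "\<And>s. 0 < s \<Longrightarrow> s \<le> r \<Longrightarrow> (\<And>z. norm z < s \<Longrightarrow> P z * E z \<noteq> 0) \<Longrightarrow> thesis"
    have "isCont (\<lambda>z. P z * E z) 0" using a r by (simp add: continuous_on_eq_continuous_at)
    from continuous_at_avoid[OF this a(2)] obtain d where d: "d > 0" "\<And>y. dist 0 y < d \<Longrightarrow> P y * E y \<noteq> 0"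
      by auto
    show thesis using *[of "min d r"] d r by auto
  qed
  \<comment> \<open>The first branch supplies the value at 0. Off 0 both expressions agree on the
    ball (\<open>formula\<close>), so G is holomorphic across the overlap with the strip.\<close>
  define G where "G z = (if z \<in> ball 0 s then M z / (P z * E z * of_real b) else
     - 1 / F z + of_real (p / 2 / b) * ((e z + 2) / e z))" for z
  have e0: "e z \<noteq> 0" if "z \<in> strip p" for z using exp_strip[OF that p] by (simp add: e_def)
  have F0': "F z \<noteq> 0" if "z \<in> strip p" for z using pos[OF that] by auto
  have formula: "M z / (P z * E z * of_real b) = - 1 / F z + of_real (p / 2 / b) * ((e z + 2) / e z)"
    if z: "z \<in> ball 0 s" "z \<noteq> 0" for z
  proof -
    have nz: "norm z < s" "norm z < r" using z s by auto
    then have "P z \<noteq> 0" "E z \<noteq> 0" using s(3)[of z] by auto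
    moreover have "z * M z = - E z * of_real b + P z * of_real (p / 2) * (e z + 2)"
      using M(2)[OF nz(2)] by (simp add: N_def)
    then have "M z = (- E z * of_real b + P z * of_real (p / 2) * (z * E z + 2)) / z"
      using z E(2)[OF nz(2)] by (simp add: field_simps)
    ultimately show ?thesis using z b unfolding P(2)[OF nz(2)] E(2)[OF nz(2)]
      by (simp add: divide_simps)
  qed
  have G_eq: "G z = - 1 / F z + of_real (p / 2 / b) * ((e z + 2) / e z)" if "z \<in> strip p" for z
    using formula[of z] that by (cases "z = 0") (auto simp: G_def strip_def)
  have G1: "G holomorphic_on strip p"
    unfolding holomorphic_on_def
  proof -
    have "(\<lambda>z. - 1 / F z + of_real (p / 2 / b) * ((e z + 2) / e z)) holomorphic_on strip p"
      by (intro holomorphic_intros holF e_hol) (use e0 F0' in auto)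
    then have "G holomorphic_on strip p" by (rule holomorphic_transform) (simp add: G_eq)
    then show "\<forall>x\<in>strip p. G field_differentiable at x within strip p"
      by (simp add: holomorphic_on_def)
  qed
  have G2: "G holomorphic_on ball 0 s"
  proof -
    have "(\<lambda>z. M z / (P z * E z * of_real b)) holomorphic_on ball 0 s"
      by (intro holomorphic_intros holomorphic_on_subset[OF M(1)] holomorphic_on_subset[OF P(1)]
        holomorphic_on_subset[OF E(1)]) (use s b in auto)
    then show ?thesis by (rule holomorphic_transform) (simp add: G_def)
  qed
  have contG: "isCont G 0"
    using G2 s(1) by (metis centre_in_ball continuous_on_eq_continuous_at holomorphic_on_imp_continuous_on open_ball)
  have re0: "Im (G (of_real x)) = 0" if "\<bar>x\<bar> < s" "x \<noteq> 0" for x :: real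
  proof -
    have "e (of_real x) = of_real (exp (p * x) - 1)" by (simp add: e_def flip: of_real_mult exp_of_real)
    moreover have "F (of_real x) = of_real (Re (F (of_real x)))"
      using real[of x] that s by (simp add: complex_eq_iff)
    ultimately have "G (of_real x) = of_real (- 1 / Re (F (of_real x)) +
        (p / 2 / b) * ((exp (p * x) - 1 + 2) / (exp (p * x) - 1)))"
      using formula[of "of_real x"] that by (simp add: G_def)
    then show ?thesis by (metis Im_complex_of_real)
  qed
  have G00: "Im (G 0) = 0" by (rule Im_zero_at_0[OF contG s(1)]) (use re0 in auto)
  show thesis
  proof
    show "0 < s" "s \<le> r" by fact+
    show "G holomorphic_on strip p \<union> ball 0 s"
      by (intro holomorphic_on_Un G1 G2 open_strip open_ball)
    show "Im (G (of_real x)) = 0" if "\<bar>x\<bar> < s" for x :: real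
      using re0[of x] that G00 by (cases "x = 0") auto
    show "Im (G z) \<ge> 0" if "z \<in> strip p" for z
    proof (rule barrier_minimum_principle[OF p _ G1 pos _ _ that, where c = "p / 2 / b"])
      show "0 < p / 2 / b" using p b by simp
      show "G z = - 1 / F z + complex_of_real (p / 2 / b) *
         ((exp (complex_of_real p * z) + 1) / (exp (complex_of_real p * z) - 1))" if "z \<in> strip p" for z
        using G_eq[OF that] by (simp add: e_def)
      show "\<exists>r>0. \<forall>z\<in>strip p. cmod z < r \<longrightarrow> \<bar>Im (G z)\<bar> < e" if "0 < e" for e
      proof -
        have "isCont (\<lambda>z. Im (G z)) 0" by (rule continuous_Im[OF contG])
        from this[unfolded continuous_at_eps_delta, rule_format, OF that]
        obtain d where "d > 0" "\<And>x. dist x 0 < d \<Longrightarrow> dist (Im (G x)) (Im (G 0)) < e"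
          by blast
        then show ?thesis using G00 by (intro exI[of _ d]) (auto simp: dist_norm)
      qed
    qed
    show "G z * F z * (exp (of_real p * z) - 1) * of_real b =
        - (exp (of_real p * z) - 1) * of_real b +
        F z * of_real (p / 2) * ((exp (of_real p * z) - 1) + 2)" if "z \<in> ball 0 s" for z
    proof (cases "z = 0")
      case True then show ?thesis using F0 by simp
    next
      case False
      have nz: "norm z < s" "norm z < r" using that s by auto
      then have "F z \<noteq> 0" "e z \<noteq> 0" using s(3)[of z] False by (simp_all add: P E)
      moreover have "G z = - 1 / F z + of_real (p / 2 / b) * ((e z + 2) / e z)"
        using formula[OF that False] that by (simp add: G_def)
      ultimately show ?thesis using b unfolding e_def[symmetric] by (simp add: field_simps)
    qed
  qed
qed

section \<open>Taylor coefficients after two steps\<close>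

lemma fps_nth_mult_low:
  fixes P Q :: "'a::comm_semiring_1 fps"
  shows "fps_nth (P * Q) 0 = fps_nth P 0 * fps_nth Q 0"
    "fps_nth (P * Q) 1 = fps_nth P 0 * fps_nth Q 1 + fps_nth P 1 * fps_nth Q 0"
    "fps_nth (P * Q) 2 = fps_nth P 0 * fps_nth Q 2 + fps_nth P 1 * fps_nth Q 1 + fps_nth P 2 * fps_nth Q 0"
    "fps_nth (P * Q) 3 = fps_nth P 0 * fps_nth Q 3 + fps_nth P 1 * fps_nth Q 2 + fps_nth P 2 * fps_nth Q 1
       + fps_nth P 3 * fps_nth Q 0"
    "fps_nth (P * Q) 4 = fps_nth P 0 * fps_nth Q 4 + fps_nth P 1 * fps_nth Q 3 + fps_nth P 2 * fps_nth Q 2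
       + fps_nth P 3 * fps_nth Q 1 + fps_nth P 4 * fps_nth Q 0"
    "fps_nth (P * Q) 5 = fps_nth P 0 * fps_nth Q 5 + fps_nth P 1 * fps_nth Q 4 + fps_nth P 2 * fps_nth Q 3
       + fps_nth P 3 * fps_nth Q 2 + fps_nth P 4 * fps_nth Q 1 + fps_nth P 5 * fps_nth Q 0"
  by (simp_all add: fps_mult_nth eval_nat_numeral)

lemma fps_expansion_eventually_unique:
  fixes f g :: "complex \<Rightarrow> complex"
  assumes "f has_fps_expansion A" "g has_fps_expansion B" "\<forall>\<^sub>F z in nhds 0. f z = g z"
  shows "A = B"
proof (rule fps_ext)
  fix n
  show "fps_nth A n = fps_nth B n"
    using fps_nth_fps_expansion[OF assms(1)] fps_nth_fps_expansion[OF assms(2)]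
      higher_deriv_cong_ev[OF assms(3) refl] by simp
qed

text \<open>One step turns z + f3 z^3 + f4 z^4 + f5 z^5 into (f3 + p^2/12) z + f4 z^2 + (f5 - f3^2 -
  p^4/720) z^3, since (p/2) coth (p z / 2) = 1/z + p^2 z / 12 - p^4 z^3 / 720 + ... . With b the new
  linear coefficient, the expression claimed to be nonnegative is b^3 times the derivative at 0
  after a second step.\<close>

lemma pick_taylor_inequality:
  fixes F :: "complex \<Rightarrow> complex" and p r d3 d4 d5 :: real
  assumes p: "0 < p" and r: "0 < r"
    and hol: "F holomorphic_on strip p \<union> ball 0 r"
    and pos: "\<And>z. z \<in> strip p \<Longrightarrow> Im (F z) > 0"
    and real: "\<And>x::real. \<bar>x\<bar> < r \<Longrightarrow> Im (F (of_real x)) = 0"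
    and F0: "F 0 = 0" and F1: "deriv F 0 = 1"
    and F2: "(deriv ^^ 2) F 0 = 0" and F3: "(deriv ^^ 3) F 0 = of_real (6 * f3)"
    and F4: "(deriv ^^ 4) F 0 = of_real (24 * f4)" and F5: "(deriv ^^ 5) F 0 = of_real (120 * f5)"
  shows "(f3 + p\<^sup>2 / 12) * (f5 - f3\<^sup>2 - p^4 / 720) - f4\<^sup>2 + (f3 + p\<^sup>2 / 12)\<^sup>2 * p\<^sup>2 / 12 \<ge> 0"
proof -
  define W :: "complex fps" where "W = fps_exp (of_real p) - 1"
  have W: "(\<lambda>z. exp (of_real p * z) - 1) has_fps_expansion W"
    unfolding W_def by (intro fps_expansion_intros)
  have Wn: "fps_nth W 0 = 0" "fps_nth W 1 = of_real p" "fps_nth W 2 = of_real (p^2 / 2)"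
    "fps_nth W 3 = of_real (p^3 / 6)" "fps_nth W 4 = of_real (p^4 / 24)" "fps_nth W 5 = of_real (p^5 / 120)"
    by (simp_all add: W_def fact_numeral)
  have step: "Q * P * W * fps_const (of_real b) =
      - W * fps_const (of_real b) + P * fps_const (of_real (p / 2)) * (W + 2)"
    if "0 < s" "\<And>z. z \<in> ball 0 s \<Longrightarrow> G z * H z * (exp (of_real p * z) - 1) * of_real b =
        - (exp (of_real p * z) - 1) * of_real b +
        H z * of_real (p / 2) * ((exp (of_real p * z) - 1) + 2)"
      "G has_fps_expansion Q" "H has_fps_expansion P" for b s :: real and G H Q P
  proof (rule fps_expansion_eventually_unique)
    show "(\<lambda>z. G z * H z * (exp (of_real p * z) - 1) * of_real b) has_fps_expansion
      Q * P * W * fps_const (of_real b)"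
      by (intro fps_expansion_intros that W)
    show "(\<lambda>z. - (exp (of_real p * z) - 1) * of_real b +
        H z * of_real (p / 2) * ((exp (of_real p * z) - 1) + 2)) has_fps_expansion
      - W * fps_const (of_real b) + P * fps_const (of_real (p / 2)) * (W + 2)"
      by (intro fps_expansion_intros that W)
    show "\<forall>\<^sub>F z in nhds 0. G z * H z * (exp (of_real p * z) - 1) * of_real b =
        - (exp (of_real p * z) - 1) * of_real b +
        H z * of_real (p / 2) * ((exp (of_real p * z) - 1) + 2)"
      using that(1,2) by (auto simp: eventually_nhds intro!: exI[of _ "ball 0 s"])
  qed
  have num: "fps_nth (W + 2) 0 = 2" "fps_nth (W + 2) 1 = of_real p" "fps_nth (W + 2) 2 = of_real (p^2 / 2)"
    "fps_nth (W + 2) 3 = of_real (p^3 / 6)" "fps_nth (W + 2) 4 = of_real (p^4 / 24)"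
    using Wn by (simp_all add: fps_numeral_nth)
  have p0: "complex_of_real p \<noteq> 0" using p by simp
  have F1': "deriv F 0 = of_real 1" using F1 by simp
  obtain G s where G: "0 < s" "s \<le> r" "G holomorphic_on strip p \<union> ball 0 s"
    "\<And>z. z \<in> strip p \<Longrightarrow> Im (G z) \<ge> 0" "\<And>x::real. \<bar>x\<bar> < s \<Longrightarrow> Im (G (of_real x)) = 0"
    "\<And>z. z \<in> ball 0 s \<Longrightarrow> G z * F z * (exp (of_real p * z) - 1) * of_real 1 =
        - (exp (of_real p * z) - 1) * of_real 1 +
        F z * of_real (p / 2) * ((exp (of_real p * z) - 1) + 2)"
  proof -
    show thesis by (rule julia_step[OF p r zero_less_one hol pos real F0 F1']) (assumption | rule that)+
  qed
  have "F holomorphic_on ball 0 r" "G holomorphic_on ball 0 s"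
    using hol G(3) by (auto elim: holomorphic_on_subset)
  then obtain P Q where P: "F has_fps_expansion P" and Q: "G has_fps_expansion Q"
    using has_fps_expansion_fps_expansion r G(1) by (metis centre_in_ball open_ball)
  have Pn: "fps_nth P 0 = 0" "fps_nth P 1 = 1" "fps_nth P 2 = 0" "fps_nth P 3 = of_real f3"
     "fps_nth P 4 = of_real f4" "fps_nth P 5 = of_real f5"
    using fps_nth_fps_expansion[OF P] F0 F1 F2 F3 F4 F5 by (simp_all add: fact_numeral)
  \<comment> \<open>Both P and W vanish to first order at 0, so the coefficient of index n
    determines Q at index n - 2. This is why indices 2 to 5 give Q at 0 to 3.\<close>
  have eq: "fps_nth (Q * P * W) n = fps_nth (P * (W + 2)) n * of_real (p / 2) - fps_nth W n" for n
  proof -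
    have "Q * P * W = P * (W + 2) * fps_const (of_real (p / 2)) - W"
      using step[OF G(1,6) Q P] by (simp add: mult.assoc mult.commute[of "fps_const (of_real p / 2)"])
    then show ?thesis by simp
  qed
  note low = fps_nth_mult_low[of "Q * P" W] fps_nth_mult_low[of Q P] fps_nth_mult_low[of P "W + 2"]
  have Q0: "fps_nth Q 0 = 0"
    using eq[of 2] p0 unfolding low num Wn Pn by (simp add: power2_eq_square)
  have Q1: "fps_nth Q 1 = of_real (f3 + p\<^sup>2 / 12)"
  proof -
    have "of_real p * fps_nth Q 1 = of_real p * of_real (f3 + p\<^sup>2 / 12)"
      using eq[of 3] unfolding low num Wn Pn Q0 by (simp add: field_simps eval_nat_numeral; algebra)
    then show ?thesis using p0 by simp
  qed
  have Q2: "fps_nth Q 2 = of_real f4"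
  proof -
    have "of_real p * fps_nth Q 2 = of_real p * of_real f4"
      using eq[of 4] unfolding low num Wn Pn Q0 Q1 by (simp add: field_simps eval_nat_numeral; algebra)
    then show ?thesis using p0 by simp
  qed
  have Q3: "fps_nth Q 3 = of_real (f5 - f3\<^sup>2 - p^4 / 720)"
  proof -
    have "of_real p * fps_nth Q 3 = of_real p * of_real (f5 - f3\<^sup>2 - p^4 / 720)"
      using eq[of 5] unfolding low num Wn Pn Q0 Q1 Q2 by (simp add: field_simps eval_nat_numeral; algebra)
    then show ?thesis using p0 by simp
  qed
  define g1 where "g1 = f3 + p\<^sup>2 / 12"
  define g3 where "g3 = f5 - f3\<^sup>2 - p^4 / 720"
  have g1: "g1 \<ge> 0"
  proof -
    define t where "t = min s (pi / p)"
    have "Re (deriv G 0) \<ge> 0"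
    proof (rule pick_deriv_nonneg)
      show "G holomorphic_on ball 0 t" "0 < t"
        using G(1,3) p by (auto simp: t_def elim!: holomorphic_on_subset)
      show "Im (G (\<i> * of_real x)) \<ge> 0" if "0 < x" "x < t" for x
        using that by (intro G(4)) (auto simp: strip_def t_def)
      show "Im (G (of_real x)) = 0" if "\<bar>x\<bar> < t" for x using that G(5) by (auto simp: t_def)
    qed
    then show ?thesis using fps_nth_fps_expansion[OF Q, of 1] Q1 by (simp add: g1_def)
  qed
  text \<open>Adding \<open>e z\<close> keeps the Pick property and makes the derivative at \<open>0\<close> strictly positive.\<close>
  have ineq: "(g1 + e) * g3 - f4\<^sup>2 + (g1 + e)\<^sup>2 * p\<^sup>2 / 12 \<ge> 0" if e: "e > 0" for e
  proof -
    define H where "H z = G z + of_real e * z" for z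
    define b where "b = g1 + e"
    have b: "b > 0" using g1 e by (simp add: b_def)
    define P' where "P' = Q + fps_const (of_real e) * fps_X"
    have HP: "H has_fps_expansion P'"
      unfolding H_def P'_def by (intro fps_expansion_intros Q)
    have P'n: "fps_nth P' 0 = 0" "fps_nth P' 1 = of_real b" "fps_nth P' 2 = of_real f4" "fps_nth P' 3 = of_real g3"
      using Q0 Q1 Q2 Q3 by (simp_all add: P'_def b_def g1_def g3_def)
    have H1: "H holomorphic_on strip p \<union> ball 0 s" unfolding H_def by (intro holomorphic_intros G)
    have H2: "Im (H z) > 0" if "z \<in> strip p" for z
      using G(4)[OF that] that e by (simp add: H_def strip_def add_nonneg_pos)
    have H3: "Im (H (of_real x)) = 0" if "\<bar>x\<bar> < s" for x :: real using G(5)[OF that] by (simp add: H_def)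
    have H4: "H 0 = 0" "deriv H 0 = of_real b"
      using fps_nth_fps_expansion[OF HP, of 0] fps_nth_fps_expansion[OF HP, of 1] P'n by simp_all
    obtain K t where K: "0 < t" "t \<le> s" "K holomorphic_on strip p \<union> ball 0 t"
      "\<And>z. z \<in> strip p \<Longrightarrow> Im (K z) \<ge> 0" "\<And>x::real. \<bar>x\<bar> < t \<Longrightarrow> Im (K (of_real x)) = 0"
      "\<And>z. z \<in> ball 0 t \<Longrightarrow> K z * H z * (exp (of_real p * z) - 1) * of_real b =
          - (exp (of_real p * z) - 1) * of_real b +
          H z * of_real (p / 2) * ((exp (of_real p * z) - 1) + 2)"
    proof -
      show thesis by (rule julia_step[OF p G(1) b H1 H2 H3 H4]) (assumption | rule that)+
    qed
    have "K holomorphic_on ball 0 t" using K(3) by (auto elim: holomorphic_on_subset)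
    then obtain Q' where Q': "K has_fps_expansion Q'"
      using has_fps_expansion_fps_expansion K(1) by (metis centre_in_ball open_ball)
    have eq': "fps_nth (Q' * P' * W) n * of_real b =
        fps_nth (P' * (W + 2)) n * of_real (p / 2) - fps_nth W n * of_real b" for n
    proof -
      have "Q' * P' * W * fps_const (of_real b) = P' * (W + 2) * fps_const (of_real (p / 2)) - W * fps_const (of_real b)"
        using step[OF K(1,6) Q' HP] by (simp add: mult.assoc mult.commute[of "fps_const (of_real p / 2)"])
      then have "fps_nth (Q' * P' * W * fps_const (of_real b)) n =
        fps_nth (P' * (W + 2) * fps_const (of_real (p / 2)) - W * fps_const (of_real b)) n" by (rule arg_cong)
      then show ?thesis by simp
    qed
    note low' = fps_nth_mult_low[of "Q' * P'" W] fps_nth_mult_low[of Q' P'] fps_nth_mult_low[of P' "W + 2"]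
    have b0: "complex_of_real b \<noteq> 0" using b by simp
    have 0: "(of_real b)\<^sup>2 * fps_nth Q' 0 = of_real f4"
    proof -
      have "of_real p * ((of_real b)\<^sup>2 * fps_nth Q' 0) = of_real p * of_real f4"
        using eq'[of 2] unfolding low' num Wn P'n by (simp add: field_simps eval_nat_numeral; algebra)
      then show ?thesis using p0 by simp
    qed
    have 1: "fps_nth Q' 1 = of_real ((b * g3 - f4\<^sup>2 + b\<^sup>2 * p\<^sup>2 / 12) / b^3)"
    proof -
      have "of_real p * ((of_real b) ^ 3 * fps_nth Q' 1) = of_real p * of_real (b * g3 - f4\<^sup>2 + b\<^sup>2 * p\<^sup>2 / 12)"
        using eq'[of 3] 0 unfolding low' num Wn P'n by (simp add: field_simps eval_nat_numeral; algebra)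
      then have "(of_real b) ^ 3 * fps_nth Q' 1 = of_real (b * g3 - f4\<^sup>2 + b\<^sup>2 * p\<^sup>2 / 12)"
        using p0 by simp
      then have "fps_nth Q' 1 = of_real (b * g3 - f4\<^sup>2 + b\<^sup>2 * p\<^sup>2 / 12) / (of_real b) ^ 3"
        using b0 by (metis nonzero_mult_div_cancel_left power_not_zero)
      then show ?thesis by simp
    qed
    define u where "u = min t (pi / p)"
    have "Re (deriv K 0) \<ge> 0"
    proof (rule pick_deriv_nonneg)
      show "K holomorphic_on ball 0 u" "0 < u"
        using K(1,3) p by (auto simp: u_def elim!: holomorphic_on_subset)
      show "Im (K (\<i> * of_real x)) \<ge> 0" if "0 < x" "x < u" for x
        using that by (intro K(4)) (auto simp: strip_def u_def)
      show "Im (K (of_real x)) = 0" if "\<bar>x\<bar> < u" for x using that K(5) by (auto simp: u_def)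
    qed
    moreover have "deriv K 0 = fps_nth Q' 1" using fps_nth_fps_expansion[OF Q', of 1] by simp
    ultimately have "(b * g3 - f4\<^sup>2 + b\<^sup>2 * p\<^sup>2 / 12) / b^3 \<ge> 0" unfolding 1 by (metis Re_complex_of_real)
    then show ?thesis using b by (simp add: zero_le_divide_iff b_def)
  qed
  \<comment> \<open>The limit e \<longrightarrow> 0 includes the case g1 = 0, in which a second step
    would divide by zero.\<close>
  have "((\<lambda>e. (g1 + e) * g3 - f4\<^sup>2 + (g1 + e)\<^sup>2 * p\<^sup>2 / 12) \<longlongrightarrow>
      (g1 + 0) * g3 - f4\<^sup>2 + (g1 + 0)\<^sup>2 * p\<^sup>2 / 12) (at_right 0)"
    by (intro tendsto_intros) simp_all
  then have "(g1 + 0) * g3 - f4\<^sup>2 + (g1 + 0)\<^sup>2 * p\<^sup>2 / 12 \<ge> 0"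
    by (rule tendsto_lowerbound) (use ineq in \<open>auto simp: eventually_at_filter\<close>)
  then show ?thesis by (simp add: g1_def g3_def)
qed

section \<open>Real analytic functions\<close>

text \<open>Second-order Taylor remainder with a constant that grows only like m^2, so that it can
  be absorbed by shrinking the radius of a power series. The remainders satisfy e_(m+1) = (x + t)
  e_m + m x^(m-1) t^2, which drives the induction; multiplying by c^2 avoids a division.\<close>

lemma monomial_taylor:
  fixes x t c :: real
  assumes "\<bar>x\<bar> \<le> c" "\<bar>x + t\<bar> \<le> c"
  shows "c\<^sup>2 * \<bar>(x + t) ^ m - x ^ m - real m * x ^ (m - 1) * t\<bar> \<le> t\<^sup>2 * (real m)\<^sup>2 * c ^ m"
proof (induction m)
  case 0 then show ?case by simp
next
  case (Suc m)
  define e where "e = (x + t) ^ m - x ^ m - real m * x ^ (m - 1) * t"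
  have c: "c \<ge> 0" using assms by simp
  have "(x + t) ^ Suc m - x ^ Suc m - real (Suc m) * x ^ (Suc m - 1) * t
      = (x + t) * e + real m * x ^ (m - 1) * t\<^sup>2"
    by (cases m) (simp_all add: e_def algebra_simps power2_eq_square)
  also have "c\<^sup>2 * \<bar>\<dots>\<bar> \<le> c\<^sup>2 * (\<bar>x + t\<bar> * \<bar>e\<bar>) + c\<^sup>2 * (real m * \<bar>x\<bar> ^ (m - 1) * t\<^sup>2)"
    unfolding distrib_left[symmetric]
    by (intro mult_left_mono order_trans[OF abs_triangle_ineq]) (simp_all add: abs_mult power_abs)
  also have "c\<^sup>2 * (\<bar>x + t\<bar> * \<bar>e\<bar>) \<le> c * (t\<^sup>2 * (real m)\<^sup>2 * c ^ m)"
  proof -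
    have "\<bar>x + t\<bar> * (c\<^sup>2 * \<bar>e\<bar>) \<le> c * (t\<^sup>2 * (real m)\<^sup>2 * c ^ m)"
      by (rule mult_mono) (use Suc c assms in \<open>auto simp: e_def\<close>)
    then show ?thesis by (simp add: algebra_simps)
  qed
  also have "c\<^sup>2 * (real m * \<bar>x\<bar> ^ (m - 1) * t\<^sup>2) \<le> real m * c ^ Suc m * t\<^sup>2"
  proof (cases m)
    case (Suc k)
    have "c\<^sup>2 * \<bar>x\<bar> ^ k \<le> c\<^sup>2 * c ^ k" using assms by (intro mult_left_mono power_mono) auto
    then have "(real m * t\<^sup>2) * (c\<^sup>2 * \<bar>x\<bar> ^ k) \<le> (real m * t\<^sup>2) * (c\<^sup>2 * c ^ k)"
      by (rule mult_left_mono) auto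
    then show ?thesis by (simp add: Suc algebra_simps power2_eq_square)
  qed simp
  also have "c * (t\<^sup>2 * (real m)\<^sup>2 * c ^ m) + real m * c ^ Suc m * t\<^sup>2 = t\<^sup>2 * c ^ Suc m * ((real m)\<^sup>2 + real m)"
    by (simp add: algebra_simps)
  also have "\<dots> \<le> t\<^sup>2 * c ^ Suc m * (real (Suc m))\<^sup>2"
  proof (rule mult_left_mono)
    show "0 \<le> t\<^sup>2 * c ^ Suc m" using c by simp
  qed (simp add: power2_eq_square algebra_simps)
  finally show ?case by (simp add: algebra_simps)
qed

definition monom_at :: "(('n::finite) \<Rightarrow> nat) \<Rightarrow> real^'n \<Rightarrow> real"
  where "monom_at \<alpha> h = (\<Prod>i\<in>UNIV. (h $ i) ^ \<alpha> i)"

lemma monom_at_split: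
  "monom_at \<alpha> h = (h $ i) ^ \<alpha> i * (\<Prod>j\<in>UNIV - {i}. (h $ j) ^ \<alpha> j)"
  unfolding monom_at_def by (simp add: prod.remove[of UNIV i])

definition vconst :: "real \<Rightarrow> real^'n::finite" where "vconst c = (\<chi> i. c)"

text \<open>Unconditional convergence of a real series is absolute. Evaluated at the diagonal point
  with all coordinates \<rho>, it dominates the series at every h whose coordinates are at most
  \<rho> in size. The choice \<rho> = r / (2 n) keeps the norm of that point at most n \<rho> = r /
  2.\<close>

lemma power_series_majorant:
  fixes a :: "(('n::finite) \<Rightarrow> nat) \<Rightarrow> real"
  assumes "0 < r" "\<And>h. norm h < r \<Longrightarrow> (\<lambda>\<alpha>. a \<alpha> * monom_at \<alpha> h) summable_on UNIV"
  obtains \<rho> where "0 < \<rho>" "\<rho> < r" "(\<lambda>\<alpha>. \<bar>a \<alpha>\<bar> * monom_at \<alpha> (vconst \<rho>)) summable_on UNIV"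
proof
  define \<rho> where "\<rho> = r / (2 * real CARD('n))"
  have n: "real CARD('n) \<ge> 1" by (simp add: Suc_leI)
  show "0 < \<rho>" using assms n by (auto simp: \<rho>_def)
  have "r * 1 < r * (2 * real CARD('n))" using assms(1) n by (intro mult_strict_left_mono) linarith+
  then show "\<rho> < r" using n by (auto simp: \<rho>_def field_simps)
  have "norm (vconst \<rho> :: real^'n) \<le> (\<Sum>i\<in>(UNIV::'n set). \<bar>\<rho>\<bar>)"
    using norm_le_l1_cart[of "vconst \<rho>"] by (simp add: vconst_def)
  also have "\<dots> = r / 2" using assms n by (simp add: \<rho>_def)
  finally have "norm (vconst \<rho> :: real^'n) < r" using assms by simp
  from assms(2)[OF this] have "(\<lambda>\<alpha>. norm (a \<alpha> * monom_at \<alpha> (vconst \<rho>))) summable_on UNIV"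
    by (rule summable_on_iff_abs_summable_on_real[THEN iffD1])
  moreover have "norm (a \<alpha> * monom_at \<alpha> (vconst \<rho>)) = \<bar>a \<alpha>\<bar> * monom_at \<alpha> (vconst \<rho>)" for \<alpha>
    using \<open>0 < \<rho>\<close> by (simp add: abs_mult monom_at_def vconst_def prod_nonneg)
  ultimately show "(\<lambda>\<alpha>. \<bar>a \<alpha>\<bar> * monom_at \<alpha> (vconst \<rho>)) summable_on UNIV" by simp
qed

lemma has_sum_uminusI:
  fixes f :: "'b \<Rightarrow> real"
  shows "(f has_sum s) A \<Longrightarrow> ((\<lambda>x. - f x) has_sum - s) A"
  using has_sum_cmult_right[of f A s "- 1"] by simp

lemma has_sum_abs_le:
  fixes f g :: "'b \<Rightarrow> real"
  assumes "(f has_sum s) A" "g summable_on A" "\<And>x. x \<in> A \<Longrightarrow> \<bar>f x\<bar> \<le> g x"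
  shows "\<bar>s\<bar> \<le> infsum g A"
proof -
  have g: "(g has_sum infsum g A) A" using assms(2) by simp
  have le: "f x \<le> g x" "- f x \<le> g x" if "x \<in> A" for x
    using assms(3)[OF that] by linarith+
  have "s \<le> infsum g A" by (rule has_sum_mono[OF assms(1) g le(1)])
  moreover have "- s \<le> infsum g A" by (rule has_sum_mono[OF has_sum_uminusI[OF assms(1)] g le(2)])
  ultimately show ?thesis by linarith
qed

lemma power_series_center:
  assumes "0 < r" "\<And>h. norm h < r \<Longrightarrow> ((\<lambda>\<alpha>. a \<alpha> * monom_at \<alpha> h) has_sum f (p + h)) UNIV"
  shows "f p = a (\<lambda>_. 0)"
proof -
  define z :: "'a \<Rightarrow> nat" where "z = (\<lambda>_. 0)"
  have mz: "monom_at z h = 1" for h by (simp add: monom_at_def z_def)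
  have "((\<lambda>\<alpha>. a \<alpha> * monom_at \<alpha> 0) has_sum a z) {z}"
    using has_sum_finite[of "{z}" "\<lambda>\<alpha>. a \<alpha> * monom_at \<alpha> 0"] by (simp add: mz)
  moreover have "a \<alpha> * monom_at \<alpha> 0 = 0" if "\<alpha> \<noteq> z" for \<alpha>
  proof -
    have "\<exists>i. \<alpha> i \<noteq> 0" using that by (auto simp: z_def)
    then obtain i where "\<alpha> i \<noteq> 0" ..
    then show ?thesis by (subst monom_at_split[of _ _ i]) simp
  qed
  ultimately have "((\<lambda>\<alpha>. a \<alpha> * monom_at \<alpha> 0) has_sum a z) UNIV"
    by (subst has_sum_cong_neutral[of "{z}"]) auto
  moreover have "((\<lambda>\<alpha>. a \<alpha> * monom_at \<alpha> 0) has_sum f p) UNIV" using assms(2)[of 0] assms(1) by simp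
  ultimately show ?thesis unfolding z_def by (rule has_sum_unique[symmetric])
qed

text \<open>\<open>F\<close> consists of the multi-indices of degree at most 1, and these terms sum
  to \<open>f p + L h\<close>. Every other term has degree at least 2, so it is at most (norm h /
  \<rho>)^2 times its majorant, and the remainder is quadratic in h.\<close>

lemma power_series_differentiable:
  fixes f :: "real^'n::finite \<Rightarrow> real"
  assumes "0 < r" and s: "\<And>h. norm h < r \<Longrightarrow> ((\<lambda>\<alpha>. a \<alpha> * monom_at \<alpha> h) has_sum f (p + h)) UNIV"
  shows "f differentiable (at p)"
proof -
  obtain \<rho> where \<rho>: "0 < \<rho>" "\<rho> < r" "(\<lambda>\<alpha>. \<bar>a \<alpha>\<bar> * monom_at \<alpha> (vconst \<rho>)) summable_on UNIV"
    by (rule power_series_majorant[OF assms(1), of a]) (use s in \<open>auto simp: summable_on_def\<close>)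
  define M where "M = infsum (\<lambda>\<alpha>. \<bar>a \<alpha>\<bar> * monom_at \<alpha> (vconst \<rho>)) UNIV"
  define z :: "'n \<Rightarrow> nat" where "z = (\<lambda>_. 0)"
  define e :: "'n \<Rightarrow> 'n \<Rightarrow> nat" where "e i = z(i := 1)" for i
  define F where "F = insert z (range e)"
  have injE: "inj e"
  proof (rule injI)
    fix i j assume "e i = e j"
    then have "e i i = e j i" by simp
    then show "i = j" by (auto simp: e_def z_def split: if_splits)
  qed
  have zF: "z \<notin> range e" by (auto simp: e_def z_def fun_eq_iff intro: exI[of _ undefined]) (metis zero_neq_one One_nat_def)
  define L where "L h = (\<Sum>i\<in>UNIV. a (e i) * h $ i)" for h :: "real^'n"
  have bl: "bounded_linear L"
    unfolding L_def by (intro bounded_linear_sum bounded_linear_const_mult) (rule bounded_linear_vec_nth)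
  have mz: "monom_at z h = 1" for h by (simp add: monom_at_def z_def)
  have me: "monom_at (e i) h = h $ i" for h i
    by (subst monom_at_split[of _ _ i]) (simp add: e_def z_def)
  have sF: "sum (\<lambda>\<alpha>. a \<alpha> * monom_at \<alpha> h) F = a z + L h" for h
    unfolding F_def L_def using zF injE by (simp add: sum.reindex mz me)
  have f0: "f p = a z"
    unfolding z_def by (rule power_series_center[of r a f p, OF assms(1)]) (rule s)
  have bound: "\<bar>f (p + h) - f p - L h\<bar> \<le> (norm h)\<^sup>2 * (M / \<rho>\<^sup>2)" if h: "norm h < \<rho>" for h
  proof -
    define g where "g \<alpha> = a \<alpha> * monom_at \<alpha> h" for \<alpha>
    have "(g has_sum (f (p + h) - sum g F)) (UNIV - F)"
      unfolding g_def using s[of h] h \<rho> by (intro has_sum_Diff has_sum_finite) (auto simp: F_def)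
    then have hs: "(g has_sum (f (p + h) - f p - L h)) (UNIV - F)"
      using sF[of h] by (simp add: g_def f0 algebra_simps)
    define G where "G \<alpha> = (norm h / \<rho>)\<^sup>2 * (\<bar>a \<alpha>\<bar> * monom_at \<alpha> (vconst \<rho>))" for \<alpha>
    have G: "G summable_on UNIV" unfolding G_def by (intro summable_on_cmult_right \<rho>)
    have Gpos: "G \<alpha> \<ge> 0" for \<alpha> using \<rho> by (auto simp: G_def monom_at_def vconst_def intro!: prod_nonneg mult_nonneg_nonneg)
    have le: "\<bar>g \<alpha>\<bar> \<le> G \<alpha>" if "\<alpha> \<in> UNIV - F" for \<alpha>
    proof -
      have two: "sum \<alpha> UNIV \<ge> 2"
      proof (rule ccontr)
        assume "\<not> ?thesis"
        then consider "sum \<alpha> UNIV = 0" | "sum \<alpha> UNIV = 1" by linarith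
        then show False
        proof cases
          case 1 then have "\<alpha> = z" by (auto simp: z_def)
          then show False using that by (simp add: F_def)
        next
          case 2
          then obtain i where "\<alpha> i = 1" "\<And>j. j \<noteq> i \<Longrightarrow> \<alpha> j = 0"
            using sum_eq_1_iff[of UNIV \<alpha>] by auto
          then have "\<alpha> = e i" by (auto simp: e_def z_def)
          then show False using that by (simp add: F_def)
        qed
      qed
      have "\<bar>monom_at \<alpha> h\<bar> = (\<Prod>i\<in>UNIV. \<bar>h $ i\<bar> ^ \<alpha> i)"
        by (simp add: monom_at_def abs_prod power_abs)
      also have "\<dots> \<le> (\<Prod>i\<in>UNIV. (norm h / \<rho>) ^ \<alpha> i * \<rho> ^ \<alpha> i)"
        using \<rho> component_le_norm_cart[of h]
        by (intro prod_mono) (auto simp: power_mult_distrib[symmetric] intro!: power_mono)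
      also have "\<dots> = (norm h / \<rho>) ^ (sum \<alpha> UNIV) * monom_at \<alpha> (vconst \<rho>)"
        by (simp add: prod.distrib power_sum monom_at_def vconst_def)
      also have "\<dots> \<le> (norm h / \<rho>)\<^sup>2 * monom_at \<alpha> (vconst \<rho>)"
        using \<rho> h two by (intro mult_right_mono power_decreasing) (auto simp: monom_at_def vconst_def prod_nonneg)
      finally show ?thesis unfolding g_def G_def abs_mult
        by (metis abs_ge_zero mult.left_commute mult_left_mono)
    qed
    have "\<bar>f (p + h) - f p - L h\<bar> \<le> infsum G (UNIV - F)"
      by (rule has_sum_abs_le[OF hs _ le]) (use summable_on_subset_banach[OF G] in \<open>auto\<close>)
    also have "\<dots> \<le> infsum G UNIV"
      by (rule infsum_mono2) (use G Gpos summable_on_subset_banach[OF G] in \<open>auto\<close>)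
    also have "\<dots> = (norm h / \<rho>)\<^sup>2 * M" unfolding G_def M_def by (rule infsum_cmult_right')
    finally show ?thesis by (simp add: power_divide)
  qed
  have "(f has_derivative L) (at p)"
    unfolding has_derivative_at
  proof (intro conjI bl)
    show "(\<lambda>h. norm (f (p + h) - f p - L h) / norm h) \<midarrow>0\<rightarrow> 0"
    proof (rule real_tendsto_sandwich)
      show "\<forall>\<^sub>F h in at 0. 0 \<le> norm (f (p + h) - f p - L h) / norm h" by simp
      show "\<forall>\<^sub>F h in at 0. norm (f (p + h) - f p - L h) / norm h \<le> norm h * (M / \<rho>\<^sup>2)"
        unfolding eventually_at
      proof (intro exI[of _ \<rho>] conjI ballI impI \<rho>)
        fix h :: "real^'n" assume h: "h \<noteq> 0 \<and> dist h 0 < \<rho>"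
        then have "\<bar>f (p + h) - f p - L h\<bar> \<le> norm h * (norm h * (M / \<rho>\<^sup>2))"
          using bound[of h] by (simp add: power2_eq_square)
        then show "norm (f (p + h) - f p - L h) / norm h \<le> norm h * (M / \<rho>\<^sup>2)"
          using h by (simp add: divide_le_eq mult.commute)
      qed
      show "((\<lambda>h::real^'n. norm h * (M / \<rho>\<^sup>2)) \<longlongrightarrow> 0) (at 0)"
        by (rule tendsto_eq_intros refl tendsto_norm_zero tendsto_ident_at | simp)+
    qed auto
  qed
  then show ?thesis by (auto simp: differentiable_def)
qed

lemma real_analytic_on_alt:
  "real_analytic_on f S \<longleftrightarrow> open S \<and> (\<forall>p\<in>S. \<exists>r>0. \<exists>a. \<forall>h. norm h < r \<longrightarrow>
     ((\<lambda>\<alpha>. a \<alpha> * monom_at \<alpha> h) has_sum f (p + h)) UNIV)"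
  unfolding real_analytic_on_def monom_at_def ..

lemma real_analytic_onD:
  assumes "real_analytic_on f S" "p \<in> S"
  shows "\<exists>r>0. \<exists>a. \<forall>h. norm h < r \<longrightarrow> ((\<lambda>\<alpha>. a \<alpha> * monom_at \<alpha> h) has_sum f (p + h)) UNIV"
  using conjunct2[OF assms(1)[unfolded real_analytic_on_alt]] assms(2) by (rule bspec)

lemma real_analytic_differentiable:
  assumes "real_analytic_on f S" "x \<in> S"
  shows "f differentiable (at x)"
proof -
  obtain r a where r: "r > 0" "\<forall>h. norm h < r \<longrightarrow> ((\<lambda>\<alpha>. a \<alpha> * monom_at \<alpha> h) has_sum f (x + h)) UNIV"
    using real_analytic_onD[OF assms] by (elim exE conjE)
  show ?thesis by (rule power_series_differentiable[of r a f x, OF r(1)]) (rule r(2)[rule_format])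
qed

text \<open>Only the coordinate i is moved. For each monomial the remainder of the linear
  approximation is quadratic in t by \<open>monomial_taylor\<close>, and the sum of these bounds is
  finite, so the termwise derivative is the derivative along the axis.\<close>

lemma power_series_partial:
  fixes f :: "real^'n::finite \<Rightarrow> real"
  assumes "0 < r" and s: "\<And>h. norm h < r \<Longrightarrow> ((\<lambda>\<alpha>. a \<alpha> * monom_at \<alpha> h) has_sum f (p + h)) UNIV"
    and d: "\<And>h. norm h < r \<Longrightarrow> f differentiable (at (p + h))"
  shows "\<exists>r'>0. r' \<le> r \<and> (\<forall>h. norm h < r' \<longrightarrow>
    ((\<lambda>\<beta>. real (Suc (\<beta> i)) * a (\<beta>(i := Suc (\<beta> i))) * monom_at \<beta> h) has_sum partial i f (p + h)) UNIV)"
proof -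
  obtain \<rho> where \<rho>: "0 < \<rho>" "\<rho> < r" "(\<lambda>\<alpha>. \<bar>a \<alpha>\<bar> * monom_at \<alpha> (vconst \<rho>)) summable_on UNIV"
    by (rule power_series_majorant[OF assms(1), of a]) (use s in \<open>auto simp: summable_on_def\<close>)
  define M where "M = infsum (\<lambda>\<alpha>. \<bar>a \<alpha>\<bar> * monom_at \<alpha> (vconst \<rho>)) UNIV"
  \<comment> \<open>As m \<le> 2^m, a quarter of the radius absorbs the factor m^2: m^2 c^m \<le>
    \<rho>^m. Steps h and t below c / 2 keep both arguments of \<open>monomial_taylor\<close> within
    c.\<close>
  define c where "c = \<rho> / 4"
  have c: "0 < c" "c < \<rho>" "c < r" using \<rho> by (auto simp: c_def)
  have pow: "(real m)\<^sup>2 * c ^ m \<le> \<rho> ^ m" for m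
  proof -
    have "real m \<le> 2 ^ m" using of_nat_less_two_power[of m, where 'a = real] by linarith
    then have "(real m)\<^sup>2 \<le> (2 ^ m)\<^sup>2" by (intro power_mono) auto
    also have "(2 ^ m)\<^sup>2 = (4::real) ^ m" by (simp add: power2_eq_square power_mult_distrib[symmetric])
    finally have "(real m)\<^sup>2 * c ^ m \<le> 4 ^ m * c ^ m" using c by (intro mult_right_mono) auto
    then show ?thesis by (simp add: c_def power_divide)
  qed
  have main: "((\<lambda>\<beta>. real (Suc (\<beta> i)) * a (\<beta>(i := Suc (\<beta> i))) * monom_at \<beta> h) has_sum partial i f (p + h)) UNIV"
    if h: "norm h < c / 2" for h
  proof -
    define Q where "Q \<alpha> = (\<Prod>j\<in>UNIV - {i}. (h $ j) ^ \<alpha> j)" for \<alpha> :: "'n \<Rightarrow> nat"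
    define R where "R \<alpha> = (\<Prod>j\<in>UNIV - {i}. \<rho> ^ \<alpha> j)" for \<alpha> :: "'n \<Rightarrow> nat"
    have hj: "\<bar>h $ j\<bar> \<le> c / 2" for j using component_le_norm_cart[of h j] h by linarith
    have QR: "\<bar>Q \<alpha>\<bar> \<le> R \<alpha>" "R \<alpha> \<ge> 0" for \<alpha>
    proof -
      have hr: "\<bar>h $ j\<bar> \<le> \<rho>" for j using hj[of j] c by linarith
      have "\<bar>Q \<alpha>\<bar> = (\<Prod>j\<in>UNIV - {i}. \<bar>h $ j\<bar> ^ \<alpha> j)" by (simp add: Q_def abs_prod power_abs)
      also have "\<dots> \<le> R \<alpha>" unfolding R_def
        using hr by (intro prod_mono) (auto intro!: power_mono)
      finally show "\<bar>Q \<alpha>\<bar> \<le> R \<alpha>" .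
      show "R \<alpha> \<ge> 0" using \<rho> by (auto simp: R_def intro!: prod_nonneg)
    qed
    have mR: "monom_at \<alpha> (vconst \<rho>) = \<rho> ^ \<alpha> i * R \<alpha>" for \<alpha>
      by (subst monom_at_split[of _ _ i]) (simp add: vconst_def R_def)
    define D where "D \<alpha> = a \<alpha> * (real (\<alpha> i) * (h $ i) ^ (\<alpha> i - 1) * Q \<alpha>)" for \<alpha>
    define N where "N \<alpha> = \<bar>a \<alpha>\<bar> * monom_at \<alpha> (vconst \<rho>)" for \<alpha>
    have sN: "N summable_on UNIV" unfolding N_def by (rule \<rho>)
    have DN: "\<bar>D \<alpha>\<bar> \<le> (1 / c) * N \<alpha>" for \<alpha>
    proof -
      have "real (\<alpha> i) * \<bar>h $ i\<bar> ^ (\<alpha> i - 1) \<le> (1 / c) * \<rho> ^ \<alpha> i"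
      proof (cases "\<alpha> i")
        case 0 then show ?thesis using c \<rho> by simp
      next
        case (Suc k)
        have "\<bar>h $ i\<bar> ^ k \<le> c ^ k" using hj[of i] c by (intro power_mono) linarith+
        then have "real (Suc k) * \<bar>h $ i\<bar> ^ k \<le> real (Suc k) * c ^ k" by (intro mult_left_mono) auto
        also have "\<dots> = (1 / c) * (real (Suc k) * c ^ Suc k)" using c by simp
        also have "\<dots> \<le> (1 / c) * ((real (Suc k))\<^sup>2 * c ^ Suc k)"
          using c by (intro mult_left_mono mult_right_mono) (auto simp: power2_eq_square)
        also have "\<dots> \<le> (1 / c) * \<rho> ^ Suc k" using c pow[of "Suc k"] by (intro mult_left_mono) auto
        finally show ?thesis using Suc by simp
      qed
      then have "(real (\<alpha> i) * \<bar>h $ i\<bar> ^ (\<alpha> i - 1)) * \<bar>Q \<alpha>\<bar> \<le> ((1 / c) * \<rho> ^ \<alpha> i) * R \<alpha>"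
        by (rule mult_mono) (use QR c \<rho> in auto)
      then have "\<bar>a \<alpha>\<bar> * ((real (\<alpha> i) * \<bar>h $ i\<bar> ^ (\<alpha> i - 1)) * \<bar>Q \<alpha>\<bar>) \<le> \<bar>a \<alpha>\<bar> * (((1 / c) * \<rho> ^ \<alpha> i) * R \<alpha>)"
        by (rule mult_left_mono) simp
      then show ?thesis by (simp add: D_def N_def mR abs_mult power_abs mult_ac)
    qed
    have "D summable_on UNIV"
    proof (rule summable_on_iff_abs_summable_on_real[THEN iffD2], rule summable_on_comparison_test)
      show "(\<lambda>\<alpha>. (1 / c) * N \<alpha>) summable_on UNIV" by (intro summable_on_cmult_right sN)
    qed (use DN in auto)
    then obtain s where Ds: "(D has_sum s) UNIV" by (auto simp: summable_on_def)
    have line: "\<bar>f (p + h + t *\<^sub>R axis i 1) - f (p + h) - t * s\<bar> \<le> t\<^sup>2 * (M / c\<^sup>2)" if t: "\<bar>t\<bar> < c / 2" for t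
    proof -
      define k where "k = h + t *\<^sub>R axis i 1"
      have kj: "k $ j = (if j = i then h $ i + t else h $ j)" for j by (simp add: k_def axis_def)
      have "norm k \<le> norm h + \<bar>t\<bar>" unfolding k_def by (rule order_trans[OF norm_triangle_ineq]) (simp add: norm_axis_1)
      then have nk: "norm k < r" "norm h < r" using h t c by linarith+
      define E where "E \<alpha> = a \<alpha> * monom_at \<alpha> k - a \<alpha> * monom_at \<alpha> h - t * D \<alpha>" for \<alpha>
      have "(E has_sum (f (p + k) - f (p + h) - t * s)) UNIV"
        unfolding E_def diff_conv_add_uminus
        by (intro has_sum_add has_sum_uminusI s nk has_sum_cmult_right Ds)
      moreover have "(\<lambda>\<alpha>. (t\<^sup>2 / c\<^sup>2) * N \<alpha>) summable_on UNIV" by (intro summable_on_cmult_right sN)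
      moreover have "\<bar>E \<alpha>\<bar> \<le> (t\<^sup>2 / c\<^sup>2) * N \<alpha>" for \<alpha>
      proof -
        define m where "m = \<alpha> i"
        define x where "x = h $ i"
        define y where "y = \<bar>(x + t) ^ m - x ^ m - real m * x ^ (m - 1) * t\<bar>"
        have "monom_at \<alpha> k = (x + t) ^ m * Q \<alpha>"
          by (subst monom_at_split[of _ _ i]) (simp add: kj Q_def x_def m_def)
        moreover have "monom_at \<alpha> h = x ^ m * Q \<alpha>"
          by (subst monom_at_split[of _ _ i]) (simp add: Q_def x_def m_def)
        ultimately have "E \<alpha> = a \<alpha> * Q \<alpha> * ((x + t) ^ m - x ^ m - real m * x ^ (m - 1) * t)"
          by (simp add: E_def D_def x_def m_def algebra_simps)
        then have Ey: "\<bar>E \<alpha>\<bar> = \<bar>a \<alpha>\<bar> * (\<bar>Q \<alpha>\<bar> * y)" by (simp add: abs_mult y_def)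
        have "c\<^sup>2 * y \<le> t\<^sup>2 * (real m)\<^sup>2 * c ^ m" unfolding y_def
          by (rule monomial_taylor) (use hj[of i] t c in \<open>auto simp: x_def\<close>)
        also have "\<dots> \<le> t\<^sup>2 * \<rho> ^ m" using mult_left_mono[OF pow[of m], of "t\<^sup>2"] by (simp add: mult_ac)
        finally have "y \<le> t\<^sup>2 / c\<^sup>2 * \<rho> ^ m" using c by (simp add: field_simps)
        with QR(1)[of \<alpha>] have "\<bar>Q \<alpha>\<bar> * y \<le> R \<alpha> * (t\<^sup>2 / c\<^sup>2 * \<rho> ^ m)"
          by (rule mult_mono) (use QR[of \<alpha>] in \<open>auto simp: y_def\<close>)
        then have "\<bar>a \<alpha>\<bar> * (\<bar>Q \<alpha>\<bar> * y) \<le> \<bar>a \<alpha>\<bar> * (R \<alpha> * (t\<^sup>2 / c\<^sup>2 * \<rho> ^ m))"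
          by (rule mult_left_mono) simp
        then show ?thesis unfolding Ey N_def mR m_def by (simp add: mult_ac)
      qed
      ultimately have "\<bar>f (p + k) - f (p + h) - t * s\<bar> \<le> infsum (\<lambda>\<alpha>. (t\<^sup>2 / c\<^sup>2) * N \<alpha>) UNIV"
        by (intro has_sum_abs_le) auto
      also have "\<dots> = (t\<^sup>2 / c\<^sup>2) * M" unfolding N_def M_def by (rule infsum_cmult_right')
      finally show ?thesis by (simp add: k_def add.assoc)
    qed
    have "((\<lambda>t. f (p + h + t *\<^sub>R axis i 1)) has_derivative (\<lambda>t. t * s)) (at 0)"
      unfolding has_derivative_at
    proof (intro conjI)
      show "bounded_linear (\<lambda>t. t * s)" by (rule bounded_linear_mult_left)
      show "(\<lambda>t. norm (f (p + h + (0 + t) *\<^sub>R axis i 1) - f (p + h + 0 *\<^sub>R axis i 1) - t * s) / norm t) \<midarrow>0\<rightarrow> 0"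
      proof (rule real_tendsto_sandwich)
        show "\<forall>\<^sub>F t in at 0. 0 \<le> norm (f (p + h + (0 + t) *\<^sub>R axis i 1) - f (p + h + 0 *\<^sub>R axis i 1) - t * s) / norm t"
          by simp
        show "\<forall>\<^sub>F t in at 0. norm (f (p + h + (0 + t) *\<^sub>R axis i 1) - f (p + h + 0 *\<^sub>R axis i 1) - t * s) / norm t
            \<le> \<bar>t\<bar> * (M / c\<^sup>2)"
          unfolding eventually_at
        proof (intro exI[of _ "c / 2"] conjI ballI impI)
          fix t :: real assume t: "t \<noteq> 0 \<and> dist t 0 < c / 2"
          then have "\<bar>f (p + h + t *\<^sub>R axis i 1) - f (p + h) - t * s\<bar> \<le> \<bar>t\<bar> * (\<bar>t\<bar> * (M / c\<^sup>2))"
            using line[of t] by (simp add: power2_eq_square)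
          then show "norm (f (p + h + (0 + t) *\<^sub>R axis i 1) - f (p + h + 0 *\<^sub>R axis i 1) - t * s) / norm t
              \<le> \<bar>t\<bar> * (M / c\<^sup>2)"
            using t by (simp add: divide_le_eq mult.commute)
        qed (use c in auto)
        show "((\<lambda>t::real. \<bar>t\<bar> * (M / c\<^sup>2)) \<longlongrightarrow> 0) (at 0)"
          by (rule tendsto_eq_intros refl tendsto_rabs_zero tendsto_ident_at | simp)+
      qed auto
    qed
    moreover have "((\<lambda>t. f (p + h + t *\<^sub>R axis i 1)) has_derivative (\<lambda>t. t * partial i f (p + h))) (at 0)"
    proof -
      have "(f has_derivative deriv_at f (p + h)) (at (p + h + 0 *\<^sub>R axis i 1))"
        using d[of h] h c by (simp add: frechet_derivative_works)
      then have "((\<lambda>t. f (p + h + t *\<^sub>R axis i 1)) has_derivative (\<lambda>t. deriv_at f (p + h) (t *\<^sub>R axis i 1))) (at 0)"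
        by (rule has_derivative_compose[rotated]) (auto intro!: derivative_eq_intros)
      moreover have "deriv_at f (p + h) (t *\<^sub>R axis i 1) = t * partial i f (p + h)" for t
        using d[of h] h c unfolding partial_def
        by (simp add: linear_cmul linear_frechet_derivative)
      ultimately show ?thesis by simp
    qed
    ultimately have "(\<lambda>t. t * s) = (\<lambda>t. t * partial i f (p + h))"
      by (rule has_derivative_unique)
    then have s_eq: "s = partial i f (p + h)" by (metis mult_1)
    \<comment> \<open>Terms with exponent 0 in the direction i vanish in \<open>D\<close>, so the
      sum may be taken over the range of \<phi> and then reindexed by the lowered exponent.\<close>
    define \<phi> where "\<phi> \<beta> = \<beta>(i := Suc (\<beta> i))" for \<beta> :: "'n \<Rightarrow> nat"
    have inj: "inj \<phi>"
    proof (rule injI)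
      fix \<beta> \<gamma> assume eq: "\<phi> \<beta> = \<phi> \<gamma>"
      show "\<beta> = \<gamma>"
      proof
        fix j show "\<beta> j = \<gamma> j" using fun_cong[OF eq, of j] by (auto simp: \<phi>_def split: if_splits)
      qed
    qed
    have range: "\<alpha> \<in> range \<phi>" if "\<alpha> i \<noteq> 0" for \<alpha>
    proof
      show "\<alpha> = \<phi> (\<alpha>(i := \<alpha> i - 1))" using that by (auto simp: \<phi>_def)
    qed simp
    have "(D has_sum s) (range \<phi>)"
    proof (subst has_sum_cong_neutral[of UNIV "range \<phi>" D D])
      show "D \<alpha> = 0" if "\<alpha> \<in> UNIV - range \<phi>" for \<alpha>
        using range[of \<alpha>] that by (auto simp: D_def)
    qed (use Ds in auto)
    then have "((D \<circ> \<phi>) has_sum s) UNIV" using has_sum_reindex[OF inj] by blast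
    moreover have "(D \<circ> \<phi>) \<beta> = real (Suc (\<beta> i)) * a (\<beta>(i := Suc (\<beta> i))) * monom_at \<beta> h" for \<beta>
    proof -
      have "Q (\<phi> \<beta>) = Q \<beta>" unfolding Q_def by (intro prod.cong) (auto simp: \<phi>_def)
      then show ?thesis by (subst monom_at_split[of _ _ i]) (simp add: D_def Q_def \<phi>_def)
    qed
    ultimately show ?thesis by (simp add: s_eq o_def)
  qed
  show ?thesis using main c by (intro exI[of _ "c / 2"]) auto
qed

lemma real_analytic_partial_series:
  assumes f: "real_analytic_on f S" and p: "p \<in> S" and r: "r > 0"
    "\<forall>h. norm h < r \<longrightarrow> ((\<lambda>\<alpha>. a \<alpha> * monom_at \<alpha> h) has_sum f (p + h)) UNIV"
  shows "\<exists>r'>0. \<forall>h. norm h < r' \<longrightarrow>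
      ((\<lambda>\<beta>. real (Suc (\<beta> i)) * a (\<beta>(i := Suc (\<beta> i))) * monom_at \<beta> h) has_sum partial i f (p + h)) UNIV"
proof -
  have "open S" using f by (simp add: real_analytic_on_alt)
  then obtain r2 where r2: "r2 > 0" "ball p r2 \<subseteq> S" using p open_contains_ball by blast
  have d: "f differentiable (at (p + h))" if "norm h < min r r2" for h
    by (rule real_analytic_differentiable[OF f]) (use that r2 in \<open>auto simp: dist_norm\<close>)
  have hs: "((\<lambda>\<alpha>. a \<alpha> * monom_at \<alpha> h) has_sum f (p + h)) UNIV" if "norm h < min r r2" for h
    using r(2) that by simp
  have 0: "0 < min r r2" using r r2 by simp
  have "\<exists>r'>0. r' \<le> min r r2 \<and> (\<forall>h. norm h < r' \<longrightarrow>
      ((\<lambda>\<beta>. real (Suc (\<beta> i)) * a (\<beta>(i := Suc (\<beta> i))) * monom_at \<beta> h) has_sum partial i f (p + h)) UNIV)"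
    by (rule power_series_partial[of "min r r2" a f p i, OF 0 hs d])
  then show ?thesis by (elim exE conjE) (rule exI, rule conjI)
qed

lemma real_analytic_partial:
  assumes f: "real_analytic_on f S"
  shows "real_analytic_on (partial i f) S"
  unfolding real_analytic_on_alt
proof (intro conjI ballI)
  show "open S" using f by (simp add: real_analytic_on_alt)
  fix p assume p: "p \<in> S"
  obtain r a where r: "r > 0" "\<forall>h. norm h < r \<longrightarrow> ((\<lambda>\<alpha>. a \<alpha> * monom_at \<alpha> h) has_sum f (p + h)) UNIV"
    using real_analytic_onD[OF f p] by (elim exE conjE)
  obtain r' where r': "r' > 0" "\<forall>h. norm h < r' \<longrightarrow>
      ((\<lambda>\<beta>. real (Suc (\<beta> i)) * a (\<beta>(i := Suc (\<beta> i))) * monom_at \<beta> h) has_sum partial i f (p + h)) UNIV"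
    using real_analytic_partial_series[of f S p r a i, OF f p r] by (elim exE conjE)
  show "\<exists>r>0. \<exists>a. \<forall>h. norm h < r \<longrightarrow> ((\<lambda>\<alpha>. a \<alpha> * monom_at \<alpha> h) has_sum partial i f (p + h)) UNIV"
    by (rule exI[of _ r'], rule conjI[OF r'(1)],
      rule exI[of _ "\<lambda>\<beta>. real (Suc (\<beta> i)) * a (\<beta>(i := Suc (\<beta> i)))"], rule r'(2))
qed

text \<open>For i different from j, both mixed derivatives are the coefficient of the monomial h_i
  h_j, whose description is symmetric in i and j.\<close>

lemma real_analytic_partial_commute:
  fixes f :: "real^'n::finite \<Rightarrow> real"
  assumes f: "real_analytic_on f S" and p: "p \<in> S"
  shows "partial i (partial j f) p = partial j (partial i f) p"
proof (cases "i = j")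
  case False
  obtain r a where r: "r > 0" "\<forall>h. norm h < r \<longrightarrow> ((\<lambda>\<alpha>. a \<alpha> * monom_at \<alpha> h) has_sum f (p + h)) UNIV"
    using real_analytic_onD[OF f p] by (elim exE conjE)
  have *: "partial i (partial j f) p = a (\<lambda>k. if k = i \<or> k = j then 1 else 0)" if ij: "i \<noteq> j" for i j
  proof -
    define b where "b \<beta> = real (Suc (\<beta> j)) * a (\<beta>(j := Suc (\<beta> j)))" for \<beta>
    define c where "c \<beta> = real (Suc (\<beta> i)) * b (\<beta>(i := Suc (\<beta> i)))" for \<beta>
    obtain r' where r': "r' > 0" "\<forall>h. norm h < r' \<longrightarrow> ((\<lambda>\<beta>. b \<beta> * monom_at \<beta> h) has_sum partial j f (p + h)) UNIV"
      using real_analytic_partial_series[of f S p r a j, OF f p r(1) r(2)]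
      unfolding b_def by (elim exE conjE)
    obtain r'' where r'': "r'' > 0" "\<forall>h. norm h < r'' \<longrightarrow> ((\<lambda>\<beta>. c \<beta> * monom_at \<beta> h) has_sum partial i (partial j f) (p + h)) UNIV"
      using real_analytic_partial_series[of "partial j f" S p r' b i, OF real_analytic_partial[OF f] p r'(1) r'(2)]
      unfolding c_def by (elim exE conjE)
    have "partial i (partial j f) p = c (\<lambda>_. 0)"
      by (rule power_series_center[of r'' c "partial i (partial j f)" p, OF r''(1)]) (rule r''(2)[rule_format])
    also have "\<dots> = a ((\<lambda>_. 0)(i := 1, j := 1))" using ij by (simp add: c_def b_def)
    also have "(\<lambda>_. 0)(i := 1, j := 1) = (\<lambda>k. if k = i \<or> k = j then 1 else (0::nat))" by auto
    finally show ?thesis .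
  qed
  from *[OF False] *[of j i] False show ?thesis by (simp add: disj_commute)
qed simp

section \<open>Functions with iterated partial derivatives\<close>

text \<open>Total differentiability is asked for at each level, but continuity is not: it follows
  for every derivative below the top. This keeps the closure proofs for sums, products and inverses
  to one induction each.\<close>

primrec diff_upto :: "nat \<Rightarrow> (real^'n::finite \<Rightarrow> real) \<Rightarrow> (real^'n) set \<Rightarrow> bool"
  where
    "diff_upto 0 f S \<longleftrightarrow> True"
  | "diff_upto (Suc k) f S \<longleftrightarrow> (\<forall>x\<in>S. f differentiable (at x)) \<and> (\<forall>i. diff_upto k (partial i f) S)"

lemma partial_eqI:
  "(f has_derivative D) (at x) \<Longrightarrow> partial i f x = D (axis i 1)"
  unfolding partial_def by (simp add: frechet_derivative_at[symmetric])

lemma differentiable_has_derivative_partial: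
  assumes "f differentiable (at x)"
  shows "(f has_derivative (\<lambda>v. \<Sum>i\<in>UNIV. v $ i * partial i f x)) (at x)"
proof -
  have l: "linear (deriv_at f x)" by (rule linear_frechet_derivative[OF assms])
  have "deriv_at f x v = (\<Sum>i\<in>UNIV. v $ i * partial i f x)" for v
  proof -
    have "deriv_at f x v = deriv_at f x (\<Sum>i\<in>UNIV. v $ i *\<^sub>R axis i 1)"
      by (simp add: basis_expansion scalar_mult_eq_scaleR[symmetric])
    also have "\<dots> = (\<Sum>i\<in>UNIV. v $ i * partial i f x)"
      by (simp add: linear_sum[OF l] linear_cmul[OF l] partial_def)
    finally show ?thesis .
  qed
  then have "deriv_at f x = (\<lambda>v. \<Sum>i\<in>UNIV. v $ i * partial i f x)" by auto
  then show ?thesis using assms by (simp add: frechet_derivative_works)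
qed

lemma partial_cong:
  assumes "open S" "x \<in> S" "\<And>y. y \<in> S \<Longrightarrow> f y = g y"
  shows "f differentiable (at x) \<longleftrightarrow> g differentiable (at x)" "partial i f x = partial i g x"
proof -
  have *: "(f has_derivative D) (at x) \<longleftrightarrow> (g has_derivative D) (at x)" for D
    using has_derivative_transform_within_open[of f D x UNIV S g, OF _ assms(1,2,3)]
      has_derivative_transform_within_open[of g D x UNIV S f, OF _ assms(1,2) assms(3)[symmetric]] by auto
  then show "f differentiable (at x) \<longleftrightarrow> g differentiable (at x)" by (simp add: differentiable_def)
  show "partial i f x = partial i g x" unfolding partial_def frechet_derivative_def * ..
qed

lemma diff_upto_cong:
  assumes "open S" "\<And>y. y \<in> S \<Longrightarrow> f y = g y"
  shows "diff_upto k f S \<longleftrightarrow> diff_upto k g S"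
  using assms(2)
proof (induction k arbitrary: f g)
  case (Suc k)
  have "diff_upto k (partial i f) S \<longleftrightarrow> diff_upto k (partial i g) S" for i
    by (rule Suc.IH) (rule partial_cong(2)[OF assms(1) _ Suc.prems])
  moreover have "(\<forall>x\<in>S. f differentiable (at x)) \<longleftrightarrow> (\<forall>x\<in>S. g differentiable (at x))"
    using partial_cong(1)[OF assms(1) _ Suc.prems] by auto
  ultimately show ?case by simp
qed simp

lemma diff_upto_Suc_imp: "diff_upto (Suc k) f S \<Longrightarrow> diff_upto k f S"
proof (induction k arbitrary: f)
  case (Suc k)
  have "diff_upto k (partial i f) S" for i by (rule Suc.IH) (use Suc.prems in auto)
  then show ?case using Suc.prems by simp
qed simp

lemma real_analytic_diff_upto: "real_analytic_on f S \<Longrightarrow> diff_upto k f S"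
  by (induction k arbitrary: f) (auto intro: real_analytic_differentiable real_analytic_partial)

lemma partial_const [simp]: "partial i (\<lambda>_. c) = (\<lambda>_. 0)"
  by (rule ext, subst partial_eqI[OF has_derivative_const]) simp

lemma partial_add:
  "f differentiable (at x) \<Longrightarrow> g differentiable (at x) \<Longrightarrow>
    partial i (\<lambda>y. f y + g y) x = partial i f x + partial i g x"
  unfolding partial_def frechet_derivative_works by (subst partial_eqI[unfolded partial_def, OF has_derivative_add]) auto

lemma partial_mult:
  fixes f g :: "real^'n::finite \<Rightarrow> real"
  shows "f differentiable (at x) \<Longrightarrow> g differentiable (at x) \<Longrightarrow>
    partial i (\<lambda>y. f y * g y) x = f x * partial i g x + partial i f x * g x"
  unfolding partial_def frechet_derivative_works by (subst partial_eqI[unfolded partial_def, OF has_derivative_mult]) auto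

lemma partial_inverse:
  fixes f :: "real^'n::finite \<Rightarrow> real"
  assumes "f differentiable (at x)" "f x \<noteq> 0"
  shows "partial i (\<lambda>y. inverse (f y)) x = (- 1) * (partial i f x * (inverse (f x) * inverse (f x)))"
  using assms(1) unfolding partial_def frechet_derivative_works
  by (subst partial_eqI[unfolded partial_def, OF Deriv.has_derivative_inverse[where f = f and x = x, OF assms(2)]]) auto

lemma diff_upto_const: "diff_upto k (\<lambda>_. c) S"
  by (induction k arbitrary: c) auto

lemma diff_upto_add: "open S \<Longrightarrow> diff_upto k f S \<Longrightarrow> diff_upto k g S \<Longrightarrow> diff_upto k (\<lambda>x. f x + g x) S"
proof (induction k arbitrary: f g)
  case (Suc k)
  have "diff_upto k (partial i (\<lambda>x. f x + g x)) S" for i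
  proof (subst diff_upto_cong[OF Suc.prems(1)])
    show "partial i (\<lambda>x. f x + g x) y = partial i f y + partial i g y" if "y \<in> S" for y
      using Suc.prems that by (intro partial_add) auto
    show "diff_upto k (\<lambda>y. partial i f y + partial i g y) S" using Suc by simp
  qed
  then show ?case using Suc.prems by (auto intro: differentiable_add)
qed simp

lemma diff_upto_mult: "open S \<Longrightarrow> diff_upto k f S \<Longrightarrow> diff_upto k g S \<Longrightarrow> diff_upto k (\<lambda>x. f x * g x) S"
proof (induction k arbitrary: f g)
  case (Suc k)
  have "diff_upto k (partial i (\<lambda>x. f x * g x)) S" for i
  proof (subst diff_upto_cong[OF Suc.prems(1)])
    show "partial i (\<lambda>x. f x * g x) y = f y * partial i g y + partial i f y * g y" if "y \<in> S" for y
      using Suc.prems that by (intro partial_mult) auto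
    show "diff_upto k (\<lambda>y. f y * partial i g y + partial i f y * g y) S"
      using Suc.prems by (intro diff_upto_add Suc.IH) (auto intro: diff_upto_Suc_imp)
  qed
  then show ?case using Suc.prems by (auto intro: differentiable_mult)
qed simp

lemma diff_upto_inverse:
  "open S \<Longrightarrow> diff_upto k f S \<Longrightarrow> (\<And>x. x \<in> S \<Longrightarrow> f x \<noteq> 0) \<Longrightarrow> diff_upto k (\<lambda>x. inverse (f x)) S"
proof (induction k arbitrary: f)
  case (Suc k)
  have "diff_upto k (partial i (\<lambda>x. inverse (f x))) S" for i
  proof (subst diff_upto_cong[OF Suc.prems(1)])
    show "partial i (\<lambda>x. inverse (f x)) y = (- 1) * (partial i f y * (inverse (f y) * inverse (f y)))" if "y \<in> S" for y
      using Suc.prems that by (intro partial_inverse) auto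
    have "diff_upto k f S" by (rule diff_upto_Suc_imp[OF Suc.prems(2)])
    then show "diff_upto k (\<lambda>y. (- 1) * (partial i f y * (inverse (f y) * inverse (f y)))) S"
      using Suc.prems by (intro diff_upto_mult diff_upto_const Suc.IH) auto
  qed
  then show ?case using Suc.prems by (auto intro!: differentiable_inverse)
qed simp

lemma diff_upto_uminus: "open S \<Longrightarrow> diff_upto k f S \<Longrightarrow> diff_upto k (\<lambda>x. - f x) S"
  using diff_upto_mult[OF _ diff_upto_const[of k "- 1"], of S f] by simp

lemma diff_upto_diff: "open S \<Longrightarrow> diff_upto k f S \<Longrightarrow> diff_upto k g S \<Longrightarrow> diff_upto k (\<lambda>x. f x - g x) S"
  unfolding diff_conv_add_uminus by (intro diff_upto_add diff_upto_uminus)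

lemma diff_upto_divide:
  "open S \<Longrightarrow> diff_upto k f S \<Longrightarrow> diff_upto k g S \<Longrightarrow> (\<And>x. x \<in> S \<Longrightarrow> g x \<noteq> 0) \<Longrightarrow> diff_upto k (\<lambda>x. f x / g x) S"
  unfolding divide_inverse by (intro diff_upto_mult diff_upto_inverse)

lemma diff_upto_sum: "open S \<Longrightarrow> (\<And>i. i \<in> I \<Longrightarrow> diff_upto k (f i) S) \<Longrightarrow> diff_upto k (\<lambda>x. \<Sum>i\<in>I. f i x) S"
  by (induction I rule: infinite_finite_induct) (auto intro: diff_upto_const diff_upto_add)

lemma diff_upto_continuous: "diff_upto (Suc k) f S \<Longrightarrow> continuous_on S f"
  by (auto intro!: continuous_at_imp_continuous_on differentiable_imp_continuous_within)

section \<open>Uniform differentiability and Gronwall's inequality\<close>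

lemma norm_linear_le_Basis:
  fixes L :: "'a::euclidean_space \<Rightarrow> 'b::real_normed_vector"
  assumes "linear L"
  shows "norm (L w) \<le> (\<Sum>b\<in>Basis. norm (L b)) * norm w"
proof -
  have "L w = L (\<Sum>b\<in>Basis. (w \<bullet> b) *\<^sub>R b)" by (simp add: euclidean_representation)
  also have "\<dots> = (\<Sum>b\<in>Basis. (w \<bullet> b) *\<^sub>R L b)" by (simp add: linear_sum[OF assms] linear_cmul[OF assms])
  also have "norm \<dots> \<le> (\<Sum>b\<in>Basis. norm w * norm (L b))"
    by (intro sum_norm_le) (auto intro!: mult_right_mono Basis_le_norm)
  finally show ?thesis by (simp add: sum_distrib_left mult.commute)
qed

text \<open>For each basis vector v, \<open>f' x v\<close> is uniformly continuous in x on the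
  compact set K. Hence f' x - f' b is uniformly small in operator norm for x near b, and the mean
  value inequality on the segment, which lies in K by convexity, gives the claim.\<close>

lemma uniform_linearization:
  fixes f :: "'a::euclidean_space \<Rightarrow> 'b::real_normed_vector"
  assumes K: "compact K" "convex K"
    and d: "\<And>x. x \<in> K \<Longrightarrow> (f has_derivative f' x) (at x)"
    and c: "\<And>v. continuous_on K (\<lambda>x. f' x v)" and e: "0 < e"
  shows "\<exists>d>0. \<forall>a\<in>K. \<forall>b\<in>K. norm (a - b) < d \<longrightarrow> norm (f a - f b - f' b (a - b)) \<le> e * norm (a - b)"
proof -
  \<comment> \<open>The operator norm is at most the sum of the norms over the basis, which has
    \<open>DIM('a)\<close> members.\<close>
  define e' where "e' = e / real DIM('a)"
  have e': "e' > 0" using e by (simp add: e'_def)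
  have "\<forall>\<^sub>F d in at_right 0. \<forall>v\<in>Basis. \<forall>x\<in>K. \<forall>y\<in>K. dist x y < d \<longrightarrow> norm (f' x v - f' y v) < e'"
  proof (rule eventually_ball_finite[OF finite_Basis], rule ballI)
    fix v :: 'a
    have "uniformly_continuous_on K (\<lambda>x. f' x v)" by (rule compact_uniformly_continuous[OF c K(1)])
    from this[unfolded uniformly_continuous_on_def, rule_format, OF e']
    obtain d where d: "d > 0" "\<forall>x\<in>K. \<forall>y\<in>K. dist y x < d \<longrightarrow> dist (f' y v) (f' x v) < e'"
      by (elim exE conjE)
    show "\<forall>\<^sub>F d in at_right 0. \<forall>x\<in>K. \<forall>y\<in>K. dist x y < d \<longrightarrow> norm (f' x v - f' y v) < e'"
    proof (rule eventually_at_rightI[OF _ d(1)], intro ballI impI)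
      fix d' x y assume "d' \<in> {0<..<d}" "x \<in> K" "y \<in> K" "dist x y < d'"
      then have "dist (f' x v) (f' y v) < e'" using d(2) by (metis greaterThanLessThan_iff less_trans)
      then show "norm (f' x v - f' y v) < e'" by (simp add: dist_norm)
    qed
  qed
  moreover have "\<forall>\<^sub>F d in at_right 0. (0::real) < d" by (simp add: eventually_at_filter)
  ultimately have "\<forall>\<^sub>F d in at_right 0. (\<forall>v\<in>Basis. \<forall>x\<in>K. \<forall>y\<in>K. dist x y < d \<longrightarrow> norm (f' x v - f' y v) < e') \<and> 0 < d"
    by (rule eventually_conj)
  from eventually_happens'[OF trivial_limit_at_right_real this]
  obtain d where dd: "d > 0" "\<forall>v\<in>Basis. \<forall>x\<in>K. \<forall>y\<in>K. dist x y < d \<longrightarrow> norm (f' x v - f' y v) < e'"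
    by (elim exE conjE)
  show ?thesis
  proof (intro exI[of _ d] conjI ballI impI dd(1))
    fix a b assume ab: "a \<in> K" "b \<in> K" "norm (a - b) < d"
    have seg: "closed_segment b a \<subseteq> K" using closed_segment_subset K ab by blast
    have "norm (f a - f b - f' b (a - b)) \<le> norm (a - b) * e"
    proof (rule differentiable_bound_linearization[of b a "closed_segment b a"])
      show "b + t *\<^sub>R (a - b) \<in> closed_segment b a" if "t \<in> {0..1}" for t
        using that by (auto simp: in_segment algebra_simps intro!: exI[of _ t])
      show "(f has_derivative f' x) (at x within closed_segment b a)" if "x \<in> closed_segment b a" for x
        using d seg that by (blast intro: has_derivative_at_withinI)
      show "onorm (f' x - f' b) \<le> e" if x: "x \<in> closed_segment b a" for x
      proof -
        have xK: "x \<in> K" using seg x by auto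
        have "dist x b < d" using segment_bound(1)[of x b a] x ab by (auto simp: dist_norm norm_minus_commute)
        have lin: "linear (\<lambda>v. f' x v - f' b v)"
          using d[OF xK] d[OF ab(2)] by (intro linear_compose_sub) (auto dest: has_derivative_linear)
        show ?thesis unfolding fun_diff_def
        proof (rule onorm_le)
          fix w
          have "(\<Sum>v\<in>Basis. norm (f' x v - f' b v)) \<le> (\<Sum>v\<in>(Basis::'a set). e')"
          proof (rule sum_mono, rule less_imp_le)
            fix v :: 'a assume v: "v \<in> Basis"
            show "norm (f' x v - f' b v) < e'"
              using dd(2)[rule_format, OF v xK ab(2) \<open>dist x b < d\<close>] .
          qed
          also have "\<dots> = e" by (simp add: e'_def)
          finally show "norm (f' x w - f' b w) \<le> e * norm w"
            using norm_linear_le_Basis[OF lin, of w] by (meson mult_right_mono norm_ge_zero order_trans)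
        qed
      qed
    qed auto
    then show "norm (f a - f b - f' b (a - b)) \<le> e * norm (a - b)" by (simp add: mult.commute)
  qed
qed

lemma uniform_derivative_bound:
  fixes f :: "'a::euclidean_space \<Rightarrow> 'b::real_normed_vector"
  assumes K: "compact K" "convex K"
    and d: "\<And>x. x \<in> K \<Longrightarrow> (f has_derivative f' x) (at x)"
    and c: "\<And>v. continuous_on K (\<lambda>x. f' x v)"
  shows "\<exists>L\<ge>0. (\<forall>x\<in>K. \<forall>w. norm (f' x w) \<le> L * norm w) \<and> (\<forall>a\<in>K. \<forall>b\<in>K. norm (f a - f b) \<le> L * norm (a - b))"
proof -
  have "\<forall>v. \<exists>B. \<forall>x\<in>K. norm (f' x v) \<le> B"
    using compact_imp_bounded[OF compact_continuous_image[OF c K(1)]] by (auto simp: bounded_iff)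
  from choice[OF this] obtain B where B: "\<forall>v. \<forall>x\<in>K. norm (f' x v) \<le> B v" ..
  define L where "L = (\<Sum>v\<in>(Basis::'a set). \<bar>B v\<bar>)"
  have L: "norm (f' x w) \<le> L * norm w" if "x \<in> K" for x w
  proof -
    have "(\<Sum>v\<in>Basis. norm (f' x v)) \<le> L" unfolding L_def
    proof (rule sum_mono)
      fix v :: 'a
      have "norm (f' x v) \<le> B v" using B that by blast
      then show "norm (f' x v) \<le> \<bar>B v\<bar>" by linarith
    qed
    then show ?thesis
      using norm_linear_le_Basis[OF has_derivative_linear[OF d[OF that]], of w]
      by (meson mult_right_mono norm_ge_zero order_trans)
  qed
  moreover have "norm (f a - f b) \<le> L * norm (a - b)" if "a \<in> K" "b \<in> K" for a b
  proof (rule differentiable_bound[OF K(2) _ _ that])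
    show "(f has_derivative f' x) (at x within K)" if "x \<in> K" for x
      by (rule has_derivative_at_withinI[OF d[OF that]])
    show "onorm (f' x) \<le> L" if "x \<in> K" for x by (rule onorm_le[OF L[OF that]])
  qed
  moreover have "L \<ge> 0" by (simp add: L_def sum_nonneg)
  ultimately show ?thesis by blast
qed

text \<open>Squared norms stay differentiable where D vanishes. From 2 |D| e \<le> |D|^2 + e^2 the
  derivative of |D|^2 is at most (2 L + 1) (|D|^2 + e^2), so |D|^2 + e^2 times the exponential
  factor decreases.\<close>

lemma gronwall:
  fixes D :: "real \<Rightarrow> 'a::real_inner"
  assumes d: "\<And>s. 0 \<le> s \<Longrightarrow> s \<le> 1 \<Longrightarrow> (D has_vector_derivative D' s) (at s)"
    and b: "\<And>s. 0 \<le> s \<Longrightarrow> s \<le> 1 \<Longrightarrow> norm (D' s) \<le> L * norm (D s) + e"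
    and L: "0 \<le> L" "0 \<le> e"
  shows "(norm (D 1))\<^sup>2 \<le> ((norm (D 0))\<^sup>2 + e\<^sup>2) * exp (2 * L + 1)"
proof -
  define \<psi> where "\<psi> s = (D s \<bullet> D s + e\<^sup>2) * exp (- (2 * L + 1) * s)" for s
  have "\<psi> 1 \<le> \<psi> 0"
  proof (rule DERIV_nonpos_imp_nonincreasing[where f = \<psi> and a = 0 and b = 1])
    fix s :: real assume s: "0 \<le> s" "s \<le> 1"
    define y where "y = (2 * (D s \<bullet> D' s) - (2 * L + 1) * (D s \<bullet> D s + e\<^sup>2)) * exp (- (2 * L + 1) * s)"
    have "((\<lambda>s. D s \<bullet> D s) has_real_derivative 2 * (D s \<bullet> D' s)) (at s)"
      using has_derivative_inner[OF d[OF s, unfolded has_vector_derivative_def] d[OF s, unfolded has_vector_derivative_def]]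
      unfolding has_field_derivative_def
      by (rule has_derivative_eq_rhs) (auto simp: inner_commute algebra_simps)
    then have "(\<psi> has_real_derivative y) (at s)"
      unfolding \<psi>_def y_def by (auto intro!: derivative_eq_intros simp: algebra_simps)
    moreover have "y \<le> 0"
    proof -
      have "D s \<bullet> D' s \<le> norm (D s) * norm (D' s)" by (rule norm_cauchy_schwarz)
      also have "\<dots> \<le> norm (D s) * (L * norm (D s) + e)" by (intro mult_left_mono b s) auto
      also have "\<dots> = L * (norm (D s))\<^sup>2 + norm (D s) * e" by (simp add: algebra_simps power2_eq_square)
      finally have 1: "2 * (D s \<bullet> D' s) \<le> 2 * L * (norm (D s))\<^sup>2 + 2 * (norm (D s) * e)" by simp
      have 2: "2 * (norm (D s) * e) \<le> (norm (D s))\<^sup>2 + e\<^sup>2"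
        using sum_squares_bound[of "norm (D s)" e] by simp
      have 3: "0 \<le> 2 * L * e\<^sup>2" using L by simp
      have "2 * (D s \<bullet> D' s) - (2 * L + 1) * (D s \<bullet> D s + e\<^sup>2) \<le> 0"
        using 1 2 3 by (simp add: dot_square_norm algebra_simps)
      then show ?thesis unfolding y_def by (simp add: mult_nonpos_nonneg)
    qed
    ultimately show "\<exists>y. (\<psi> has_real_derivative y) (at s) \<and> y \<le> 0" by blast
  qed simp
  then have "(norm (D 1))\<^sup>2 + e\<^sup>2 \<le> ((norm (D 0))\<^sup>2 + e\<^sup>2) * exp (2 * L + 1)"
    by (simp add: \<psi>_def dot_square_norm exp_minus field_simps exp_diff exp_add)
  then show ?thesis using zero_le_power2[of e] by linarith
qed

text \<open>Continuity method: before the first time outside Z' all times lie in Z, by closedness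
  that time lies in Z as well, and \<open>step\<close> improves this to Z'.\<close>

lemma interval_bootstrap:
  fixes Z Z' :: "real set"
  assumes "closed Z" "open Z'" "Z' \<subseteq> Z" "0 \<in> Z'"
    and step: "\<And>s. 0 \<le> s \<Longrightarrow> s \<le> 1 \<Longrightarrow> {0..s} \<subseteq> Z \<Longrightarrow> s \<in> Z'"
  shows "{0..1} \<subseteq> Z"
proof (rule ccontr)
  assume neg: "\<not> {0..1} \<subseteq> Z"
  define B where "B = {0..1} - Z'"
  have B: "closed B" "B \<noteq> {}" "bdd_below B"
    using assms neg by (auto simp: B_def intro!: closed_Diff bdd_belowI[of _ 0])
  define m where "m = Inf B"
  have m: "m \<in> B" unfolding m_def by (rule closed_contains_Inf[OF B(2,3,1)])
  have below: "s \<in> Z" if "0 \<le> s" "s < m" for s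
  proof (rule ccontr)
    assume "s \<notin> Z"
    then have "s \<in> B" using that m assms(3) by (auto simp: B_def)
    then have "m \<le> s" unfolding m_def by (intro cInf_lower B)
    with that show False by simp
  qed
  have "m > 0" using m assms(4) by (cases "m = 0") (auto simp: B_def)
  have "{0..m} \<subseteq> Z"
  proof -
    have "{0..m} = closure {0..<m}" using \<open>m > 0\<close> by (simp add: closure_atLeastLessThan)
    also have "\<dots> \<subseteq> Z" using below assms(1) by (intro closure_minimal) auto
    finally show ?thesis .
  qed
  then have "m \<in> Z'" using m step by (auto simp: B_def)
  with m show False by (simp add: B_def)
qed

text \<open>A curve \<open>V\<close> that solves \<open>V' = X V\<close> as long as it stays in \<open>K = cball P \<rho>\<close>; the set \<open>O\<close> of
  times at which it is defined is open, but need not be all of the line.\<close>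

lemma ode_lipschitz_stability:
  fixes X :: "'a::euclidean_space \<Rightarrow> 'a" and U V :: "real \<Rightarrow> 'a"
  assumes L: "0 \<le> L" "\<And>a b. a \<in> cball P \<rho> \<Longrightarrow> b \<in> cball P \<rho> \<Longrightarrow> norm (X a - X b) \<le> L * norm (a - b)"
    and U: "\<And>t. \<bar>t - t1\<bar> \<le> 1/2 * \<epsilon> \<Longrightarrow> U t \<in> cball P (\<rho> / 2)"
    "\<And>t. \<bar>t - t1\<bar> \<le> 1/2 * \<epsilon> \<Longrightarrow> (U has_vector_derivative X (U t)) (at t)"
    and \<epsilon>: "0 < \<epsilon>" "\<epsilon> \<le> 1"
    and V: "\<And>t. t \<in> T \<Longrightarrow> V t \<in> cball P \<rho> \<Longrightarrow> (V has_vector_derivative X (V t)) (at t)"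
    and cl: "closed {t \<in> T. V t \<in> cball P \<rho>}" and op: "open {t \<in> T. V t \<in> ball P \<rho>}"
    and t0: "\<bar>t0 - t1\<bar> \<le> 1/2 * \<epsilon>" "t0 \<in> T"
    and small: "norm (V t0 - U t0) * exp (2 * L + 1) < \<rho> / 2"
    and t: "\<bar>t - t1\<bar> \<le> 1/2 * \<epsilon>"
  shows "t \<in> T" "V t \<in> cball P \<rho>" "norm (V t - U t) \<le> norm (V t0 - U t0) * exp (2 * L + 1)"
proof -
  \<comment> \<open>Reparametrizing the segment from t0 to t by the unit interval treats both
    directions of time at once; its length is at most \<epsilon> \<le> 1.\<close>
  define r where "r s = t0 + s * (t - t0)" for s :: real
  have rng: "\<bar>r s - t1\<bar> \<le> 1/2 * \<epsilon>" if "0 \<le> s" "s \<le> 1" for s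
  proof -
    have "r s - t1 = (1 - s) * (t0 - t1) + s * (t - t1)" by (simp add: r_def algebra_simps)
    also have "\<bar>\<dots>\<bar> \<le> (1 - s) * \<bar>t0 - t1\<bar> + s * \<bar>t - t1\<bar>"
      using that by (intro order_trans[OF abs_triangle_ineq]) (simp add: abs_mult)
    also have "\<dots> \<le> (1 - s) * (1/2 * \<epsilon>) + s * (1/2 * \<epsilon>)"
      using that t0 t by (intro add_mono mult_left_mono) auto
    also have "\<dots> = 1/2 * \<epsilon>" by (simp add: field_simps)
    finally show ?thesis .
  qed
  have tt: "\<bar>t - t0\<bar> \<le> 1" using t0(1) t \<epsilon> by linarith
  have main: "norm (V (r s) - U (r s)) \<le> norm (V t0 - U t0) * exp (2 * L + 1)"
    if s: "0 \<le> s" "s \<le> 1" and Z: "\<And>s'. 0 \<le> s' \<Longrightarrow> s' \<le> s \<Longrightarrow> r s' \<in> T \<and> V (r s') \<in> cball P \<rho>" for s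
  proof -
    define D where "D x = V (r (s * x)) - U (r (s * x))" for x
    define D' where "D' x = (s * (t - t0)) *\<^sub>R (X (V (r (s * x))) - X (U (r (s * x))))" for x
    have sx: "0 \<le> s * x" "s * x \<le> s" if "0 \<le> x" "x \<le> 1" for x
      using that s by (auto intro: mult_left_le)
    have "(norm (D 1))\<^sup>2 \<le> ((norm (D 0))\<^sup>2 + 0\<^sup>2) * exp (2 * L + 1)"
    proof (rule gronwall[of D D'])
      fix x :: real assume x: "0 \<le> x" "x \<le> 1"
      have rx: "((\<lambda>x. r (s * x)) has_vector_derivative s * (t - t0)) (at x)"
        unfolding r_def has_real_derivative_iff_has_vector_derivative[symmetric]
        by (auto intro!: derivative_eq_intros)
      have z: "r (s * x) \<in> T" "V (r (s * x)) \<in> cball P \<rho>" using Z[OF sx[OF x]] by auto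
      have rr: "\<bar>r (s * x) - t1\<bar> \<le> 1/2 * \<epsilon>" by (rule rng) (use sx[OF x] s in auto)
      have "((V \<circ> (\<lambda>x. r (s * x))) has_vector_derivative (s * (t - t0)) *\<^sub>R X (V (r (s * x)))) (at x)"
        by (rule vector_diff_chain_at[OF rx V[OF z]])
      moreover have "((U \<circ> (\<lambda>x. r (s * x))) has_vector_derivative (s * (t - t0)) *\<^sub>R X (U (r (s * x)))) (at x)"
        by (rule vector_diff_chain_at[OF rx U(2)[OF rr]])
      ultimately show "(D has_vector_derivative D' x) (at x)"
        unfolding D_def D'_def scaleR_diff_right o_def by (rule has_vector_derivative_diff)
      have "\<rho> \<ge> 0" using z by (meson mem_cball zero_le_dist order_trans)
      then have UK: "U (r (s * x)) \<in> cball P \<rho>" using U(1)[OF rr] by auto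
      have "norm (D' x) = \<bar>s * (t - t0)\<bar> * norm (X (V (r (s * x))) - X (U (r (s * x))))" by (simp add: D'_def)
      also have "\<dots> \<le> 1 * (L * norm (D x))"
        unfolding D_def by (intro mult_mono L(2) z UK) (use s tt in \<open>auto simp: abs_mult intro: mult_le_one\<close>)
      finally show "norm (D' x) \<le> L * norm (D x) + 0" by simp
    qed (use L in auto)
    then have "(norm (D 1))\<^sup>2 \<le> (norm (D 0))\<^sup>2 * exp (2 * L + 1)" by simp
    also have "\<dots> \<le> (norm (D 0))\<^sup>2 * (exp (2 * L + 1))\<^sup>2"
      using L by (intro mult_left_mono) (auto simp: power2_eq_square)
    finally have "(norm (D 1))\<^sup>2 \<le> (norm (D 0) * exp (2 * L + 1))\<^sup>2" by (simp add: power_mult_distrib)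
    then have "norm (D 1) \<le> norm (D 0) * exp (2 * L + 1)" by (rule power2_le_imp_le) simp
    then show ?thesis by (simp add: D_def r_def)
  qed
  \<comment> \<open>As long as V stays in the closed ball, Gronwall keeps it within less than \<rho>
    / 2 of U, which itself is within \<rho> / 2 of P. So V is even in the open ball, and the
    bootstrap closes. The condition that V is still defined is carried along in both sets.\<close>
  define Z where "Z = r -` {t \<in> T. V t \<in> cball P \<rho>}"
  define Z' where "Z' = r -` {t \<in> T. V t \<in> ball P \<rho>}"
  have rc: "continuous_on UNIV r" unfolding r_def by (intro continuous_intros)
  have near: "V (r s) \<in> ball P \<rho>" if "0 \<le> s" "s \<le> 1" "norm (V (r s) - U (r s)) \<le> norm (V t0 - U t0) * exp (2 * L + 1)" for s
  proof -
    have "dist P (V (r s)) \<le> dist P (U (r s)) + norm (V (r s) - U (r s))"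
      by (metis dist_commute dist_norm dist_triangle)
    moreover have "dist P (U (r s)) \<le> \<rho> / 2" using U(1)[OF rng[OF that(1,2)]] by simp
    ultimately show ?thesis using that(3) small by simp
  qed
  have "norm (V t0 - U t0) * 1 \<le> norm (V t0 - U t0) * exp (2 * L + 1)"
    using L by (intro mult_left_mono) auto
  then have 0: "0 \<in> Z'" using near[of 0] t0 by (simp add: Z'_def r_def)
  have "{0..1} \<subseteq> Z"
  proof (rule interval_bootstrap[of Z Z'])
    show "closed Z" unfolding Z_def by (rule closed_vimage[OF cl rc])
    show "open Z'" unfolding Z'_def by (rule open_vimage[OF op rc])
    show "Z' \<subseteq> Z" by (auto simp: Z_def Z'_def)
    show "s \<in> Z'" if s: "0 \<le> s" "s \<le> 1" "{0..s} \<subseteq> Z" for s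
    proof -
      have Z: "r s' \<in> T \<and> V (r s') \<in> cball P \<rho>" if "0 \<le> s'" "s' \<le> s" for s'
        using s(3) that by (auto simp: Z_def)
      have "V (r s) \<in> ball P \<rho>" by (rule near[OF s(1,2) main[OF s(1,2) Z]])
      then show ?thesis using Z[of s] s by (simp add: Z'_def)
    qed
  qed (rule 0)
  then have Z: "r s \<in> T \<and> V (r s) \<in> cball P \<rho>" if "0 \<le> s" "s \<le> 1" for s
    using that by (auto simp: Z_def)
  have r1: "r 1 = t" by (simp add: r_def)
  show "t \<in> T" "V t \<in> cball P \<rho>" using Z[of 1] r1 by auto
  show "norm (V t - U t) \<le> norm (V t0 - U t0) * exp (2 * L + 1)"
    using main[of 1] Z r1 by auto
qed


text \<open>Differentiability in the initial value, for a sequence of solutions. The scaled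
  differences \<open>D n\<close> are bounded and solve the linearized equation up to an error
  tending to 0 uniformly. Gronwall for \<open>D m - D n\<close> makes them uniformly Cauchy, and
  convergence of the derivatives passes the linearized equation to the limit.\<close>

lemma ode_variation:
  fixes X :: "'a::euclidean_space \<Rightarrow> 'a" and U :: "real \<Rightarrow> 'a" and V :: "nat \<Rightarrow> real \<Rightarrow> 'a"
  assumes X: "\<And>x. x \<in> cball P \<rho> \<Longrightarrow> (X has_derivative X' x) (at x)"
    "\<And>v. continuous_on (cball P \<rho>) (\<lambda>x. X' x v)" and \<rho>: "0 < \<rho>"
    and U: "\<And>t. \<bar>t - t1\<bar> \<le> 1/2 * \<epsilon> \<Longrightarrow> U t \<in> cball P (\<rho> / 2)"
    "\<And>t. \<bar>t - t1\<bar> \<le> 1/2 * \<epsilon> \<Longrightarrow> (U has_vector_derivative X (U t)) (at t)"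
    and \<epsilon>: "0 < \<epsilon>" "\<epsilon> \<le> 1"
    and V: "\<And>n t. t \<in> T n \<Longrightarrow> V n t \<in> cball P \<rho> \<Longrightarrow> (V n has_vector_derivative X (V n t)) (at t)"
    and cl: "\<And>n. closed {t \<in> T n. V n t \<in> cball P \<rho>}" and op: "\<And>n. open {t \<in> T n. V n t \<in> ball P \<rho>}"
    and t0: "\<bar>t0 - t1\<bar> \<le> 1/2 * \<epsilon>" "\<forall>\<^sub>F n in sequentially. t0 \<in> T n"
    and lim: "(\<lambda>n. real n *\<^sub>R (V n t0 - U t0)) \<longlonglongrightarrow> w0"
  shows "\<exists>W. (\<forall>\<^sub>F n in sequentially. \<forall>t. \<bar>t - t1\<bar> \<le> 1/2 * \<epsilon> \<longrightarrow> t \<in> T n) \<and>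
    uniform_limit {t. \<bar>t - t1\<bar> \<le> 1/2 * \<epsilon>} (\<lambda>n t. real n *\<^sub>R (V n t - U t)) W sequentially \<and>
    (\<forall>t. \<bar>t - t1\<bar> < 1/2 * \<epsilon> \<longrightarrow> (W has_vector_derivative X' (U t) (W t)) (at t))"
proof -
  define I where "I = {t. \<bar>t - t1\<bar> \<le> 1/2 * \<epsilon>}"
  define D where "D n t = real n *\<^sub>R (V n t - U t)" for n t
  define D' where "D' n t = real n *\<^sub>R (X (V n t) - X (U t))" for n t
  have "\<exists>L\<ge>0. (\<forall>x\<in>cball P \<rho>. \<forall>w. norm (X' x w) \<le> L * norm w) \<and>
      (\<forall>a\<in>cball P \<rho>. \<forall>b\<in>cball P \<rho>. norm (X a - X b) \<le> L * norm (a - b))"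
    by (rule uniform_derivative_bound[OF compact_cball convex_cball X])
  then obtain L where L0: "0 \<le> L" and LX': "\<forall>x\<in>cball P \<rho>. \<forall>w. norm (X' x w) \<le> L * norm w"
    and LX: "\<forall>a\<in>cball P \<rho>. \<forall>b\<in>cball P \<rho>. norm (X a - X b) \<le> L * norm (a - b)"
    by (elim exE conjE)
  define C where "C = exp (2 * L + 1)"
  have C: "C \<ge> 1" using L0 by (simp add: C_def)
  have UK: "U t \<in> cball P \<rho>" if "t \<in> I" for t
    using U(1)[of t] that \<rho> by (auto simp: I_def)
  have t0I: "t0 \<in> I" using t0 by (simp add: I_def)
  have "\<exists>K>0. \<forall>n. norm (D n t0) \<le> K"
    using convergent_imp_Bseq[OF convergentI[OF lim]] unfolding Bseq_def D_def .
  then obtain M0 where M0: "M0 > 0" "\<forall>n. norm (D n t0) \<le> M0" by (elim exE conjE)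
  define M where "M = M0 * C"
  have M: "M > 0" using M0 C by (simp add: M_def)
  have "(\<lambda>n. inverse (real n) *\<^sub>R D n t0) \<longlonglongrightarrow> 0 *\<^sub>R w0"
    unfolding D_def by (intro tendsto_scaleR lim lim_inverse_n)
  moreover have "\<forall>\<^sub>F n in sequentially. inverse (real n) *\<^sub>R D n t0 = V n t0 - U t0"
    using eventually_gt_at_top[of 0] by eventually_elim (simp add: D_def)
  ultimately have "(\<lambda>n. V n t0 - U t0) \<longlonglongrightarrow> 0"
    unfolding scaleR_zero_left by (rule Lim_transform_eventually)
  then have "(\<lambda>n. norm (V n t0 - U t0) * C) \<longlonglongrightarrow> 0"
    by (intro tendsto_mult_left_zero tendsto_norm_zero)
  then have "\<forall>\<^sub>F n in sequentially. norm (V n t0 - U t0) * C < \<rho> / 2"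
    by (rule order_tendstoD) (use \<rho> in simp)
  with t0(2) have good: "\<forall>\<^sub>F n in sequentially. \<forall>t\<in>I. t \<in> T n \<and> V n t \<in> cball P \<rho> \<and> norm (D n t) \<le> M"
  proof eventually_elim
    case (elim n)
    show ?case
    proof
      fix t assume "t \<in> I"
      then have t: "\<bar>t - t1\<bar> \<le> 1/2 * \<epsilon>" by (simp add: I_def)
      have LX2: "norm (X a - X b) \<le> L * norm (a - b)" if "a \<in> cball P \<rho>" "b \<in> cball P \<rho>" for a b
        using LX that by blast
      note st = ode_lipschitz_stability[of L P \<rho> X t1 \<epsilon> U "T n" "V n" t0 t,
          OF L0 LX2 U \<epsilon> V cl op t0(1) elim(1) elim(2)[unfolded C_def] t]
      have "norm (D n t) = real n * norm (V n t - U t)" by (simp add: D_def)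
      also have "\<dots> \<le> real n * (norm (V n t0 - U t0) * C)"
        unfolding C_def by (intro mult_left_mono st) auto
      also have "\<dots> = norm (D n t0) * C" by (simp add: D_def)
      also have "\<dots> \<le> M" unfolding M_def using M0(2)[rule_format, of n] C by (intro mult_right_mono) auto
      finally show "t \<in> T n \<and> V n t \<in> cball P \<rho> \<and> norm (D n t) \<le> M" using st by blast
    qed
  qed
  have Dder: "(D n has_vector_derivative D' n t) (at t)" if "t \<in> I" "t \<in> T n" "V n t \<in> cball P \<rho>" for n t
    unfolding D_def D'_def
    using V[OF that(2,3)] U(2)[of t] that(1) by (auto intro!: derivative_eq_intros simp: I_def)
  \<comment> \<open>V n is within M / n of U, so eventually the linearization error of X is at most
    (e / M) |V n - U|; scaled by n this is at most (e / M) M = e.\<close>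
  have lin: "\<forall>\<^sub>F n in sequentially. \<forall>t\<in>I. norm (D' n t - X' (U t) (D n t)) \<le> e" if e: "e > 0" for e
  proof -
    have "\<exists>d>0. \<forall>a\<in>cball P \<rho>. \<forall>b\<in>cball P \<rho>. norm (a - b) < d \<longrightarrow>
        norm (X a - X b - X' b (a - b)) \<le> (e / M) * norm (a - b)"
      by (rule uniform_linearization[OF compact_cball convex_cball X]) (use e M in simp_all)
    then obtain d where d: "d > 0" "\<forall>a\<in>cball P \<rho>. \<forall>b\<in>cball P \<rho>. norm (a - b) < d \<longrightarrow>
        norm (X a - X b - X' b (a - b)) \<le> (e / M) * norm (a - b)"
      by (elim exE conjE)
    have "\<forall>\<^sub>F n in sequentially. real n > M / d"
      using eventually_gt_at_top[of "nat \<lceil>M / d\<rceil>"] by eventually_elim linarith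
    with good show ?thesis
    proof eventually_elim
      case (elim n)
      show ?case
      proof
        fix t assume t: "t \<in> I"
        have n: "real n > 0" using elim(2) M d(1) by (meson divide_pos_pos less_trans)
        have g: "V n t \<in> cball P \<rho>" "norm (D n t) \<le> M" using elim(1) t by auto
        have "real n * norm (V n t - U t) \<le> M" using g(2) by (simp add: D_def)
        moreover have "M < d * real n" using elim(2) d(1) by (simp add: field_simps)
        ultimately have "norm (V n t - U t) * real n < d * real n" by (simp add: mult.commute)
        then have "norm (V n t - U t) < d" using n by simp
        then have "norm (X (V n t) - X (U t) - X' (U t) (V n t - U t)) \<le> (e / M) * norm (V n t - U t)"
          using d(2) g(1) UK[OF t] by blast
        then have "real n * norm (X (V n t) - X (U t) - X' (U t) (V n t - U t)) \<le> real n * ((e / M) * norm (V n t - U t))"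
          by (rule mult_left_mono) simp
        also have "\<dots> = (e / M) * norm (D n t)" by (simp add: D_def)
        also have "\<dots> \<le> (e / M) * M" using g(2) e M by (intro mult_left_mono) auto
        also have "\<dots> = e" using M by simp
        also have "real n * norm (X (V n t) - X (U t) - X' (U t) (V n t - U t)) =
            norm (real n *\<^sub>R (X (V n t) - X (U t) - X' (U t) (V n t - U t)))" by simp
        also have "real n *\<^sub>R (X (V n t) - X (U t) - X' (U t) (V n t - U t)) = D' n t - X' (U t) (D n t)"
          using linear_cmul[OF has_derivative_linear[OF X(1)[OF UK[OF t]]], of "real n" "V n t - U t"]
          by (simp add: D_def D'_def scaleR_diff_right)
        finally show "norm (D' n t - X' (U t) (D n t)) \<le> e" .
      qed
    qed
  qed
  have "uniformly_Cauchy_on I D"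
  proof (rule uniformly_Cauchy_onI)
    fix e0 :: real assume e0: "e0 > 0"
    \<comment> \<open>Gronwall yields at most (\<eta>^2 + \<eta>^2) C, and this choice makes it e0^2
      / (2 C), which is at most e0^2 because C \<ge> 1.\<close>
    define \<eta> where "\<eta> = e0 / (2 * C)"
    have \<eta>: "\<eta> > 0" using e0 C by (simp add: \<eta>_def)
    have "Cauchy (\<lambda>n. D n t0)" using LIMSEQ_imp_Cauchy[OF lim] by (simp add: D_def)
    from CauchyD[OF this \<eta>]
    obtain N0 where N0: "\<forall>m\<ge>N0. \<forall>n\<ge>N0. norm (D m t0 - D n t0) < \<eta>" by (elim exE)
    have "\<forall>\<^sub>F n in sequentially. (\<forall>t\<in>I. t \<in> T n \<and> V n t \<in> cball P \<rho> \<and> norm (D n t) \<le> M) \<and>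
        (\<forall>t\<in>I. norm (D' n t - X' (U t) (D n t)) \<le> \<eta> / 2)"
      by (intro eventually_conj good lin) (use \<eta> in simp)
    then obtain N1 where N1: "\<forall>n\<ge>N1. (\<forall>t\<in>I. t \<in> T n \<and> V n t \<in> cball P \<rho> \<and> norm (D n t) \<le> M) \<and>
        (\<forall>t\<in>I. norm (D' n t - X' (U t) (D n t)) \<le> \<eta> / 2)"
      unfolding eventually_sequentially by (elim exE)
    show "\<exists>N. \<forall>t\<in>I. \<forall>m\<ge>N. \<forall>n\<ge>N. dist (D m t) (D n t) < e0"
    proof (intro exI[of _ "max N0 N1"] ballI allI impI)
      fix t m n assume t: "t \<in> I" and mn: "m \<ge> max N0 N1" "n \<ge> max N0 N1"
      define r where "r s = t0 + s * (t - t0)" for s :: real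
      have rI: "r s \<in> I" if "0 \<le> s" "s \<le> 1" for s
      proof -
        have "r s - t1 = (1 - s) * (t0 - t1) + s * (t - t1)" by (simp add: r_def algebra_simps)
        also have "\<bar>\<dots>\<bar> \<le> (1 - s) * \<bar>t0 - t1\<bar> + s * \<bar>t - t1\<bar>"
          using that by (intro order_trans[OF abs_triangle_ineq]) (simp add: abs_mult)
        also have "\<dots> \<le> (1 - s) * (1/2 * \<epsilon>) + s * (1/2 * \<epsilon>)"
          using that t0 t by (intro add_mono mult_left_mono) (auto simp: I_def)
        also have "\<dots> = 1/2 * \<epsilon>" by (simp add: field_simps)
        finally show ?thesis by (simp add: I_def)
      qed
      have "\<bar>t - t1\<bar> \<le> 1/2 * \<epsilon>" using t by (simp add: I_def)
      then have tt: "\<bar>t - t0\<bar> \<le> 1" using t0(1) \<epsilon> by linarith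
      define E where "E s = D m (r s) - D n (r s)" for s
      define E' where "E' s = (t - t0) *\<^sub>R (D' m (r s) - D' n (r s))" for s
      have "(norm (E 1))\<^sup>2 \<le> ((norm (E 0))\<^sup>2 + \<eta>\<^sup>2) * exp (2 * L + 1)"
      proof (rule gronwall[of E E'])
        fix s :: real assume s: "0 \<le> s" "s \<le> 1"
        have rs: "r s \<in> I" by (rule rI[OF s])
        have m: "r s \<in> T m" "V m (r s) \<in> cball P \<rho>" "norm (D' m (r s) - X' (U (r s)) (D m (r s))) \<le> \<eta> / 2"
          and n: "r s \<in> T n" "V n (r s) \<in> cball P \<rho>" "norm (D' n (r s) - X' (U (r s)) (D n (r s))) \<le> \<eta> / 2"
          using N1 mn rs by auto
        have rd: "(r has_vector_derivative (t - t0)) (at s)"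
          unfolding r_def has_real_derivative_iff_has_vector_derivative[symmetric]
          by (auto intro!: derivative_eq_intros)
        show "(E has_vector_derivative E' s) (at s)"
          unfolding E_def E'_def scaleR_diff_right
          using has_vector_derivative_diff[OF vector_diff_chain_at[OF rd Dder[OF rs m(1,2)]]
              vector_diff_chain_at[OF rd Dder[OF rs n(1,2)]]] by (simp add: o_def)
        have "X' (U (r s)) (E s) = X' (U (r s)) (D m (r s)) - X' (U (r s)) (D n (r s))"
          unfolding E_def by (rule linear_diff[OF has_derivative_linear[OF X(1)[OF UK[OF rs]]]])
        then have "D' m (r s) - D' n (r s) = X' (U (r s)) (E s) +
            ((D' m (r s) - X' (U (r s)) (D m (r s))) - (D' n (r s) - X' (U (r s)) (D n (r s))))" by simp
        then have "norm (D' m (r s) - D' n (r s)) \<le> norm (X' (U (r s)) (E s)) + (\<eta> / 2 + \<eta> / 2)"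
          using m(3) n(3) by (smt (verit) norm_triangle_ineq norm_triangle_ineq4)
        also have "\<dots> \<le> L * norm (E s) + \<eta>" using LX' UK[OF rs] by simp
        finally have b: "norm (D' m (r s) - D' n (r s)) \<le> L * norm (E s) + \<eta>" .
        have "norm (E' s) = \<bar>t - t0\<bar> * norm (D' m (r s) - D' n (r s))" by (simp add: E'_def)
        also have "\<dots> \<le> 1 * (L * norm (E s) + \<eta>)" by (rule mult_mono) (use tt b in auto)
        finally show "norm (E' s) \<le> L * norm (E s) + \<eta>" by simp
      qed (use L0 \<eta> in auto)
      also have "\<dots> < (\<eta>\<^sup>2 + \<eta>\<^sup>2) * C"
      proof -
        have "norm (E 0) < \<eta>" using N0 mn by (simp add: E_def r_def)
        then have "(norm (E 0))\<^sup>2 < \<eta>\<^sup>2" by (intro power_strict_mono) auto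
        then show ?thesis unfolding C_def by (intro mult_strict_right_mono) auto
      qed
      also have "\<dots> = e0\<^sup>2 / (2 * C)" using C by (simp add: \<eta>_def power2_eq_square field_simps)
      also have "\<dots> \<le> e0\<^sup>2 / 1" using C by (intro divide_left_mono) auto
      finally have "(norm (E 1))\<^sup>2 < e0\<^sup>2" by simp
      then have "norm (E 1) < e0" using e0 by (intro power2_less_imp_less[of "norm (E 1)" e0]) auto
      then show "dist (D m t) (D n t) < e0" by (simp add: E_def r_def dist_norm)
    qed
  qed
  from Cauchy_uniformly_convergent[OF this, unfolded uniformly_convergent_on_def]
  obtain W where W: "uniform_limit I D W sequentially"
    by (elim exE)
  have der: "(W has_vector_derivative X' (U t) (W t)) (at t)" if t: "\<bar>t - t1\<bar> < 1/2 * \<epsilon>" for t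
  proof -
    \<comment> \<open>\<open>has_derivative_sequence\<close> wants every member to be differentiable
      on I, which holds only from some index on; hence the shift by N.\<close>
    obtain N where N: "\<forall>n\<ge>N. \<forall>t\<in>I. t \<in> T n \<and> V n t \<in> cball P \<rho> \<and> norm (D n t) \<le> M"
      using good unfolding eventually_sequentially by (elim exE)
    have pw: "(\<lambda>n. D (n + N) x) \<longlonglongrightarrow> W x" if "x \<in> I" for x
      using LIMSEQ_ignore_initial_segment[OF tendsto_uniform_limitI[OF W that]] .
    have "\<exists>g. \<forall>x\<in>I. (\<lambda>n. D (n + N) x) \<longlonglongrightarrow> g x \<and>
        (g has_derivative (\<lambda>h. h *\<^sub>R X' (U x) (W x))) (at x within I)"
    proof (rule has_derivative_sequence[where f' = "\<lambda>n x h. h *\<^sub>R D' (n + N) x"])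
      have "I = cball t1 (1/2 * \<epsilon>)" by (auto simp: I_def dist_real_def abs_minus_commute)
      then show "convex I" by simp
      show "(D (n + N) has_derivative (\<lambda>h. h *\<^sub>R D' (n + N) x)) (at x within I)" if "x \<in> I" for n x
      proof -
        have "x \<in> T (n + N)" "V (n + N) x \<in> cball P \<rho>" using N that by auto
        from Dder[OF that this] show ?thesis
          unfolding has_vector_derivative_def by (rule has_derivative_at_withinI)
      qed
      show "t0 \<in> I" "(\<lambda>n. D (n + N) t0) \<longlonglongrightarrow> W t0" using t0I pw by auto
      fix e :: real assume e: "e > 0"
      have "\<forall>\<^sub>F n in sequentially. \<forall>x\<in>I. dist (D n x) (W x) < e / (2 * (L + 1))"
        by (rule uniform_limitD[OF W]) (use e L0 in simp)
      moreover have "\<forall>\<^sub>F n in sequentially. \<forall>x\<in>I. norm (D' n x - X' (U x) (D n x)) \<le> e / 2"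
        by (rule lin) (use e in simp)
      ultimately have "\<forall>\<^sub>F n in sequentially. \<forall>x\<in>I. norm (D' n x - X' (U x) (W x)) \<le> e"
      proof eventually_elim
        case (elim n)
        show ?case
        proof
          fix x assume x: "x \<in> I"
          have "norm (X' (U x) (D n x - W x)) \<le> L * norm (D n x - W x)" using LX' UK[OF x] by blast
          also have "\<dots> \<le> (L + 1) * (e / (2 * (L + 1)))"
            using elim(1) x L0 by (intro mult_mono) (auto simp: dist_norm less_imp_le)
          also have "\<dots> = e / 2" using L0 by (simp add: field_simps)
          finally have "norm (X' (U x) (D n x) - X' (U x) (W x)) \<le> e / 2"
            using linear_diff[OF has_derivative_linear[OF X(1)[OF UK[OF x]]], of "D n x" "W x"] by simp
          moreover have "norm (D' n x - X' (U x) (D n x)) \<le> e / 2" using elim(2) x by blast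
          ultimately show "norm (D' n x - X' (U x) (W x)) \<le> e"
            using norm_triangle_ineq[of "D' n x - X' (U x) (D n x)" "X' (U x) (D n x) - X' (U x) (W x)"] by simp
        qed
      qed
      then have "\<forall>\<^sub>F n in sequentially. \<forall>x\<in>I. norm (D' (n + N) x - X' (U x) (W x)) \<le> e"
        by (rule sequentially_offset)
      then show "\<forall>\<^sub>F n in sequentially. \<forall>x\<in>I. \<forall>h. norm (h *\<^sub>R D' (n + N) x - h *\<^sub>R X' (U x) (W x)) \<le> e * norm h"
      proof eventually_elim
        case (elim n)
        show ?case
        proof (intro ballI allI)
          fix x h assume "x \<in> I"
          then have "\<bar>h\<bar> * norm (D' (n + N) x - X' (U x) (W x)) \<le> \<bar>h\<bar> * e"
            using elim by (intro mult_left_mono) auto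
          then show "norm (h *\<^sub>R D' (n + N) x - h *\<^sub>R X' (U x) (W x)) \<le> e * norm h"
            unfolding scaleR_diff_right[symmetric] by (simp add: mult.commute)
        qed
      qed
    qed
    then obtain g where g: "\<forall>x\<in>I. (\<lambda>n. D (n + N) x) \<longlonglongrightarrow> g x \<and>
        (g has_derivative (\<lambda>h. h *\<^sub>R X' (U x) (W x))) (at x within I)"
      by (elim exE)
    have gW: "g x = W x" if "x \<in> I" for x
      by (rule LIMSEQ_unique[OF conjunct1[OF bspec[OF g that]] pw[OF that]])
    \<comment> \<open>The limit theorem gives derivatives within the closed interval I only.
      Restriction to its interior makes them two-sided.\<close>
    define J where "J = {t. \<bar>t - t1\<bar> < 1/2 * \<epsilon>}"
    have J: "J = ball t1 (1/2 * \<epsilon>)" by (auto simp: J_def dist_real_def abs_minus_commute)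
    have oJ: "open J" unfolding J by (rule open_ball)
    have JI: "J \<subseteq> I" by (auto simp: J_def I_def)
    have tJ: "t \<in> J" using t by (simp add: J_def)
    have "(g has_derivative (\<lambda>h. h *\<^sub>R X' (U t) (W t))) (at t within J)"
      by (rule has_derivative_subset[OF conjunct2[OF bspec[OF g subsetD[OF JI tJ]]] JI])
    then have "(g has_derivative (\<lambda>h. h *\<^sub>R X' (U t) (W t))) (at t)"
      unfolding at_within_open[OF tJ oJ] .
    then have "(W has_derivative (\<lambda>h. h *\<^sub>R X' (U t) (W t))) (at t)"
    proof (rule has_derivative_transform_within_open[where s = J])
      show "open J" by (rule oJ)
      show "t \<in> J" by (rule tJ)
      show "g x = W x" if "x \<in> J" for x using gW subsetD[OF JI that] .
    qed
    then show ?thesis by (simp add: has_vector_derivative_def)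
  qed
  have "\<forall>\<^sub>F n in sequentially. \<forall>t. \<bar>t - t1\<bar> \<le> 1/2 * \<epsilon> \<longrightarrow> t \<in> T n"
    using good by eventually_elim (auto simp: I_def)
  moreover have "\<forall>t. \<bar>t - t1\<bar> < 1/2 * \<epsilon> \<longrightarrow> (W has_vector_derivative X' (U t) (W t)) (at t)"
    using der by simp
  ultimately show ?thesis using W[unfolded I_def D_def] by (intro exI[of _ W] conjI)
qed

section \<open>Metrics in a chart\<close>

lemma matrix_inv_eqI:
  fixes A B :: "real^'n^'n"
  assumes "A ** B = mat 1"
  shows "matrix_inv A = B"
proof -
  have "B ** A = mat 1" using assms matrix_left_right_inverse by blast
  then have "\<exists>A'. A ** A' = mat 1 \<and> A' ** A = mat 1" using assms by blast
  from someI_ex[OF this] have inv: "matrix_inv A ** A = mat 1" by (simp add: matrix_inv_def)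
  have "matrix_inv A = matrix_inv A ** (A ** B)" using assms by simp
  also have "\<dots> = B" unfolding matrix_mul_assoc inv by simp
  finally show ?thesis .
qed

locale chart_metric =
  fixes G :: "real^2 \<Rightarrow> real^2^2" and \<Omega> :: "(real^2) set"
  assumes an: "real_analytic_on (\<lambda>x. G x $ i $ j) \<Omega>"
    and transp: "x \<in> \<Omega> \<Longrightarrow> transpose (G x) = G x"
    and pos: "x \<in> \<Omega> \<Longrightarrow> u \<noteq> 0 \<Longrightarrow> u \<bullet> (G x *v u) > 0"
begin

abbreviation "\<Gamma> \<equiv> christoffel G"

lemma open_\<Omega>: "open \<Omega>"
  using an by (simp add: real_analytic_on_def)

lemma G_sym: "x \<in> \<Omega> \<Longrightarrow> G x $ i $ j = G x $ j $ i"
proof -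
  assume "x \<in> \<Omega>"
  moreover have "transpose (G x) $ j $ i = G x $ i $ j" by (simp add: transpose_def)
  ultimately show ?thesis using transp by simp
qed

lemma quad: "u \<bullet> (G x *v w) = u $ 1 * (G x $ 1 $ 1 * w $ 1 + G x $ 1 $ 2 * w $ 2)
    + u $ 2 * (G x $ 2 $ 1 * w $ 1 + G x $ 2 $ 2 * w $ 2)"
  by (simp add: inner_vec_def matrix_vector_mult_def sum_2)

lemma G11_pos: "x \<in> \<Omega> \<Longrightarrow> G x $ 1 $ 1 > 0"
proof -
  assume x: "x \<in> \<Omega>"
  have "(axis 1 1 :: real^2) \<noteq> 0" by (simp add: axis_eq_0_iff)
  from pos[OF x this] show ?thesis unfolding quad by (simp add: axis_def)
qed

lemma det_eq: "det (G x) = G x $ 1 $ 1 * G x $ 2 $ 2 - G x $ 1 $ 2 * G x $ 2 $ 1"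
  by (simp add: det_2)

lemma det_pos: assumes x: "x \<in> \<Omega>" shows "det (G x) > 0"
proof -
  \<comment> \<open>The quadratic form of G at (- G12, G11) is G11 times the determinant.\<close>
  define u :: "real^2" where "u = vector [- G x $ 1 $ 2, G x $ 1 $ 1]"
  have "u $ 2 \<noteq> 0" using G11_pos[OF x] by (simp add: u_def)
  then have "u \<noteq> 0" by auto
  from pos[OF x this] have "G x $ 1 $ 1 * det (G x) > 0"
    unfolding quad det_eq using G_sym[OF x, of 1 2] by (simp add: u_def algebra_simps)
  then show ?thesis using G11_pos[OF x] by (simp add: zero_less_mult_iff)
qed

lemma inv_G:
  assumes x: "x \<in> \<Omega>"
  shows "matrix_inv (G x) $ 1 $ 1 = G x $ 2 $ 2 / det (G x)"
    "matrix_inv (G x) $ 1 $ 2 = - G x $ 1 $ 2 / det (G x)"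
    "matrix_inv (G x) $ 2 $ 1 = - G x $ 1 $ 2 / det (G x)"
    "matrix_inv (G x) $ 2 $ 2 = G x $ 1 $ 1 / det (G x)"
proof -
  define B :: "real^2^2" where "B = vector [vector [G x $ 2 $ 2 / det (G x), - G x $ 1 $ 2 / det (G x)],
     vector [- G x $ 1 $ 2 / det (G x), G x $ 1 $ 1 / det (G x)]]"
  have "G x ** B = mat 1"
    using det_pos[OF x] G_sym[OF x, of 2 1]
    unfolding matrix_matrix_mult_def mat_def vec_eq_iff forall_2 sum_2 B_def
    by (simp add: diff_divide_distrib[symmetric] add_divide_distrib[symmetric] det_eq)
  then have "matrix_inv (G x) = B" by (rule matrix_inv_eqI)
  then show "matrix_inv (G x) $ 1 $ 1 = G x $ 2 $ 2 / det (G x)"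
    "matrix_inv (G x) $ 1 $ 2 = - G x $ 1 $ 2 / det (G x)"
    "matrix_inv (G x) $ 2 $ 1 = - G x $ 1 $ 2 / det (G x)"
    "matrix_inv (G x) $ 2 $ 2 = G x $ 1 $ 1 / det (G x)"
    by (simp_all add: B_def)
qed

section \<open>Regularity and identities of the Christoffel symbols\<close>

lemma diff_upto_G: "diff_upto k (\<lambda>x. G x $ i $ j) \<Omega>"
  by (rule real_analytic_diff_upto[OF an])

lemma diff_upto_dG: "diff_upto k (partial l (\<lambda>x. G x $ i $ j)) \<Omega>"
  by (rule real_analytic_diff_upto[OF real_analytic_partial[OF an]])

lemma diff_upto_det: "diff_upto k (\<lambda>x. det (G x)) \<Omega>"
  unfolding det_eq by (intro diff_upto_diff diff_upto_mult diff_upto_G open_\<Omega>)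

lemma diff_upto_inv: "diff_upto k (\<lambda>x. matrix_inv (G x) $ i $ j) \<Omega>"
proof -
  have d: "det (G x) \<noteq> 0" if "x \<in> \<Omega>" for x using det_pos[OF that] by simp
  have "i = 1 \<or> i = 2" "j = 1 \<or> j = 2" using exhaust_2 by auto
  then consider "i = 1" "j = 1" | "i = 1" "j = 2" | "i = 2" "j = 1" | "i = 2" "j = 2" by blast
  then show ?thesis
  proof cases
    case 1 then show ?thesis
      by (subst diff_upto_cong[OF open_\<Omega>]) (auto simp: inv_G intro!: diff_upto_divide diff_upto_det diff_upto_G open_\<Omega> d)
  next
    case 2 then show ?thesis
      by (subst diff_upto_cong[OF open_\<Omega>]) (auto simp: inv_G intro!: diff_upto_divide diff_upto_uminus diff_upto_det diff_upto_G open_\<Omega> d)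
  next
    case 3 then show ?thesis
      by (subst diff_upto_cong[OF open_\<Omega>]) (auto simp: inv_G intro!: diff_upto_divide diff_upto_uminus diff_upto_det diff_upto_G open_\<Omega> d)
  next
    case 4 then show ?thesis
      by (subst diff_upto_cong[OF open_\<Omega>]) (auto simp: inv_G intro!: diff_upto_divide diff_upto_det diff_upto_G open_\<Omega> d)
  qed
qed

lemma diff_upto_\<Gamma>: "diff_upto k (\<Gamma> l i j) \<Omega>"
proof -
  have "\<Gamma> l i j = (\<lambda>x. (1/2) * (\<Sum>m\<in>UNIV. matrix_inv (G x) $ l $ m *
    (partial i (\<lambda>y. G y $ j $ m) x + partial j (\<lambda>y. G y $ i $ m) x - partial m (\<lambda>y. G y $ i $ j) x)))"
    by (rule ext) (simp add: christoffel_def)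
  then show ?thesis
    by (simp only:) (intro diff_upto_mult diff_upto_const diff_upto_sum diff_upto_diff diff_upto_add diff_upto_inv diff_upto_dG open_\<Omega>)
qed

lemma \<Gamma>_diff: "x \<in> \<Omega> \<Longrightarrow> \<Gamma> l i j differentiable (at x)"
  using diff_upto_\<Gamma>[of 1] by simp

lemma G_diff: "x \<in> \<Omega> \<Longrightarrow> (\<lambda>x. G x $ i $ j) differentiable (at x)"
  using diff_upto_G[of 1] by simp

lemma partial_G_sym: "x \<in> \<Omega> \<Longrightarrow> partial l (\<lambda>x. G x $ i $ j) x = partial l (\<lambda>x. G x $ j $ i) x"
  by (rule partial_cong(2)[OF open_\<Omega>]) (auto intro: G_sym)

lemma \<Gamma>_sym: "x \<in> \<Omega> \<Longrightarrow> \<Gamma> k i j x = \<Gamma> k j i x"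
  unfolding christoffel_def by (simp add: partial_G_sym[of x _ i j] add.commute)

lemma partial_\<Gamma>_sym: "x \<in> \<Omega> \<Longrightarrow> partial l (\<Gamma> k i j) x = partial l (\<Gamma> k j i) x"
  by (rule partial_cong(2)[OF open_\<Omega>]) (auto intro: \<Gamma>_sym)

text \<open>Lowering the upper index cancels the inverse matrix and leaves the Christoffel symbols
  of the first kind.\<close>

lemma \<Gamma>_lower:
  assumes x: "x \<in> \<Omega>"
  shows "(\<Sum>k\<in>UNIV. G x $ l $ k * \<Gamma> k i j x) = (1/2) * (partial i (\<lambda>y. G y $ j $ l) x
     + partial j (\<lambda>y. G y $ i $ l) x - partial l (\<lambda>y. G y $ i $ j) x)"
proof -
  define B where "B m = partial i (\<lambda>y. G y $ j $ m) x + partial j (\<lambda>y. G y $ i $ m) x - partial m (\<lambda>y. G y $ i $ j) x" for m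
  define D where "D = det (G x)"
  have D: "D \<noteq> 0" "D = G x $ 1 $ 1 * G x $ 2 $ 2 - G x $ 1 $ 2 * G x $ 1 $ 2"
    using det_pos[OF x] G_sym[OF x, of 2 1] by (auto simp: D_def det_eq)
  have ge: "\<Gamma> k i j x = (1/2) * (matrix_inv (G x) $ k $ 1 * B 1 + matrix_inv (G x) $ k $ 2 * B 2)" for k
    by (simp add: christoffel_def sum_2 B_def)
  have g: "D * \<Gamma> 1 i j x = (1/2) * (G x $ 2 $ 2 * B 1 - G x $ 1 $ 2 * B 2)"
      "D * \<Gamma> 2 i j x = (1/2) * (G x $ 1 $ 1 * B 2 - G x $ 1 $ 2 * B 1)"
    unfolding ge inv_G[OF x] D_def[symmetric] using D(1) by (simp_all add: field_simps)
  have "D * (\<Sum>k\<in>UNIV. G x $ l $ k * \<Gamma> k i j x) = D * ((1/2) * B l)"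
  proof -
    have "D * (\<Sum>k\<in>UNIV. G x $ l $ k * \<Gamma> k i j x) = G x $ l $ 1 * (D * \<Gamma> 1 i j x) + G x $ l $ 2 * (D * \<Gamma> 2 i j x)"
      by (simp add: sum_2 algebra_simps)
    also have "\<dots> = D * ((1/2) * B l)"
      unfolding g using exhaust_2[of l] G_sym[OF x, of 2 1] by (auto simp: D(2) algebra_simps)
    finally show ?thesis .
  qed
  then show ?thesis using D(1) by (simp add: B_def)
qed

text \<open>Compatibility of the connection with the metric: the covariant derivative of G vanishes.
  Later it eliminates all first derivatives of G in favour of Christoffel symbols.\<close>

lemma partial_G:
  assumes x: "x \<in> \<Omega>"
  shows "partial m (\<lambda>y. G y $ i $ j) x = (\<Sum>n\<in>UNIV. G x $ j $ n * \<Gamma> n m i x + G x $ i $ n * \<Gamma> n m j x)"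
  unfolding sum.distrib \<Gamma>_lower[OF x] using partial_G_sym[OF x, of m i j] partial_G_sym[OF x, of j i m]
  partial_G_sym[OF x, of i j m] partial_G_sym[OF x, of j m i] by (simp add: field_simps)

text \<open>Differentiating the lowered identity instead of the definition of \<Gamma> avoids
  derivatives of \<open>matrix_inv\<close> and leaves second derivatives of G, whose symmetry is
  available.\<close>

lemma partial_\<Gamma>_lower:
  assumes x: "x \<in> \<Omega>"
  shows "(\<Sum>k\<in>UNIV. partial m (\<lambda>y. G y $ l $ k) x * \<Gamma> k i j x + G x $ l $ k * partial m (\<Gamma> k i j) x)
    = (1/2) * (partial m (partial i (\<lambda>y. G y $ j $ l)) x
     + partial m (partial j (\<lambda>y. G y $ i $ l)) x - partial m (partial l (\<lambda>y. G y $ i $ j)) x)"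
proof -
  have d1: "((\<lambda>y. G y $ a $ b) has_derivative (\<lambda>v. \<Sum>i\<in>UNIV. v $ i * partial i (\<lambda>y. G y $ a $ b) x)) (at x)" for a b
    by (rule differentiable_has_derivative_partial[OF G_diff[OF x]])
  have d2: "(\<Gamma> k i j has_derivative (\<lambda>v. \<Sum>l\<in>UNIV. v $ l * partial l (\<Gamma> k i j) x)) (at x)" for k
    by (rule differentiable_has_derivative_partial[OF \<Gamma>_diff[OF x]])
  have d3: "(partial c (\<lambda>y. G y $ a $ b) has_derivative (\<lambda>v. \<Sum>l\<in>UNIV. v $ l * partial l (partial c (\<lambda>y. G y $ a $ b)) x)) (at x)" for a b c
    by (rule differentiable_has_derivative_partial) (use diff_upto_dG[of 1 c a b] x in simp)
  have ax: "(\<Sum>i\<in>UNIV. axis m 1 $ i * f i) = f m" for f :: "2 \<Rightarrow> real"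
    using exhaust_2[of m] by (auto simp: sum_2 axis_def)
  have "partial m (\<lambda>x. \<Sum>k\<in>UNIV. G x $ l $ k * \<Gamma> k i j x) x =
     (\<Sum>k\<in>UNIV. partial m (\<lambda>y. G y $ l $ k) x * \<Gamma> k i j x + G x $ l $ k * partial m (\<Gamma> k i j) x)"
    by (subst partial_eqI) (rule has_derivative_sum has_derivative_mult d1 d2 | simp add: ax add.commute)+
  moreover have "partial m (\<lambda>x. \<Sum>k\<in>UNIV. G x $ l $ k * \<Gamma> k i j x) x =
     partial m (\<lambda>x. (1/2) * (partial i (\<lambda>y. G y $ j $ l) x
     + partial j (\<lambda>y. G y $ i $ l) x - partial l (\<lambda>y. G y $ i $ j) x)) x"
    by (rule partial_cong(2)[OF open_\<Omega> x \<Gamma>_lower])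
  moreover have "\<dots> = (1/2) * (partial m (partial i (\<lambda>y. G y $ j $ l)) x
     + partial m (partial j (\<lambda>y. G y $ i $ l)) x - partial m (partial l (\<lambda>y. G y $ i $ j)) x)"
    by (subst partial_eqI[OF has_derivative_mult_right[OF has_derivative_diff[OF has_derivative_add[OF d3 d3] d3]]])
       (simp only: ax)
  ultimately show ?thesis by simp
qed

section \<open>Gauss curvature of a metric in a chart\<close>

definition \<kappa> :: "real^2 \<Rightarrow> real"
  where "\<kappa> x = (\<Sum>l\<in>UNIV. G x $ 1 $ l * riemann G l 1 2 2 x) / det (G x)"

lemma diff_upto_\<kappa>: "diff_upto k \<kappa> \<Omega>"
proof -
  have r: "diff_upto k (riemann G l i j m) \<Omega>" for l i j m
  proof -
    have "riemann G l i j m = (\<lambda>x. partial i (\<Gamma> l j m) x - partial j (\<Gamma> l i m) x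
      + (\<Sum>n\<in>UNIV. \<Gamma> n j m x * \<Gamma> l i n x - \<Gamma> n i m x * \<Gamma> l j n x))"
      by (rule ext) (simp add: riemann_def)
    moreover have "diff_upto k (partial i (\<Gamma> l j m)) \<Omega>" for i l j m using diff_upto_\<Gamma>[of "Suc k" l j m] by simp
    ultimately show ?thesis by (simp only:) (intro diff_upto_add diff_upto_diff diff_upto_sum diff_upto_mult diff_upto_\<Gamma> open_\<Omega>)
  qed
  have d: "det (G x) \<noteq> 0" if "x \<in> \<Omega>" for x using det_pos[OF that] by simp
  have "\<kappa> = (\<lambda>x. (\<Sum>l\<in>UNIV. G x $ 1 $ l * riemann G l 1 2 2 x) / det (G x))" by (rule ext) (simp add: \<kappa>_def)
  then show ?thesis by (simp only:) (intro diff_upto_divide diff_upto_sum diff_upto_mult diff_upto_G r diff_upto_det d open_\<Omega>)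
qed

text \<open>The endomorphism R(1,2) is skew with respect to G. In dimension 2 such an endomorphism
  is determined by one number, and \<kappa> is defined to be that number; solving the resulting
  linear system, multiplied by the determinant, gives the four components.\<close>

lemma riemann_components:
  assumes x: "x \<in> \<Omega>"
  shows "riemann G 1 1 2 1 x = \<kappa> x * G x $ 1 $ 2" "riemann G 1 1 2 2 x = \<kappa> x * G x $ 2 $ 2"
    "riemann G 2 1 2 1 x = - \<kappa> x * G x $ 1 $ 1" "riemann G 2 1 2 2 x = - \<kappa> x * G x $ 1 $ 2"
proof -
  define e f h where "e = G x $ 1 $ 1" and "f = G x $ 1 $ 2" and "h = G x $ 2 $ 2"
  have g21: "G x $ 2 $ 1 = f" using G_sym[OF x, of 2 1] by (simp add: f_def)
  define D where "D = det (G x)"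
  have D: "D \<noteq> 0" "D = e * h - f * f"
    using det_pos[OF x] g21 by (auto simp: D_def det_eq e_def f_def h_def)
  \<comment> \<open>Skew symmetry. With its index lowered, R(1,2) is a sum of second derivatives of
    G and products of Christoffel symbols, antisymmetric in k and l once the term with both
    derivatives 1 and 2 drops out by commutation.\<close>
  have q: "(\<Sum>n\<in>UNIV. G x $ l $ n * riemann G n 1 2 k x) + (\<Sum>n\<in>UNIV. G x $ k $ n * riemann G n 1 2 l x) = 0" for k l
  proof -
    have *: "(\<Sum>n\<in>UNIV. G x $ l $ n * riemann G n 1 2 k x) =
       (1/2) * (partial 1 (partial k (\<lambda>y. G y $ 2 $ l)) x - partial 1 (partial l (\<lambda>y. G y $ 2 $ k)) x
        - partial 2 (partial k (\<lambda>y. G y $ 1 $ l)) x + partial 2 (partial l (\<lambda>y. G y $ 1 $ k)) x)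
       + (\<Sum>n\<in>UNIV. \<Sum>m\<in>UNIV. G x $ n $ m * (\<Gamma> m 2 l x * \<Gamma> n 1 k x - \<Gamma> m 1 l x * \<Gamma> n 2 k x))" for k l
    proof -
      have c: "partial 1 (partial 2 (\<lambda>y. G y $ k $ l)) x = partial 2 (partial 1 (\<lambda>y. G y $ k $ l)) x"
        by (rule real_analytic_partial_commute[OF an x])
      have h1: "(\<Sum>n\<in>UNIV. G x $ l $ n * (partial 1 (\<Gamma> n 2 k) x - partial 2 (\<Gamma> n 1 k) x)) =
         (1/2) * (partial 1 (partial k (\<lambda>y. G y $ 2 $ l)) x - partial 1 (partial l (\<lambda>y. G y $ 2 $ k)) x
        - partial 2 (partial k (\<lambda>y. G y $ 1 $ l)) x + partial 2 (partial l (\<lambda>y. G y $ 1 $ k)) x)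
        - (\<Sum>n\<in>UNIV. partial 1 (\<lambda>y. G y $ l $ n) x * \<Gamma> n 2 k x - partial 2 (\<lambda>y. G y $ l $ n) x * \<Gamma> n 1 k x)"
        using partial_\<Gamma>_lower[OF x, of 1 l 2 k] partial_\<Gamma>_lower[OF x, of 2 l 1 k] c
        unfolding sum_2 by (simp add: algebra_simps)
      have h2: "(\<Sum>n\<in>UNIV. G x $ l $ n * riemann G n 1 2 k x) =
        (\<Sum>n\<in>UNIV. G x $ l $ n * (partial 1 (\<Gamma> n 2 k) x - partial 2 (\<Gamma> n 1 k) x)) +
        (\<Sum>n\<in>UNIV. G x $ l $ n * (\<Sum>m\<in>UNIV. \<Gamma> m 2 k x * \<Gamma> n 1 m x - \<Gamma> m 1 k x * \<Gamma> n 2 m x))"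
        unfolding riemann_def sum_2 by (simp add: algebra_simps)
      show ?thesis unfolding h2 h1 partial_G[OF x]
        unfolding sum_2 using G_sym[OF x, of 2 1] by (simp add: algebra_simps)
    qed
    show ?thesis unfolding *[of l k] *[of k l] unfolding sum_2 using G_sym[OF x, of 2 1]
      by (simp add: algebra_simps)
  qed
  define r11 r12 r21 r22 where "r11 = riemann G 1 1 2 1 x" and "r12 = riemann G 1 1 2 2 x"
    and "r21 = riemann G 2 1 2 1 x" and "r22 = riemann G 2 1 2 2 x"
  have k: "\<kappa> x * D = e * r12 + f * r22"
    using D(1) by (simp add: \<kappa>_def D_def sum_2 e_def f_def r12_def r22_def)
  have q1: "e * r11 + f * r21 = 0" using q[of 1 1] by (simp add: sum_2 e_def f_def r11_def r21_def)
  have q2: "f * r12 + h * r22 = 0" using q[of 2 2] g21 by (simp add: sum_2 h_def r12_def r22_def)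
  have q3: "e * r12 + f * r22 + (f * r11 + h * r21) = 0"
    using q[of 1 2] g21 by (simp add: sum_2 e_def f_def h_def r11_def r12_def r21_def r22_def)
  have "D * r11 = D * (\<kappa> x * f)" "D * r12 = D * (\<kappa> x * h)" "D * r21 = D * (- \<kappa> x * e)" "D * r22 = D * (- \<kappa> x * f)"
    using k q1 q2 q3 unfolding D(2) by algebra+
  then have "r11 = \<kappa> x * f" "r12 = \<kappa> x * h" "r21 = - \<kappa> x * e" "r22 = - \<kappa> x * f"
    by (simp_all only: mult_left_cancel[OF D(1)])
  then show "riemann G 1 1 2 1 x = \<kappa> x * G x $ 1 $ 2" "riemann G 1 1 2 2 x = \<kappa> x * G x $ 2 $ 2"
    "riemann G 2 1 2 1 x = - \<kappa> x * G x $ 1 $ 1" "riemann G 2 1 2 2 x = - \<kappa> x * G x $ 1 $ 2"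
    by (simp_all add: r11_def r12_def r21_def r22_def e_def f_def h_def)
qed

text \<open>The trace of the connection is the logarithmic derivative of sqrt (det G). Equivalently,
  the area form in \<open>jac\<close> is parallel.\<close>

lemma partial_det:
  assumes x: "x \<in> \<Omega>"
  shows "partial i (\<lambda>x. det (G x)) x = 2 * det (G x) * (\<Gamma> 1 i 1 x + \<Gamma> 2 i 2 x)"
proof -
  have "partial i (\<lambda>x. det (G x)) x = (G x $ 1 $ 1 * partial i (\<lambda>x. G x $ 2 $ 2) x + partial i (\<lambda>x. G x $ 1 $ 1) x * G x $ 2 $ 2)
     - (G x $ 1 $ 2 * partial i (\<lambda>x. G x $ 2 $ 1) x + partial i (\<lambda>x. G x $ 1 $ 2) x * G x $ 2 $ 1)"
    unfolding det_eq
    by (subst partial_eqI[OF has_derivative_diff[OF has_derivative_mult has_derivative_mult,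
      OF differentiable_has_derivative_partial differentiable_has_derivative_partial
         differentiable_has_derivative_partial differentiable_has_derivative_partial,
      OF G_diff G_diff G_diff G_diff, OF x x x x]])
      (use exhaust_2[of i] in \<open>auto simp: sum_2 axis_def\<close>)
  then show ?thesis unfolding partial_G[OF x] det_eq sum_2
    using G_sym[OF x, of 2 1] by (simp add: algebra_simps)
qed


subsection \<open>The geodesic vector field and its linearization\<close>

definition spray :: "(real^2) \<times> (real^2) \<Rightarrow> (real^2) \<times> (real^2)"
  where "spray a = (snd a, \<chi> k. - (\<Sum>i\<in>UNIV. \<Sum>j\<in>UNIV. \<Gamma> k i j (fst a) * snd a $ i * snd a $ j))"

definition dspray :: "(real^2) \<times> (real^2) \<Rightarrow> (real^2) \<times> (real^2) \<Rightarrow> (real^2) \<times> (real^2)"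
  where "dspray a b = (snd b, \<chi> k. - (\<Sum>i\<in>UNIV. \<Sum>j\<in>UNIV.
     (\<Sum>l\<in>UNIV. fst b $ l * partial l (\<Gamma> k i j) (fst a)) * snd a $ i * snd a $ j
     + \<Gamma> k i j (fst a) * (snd b $ i * snd a $ j + snd a $ i * snd b $ j)))"

lemma has_derivative_spray:
  assumes "fst a \<in> \<Omega>"
  shows "(spray has_derivative dspray a) (at a)"
proof -
  have g: "((\<lambda>a. \<Gamma> k i j (fst a)) has_derivative (\<lambda>b. \<Sum>l\<in>UNIV. fst b $ l * partial l (\<Gamma> k i j) (fst a))) (at a)" for k i j
    by (rule has_derivative_compose[OF has_derivative_fst[OF has_derivative_ident]
      differentiable_has_derivative_partial[OF \<Gamma>_diff[OF assms]], simplified])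
  have c: "((\<lambda>a. snd a $ i) has_derivative (\<lambda>b. snd b $ i)) (at a)" for i :: 2 and a :: "(real^2) \<times> (real^2)"
    by (intro bounded_linear.has_derivative[OF bounded_linear_vec_nth] has_derivative_snd has_derivative_ident)
  have k: "((\<lambda>a. - (\<Sum>i\<in>UNIV. \<Sum>j\<in>UNIV. \<Gamma> k i j (fst a) * snd a $ i * snd a $ j)) has_derivative
     (\<lambda>b. - (\<Sum>i\<in>UNIV. \<Sum>j\<in>UNIV. (\<Sum>l\<in>UNIV. fst b $ l * partial l (\<Gamma> k i j) (fst a)) * snd a $ i * snd a $ j
     + \<Gamma> k i j (fst a) * (snd b $ i * snd a $ j + snd a $ i * snd b $ j)))) (at a)" for k
    by (rule has_derivative_eq_rhs, (rule has_derivative_minus has_derivative_sum has_derivative_mult g c)+)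
      (simp add: algebra_simps)
  have "((\<lambda>a. \<chi> k. - (\<Sum>i\<in>UNIV. \<Sum>j\<in>UNIV. \<Gamma> k i j (fst a) * snd a $ i * snd a $ j)) has_derivative
     (\<lambda>b. \<chi> k. - (\<Sum>i\<in>UNIV. \<Sum>j\<in>UNIV. (\<Sum>l\<in>UNIV. fst b $ l * partial l (\<Gamma> k i j) (fst a)) * snd a $ i * snd a $ j
     + \<Gamma> k i j (fst a) * (snd b $ i * snd a $ j + snd a $ i * snd b $ j)))) (at a)"
    unfolding has_derivative_componentwise_within[of "\<lambda>a. \<chi> k. _ k a"]
    by (auto simp: Basis_vec_def inner_axis intro!: k)
  then show ?thesis unfolding spray_def dspray_def
    by (intro has_derivative_Pair has_derivative_snd has_derivative_ident)
qed

lemma continuous_dspray: "continuous_on (\<Omega> \<times> UNIV) (\<lambda>a. dspray a b)"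
proof -
  have 1: "continuous_on (\<Omega> \<times> UNIV) (\<lambda>a::(real^2)\<times>(real^2). \<Gamma> k i j (fst a))" for k i j
    by (rule continuous_on_compose2[OF diff_upto_continuous[OF diff_upto_\<Gamma>[of "Suc 0"]]]) (auto intro!: continuous_intros)
  have "diff_upto 1 (partial l (\<Gamma> k i j)) \<Omega>" for l k i j using diff_upto_\<Gamma>[of "Suc 1" k i j] by simp
  then have 2: "continuous_on (\<Omega> \<times> UNIV) (\<lambda>a::(real^2)\<times>(real^2). partial l (\<Gamma> k i j) (fst a))" for l k i j
    by (intro continuous_on_compose2[OF diff_upto_continuous[of 0 "partial l (\<Gamma> k i j)" \<Omega>]]) (auto intro!: continuous_intros)
  show ?thesis unfolding dspray_def by (intro continuous_intros 1 2)
qed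

text \<open>Along a unit speed geodesic \<open>u\<close>, \<open>jac\<close> is the signed length of the component of a variation field
  \<open>w\<close> normal to \<open>u'\<close>, and \<open>djac\<close> is the same for the covariant derivative of \<open>w\<close>.\<close>

definition jac :: "(real^2) \<times> (real^2) \<Rightarrow> (real^2) \<times> (real^2) \<Rightarrow> real"
  where "jac a b = sqrt (det (G (fst a))) * (snd a $ 1 * fst b $ 2 - snd a $ 2 * fst b $ 1)"

definition djac :: "(real^2) \<times> (real^2) \<Rightarrow> (real^2) \<times> (real^2) \<Rightarrow> real"
  where "djac a b = sqrt (det (G (fst a))) *
    (snd a $ 1 * (snd b $ 2 + (\<Sum>i\<in>UNIV. \<Sum>j\<in>UNIV. \<Gamma> 2 i j (fst a) * snd a $ i * fst b $ j))
   - snd a $ 2 * (snd b $ 1 + (\<Sum>i\<in>UNIV. \<Sum>j\<in>UNIV. \<Gamma> 1 i j (fst a) * snd a $ i * fst b $ j)))"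

text \<open>\<open>jac\<close> is the area form applied to the velocity a and the variation w. Area
  form and a are parallel along the geodesic, so differentiation falls on w: first it gives
  \<open>djac\<close>, then the area of a and the second covariant derivative of w, which by the
  linearized geodesic equation is the curvature term. In dimension 2 and at unit speed that term is
  - \<kappa> times \<open>jac\<close>.\<close>

lemma jacobi_equation:
  assumes x: "fst (U t) \<in> \<Omega>"
    and U: "(U has_vector_derivative spray (U t)) (at t)"
    and W: "(W has_vector_derivative dspray (U t) (W t)) (at t)"
  shows "((\<lambda>t. jac (U t) (W t)) has_real_derivative djac (U t) (W t)) (at t)"
    and "snd (U t) \<bullet> (G (fst (U t)) *v snd (U t)) = 1 \<Longrightarrow>
      ((\<lambda>t. djac (U t) (W t)) has_real_derivative - \<kappa> (fst (U t)) * jac (U t) (W t)) (at t)"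
proof -
  define a :: "2 \<Rightarrow> real" where "a i = snd (U t) $ i" for i
  define w :: "2 \<Rightarrow> real" where "w i = fst (W t) $ i" for i
  define z :: "2 \<Rightarrow> real" where "z i = snd (W t) $ i" for i
  define \<gamma> where "\<gamma> k i j = \<Gamma> k i j (fst (U t))" for k i j
  define d where "d l k i j = partial l (\<Gamma> k i j) (fst (U t))" for l k i j
  have gs: "\<gamma> k 2 1 = \<gamma> k 1 2" for k unfolding \<gamma>_def by (rule \<Gamma>_sym[OF x])
  have ds: "d l k 2 1 = d l k 1 2" for k l unfolding d_def by (rule partial_\<Gamma>_sym[OF x])
  have fst': "((\<lambda>t. fst (f t)) has_vector_derivative fst f') (at t)"
    and snd': "((\<lambda>t. snd (f t)) has_vector_derivative snd f') (at t)"
    if "(f has_vector_derivative f') (at t)" for f :: "real \<Rightarrow> (real^2) \<times> (real^2)" and f'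
    using bounded_linear.has_vector_derivative[OF bounded_linear_fst that]
      bounded_linear.has_vector_derivative[OF bounded_linear_snd that] by auto
  have nth': "((\<lambda>t. f t $ i) has_real_derivative f' $ i) (at t)"
    if "(f has_vector_derivative f') (at t)" for f :: "real \<Rightarrow> real^2" and f' i
    using bounded_linear.has_vector_derivative[OF bounded_linear_vec_nth that, of i]
    by (simp add: has_real_derivative_iff_has_vector_derivative)
  have du: "((\<lambda>t. fst (U t)) has_vector_derivative snd (U t)) (at t)" using fst'[OF U] by (simp add: spray_def)
  have dfun: "((\<lambda>t. f (fst (U t))) has_real_derivative (\<Sum>l\<in>UNIV. a l * partial l f (fst (U t)))) (at t)"
    if "f differentiable (at (fst (U t)))" for f :: "real^2 \<Rightarrow> real"
    using vector_derivative_diff_chain_within[OF du, of f "\<lambda>v. \<Sum>i\<in>UNIV. v $ i * partial i f (fst (U t))"]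
      has_derivative_at_withinI[OF differentiable_has_derivative_partial[OF that]]
    by (simp add: o_def a_def has_real_derivative_iff_has_vector_derivative)
  have da: "((\<lambda>t. snd (U t) $ k) has_real_derivative - (\<gamma> k 1 1 * a 1 * a 1 + 2 * \<gamma> k 1 2 * a 1 * a 2 + \<gamma> k 2 2 * a 2 * a 2)) (at t)" for k
    using nth'[OF snd'[OF U], of k] by (rule DERIV_cong)
      (simp add: spray_def sum_2 \<gamma>_def[symmetric] a_def[symmetric] gs algebra_simps)
  have dw: "((\<lambda>t. fst (W t) $ k) has_real_derivative z k) (at t)" for k
    using nth'[OF fst'[OF W], of k] by (simp add: dspray_def z_def)
  have dz: "((\<lambda>t. snd (W t) $ k) has_real_derivative
     - ((w 1 * d 1 k 1 1 + w 2 * d 2 k 1 1) * a 1 * a 1 + 2 * (w 1 * d 1 k 1 2 + w 2 * d 2 k 1 2) * a 1 * a 2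
        + (w 1 * d 1 k 2 2 + w 2 * d 2 k 2 2) * a 2 * a 2
        + 2 * (\<gamma> k 1 1 * a 1 * z 1 + \<gamma> k 1 2 * (a 1 * z 2 + a 2 * z 1) + \<gamma> k 2 2 * a 2 * z 2))) (at t)" for k
    using nth'[OF snd'[OF W], of k] by (rule DERIV_cong)
      (simp add: dspray_def sum_2 \<gamma>_def[symmetric] d_def[symmetric] a_def[symmetric] w_def[symmetric]
        z_def[symmetric] gs ds algebra_simps)
  have dg: "((\<lambda>t. \<Gamma> k i j (fst (U t))) has_real_derivative (a 1 * d 1 k i j + a 2 * d 2 k i j)) (at t)" for k i j
    using dfun[OF \<Gamma>_diff[OF x], of k i j] by (simp add: sum_2 d_def)
  define s where "s = sqrt (det (G (fst (U t))))"
  have s0: "s > 0" using det_pos[OF x] by (simp add: s_def)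
  define tr where "tr = a 1 * (\<gamma> 1 1 1 + \<gamma> 2 1 2) + a 2 * (\<gamma> 1 1 2 + \<gamma> 2 2 2)"
  have dsq: "((\<lambda>t. sqrt (det (G (fst (U t))))) has_real_derivative s * tr) (at t)"
  proof -
    have "(\<lambda>x. det (G x)) differentiable (at (fst (U t)))" using diff_upto_det[of 1] x by simp
    from dfun[OF this] have "((\<lambda>t. det (G (fst (U t)))) has_real_derivative 2 * (s * s) * tr) (at t)"
      unfolding partial_det[OF x] sum_2 by (rule DERIV_cong)
        (use det_pos[OF x] gs in \<open>simp add: s_def tr_def \<gamma>_def algebra_simps\<close>)
    from DERIV_chain2[OF DERIV_real_sqrt[OF det_pos[OF x]] this]
    show ?thesis by (rule DERIV_cong) (use s0 in \<open>simp add: s_def[symmetric] field_simps\<close>)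
  qed
  show "((\<lambda>t. jac (U t) (W t)) has_real_derivative djac (U t) (W t)) (at t)"
    unfolding jac_def
    by (rule DERIV_cong, (rule DERIV_mult DERIV_diff dsq da dw)+)
      (simp add: djac_def sum_2 s_def[symmetric] \<gamma>_def[symmetric] a_def[symmetric] w_def[symmetric]
        z_def[symmetric] gs tr_def algebra_simps)
  assume unit: "snd (U t) \<bullet> (G (fst (U t)) *v snd (U t)) = 1"
  define e f h K where "e = G (fst (U t)) $ 1 $ 1" and "f = G (fst (U t)) $ 1 $ 2" and "h = G (fst (U t)) $ 2 $ 2"
    and "K = \<kappa> (fst (U t))"
  have un: "a 1 * (e * a 1 + f * a 2) + a 2 * (f * a 1 + h * a 2) = 1"
    using unit G_sym[OF x, of 2 1] unfolding quad by (simp add: a_def e_def f_def h_def)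
  have rc: "K * f = d 1 1 1 2 - d 2 1 1 1 + (\<gamma> 1 1 2 * \<gamma> 1 1 1 - \<gamma> 1 1 1 * \<gamma> 1 1 2) + (\<gamma> 2 1 2 * \<gamma> 1 1 2 - \<gamma> 2 1 1 * \<gamma> 1 2 2)"
    "K * h = d 1 1 2 2 - d 2 1 1 2 + (\<gamma> 1 2 2 * \<gamma> 1 1 1 - \<gamma> 1 1 2 * \<gamma> 1 1 2) + (\<gamma> 2 2 2 * \<gamma> 1 1 2 - \<gamma> 2 1 2 * \<gamma> 1 2 2)"
    "- K * e = d 1 2 1 2 - d 2 2 1 1 + (\<gamma> 1 1 2 * \<gamma> 2 1 1 - \<gamma> 1 1 1 * \<gamma> 2 1 2) + (\<gamma> 2 1 2 * \<gamma> 2 1 2 - \<gamma> 2 1 1 * \<gamma> 2 2 2)"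
    "- K * f = d 1 2 2 2 - d 2 2 1 2 + (\<gamma> 1 2 2 * \<gamma> 2 1 1 - \<gamma> 1 1 2 * \<gamma> 2 1 2) + (\<gamma> 2 2 2 * \<gamma> 2 1 2 - \<gamma> 2 1 2 * \<gamma> 2 2 2)"
    using riemann_components[OF x] unfolding riemann_def sum_2
    by (simp_all add: K_def e_def f_def h_def \<gamma>_def[symmetric] d_def[symmetric] gs ds)
  \<comment> \<open>These are the components of R(1,2) a. Their area with a is - K times the squared
    length of a, hence - K. Expanding them by \<open>rc\<close> writes - K times \<open>jac\<close>
    in the derivatives of \<Gamma> that the second differentiation produces.\<close>
  define R1 R2 where "R1 = K * f * a 1 + K * h * a 2" and "R2 = - K * e * a 1 + (- K * f) * a 2"
  have R: "a 1 * R2 - a 2 * R1 = - K"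
  proof -
    have "a 1 * R2 - a 2 * R1 = - K * (a 1 * (e * a 1 + f * a 2) + a 2 * (f * a 1 + h * a 2))"
      by (simp add: R1_def R2_def algebra_simps)
    then show ?thesis by (simp add: un)
  qed
  have "- K * (s * (a 1 * w 2 - a 2 * w 1)) = s * (a 1 * w 2 - a 2 * w 1) * (a 1 * R2 - a 2 * R1)"
    unfolding R by simp
  note fin = this[unfolded R1_def R2_def rc]
  show "((\<lambda>t. djac (U t) (W t)) has_real_derivative - \<kappa> (fst (U t)) * jac (U t) (W t)) (at t)"
    unfolding djac_def sum_2
    apply (rule DERIV_cong, (rule DERIV_mult DERIV_diff DERIV_add dsq da dw dz dg)+)
    unfolding jac_def s_def[symmetric] \<gamma>_def[symmetric] a_def[symmetric] w_def[symmetric]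
        z_def[symmetric] gs ds tr_def K_def[symmetric] fin
    by (simp add: algebra_simps)
qed

text \<open>Metric compatibility turns the derivative of G along the curve into Christoffel terms,
  which cancel those coming from the acceleration.\<close>

lemma speed_derivative:
  assumes x: "fst (U t) \<in> \<Omega>"
    and U: "(U has_vector_derivative spray (U t)) (at t)"
  shows "((\<lambda>t. snd (U t) \<bullet> (G (fst (U t)) *v snd (U t))) has_real_derivative 0) (at t)"
proof -
  define a :: "2 \<Rightarrow> real" where "a i = snd (U t) $ i" for i
  define \<gamma> where "\<gamma> k i j = \<Gamma> k i j (fst (U t))" for k i j
  define q where "q i j = G (fst (U t)) $ i $ j" for i j
  have gs: "\<gamma> k 2 1 = \<gamma> k 1 2" for k unfolding \<gamma>_def by (rule \<Gamma>_sym[OF x])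
  have qs: "q 2 1 = q 1 2" unfolding q_def by (rule G_sym[OF x])
  have du: "((\<lambda>t. fst (U t)) has_vector_derivative snd (U t)) (at t)"
    using bounded_linear.has_vector_derivative[OF bounded_linear_fst U] by (simp add: spray_def)
  have da: "((\<lambda>t. snd (U t) $ k) has_real_derivative - (\<gamma> k 1 1 * a 1 * a 1 + 2 * \<gamma> k 1 2 * a 1 * a 2 + \<gamma> k 2 2 * a 2 * a 2)) (at t)" for k
    using bounded_linear.has_vector_derivative[OF bounded_linear_vec_nth
        bounded_linear.has_vector_derivative[OF bounded_linear_snd U], of k]
    unfolding has_real_derivative_iff_has_vector_derivative[symmetric]
    by (rule DERIV_cong) (simp add: spray_def sum_2 \<gamma>_def[symmetric] a_def[symmetric] gs algebra_simps)
  have dq: "((\<lambda>t. G (fst (U t)) $ i $ j) has_real_derivative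
      (\<Sum>l\<in>UNIV. a l * (\<Sum>n\<in>UNIV. q j n * \<gamma> n l i + q i n * \<gamma> n l j))) (at t)" for i j
    using vector_derivative_diff_chain_within[OF du, of "\<lambda>x. G x $ i $ j"
        "\<lambda>v. \<Sum>l\<in>UNIV. v $ l * partial l (\<lambda>x. G x $ i $ j) (fst (U t))"]
      has_derivative_at_withinI[OF differentiable_has_derivative_partial[OF G_diff[OF x]], of i j]
    unfolding partial_G[OF x]
    by (simp add: o_def a_def \<gamma>_def q_def has_real_derivative_iff_has_vector_derivative)
  show ?thesis unfolding quad
    by (rule DERIV_cong, (rule DERIV_mult DERIV_add da dq)+)
      (simp add: sum_2 q_def[symmetric] a_def[symmetric] gs qs algebra_simps)
qed

end

section \<open>Surfaces\<close>

text \<open>The chain rule for sequences, with 1 / n as parameter. Convergence of n (b n - a) puts b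
  n within O(1/n) of a, so n times the remainder o(|b n - a|) of the derivative vanishes in the
  limit.\<close>

lemma scaled_difference_tendsto:
  fixes f :: "'a::real_normed_vector \<Rightarrow> 'b::real_normed_vector"
  assumes f: "(f has_derivative D) (at a)"
    and lim: "(\<lambda>n. real n *\<^sub>R (b n - a)) \<longlonglongrightarrow> w"
  shows "b \<longlonglongrightarrow> a" "(\<lambda>n. real n *\<^sub>R (f (b n) - f a)) \<longlonglongrightarrow> D w"
proof -
  have "(\<lambda>n. inverse (real n) *\<^sub>R (real n *\<^sub>R (b n - a))) \<longlonglongrightarrow> 0 *\<^sub>R w"
    by (intro tendsto_scaleR lim lim_inverse_n)
  moreover have "\<forall>\<^sub>F n in sequentially. inverse (real n) *\<^sub>R (real n *\<^sub>R (b n - a)) = b n - a"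
    using eventually_gt_at_top[of 0] by eventually_elim simp
  ultimately have "(\<lambda>n. b n - a) \<longlonglongrightarrow> 0"
    unfolding scaleR_zero_left by (rule Lim_transform_eventually)
  then show b: "b \<longlonglongrightarrow> a" by (simp add: LIM_zero_iff)
  define r where "r n = real n *\<^sub>R (f (b n) - f a - D (b n - a))" for n
  have "r \<longlonglongrightarrow> 0"
  proof (rule tendstoI)
    fix e :: real assume e: "e > 0"
    have "\<exists>K>0. \<forall>n. norm (real n *\<^sub>R (b n - a)) \<le> K"
      using convergent_imp_Bseq[OF convergentI[OF lim]] unfolding Bseq_def .
    then obtain K where K: "K > 0" "\<forall>n. norm (real n *\<^sub>R (b n - a)) \<le> K" by (elim exE conjE)
    define e' where "e' = e / (2 * K)"
    have e': "e' > 0" using e K by (simp add: e'_def)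
    from f[unfolded has_derivative_at_alt] e'
    have "\<exists>d>0. \<forall>y. norm (y - a) < d \<longrightarrow> norm (f y - f a - D (y - a)) \<le> e' * norm (y - a)" by simp
    then obtain d where d: "d > 0" "\<forall>y. norm (y - a) < d \<longrightarrow> norm (f y - f a - D (y - a)) \<le> e' * norm (y - a)"
      by (elim exE conjE)
    have "\<forall>\<^sub>F n in sequentially. dist (b n) a < d" by (rule tendstoD[OF b d(1)])
    then show "\<forall>\<^sub>F n in sequentially. dist (r n) 0 < e"
    proof eventually_elim
      case (elim n)
      have "norm (r n) = real n * norm (f (b n) - f a - D (b n - a))" by (simp add: r_def)
      also have "\<dots> \<le> real n * (e' * norm (b n - a))"
        using d(2) elim by (intro mult_left_mono) (auto simp: dist_norm)
      also have "\<dots> = e' * norm (real n *\<^sub>R (b n - a))" by simp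
      also have "\<dots> \<le> e' * K" using K(2) e' by (intro mult_left_mono) auto
      also have "\<dots> < e" using e K by (simp add: e'_def)
      finally show ?case by simp
    qed
  qed
  moreover have "(\<lambda>n. D (real n *\<^sub>R (b n - a))) \<longlonglongrightarrow> D w"
    by (rule bounded_linear.tendsto[OF has_derivative_bounded_linear[OF f] lim])
  ultimately have "(\<lambda>n. r n + D (real n *\<^sub>R (b n - a))) \<longlonglongrightarrow> 0 + D w" by (rule tendsto_add)
  moreover have "r n + D (real n *\<^sub>R (b n - a)) = real n *\<^sub>R (f (b n) - f a)" for n
    using linear_cmul[OF has_derivative_linear[OF f], of "real n" "b n - a"]
    by (simp add: r_def scaleR_diff_right)
  ultimately show "(\<lambda>n. real n *\<^sub>R (f (b n) - f a)) \<longlonglongrightarrow> D w" by simp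
qed

locale surface =
  fixes A :: "('a::{t2_space, second_countable_topology}, 2) chart set"
    and g :: "('a, 2) metric"
  assumes atlas: "analytic_atlas A" and metric: "analytic_metric A g"
begin

abbreviation \<Omega> where "\<Omega> c \<equiv> map_of_chart c ` dom_of c"

lemma chart_metric_chart: "c \<in> A \<Longrightarrow> chart_metric (g c) (\<Omega> c)"
  using metric unfolding analytic_metric_def chart_metric_def by blast

lemma open_dom: "c \<in> A \<Longrightarrow> open (dom_of c)" and open_\<Omega>: "c \<in> A \<Longrightarrow> open (\<Omega> c)"
  and homeo: "c \<in> A \<Longrightarrow> homeomorphism (dom_of c) (\<Omega> c) (map_of_chart c) (inv_chart c)"
  using atlas unfolding analytic_atlas_def by blast+

lemma chart_ex: "\<exists>c\<in>A. p \<in> dom_of c"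
  using atlas unfolding analytic_atlas_def by blast

lemma chart_at: "chart_at A p \<in> A" "p \<in> dom_of (chart_at A p)"
proof -
  have "\<exists>c. c \<in> A \<and> p \<in> dom_of c" using chart_ex by blast
  from someI_ex[OF this] show "chart_at A p \<in> A" "p \<in> dom_of (chart_at A p)"
    by (simp_all add: chart_at_def)
qed

lemma inv_map: "c \<in> A \<Longrightarrow> p \<in> dom_of c \<Longrightarrow> inv_chart c (map_of_chart c p) = p"
  using homeo by (simp add: homeomorphism_def)

lemma map_inv: "c \<in> A \<Longrightarrow> x \<in> \<Omega> c \<Longrightarrow> map_of_chart c (inv_chart c x) = x"
  by (rule homeomorphism_apply2[OF homeo])

lemma inv_dom: "c \<in> A \<Longrightarrow> x \<in> \<Omega> c \<Longrightarrow> inv_chart c x \<in> dom_of c"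
  using homeomorphism_image2[OF homeo] by blast

lemma continuous_map: "c \<in> A \<Longrightarrow> continuous_on (dom_of c) (map_of_chart c)"
  and continuous_inv: "c \<in> A \<Longrightarrow> continuous_on (\<Omega> c) (inv_chart c)"
  using homeo by (simp_all add: homeomorphism_def)

subsection \<open>Change of charts\<close>

lemma transition_analytic:
  "c \<in> A \<Longrightarrow> d \<in> A \<Longrightarrow> real_analytic_on (\<lambda>x. transition c d x $ i) (map_of_chart c ` (dom_of c \<inter> dom_of d))"
  using atlas unfolding analytic_atlas_def by blast

abbreviation overlap where "overlap c d \<equiv> map_of_chart c ` (dom_of c \<inter> dom_of d)"

lemma open_overlap: "c \<in> A \<Longrightarrow> d \<in> A \<Longrightarrow> open (overlap c d)"
  using transition_analytic[of c d 1] by (simp add: real_analytic_on_def)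

definition dtransition :: "('a, 2) chart \<Rightarrow> ('a, 2) chart \<Rightarrow> 2 \<Rightarrow> 2 \<Rightarrow> real^2 \<Rightarrow> real"
  where "dtransition c d k i = partial i (\<lambda>x. transition c d x $ k)"

lemma diff_upto_dtransition: "c \<in> A \<Longrightarrow> d \<in> A \<Longrightarrow> diff_upto k (dtransition c d l i) (overlap c d)"
  unfolding dtransition_def by (intro real_analytic_diff_upto real_analytic_partial transition_analytic)

lemma transition_has_derivative:
  assumes "c \<in> A" "d \<in> A" "x \<in> overlap c d"
  shows "(transition c d has_derivative (\<lambda>v. \<chi> k. \<Sum>i\<in>UNIV. v $ i * dtransition c d k i x)) (at x)"
proof -
  have k: "((\<lambda>x. transition c d x $ k) has_derivative (\<lambda>v. \<Sum>i\<in>UNIV. v $ i * dtransition c d k i x)) (at x)" for k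
    unfolding dtransition_def
    by (intro differentiable_has_derivative_partial real_analytic_differentiable[OF transition_analytic[OF assms(1,2)] assms(3)])
  show ?thesis
    unfolding has_derivative_componentwise_within[of "transition c d"]
    by (auto simp: Basis_vec_def inner_axis intro!: k)
qed

lemma deriv_transition:
  assumes "c \<in> A" "d \<in> A" "x \<in> overlap c d"
  shows "deriv_at (transition c d) x v = (\<chi> k. \<Sum>i\<in>UNIV. v $ i * dtransition c d k i x)"
  unfolding frechet_derivative_at[OF transition_has_derivative[OF assms], symmetric] ..

text \<open>The tangent map of the transition map, that is, the change of coordinates of the tangent
  bundle between the bundle charts of c and d.\<close>

definition ttransition :: "('a, 2) chart \<Rightarrow> ('a, 2) chart \<Rightarrow> (real^2) \<times> (real^2) \<Rightarrow> (real^2) \<times> (real^2)"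
  where "ttransition c d a = (transition c d (fst a), \<chi> k. \<Sum>i\<in>UNIV. snd a $ i * dtransition c d k i (fst a))"

text \<open>The velocity part of D contains second derivatives of the transition and is left
  unspecified: chart changes of variations are needed explicitly in the position part only, since
  that alone enters \<open>jac\<close>.\<close>

lemma ttransition_has_derivative:
  assumes "c \<in> A" "d \<in> A" "fst a \<in> overlap c d"
  shows "\<exists>D. (ttransition c d has_derivative D) (at a) \<and>
    (\<forall>b. fst (D b) = (\<chi> k. \<Sum>i\<in>UNIV. fst b $ i * dtransition c d k i (fst a)))"
proof -
  have dd: "(dtransition c d k i has_derivative (\<lambda>v. \<Sum>l\<in>UNIV. v $ l * partial l (dtransition c d k i) (fst a))) (at (fst a))" for k i
    by (rule differentiable_has_derivative_partial[OF
      bspec[OF conjunct1[OF diff_upto_dtransition[OF assms(1,2), of "Suc 0" k i, unfolded diff_upto.simps]] assms(3)]])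
  have g: "((\<lambda>a. dtransition c d k i (fst a)) has_derivative (\<lambda>b. \<Sum>l\<in>UNIV. fst b $ l * partial l (dtransition c d k i) (fst a))) (at a)" for k i
    by (rule has_derivative_compose[OF has_derivative_fst[OF has_derivative_ident] dd, simplified])
  have c: "((\<lambda>a. snd a $ i) has_derivative (\<lambda>b. snd b $ i)) (at a)" for i :: 2 and a :: "(real^2) \<times> (real^2)"
    by (intro bounded_linear.has_derivative[OF bounded_linear_vec_nth] has_derivative_snd has_derivative_ident)
  define D2 where "D2 k b = (\<Sum>i\<in>UNIV. snd a $ i * (\<Sum>l\<in>UNIV. fst b $ l * partial l (dtransition c d k i) (fst a))
       + snd b $ i * dtransition c d k i (fst a))" for k b
  have k: "((\<lambda>a. \<Sum>i\<in>UNIV. snd a $ i * dtransition c d k i (fst a)) has_derivative D2 k) (at a)" for k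
    unfolding D2_def by (intro has_derivative_sum has_derivative_mult g c)
  have 2: "((\<lambda>a. \<chi> k. \<Sum>i\<in>UNIV. snd a $ i * dtransition c d k i (fst a)) has_derivative (\<lambda>b. \<chi> k. D2 k b)) (at a)"
    unfolding has_derivative_componentwise_within[of "\<lambda>a. \<chi> k. _ k a"]
    by (auto simp: Basis_vec_def inner_axis intro!: k)
  have 1: "((\<lambda>a. transition c d (fst a)) has_derivative (\<lambda>b. \<chi> k. \<Sum>i\<in>UNIV. fst b $ i * dtransition c d k i (fst a))) (at a)"
    by (rule has_derivative_compose[OF has_derivative_fst[OF has_derivative_ident] transition_has_derivative[OF assms], simplified])
  show ?thesis
    unfolding ttransition_def by (rule exI, rule conjI, rule has_derivative_Pair[OF 1 2]) simp
qed

definition dtransition_det :: "('a, 2) chart \<Rightarrow> ('a, 2) chart \<Rightarrow> real^2 \<Rightarrow> real"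
  where "dtransition_det c d x = dtransition c d 1 1 x * dtransition c d 2 2 x - dtransition c d 1 2 x * dtransition c d 2 1 x"

lemma metric_change:
  assumes "c \<in> A" "d \<in> A" "p \<in> dom_of c" "p \<in> dom_of d"
  defines "x \<equiv> map_of_chart c p" and "y \<equiv> map_of_chart d p"
  shows "u \<bullet> (g c x *v w) = (\<chi> k. \<Sum>i\<in>UNIV. u $ i * dtransition c d k i x) \<bullet> (g d y *v (\<chi> k. \<Sum>i\<in>UNIV. w $ i * dtransition c d k i x))"
proof -
  have "x \<in> overlap c d" using assms by auto
  note D = deriv_transition[OF assms(1,2) this]
  have "u \<bullet> (g c x *v w) = deriv_at (transition c d) x u \<bullet> (g d y *v deriv_at (transition c d) x w)"
    using metric assms unfolding analytic_metric_def Let_def by blast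
  then show ?thesis unfolding D .
qed

text \<open>The matrix of g in c is the congruence transform of the one in d by the Jacobian. That
  the Jacobian is invertible is read off from positivity of the determinant on the left.\<close>

lemma det_change:
  assumes "c \<in> A" "d \<in> A" "p \<in> dom_of c" "p \<in> dom_of d"
  shows "det (g c (map_of_chart c p)) = (dtransition_det c d (map_of_chart c p))\<^sup>2 * det (g d (map_of_chart d p))"
    "dtransition_det c d (map_of_chart c p) \<noteq> 0"
proof -
  interpret C: chart_metric "g c" "\<Omega> c" by (rule chart_metric_chart[OF assms(1)])
  interpret D: chart_metric "g d" "\<Omega> d" by (rule chart_metric_chart[OF assms(2)])
  define x y where "x = map_of_chart c p" and "y = map_of_chart d p"
  have x: "x \<in> \<Omega> c" and y: "y \<in> \<Omega> d" using assms by (auto simp: x_def y_def)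
  note m = metric_change[OF assms, folded x_def y_def, unfolded C.quad D.quad]
  have e11: "g c x $ 1 $ 1 = dtransition c d 1 1 x * (g d y $ 1 $ 1 * dtransition c d 1 1 x + g d y $ 1 $ 2 * dtransition c d 2 1 x)
      + dtransition c d 2 1 x * (g d y $ 2 $ 1 * dtransition c d 1 1 x + g d y $ 2 $ 2 * dtransition c d 2 1 x)"
    using m[of "axis 1 1" "axis 1 1"] by (simp add: axis_def sum_2)
  have e12: "g c x $ 1 $ 2 = dtransition c d 1 1 x * (g d y $ 1 $ 1 * dtransition c d 1 2 x + g d y $ 1 $ 2 * dtransition c d 2 2 x)
      + dtransition c d 2 1 x * (g d y $ 2 $ 1 * dtransition c d 1 2 x + g d y $ 2 $ 2 * dtransition c d 2 2 x)"
    using m[of "axis 1 1" "axis 2 1"] by (simp add: axis_def sum_2)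
  have e22: "g c x $ 2 $ 2 = dtransition c d 1 2 x * (g d y $ 1 $ 1 * dtransition c d 1 2 x + g d y $ 1 $ 2 * dtransition c d 2 2 x)
      + dtransition c d 2 2 x * (g d y $ 2 $ 1 * dtransition c d 1 2 x + g d y $ 2 $ 2 * dtransition c d 2 2 x)"
    using m[of "axis 2 1" "axis 2 1"] by (simp add: axis_def sum_2)
  show "det (g c (map_of_chart c p)) = (dtransition_det c d (map_of_chart c p))\<^sup>2 * det (g d (map_of_chart d p))"
    unfolding x_def[symmetric] y_def[symmetric] C.det_eq D.det_eq dtransition_det_def C.G_sym[OF x, of 2 1] e11 e12 e22
      D.G_sym[OF y, of 2 1]
    by (simp add: power2_eq_square algebra_simps)
  then show "dtransition_det c d (map_of_chart c p) \<noteq> 0"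
    using C.det_pos[OF x] unfolding x_def by auto
qed

subsection \<open>Geodesics in charts\<close>

definition state :: "('a, 2) chart \<Rightarrow> (real \<Rightarrow> 'a) \<Rightarrow> real \<Rightarrow> (real^2) \<times> (real^2)"
  where "state c \<gamma> t = (map_of_chart c (\<gamma> t), vector_derivative (map_of_chart c \<circ> \<gamma>) (at t))"

lemma state_\<Omega>: "\<gamma> t \<in> dom_of c \<Longrightarrow> fst (state c \<gamma> t) \<in> \<Omega> c"
  by (simp add: state_def)

lemma geodesic_differentiable:
  "geodesic A g \<gamma> \<Longrightarrow> c \<in> A \<Longrightarrow> \<gamma> t \<in> dom_of c \<Longrightarrow>
    ((map_of_chart c \<circ> \<gamma>) has_vector_derivative snd (state c \<gamma> t)) (at t)"
  unfolding geodesic_def Let_def state_def by (simp add: vector_derivative_works[symmetric])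

lemma state_derivative:
  assumes "geodesic A g \<gamma>" "c \<in> A" "\<gamma> t \<in> dom_of c"
  shows "(state c \<gamma> has_vector_derivative chart_metric.spray (g c) (state c \<gamma> t)) (at t)"
proof -
  have sp: "chart_metric.spray (g c) (state c \<gamma> t) = (snd (state c \<gamma> t),
      \<chi> k. - (\<Sum>i\<in>UNIV. \<Sum>j\<in>UNIV. christoffel (g c) k i j (fst (state c \<gamma> t)) * snd (state c \<gamma> t) $ i * snd (state c \<gamma> t) $ j))"
    using chart_metric.spray_def[OF chart_metric_chart[OF assms(2)]] by simp
  have "((\<lambda>s. vector_derivative (map_of_chart c \<circ> \<gamma>) (at s)) has_vector_derivative
      (\<chi> k. - (\<Sum>i\<in>UNIV. \<Sum>j\<in>UNIV. christoffel (g c) k i j (fst (state c \<gamma> t)) * snd (state c \<gamma> t) $ i * snd (state c \<gamma> t) $ j))) (at t)"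
    using assms unfolding geodesic_def Let_def state_def by simp
  then have 2: "((\<lambda>s. vector_derivative (map_of_chart c \<circ> \<gamma>) (at s)) has_vector_derivative snd (chart_metric.spray (g c) (state c \<gamma> t))) (at t)"
    by (simp only: sp snd_conv)
  have 1: "((\<lambda>s. map_of_chart c (\<gamma> s)) has_vector_derivative fst (chart_metric.spray (g c) (state c \<gamma> t))) (at t)"
    using geodesic_differentiable[OF assms] unfolding sp o_def by simp
  show ?thesis
    using has_vector_derivative_Pair[OF 1 2] unfolding state_def by simp
qed

lemma geodesic_continuous: "geodesic A g \<gamma> \<Longrightarrow> continuous_on UNIV \<gamma>"
  by (simp add: geodesic_def)

lemma open_times: "geodesic A g \<gamma> \<Longrightarrow> c \<in> A \<Longrightarrow> open {t. \<gamma> t \<in> dom_of c}"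
  using open_vimage[OF open_dom geodesic_continuous] by (simp add: vimage_def)

lemma state_continuous_on:
  assumes "geodesic A g \<gamma>" "c \<in> A" "S \<subseteq> {t. \<gamma> t \<in> dom_of c}"
  shows "continuous_on S (state c \<gamma>)"
  using assms state_derivative[OF assms(1,2)]
  by (intro continuous_at_imp_continuous_on ballI)
    (auto intro: has_derivative_continuous simp: has_vector_derivative_def)

lemma open_state_vimage:
  assumes "geodesic A g \<gamma>" "c \<in> A" "open B"
  shows "open {t \<in> {t. \<gamma> t \<in> dom_of c}. state c \<gamma> t \<in> B}"
  using continuous_open_preimage[OF state_continuous_on[OF assms(1,2) order_refl] open_times[OF assms(1,2)] assms(3)]
  by (simp add: vimage_def Int_def)

text \<open>The times at which \<gamma> is in the chart form an open set only. Compactness of B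
  repairs this: its base points form a compact, hence closed, set K inside the chart domain, and on
  the closed preimage of K the state is continuous.\<close>

lemma closed_state_vimage:
  assumes \<gamma>: "geodesic A g \<gamma>" and c: "c \<in> A" and B: "compact B" "fst ` B \<subseteq> \<Omega> c"
  shows "closed {t \<in> {t. \<gamma> t \<in> dom_of c}. state c \<gamma> t \<in> B}"
proof -
  define K where "K = inv_chart c ` fst ` B"
  have "compact (fst ` B)" by (intro compact_continuous_image B continuous_intros)
  then have "compact K" unfolding K_def
    by (rule compact_continuous_image[OF continuous_on_subset[OF continuous_inv[OF c] B(2)]])
  then have clK: "closed (\<gamma> -` K)"
    by (intro closed_vimage compact_imp_closed geodesic_continuous \<gamma>)
  have Kdom: "K \<subseteq> dom_of c" using inv_dom[OF c] B(2) by (auto simp: K_def)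
  have "{t \<in> {t. \<gamma> t \<in> dom_of c}. state c \<gamma> t \<in> B} = \<gamma> -` K \<inter> state c \<gamma> -` B"
  proof (intro set_eqI iffI)
    fix t assume "t \<in> {t \<in> {t. \<gamma> t \<in> dom_of c}. state c \<gamma> t \<in> B}"
    then have t: "\<gamma> t \<in> dom_of c" "state c \<gamma> t \<in> B" by auto
    then have "inv_chart c (fst (state c \<gamma> t)) \<in> K" by (simp add: K_def)
    then have "\<gamma> t \<in> K" using inv_map[OF c t(1)] by (simp add: state_def)
    then show "t \<in> \<gamma> -` K \<inter> state c \<gamma> -` B" using t by simp
  qed (use Kdom in auto)
  moreover have "closed (\<gamma> -` K \<inter> state c \<gamma> -` B)"
    by (rule continuous_closed_preimage[OF state_continuous_on[OF \<gamma> c] clK compact_imp_closed[OF B(1)]])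
      (use Kdom in auto)
  ultimately show ?thesis by simp
qed

lemma state_change:
  assumes \<gamma>: "geodesic A g \<gamma>" and c: "c \<in> A" "d \<in> A" and t: "\<gamma> t \<in> dom_of c" "\<gamma> t \<in> dom_of d"
  shows "state d \<gamma> t = ttransition c d (state c \<gamma> t)"
proof -
  define x where "x = map_of_chart c (\<gamma> t)"
  have x: "x \<in> overlap c d" using t by (auto simp: x_def)
  have x': "(map_of_chart c \<circ> \<gamma>) t \<in> overlap c d" using x by (simp add: x_def)
  have eq: "transition c d (map_of_chart c (\<gamma> s)) = map_of_chart d (\<gamma> s)" if "\<gamma> s \<in> dom_of c" for s
    using inv_map[OF c(1) that] by (simp add: transition_def)
  have "((transition c d \<circ> (map_of_chart c \<circ> \<gamma>)) has_vector_derivative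
      (\<chi> k. \<Sum>i\<in>UNIV. snd (state c \<gamma> t) $ i * dtransition c d k i x)) (at t)"
    using vector_derivative_diff_chain_within[OF geodesic_differentiable[OF \<gamma> c(1) t(1)]
      has_derivative_at_withinI[OF transition_has_derivative[OF c x']]] by (simp add: x_def comp_def)
  then have "((map_of_chart d \<circ> \<gamma>) has_vector_derivative
      (\<chi> k. \<Sum>i\<in>UNIV. snd (state c \<gamma> t) $ i * dtransition c d k i x)) (at t)"
    by (rule has_vector_derivative_transform_within_open[OF _ open_times[OF \<gamma> c(1)]]) (use t eq in auto)
  from vector_derivative_at[OF this] show ?thesis
    by (simp add: state_def ttransition_def eq[OF t(1)] x_def)
qed

subsection \<open>Variations through geodesics\<close>

text \<open>A variation of the geodesic \<open>\<gamma>\<close> is a mere sequence \<open>\<gamma>n\<close>, with \<open>1 / n\<close> in the role of the parameter: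
  the difference quotients have to converge in a chart, together with those of the velocities.\<close>

definition var_quot :: "('a, 2) chart \<Rightarrow> (real \<Rightarrow> 'a) \<Rightarrow> (nat \<Rightarrow> real \<Rightarrow> 'a) \<Rightarrow> nat \<Rightarrow> real \<Rightarrow> (real^2) \<times> (real^2)"
  where "var_quot c \<gamma> \<gamma>n n t = real n *\<^sub>R (state c (\<gamma>n n) t - state c \<gamma> t)"

definition var_at :: "('a, 2) chart \<Rightarrow> (real \<Rightarrow> 'a) \<Rightarrow> (nat \<Rightarrow> real \<Rightarrow> 'a) \<Rightarrow> real \<Rightarrow> (real^2) \<times> (real^2) \<Rightarrow> bool"
  where "var_at c \<gamma> \<gamma>n t w \<longleftrightarrow> (\<forall>\<^sub>F n in sequentially. \<gamma>n n t \<in> dom_of c) \<and> (\<lambda>n. var_quot c \<gamma> \<gamma>n n t) \<longlonglongrightarrow> w"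

text \<open>States in the two charts are related by \<open>ttransition\<close>, so the chain rule
  for sequences applies. Convergence in c also gives convergence of the base points, which therefore
  eventually lie in the domain of d.\<close>

lemma var_change:
  assumes \<gamma>: "geodesic A g \<gamma>" "\<And>n. geodesic A g (\<gamma>n n)" and c: "c \<in> A" "d \<in> A"
    and t: "\<gamma> t \<in> dom_of c" "\<gamma> t \<in> dom_of d" and v: "var_at c \<gamma> \<gamma>n t w"
  shows "\<exists>w'. var_at d \<gamma> \<gamma>n t w' \<and> fst w' = (\<chi> k. \<Sum>i\<in>UNIV. fst w $ i * dtransition c d k i (map_of_chart c (\<gamma> t)))"
proof -
  have "fst (state c \<gamma> t) \<in> overlap c d" using t by (auto simp: state_def)
  from ttransition_has_derivative[OF c this] obtain D where D: "(ttransition c d has_derivative D) (at (state c \<gamma> t))"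
    "\<forall>b. fst (D b) = (\<chi> k. \<Sum>i\<in>UNIV. fst b $ i * dtransition c d k i (fst (state c \<gamma> t)))"
    by (elim exE conjE)
  have ev: "\<forall>\<^sub>F n in sequentially. \<gamma>n n t \<in> dom_of c" and lim: "(\<lambda>n. real n *\<^sub>R (state c (\<gamma>n n) t - state c \<gamma> t)) \<longlonglongrightarrow> w"
    using v by (simp_all add: var_at_def var_quot_def)
  note sd = scaled_difference_tendsto[OF D(1) lim]
  have "(\<lambda>n. fst (state c (\<gamma>n n) t)) \<longlonglongrightarrow> fst (state c \<gamma> t)" by (rule tendsto_fst[OF sd(1)])
  moreover have "isCont (inv_chart c) (fst (state c \<gamma> t))"
    using continuous_inv[OF c(1)] open_\<Omega>[OF c(1)] t(1) by (simp add: continuous_on_eq_continuous_at state_def)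
  ultimately have "(\<lambda>n. inv_chart c (fst (state c (\<gamma>n n) t))) \<longlonglongrightarrow> inv_chart c (fst (state c \<gamma> t))"
    by (rule isCont_tendsto_compose[rotated])
  moreover have "inv_chart c (fst (state c \<gamma> t)) = \<gamma> t" using inv_map[OF c(1) t(1)] by (simp add: state_def)
  ultimately have "\<forall>\<^sub>F n in sequentially. inv_chart c (fst (state c (\<gamma>n n) t)) \<in> dom_of d"
    using topological_tendstoD[OF _ open_dom[OF c(2)]] t(2) by fastforce
  with ev have ev2: "\<forall>\<^sub>F n in sequentially. \<gamma>n n t \<in> dom_of c \<and> \<gamma>n n t \<in> dom_of d"
    by eventually_elim (simp add: state_def inv_map[OF c(1)])
  have "\<forall>\<^sub>F n in sequentially. real n *\<^sub>R (ttransition c d (state c (\<gamma>n n) t) - ttransition c d (state c \<gamma> t)) = var_quot d \<gamma> \<gamma>n n t"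
    using ev2
  proof eventually_elim
    case (elim n)
    then show ?case
      using state_change[of "\<gamma>n n" c d t, OF \<gamma>(2) c] state_change[of \<gamma> c d t, OF \<gamma>(1) c t] by (simp add: var_quot_def)
  qed
  with sd(2) have "(\<lambda>n. var_quot d \<gamma> \<gamma>n n t) \<longlonglongrightarrow> D w" by (rule Lim_transform_eventually)
  moreover have "\<forall>\<^sub>F n in sequentially. \<gamma>n n t \<in> dom_of d" using ev2 by eventually_elim simp
  ultimately have "var_at d \<gamma> \<gamma>n t (D w)" by (simp add: var_at_def)
  then show ?thesis using spec[OF D(2), of w] by (intro exI[of _ "D w"]) (simp add: state_def)
qed

text \<open>Applies \<open>ode_variation\<close> to the geodesic field in a ball of states around
  time t1. The radius \<epsilon> depends on t1 but not on the time t0 at which convergence is known;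
  this lets convergence spread both from t1 and to t1.\<close>

lemma var_local:
  assumes \<gamma>: "geodesic A g \<gamma>" "\<And>n. geodesic A g (\<gamma>n n)" and c: "c \<in> A" and t1: "\<gamma> t1 \<in> dom_of c"
  shows "\<exists>\<epsilon>>0. (\<forall>t. \<bar>t - t1\<bar> \<le> \<epsilon> \<longrightarrow> \<gamma> t \<in> dom_of c) \<and>
    (\<forall>t0 w. \<bar>t0 - t1\<bar> \<le> \<epsilon> \<longrightarrow> var_at c \<gamma> \<gamma>n t0 w \<longrightarrow>
      (\<exists>W. (\<forall>\<^sub>F n in sequentially. \<forall>t. \<bar>t - t1\<bar> \<le> \<epsilon> \<longrightarrow> \<gamma>n n t \<in> dom_of c) \<and>
        uniform_limit {t. \<bar>t - t1\<bar> \<le> \<epsilon>} (\<lambda>n t. var_quot c \<gamma> \<gamma>n n t) W sequentially \<and>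
        (\<forall>t. \<bar>t - t1\<bar> < \<epsilon> \<longrightarrow> (W has_vector_derivative chart_metric.dspray (g c) (state c \<gamma> t) (W t)) (at t))))"
proof -
  interpret C: chart_metric "g c" "\<Omega> c" by (rule chart_metric_chart[OF c])
  define P where "P = state c \<gamma> t1"
  have "open (\<Omega> c \<times> (UNIV :: (real^2) set))" by (intro open_Times C.open_\<Omega> open_UNIV)
  moreover have "P \<in> \<Omega> c \<times> UNIV" using state_\<Omega>[of \<gamma> t1 c, OF t1] by (simp add: P_def mem_Times_iff)
  ultimately obtain \<rho> where \<rho>: "0 < \<rho>" "cball P \<rho> \<subseteq> \<Omega> c \<times> UNIV"
    using open_contains_cball by blast
  have in\<Omega>: "fst x \<in> \<Omega> c" if "x \<in> cball P \<rho>" for x using \<rho>(2) that by (auto simp: mem_Times_iff)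
  have "open {t \<in> {t. \<gamma> t \<in> dom_of c}. state c \<gamma> t \<in> ball P (\<rho> / 2)}"
    by (rule open_state_vimage[OF \<gamma>(1) c open_ball])
  moreover have "t1 \<in> {t \<in> {t. \<gamma> t \<in> dom_of c}. state c \<gamma> t \<in> ball P (\<rho> / 2)}"
    using t1 \<rho> by (simp add: P_def)
  ultimately obtain e0 where e0: "0 < e0" "ball t1 e0 \<subseteq> {t \<in> {t. \<gamma> t \<in> dom_of c}. state c \<gamma> t \<in> ball P (\<rho> / 2)}"
    using open_contains_ball by blast
  define e where "e = min 1 e0"
  have e: "0 < e" "e \<le> 1" using e0 by (auto simp: e_def)
  have U0: "\<gamma> t \<in> dom_of c" "state c \<gamma> t \<in> cball P (\<rho> / 2)" if "\<bar>t - t1\<bar> \<le> 1/2 * e" for t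
  proof -
    have "\<bar>t - t1\<bar> < e0" using that e e0(1) by (auto simp: e_def)
    then have "t \<in> ball t1 e0" by (simp add: dist_real_def abs_minus_commute)
    then show "\<gamma> t \<in> dom_of c" "state c \<gamma> t \<in> cball P (\<rho> / 2)" using e0(2) by auto
  qed
  show ?thesis
  proof (intro exI[of _ "1/2 * e"] conjI allI impI)
    show "0 < 1/2 * e" using e by simp
    show "\<gamma> t \<in> dom_of c" if "\<bar>t - t1\<bar> \<le> 1/2 * e" for t by (rule U0(1)[OF that])
    fix t0 w assume t0: "\<bar>t0 - t1\<bar> \<le> 1/2 * e" and v: "var_at c \<gamma> \<gamma>n t0 w"
    have "\<exists>W. (\<forall>\<^sub>F n in sequentially. \<forall>t. \<bar>t - t1\<bar> \<le> 1/2 * e \<longrightarrow> t \<in> {t. \<gamma>n n t \<in> dom_of c}) \<and>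
      uniform_limit {t. \<bar>t - t1\<bar> \<le> 1/2 * e} (\<lambda>n t. real n *\<^sub>R (state c (\<gamma>n n) t - state c \<gamma> t)) W sequentially \<and>
      (\<forall>t. \<bar>t - t1\<bar> < 1/2 * e \<longrightarrow> (W has_vector_derivative C.dspray (state c \<gamma> t) (W t)) (at t))"
    proof (rule ode_variation[of P \<rho> C.spray C.dspray t1 e "state c \<gamma>" "\<lambda>n. {t. \<gamma>n n t \<in> dom_of c}" "\<lambda>n. state c (\<gamma>n n)" t0 w])
      show "(C.spray has_derivative C.dspray x) (at x)" if "x \<in> cball P \<rho>" for x
        by (rule C.has_derivative_spray[OF in\<Omega>[OF that]])
      show "continuous_on (cball P \<rho>) (\<lambda>x. C.dspray x v)" for v
        by (rule continuous_on_subset[OF C.continuous_dspray \<rho>(2)])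
      show "state c \<gamma> t \<in> cball P (\<rho> / 2)" if "\<bar>t - t1\<bar> \<le> 1 / 2 * e" for t by (rule U0(2)[OF that])
      show "(state c \<gamma> has_vector_derivative C.spray (state c \<gamma> t)) (at t)" if "\<bar>t - t1\<bar> \<le> 1 / 2 * e" for t
        by (rule state_derivative[OF \<gamma>(1) c U0(1)[OF that]])
      show "(state c (\<gamma>n n) has_vector_derivative C.spray (state c (\<gamma>n n) t)) (at t)"
        if "t \<in> {t. \<gamma>n n t \<in> dom_of c}" for n t
        by (rule state_derivative[OF \<gamma>(2) c]) (use that in simp)
      show "closed {t \<in> {t. \<gamma>n n t \<in> dom_of c}. state c (\<gamma>n n) t \<in> cball P \<rho>}" for n
        by (rule closed_state_vimage[OF \<gamma>(2) c compact_cball]) (use in\<Omega> in blast)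
      show "open {t \<in> {t. \<gamma>n n t \<in> dom_of c}. state c (\<gamma>n n) t \<in> ball P \<rho>}" for n
        by (rule open_state_vimage[OF \<gamma>(2) c open_ball])
      show "\<forall>\<^sub>F n in sequentially. t0 \<in> {t. \<gamma>n n t \<in> dom_of c}"
        "(\<lambda>n. real n *\<^sub>R (state c (\<gamma>n n) t0 - state c \<gamma> t0)) \<longlonglongrightarrow> w"
        using v by (simp_all add: var_at_def var_quot_def)
    qed (fact \<rho>(1) e t0)+
    then show "\<exists>W. (\<forall>\<^sub>F n in sequentially. \<forall>t. \<bar>t - t1\<bar> \<le> 1/2 * e \<longrightarrow> \<gamma>n n t \<in> dom_of c) \<and>
        uniform_limit {t. \<bar>t - t1\<bar> \<le> 1/2 * e} (\<lambda>n t. var_quot c \<gamma> \<gamma>n n t) W sequentially \<and>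
        (\<forall>t. \<bar>t - t1\<bar> < 1/2 * e \<longrightarrow> (W has_vector_derivative C.dspray (state c \<gamma> t) (W t)) (at t))"
      unfolding var_quot_def mem_Collect_eq .
  qed
qed

text \<open>The set B of times with convergent quotients is open and closed by
  \<open>var_local\<close>, and it contains s0, so it is the whole line. Demanding convergence in
  all charts around \<gamma> t makes B independent of charts, which \<open>var_change\<close>
  justifies.\<close>

lemma var_global:
  assumes \<gamma>: "geodesic A g \<gamma>" "\<And>n. geodesic A g (\<gamma>n n)"
    and v: "c0 \<in> A" "\<gamma> s0 \<in> dom_of c0" "var_at c0 \<gamma> \<gamma>n s0 w0" and c: "c \<in> A" "\<gamma> t \<in> dom_of c"
  shows "\<exists>w. var_at c \<gamma> \<gamma>n t w"
proof -
  define B where "B = {t. \<forall>c\<in>A. \<gamma> t \<in> dom_of c \<longrightarrow> (\<exists>w. var_at c \<gamma> \<gamma>n t w)}"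
  have BI: "t \<in> B" if "c \<in> A" "\<gamma> t \<in> dom_of c" "var_at c \<gamma> \<gamma>n t w" for c t w
    using var_change[OF \<gamma> that(1) _ that(2) _ that(3)] unfolding B_def by blast
  have nb: "\<exists>\<epsilon>>0. \<forall>t0 t. \<bar>t0 - t1\<bar> < \<epsilon> \<longrightarrow> \<bar>t - t1\<bar> < \<epsilon> \<longrightarrow> t0 \<in> B \<longrightarrow> t \<in> B" for t1
  proof -
    obtain c where c: "c \<in> A" "\<gamma> t1 \<in> dom_of c" using chart_ex by blast
    from var_local[of \<gamma> \<gamma>n c t1, OF \<gamma> c] obtain \<epsilon> where e: "\<epsilon> > 0" "\<forall>t. \<bar>t - t1\<bar> \<le> \<epsilon> \<longrightarrow> \<gamma> t \<in> dom_of c"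
      "\<forall>t0 w. \<bar>t0 - t1\<bar> \<le> \<epsilon> \<longrightarrow> var_at c \<gamma> \<gamma>n t0 w \<longrightarrow>
      (\<exists>W. (\<forall>\<^sub>F n in sequentially. \<forall>t. \<bar>t - t1\<bar> \<le> \<epsilon> \<longrightarrow> \<gamma>n n t \<in> dom_of c) \<and>
        uniform_limit {t. \<bar>t - t1\<bar> \<le> \<epsilon>} (\<lambda>n t. var_quot c \<gamma> \<gamma>n n t) W sequentially \<and>
        (\<forall>t. \<bar>t - t1\<bar> < \<epsilon> \<longrightarrow> (W has_vector_derivative chart_metric.dspray (g c) (state c \<gamma> t) (W t)) (at t)))"
      by (elim exE conjE)
    have "t \<in> B" if t: "\<bar>t0 - t1\<bar> < \<epsilon>" "\<bar>t - t1\<bar> < \<epsilon>" "t0 \<in> B" for t0 t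
    proof -
      have "\<exists>w. var_at c \<gamma> \<gamma>n t0 w" using t e(2) c(1) unfolding B_def by auto
      then obtain w where w: "var_at c \<gamma> \<gamma>n t0 w" ..
      from e(3)[rule_format, OF less_imp_le[OF t(1)] w]
      obtain W where W: "\<forall>\<^sub>F n in sequentially. \<forall>t. \<bar>t - t1\<bar> \<le> \<epsilon> \<longrightarrow> \<gamma>n n t \<in> dom_of c"
        "uniform_limit {t. \<bar>t - t1\<bar> \<le> \<epsilon>} (\<lambda>n t. var_quot c \<gamma> \<gamma>n n t) W sequentially" by (elim exE conjE)
      have "(\<lambda>n. var_quot c \<gamma> \<gamma>n n t) \<longlonglongrightarrow> W t"
        by (rule tendsto_uniform_limitI[OF W(2)]) (use t in simp)
      moreover have "\<forall>\<^sub>F n in sequentially. \<gamma>n n t \<in> dom_of c"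
        using W(1) by eventually_elim (use t in simp)
      ultimately have "var_at c \<gamma> \<gamma>n t (W t)" by (simp add: var_at_def)
      then show "t \<in> B" by (rule BI[OF c(1) e(2)[rule_format, OF less_imp_le[OF t(2)]]])
    qed
    then show ?thesis using e(1) by blast
  qed
  have "open B" unfolding open_dist
  proof
    fix t1 assume t1: "t1 \<in> B"
    obtain \<epsilon> where e: "\<epsilon> > 0" "\<forall>t0 t. \<bar>t0 - t1\<bar> < \<epsilon> \<longrightarrow> \<bar>t - t1\<bar> < \<epsilon> \<longrightarrow> t0 \<in> B \<longrightarrow> t \<in> B"
      using nb[of t1] by (elim exE conjE)
    have "y \<in> B" if "dist y t1 < \<epsilon>" for y
      using e(2)[rule_format, of t1 y] that e(1) t1 by (simp add: dist_real_def)
    then show "\<exists>e>0. \<forall>y. dist y t1 < e \<longrightarrow> y \<in> B" using e(1) by blast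
  qed
  moreover have "open (- B)" unfolding open_dist
  proof
    fix t1 assume t1: "t1 \<in> - B"
    obtain \<epsilon> where e: "\<epsilon> > 0" "\<forall>t0 t. \<bar>t0 - t1\<bar> < \<epsilon> \<longrightarrow> \<bar>t - t1\<bar> < \<epsilon> \<longrightarrow> t0 \<in> B \<longrightarrow> t \<in> B"
      using nb[of t1] by (elim exE conjE)
    have "y \<in> - B" if "dist y t1 < \<epsilon>" for y
    proof
      assume "y \<in> B"
      with e(2)[rule_format, of y t1] that e(1) t1 show False by (simp add: dist_real_def)
    qed
    then show "\<exists>e>0. \<forall>y. dist y t1 < e \<longrightarrow> y \<in> - B" using e(1) by blast
  qed
  moreover have "s0 \<in> B" by (rule BI[OF v])
  ultimately have "B = UNIV" using clopen[of B] unfolding closed_def by blast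
  then have "t \<in> B" by simp
  then show ?thesis using c by (simp add: B_def)
qed

subsection \<open>Unit speed\<close>

lemma metric_inner_velocity:
  assumes \<gamma>: "geodesic A g \<gamma>" and c: "c \<in> A" "\<gamma> t \<in> dom_of c"
  shows "metric_inner A g (velocity A \<gamma> t) (velocity A \<gamma> t) =
    snd (state c \<gamma> t) \<bullet> (g c (fst (state c \<gamma> t)) *v snd (state c \<gamma> t))"
proof -
  define e where "e = chart_at A (\<gamma> t)"
  have e: "e \<in> A" "\<gamma> t \<in> dom_of e" using chart_at by (simp_all add: e_def)
  have "metric_inner A g (velocity A \<gamma> t) (velocity A \<gamma> t) =
    snd (state e \<gamma> t) \<bullet> (g e (map_of_chart e (\<gamma> t)) *v snd (state e \<gamma> t))"
    using e by (simp add: metric_inner_def velocity_def e_def[symmetric] state_def)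
  also have "snd (state e \<gamma> t) = (\<chi> k. \<Sum>i\<in>UNIV. snd (state c \<gamma> t) $ i * dtransition c e k i (map_of_chart c (\<gamma> t)))"
    unfolding state_change[OF \<gamma> c(1) e(1) c(2) e(2)] ttransition_def by (simp add: state_def)
  also have "\<dots> \<bullet> (g e (map_of_chart e (\<gamma> t)) *v \<dots>) = snd (state c \<gamma> t) \<bullet> (g c (map_of_chart c (\<gamma> t)) *v snd (state c \<gamma> t))"
    by (rule metric_change[OF c(1) e(1) c(2) e(2), symmetric])
  finally show ?thesis by (simp add: state_def)
qed

lemma unit_state:
  assumes "unit_speed_geodesic A g \<gamma>" "c \<in> A" "\<gamma> t \<in> dom_of c"
  shows "snd (state c \<gamma> t) \<bullet> (g c (fst (state c \<gamma> t)) *v snd (state c \<gamma> t)) = 1"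
proof -
  have "geodesic A g \<gamma>" "tnorm A g (velocity A \<gamma> t) = 1" using assms(1) by (auto simp: unit_speed_geodesic_def)
  then show ?thesis using metric_inner_velocity[of \<gamma> c t] assms by (simp add: tnorm_def)
qed

text \<open>Speed is constant along a geodesic. As the curve moves through several charts, constancy
  is shown for the chart-free \<open>metric_inner\<close> and only its derivative is computed in a
  chart.\<close>

lemma unit_speedI:
  assumes \<gamma>: "geodesic A g \<gamma>" and c: "c \<in> A" "\<gamma> 0 \<in> dom_of c"
    and 1: "snd (state c \<gamma> 0) \<bullet> (g c (fst (state c \<gamma> 0)) *v snd (state c \<gamma> 0)) = 1"
  shows "unit_speed_geodesic A g \<gamma>"
proof -
  define q where "q t = metric_inner A g (velocity A \<gamma> t) (velocity A \<gamma> t)" for t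
  have "(q has_real_derivative 0) (at t)" for t
  proof -
    obtain d where d: "d \<in> A" "\<gamma> t \<in> dom_of d" using chart_ex by blast
    interpret D: chart_metric "g d" "\<Omega> d" by (rule chart_metric_chart[OF d(1)])
    have "((\<lambda>t. snd (state d \<gamma> t) \<bullet> (g d (fst (state d \<gamma> t)) *v snd (state d \<gamma> t))) has_real_derivative 0) (at t)"
      by (rule D.speed_derivative[OF state_\<Omega>[of \<gamma> t d, OF d(2)] state_derivative[OF \<gamma> d]])
    then show ?thesis
      by (rule has_field_derivative_transform_within_open[OF _ open_times[OF \<gamma> d(1)]])
        (use d metric_inner_velocity[OF \<gamma> d(1)] in \<open>auto simp: q_def\<close>)
  qed
  then have "q t = q 0" for t using DERIV_isconst_all by blast
  moreover have "q 0 = 1" using metric_inner_velocity[OF \<gamma> c] 1 by (simp add: q_def)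
  ultimately have "tnorm A g (velocity A \<gamma> t) = 1" for t by (simp add: tnorm_def q_def)
  then show ?thesis using \<gamma> by (simp add: unit_speed_geodesic_def)
qed

section \<open>Geodesics with given initial data and variation fields\<close>

lemma transition_compose:
  assumes c: "c \<in> A" "d \<in> A" "e \<in> A" and p: "p \<in> dom_of c" "p \<in> dom_of d" "p \<in> dom_of e"
  shows "deriv_at (transition c e) (map_of_chart c p) v =
    deriv_at (transition d e) (map_of_chart d p) (deriv_at (transition c d) (map_of_chart c p) v)"
proof -
  define x where "x = map_of_chart c p"
  have x: "x \<in> overlap c d" "x \<in> overlap c e" and y: "map_of_chart d p \<in> overlap d e" using p by (auto simp: x_def)
  have tx: "transition c d x = map_of_chart d p" using inv_map[OF c(1) p(1)] by (simp add: transition_def x_def)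
  define S where "S = overlap c d \<inter> overlap c e"
  have "(transition c d has_derivative deriv_at (transition c d) x) (at x)"
    using transition_has_derivative[OF c(1,2) x(1)] by (auto simp: frechet_derivative_works[symmetric] differentiable_def)
  moreover have "(transition d e has_derivative deriv_at (transition d e) (map_of_chart d p)) (at (transition c d x))"
    using transition_has_derivative[OF c(2,3) y] unfolding tx by (auto simp: frechet_derivative_works[symmetric] differentiable_def)
  ultimately have "((\<lambda>x. transition d e (transition c d x)) has_derivative
     (\<lambda>v. deriv_at (transition d e) (map_of_chart d p) (deriv_at (transition c d) x v))) (at x)"
    by (rule has_derivative_compose)
  then have "(transition c e has_derivative
     (\<lambda>v. deriv_at (transition d e) (map_of_chart d p) (deriv_at (transition c d) x v))) (at x)"
  proof (rule has_derivative_transform_within_open)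
    show "open S" unfolding S_def by (intro open_Int open_overlap c)
    show "x \<in> S" using x by (simp add: S_def)
    show "transition d e (transition c d y) = transition c e y" if y: "y \<in> S" for y
    proof -
      obtain q where q: "q \<in> dom_of c" "q \<in> dom_of d" "y = map_of_chart c q" using y by (auto simp: S_def)
      show ?thesis using inv_map[OF c(1) q(1)] inv_map[OF c(2) q(2)] by (simp add: transition_def q(3))
    qed
  qed
  from frechet_derivative_at[OF this] show ?thesis unfolding x_def by (simp add: fun_eq_iff)
qed

text \<open>Completeness speaks of tangent vectors, which carry components in all charts. The family
  is generated from the single component v by the transition derivatives, and
  \<open>transition_compose\<close> is the cocycle condition that makes it a tangent vector.\<close>

lemma geodesic_from:
  assumes comp: "complete_metric A g" and c: "c \<in> A" and x: "x \<in> \<Omega> c"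
  shows "\<exists>\<gamma>. geodesic A g \<gamma> \<and> \<gamma> 0 \<in> dom_of c \<and> state c \<gamma> 0 = (x, v)"
proof -
  define p where "p = inv_chart c x"
  have p: "p \<in> dom_of c" "map_of_chart c p = x" using inv_dom[OF c x] map_inv[OF c x] by (simp_all add: p_def)
  define w where "w = (\<lambda>d. if d \<in> A \<and> p \<in> dom_of d then deriv_at (transition c d) x v else 0)"
  have "(p, w) \<in> tangent_bundle A"
    unfolding tangent_bundle_def mem_Collect_eq prod.case
  proof (intro conjI ballI allI impI)
    fix d e assume "d \<in> A" "e \<in> A" "p \<in> dom_of d \<and> p \<in> dom_of e"
    then show "w e = deriv_at (transition d e) (map_of_chart d p) (w d)"
      using transition_compose[OF c _ _ p(1), of d e v, unfolded p(2)] by (simp add: w_def)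
  qed (auto simp: w_def)
  then obtain \<gamma> where \<gamma>: "geodesic A g \<gamma>" "velocity A \<gamma> 0 = (p, w)"
    using comp unfolding complete_metric_def by blast
  have "w c = v"
  proof -
    have "(transition c c has_derivative (\<lambda>v. v)) (at x)"
      by (rule has_derivative_transform_within_open[OF has_derivative_ident open_\<Omega>[OF c] x])
        (simp add: transition_def map_inv[OF c])
    from frechet_derivative_at[OF this] have "deriv_at (transition c c) x v = v" by (simp add: fun_eq_iff)
    then show ?thesis using c p by (simp add: w_def)
  qed
  moreover have g0: "\<gamma> 0 = p" using \<gamma>(2) by (simp add: velocity_def)
  moreover have "(if c \<in> A \<and> \<gamma> 0 \<in> dom_of c then vector_derivative (map_of_chart c \<circ> \<gamma>) (at 0) else 0) = w c"
    using \<gamma>(2) by (auto simp: velocity_def)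
  ultimately have "state c \<gamma> 0 = (x, v)" using c p by (simp add: state_def)
  then show ?thesis using \<gamma>(1) g0 p(1) by auto
qed

text \<open>Convergence is required in one chart at time 0 only; \<open>var_global\<close> extends
  it to all times and all charts.\<close>

definition is_variation :: "(real \<Rightarrow> 'a) \<Rightarrow> (nat \<Rightarrow> real \<Rightarrow> 'a) \<Rightarrow> bool"
  where "is_variation \<gamma> \<gamma>n \<longleftrightarrow> unit_speed_geodesic A g \<gamma> \<and> (\<forall>n. unit_speed_geodesic A g (\<gamma>n n)) \<and>
    (\<exists>c w. c \<in> A \<and> \<gamma> 0 \<in> dom_of c \<and> var_at c \<gamma> \<gamma>n 0 w)"

lemma is_variation_geodesic:
  assumes "is_variation \<gamma> \<gamma>n"
  shows "geodesic A g \<gamma>" "geodesic A g (\<gamma>n n)"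
  using assms by (auto simp: is_variation_def unit_speed_geodesic_def)

definition var_field :: "(real \<Rightarrow> 'a) \<Rightarrow> (nat \<Rightarrow> real \<Rightarrow> 'a) \<Rightarrow> ('a, 2) chart \<Rightarrow> real \<Rightarrow> (real^2) \<times> (real^2)"
  where "var_field \<gamma> \<gamma>n c t = lim (\<lambda>n. var_quot c \<gamma> \<gamma>n n t)"

lemma var_at_var_field_eq: "var_at c \<gamma> \<gamma>n t w \<Longrightarrow> var_field \<gamma> \<gamma>n c t = w"
  unfolding var_field_def var_at_def by (simp add: limI)

lemma var_at_var_field:
  assumes v: "is_variation \<gamma> \<gamma>n" and c: "c \<in> A" "\<gamma> t \<in> dom_of c"
  shows "var_at c \<gamma> \<gamma>n t (var_field \<gamma> \<gamma>n c t)"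
proof -
  obtain d w where d: "d \<in> A" "\<gamma> 0 \<in> dom_of d" "var_at d \<gamma> \<gamma>n 0 w"
    using v unfolding is_variation_def by (elim conjE exE)
  have "\<exists>w. var_at c \<gamma> \<gamma>n t w" by (rule var_global[OF is_variation_geodesic[OF v] d c])
  then obtain w' where "var_at c \<gamma> \<gamma>n t w'" ..
  then show ?thesis using var_at_var_field_eq[of c \<gamma> \<gamma>n t w'] by simp
qed

lemma var_field_local:
  assumes v: "is_variation \<gamma> \<gamma>n" and c: "c \<in> A" "\<gamma> t1 \<in> dom_of c"
  shows "\<exists>\<epsilon>>0. (\<forall>t. \<bar>t - t1\<bar> \<le> \<epsilon> \<longrightarrow> \<gamma> t \<in> dom_of c) \<and>
      (\<forall>\<^sub>F n in sequentially. \<forall>t. \<bar>t - t1\<bar> \<le> \<epsilon> \<longrightarrow> \<gamma>n n t \<in> dom_of c) \<and>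
      uniform_limit {t. \<bar>t - t1\<bar> \<le> \<epsilon>} (\<lambda>n t. var_quot c \<gamma> \<gamma>n n t) (var_field \<gamma> \<gamma>n c) sequentially \<and>
      (\<forall>t. \<bar>t - t1\<bar> < \<epsilon> \<longrightarrow>
        (var_field \<gamma> \<gamma>n c has_vector_derivative chart_metric.dspray (g c) (state c \<gamma> t) (var_field \<gamma> \<gamma>n c t)) (at t))"
proof -
  from var_local[of \<gamma> \<gamma>n c t1, OF is_variation_geodesic[OF v] c]
  obtain \<epsilon> where e: "\<epsilon> > 0" "\<forall>t. \<bar>t - t1\<bar> \<le> \<epsilon> \<longrightarrow> \<gamma> t \<in> dom_of c"
    "\<forall>t0 w. \<bar>t0 - t1\<bar> \<le> \<epsilon> \<longrightarrow> var_at c \<gamma> \<gamma>n t0 w \<longrightarrow>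
      (\<exists>W. (\<forall>\<^sub>F n in sequentially. \<forall>t. \<bar>t - t1\<bar> \<le> \<epsilon> \<longrightarrow> \<gamma>n n t \<in> dom_of c) \<and>
        uniform_limit {t. \<bar>t - t1\<bar> \<le> \<epsilon>} (\<lambda>n t. var_quot c \<gamma> \<gamma>n n t) W sequentially \<and>
        (\<forall>t. \<bar>t - t1\<bar> < \<epsilon> \<longrightarrow> (W has_vector_derivative chart_metric.dspray (g c) (state c \<gamma> t) (W t)) (at t)))"
    by (elim exE conjE)
  have "\<bar>t1 - t1\<bar> \<le> \<epsilon>" using e(1) by simp
  from e(3)[rule_format, OF this var_at_var_field[OF v c]]
  obtain W where W: "\<forall>\<^sub>F n in sequentially. \<forall>t. \<bar>t - t1\<bar> \<le> \<epsilon> \<longrightarrow> \<gamma>n n t \<in> dom_of c"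
    "uniform_limit {t. \<bar>t - t1\<bar> \<le> \<epsilon>} (\<lambda>n t. var_quot c \<gamma> \<gamma>n n t) W sequentially"
    "\<forall>t. \<bar>t - t1\<bar> < \<epsilon> \<longrightarrow> (W has_vector_derivative chart_metric.dspray (g c) (state c \<gamma> t) (W t)) (at t)"
    by (elim exE conjE)
  have Weq: "var_field \<gamma> \<gamma>n c t = W t" if "\<bar>t - t1\<bar> \<le> \<epsilon>" for t
    unfolding var_field_def by (rule limI, rule tendsto_uniform_limitI[OF W(2)]) (use that in simp)
  have op: "open {t. \<bar>t - t1\<bar> < \<epsilon>}" by (intro open_Collect_less continuous_intros)
  have der: "(var_field \<gamma> \<gamma>n c has_vector_derivative chart_metric.dspray (g c) (state c \<gamma> t) (var_field \<gamma> \<gamma>n c t)) (at t)"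
    if t: "\<bar>t - t1\<bar> < \<epsilon>" for t
  proof -
    have "(W has_vector_derivative chart_metric.dspray (g c) (state c \<gamma> t) (W t)) (at t)" using W(3) t by blast
    then have "(var_field \<gamma> \<gamma>n c has_vector_derivative chart_metric.dspray (g c) (state c \<gamma> t) (W t)) (at t)"
      by (rule has_vector_derivative_transform_within_open[OF _ op]) (use t Weq in auto)
    then show ?thesis using Weq[of t] t by simp
  qed
  have "uniform_limit {t. \<bar>t - t1\<bar> \<le> \<epsilon>} (\<lambda>n t. var_quot c \<gamma> \<gamma>n n t) (var_field \<gamma> \<gamma>n c) sequentially"
    using W(2) by (rule uniform_limit_cong'[THEN iffD1, rotated 2]) (simp_all add: Weq)
  then show ?thesis using e(1,2) W(1) der by (intro exI[of _ \<epsilon>] conjI) auto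
qed

lemma var_field_derivative:
  assumes v: "is_variation \<gamma> \<gamma>n" and c: "c \<in> A" "\<gamma> t \<in> dom_of c"
  shows "(var_field \<gamma> \<gamma>n c has_vector_derivative chart_metric.dspray (g c) (state c \<gamma> t) (var_field \<gamma> \<gamma>n c t)) (at t)"
proof -
  from var_field_local[OF v c] obtain \<epsilon> where e: "\<epsilon> > 0" "\<forall>s. \<bar>s - t\<bar> < \<epsilon> \<longrightarrow>
    (var_field \<gamma> \<gamma>n c has_vector_derivative chart_metric.dspray (g c) (state c \<gamma> s) (var_field \<gamma> \<gamma>n c s)) (at s)"
    by (elim exE conjE)
  then show ?thesis using spec[OF e(2), of t] by simp
qed

lemma var_field_change:
  assumes v: "is_variation \<gamma> \<gamma>n" and c: "c \<in> A" "d \<in> A" and t: "\<gamma> t \<in> dom_of c" "\<gamma> t \<in> dom_of d"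
  shows "fst (var_field \<gamma> \<gamma>n d t) = (\<chi> k. \<Sum>i\<in>UNIV. fst (var_field \<gamma> \<gamma>n c t) $ i * dtransition c d k i (map_of_chart c (\<gamma> t)))"
proof -
  from var_change[OF is_variation_geodesic[OF v] c t var_at_var_field[OF v c(1) t(1)]]
  obtain w' where "var_at d \<gamma> \<gamma>n t w'"
    "fst w' = (\<chi> k. \<Sum>i\<in>UNIV. fst (var_field \<gamma> \<gamma>n c t) $ i * dtransition c d k i (map_of_chart c (\<gamma> t)))"
    by (elim exE conjE)
  then show ?thesis using var_at_var_field_eq[of d \<gamma> \<gamma>n t w'] by simp
qed

section \<open>Normal components, chart invariance and the Wronskian\<close>

definition J :: "(real \<Rightarrow> 'a) \<Rightarrow> (nat \<Rightarrow> real \<Rightarrow> 'a) \<Rightarrow> ('a, 2) chart \<Rightarrow> real \<Rightarrow> real"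
  where "J \<gamma> \<gamma>n c t = chart_metric.jac (g c) (state c \<gamma> t) (var_field \<gamma> \<gamma>n c t)"

definition J' :: "(real \<Rightarrow> 'a) \<Rightarrow> (nat \<Rightarrow> real \<Rightarrow> 'a) \<Rightarrow> ('a, 2) chart \<Rightarrow> real \<Rightarrow> real"
  where "J' \<gamma> \<gamma>n c t = chart_metric.djac (g c) (state c \<gamma> t) (var_field \<gamma> \<gamma>n c t)"

abbreviation curv :: "('a, 2) chart \<Rightarrow> real^2 \<Rightarrow> real"
  where "curv c \<equiv> chart_metric.\<kappa> (g c)"

lemma J_derivative:
  assumes v: "is_variation \<gamma> \<gamma>n" and c: "c \<in> A" "\<gamma> t \<in> dom_of c"
  shows "(J \<gamma> \<gamma>n c has_real_derivative J' \<gamma> \<gamma>n c t) (at t)"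
    "(J' \<gamma> \<gamma>n c has_real_derivative - curv c (map_of_chart c (\<gamma> t)) * J \<gamma> \<gamma>n c t) (at t)"
proof -
  interpret C: chart_metric "g c" "\<Omega> c" by (rule chart_metric_chart[OF c(1)])
  have us: "unit_speed_geodesic A g \<gamma>" using v by (simp add: is_variation_def)
  note je = C.jacobi_equation[OF state_\<Omega>[of \<gamma> t c, OF c(2)] state_derivative[OF is_variation_geodesic(1)[OF v] c]
      var_field_derivative[OF v c]]
  show "(J \<gamma> \<gamma>n c has_real_derivative J' \<gamma> \<gamma>n c t) (at t)"
    using je(1) unfolding J_def[abs_def] J'_def .
  have "((\<lambda>t. C.djac (state c \<gamma> t) (var_field \<gamma> \<gamma>n c t)) has_real_derivative
      - C.\<kappa> (fst (state c \<gamma> t)) * C.jac (state c \<gamma> t) (var_field \<gamma> \<gamma>n c t)) (at t)"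
    by (rule je(2)[OF unit_state[OF us c]])
  then show "(J' \<gamma> \<gamma>n c has_real_derivative - curv c (map_of_chart c (\<gamma> t)) * J \<gamma> \<gamma>n c t) (at t)"
    unfolding J_def J'_def[abs_def] by (simp add: state_def)
qed

text \<open>The normal components \<open>J\<close> in two charts differ by this locally constant sign.\<close>

definition orient :: "(real \<Rightarrow> 'a) \<Rightarrow> ('a, 2) chart \<Rightarrow> ('a, 2) chart \<Rightarrow> real \<Rightarrow> real"
  where "orient \<gamma> c d t = sgn (dtransition_det c d (map_of_chart c (\<gamma> t)))"

lemma orient_square:
  assumes "c \<in> A" "d \<in> A" "\<gamma> t \<in> dom_of c" "\<gamma> t \<in> dom_of d"
  shows "orient \<gamma> c d t * orient \<gamma> c d t = 1"
  using det_change(2)[OF assms] by (simp add: orient_def sgn_if)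

lemma J_change:
  assumes v: "is_variation \<gamma> \<gamma>n" and c: "c \<in> A" "d \<in> A" and t: "\<gamma> t \<in> dom_of c" "\<gamma> t \<in> dom_of d"
  shows "J \<gamma> \<gamma>n d t = orient \<gamma> c d t * J \<gamma> \<gamma>n c t"
proof -
  interpret C: chart_metric "g c" "\<Omega> c" by (rule chart_metric_chart[OF c(1)])
  interpret D: chart_metric "g d" "\<Omega> d" by (rule chart_metric_chart[OF c(2)])
  define x y \<delta> where "x = map_of_chart c (\<gamma> t)" and "y = map_of_chart d (\<gamma> t)" and "\<delta> = dtransition_det c d x"
  define a w where "a = snd (state c \<gamma> t)" and "w = fst (var_field \<gamma> \<gamma>n c t)"
  have sq: "sqrt (det (g c x)) = \<bar>\<delta>\<bar> * sqrt (det (g d y))"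
    using det_change(1)[OF c t] by (simp add: x_def y_def \<delta>_def real_sqrt_mult)
  have sd: "snd (state d \<gamma> t) = (\<chi> k. \<Sum>i\<in>UNIV. a $ i * dtransition c d k i x)"
    unfolding state_change[OF is_variation_geodesic(1)[OF v] c t] ttransition_def by (simp add: state_def a_def x_def)
  have vd: "fst (var_field \<gamma> \<gamma>n d t) = (\<chi> k. \<Sum>i\<in>UNIV. w $ i * dtransition c d k i x)"
    unfolding var_field_change[OF v c t] by (simp add: w_def x_def)
  have "J \<gamma> \<gamma>n d t = sqrt (det (g d y)) * (\<delta> * (a $ 1 * w $ 2 - a $ 2 * w $ 1))"
    unfolding J_def D.jac_def sd vd by (simp add: state_def y_def \<delta>_def dtransition_det_def sum_2 algebra_simps)
  also have "\<dots> = sgn \<delta> * (sqrt (det (g c x)) * (a $ 1 * w $ 2 - a $ 2 * w $ 1))"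
    unfolding sq by (simp add: sgn_if)
  also have "\<dots> = orient \<gamma> c d t * J \<gamma> \<gamma>n c t"
    unfolding J_def C.jac_def by (simp add: orient_def state_def x_def \<delta>_def a_def w_def)
  finally show ?thesis .
qed

text \<open>The Jacobian determinant of the transition is continuous and nonzero along \<gamma>, so
  its sign is constant near t and may be treated as a constant factor when differentiating.\<close>

lemma orient_derivative:
  assumes \<gamma>: "geodesic A g \<gamma>" and c: "c \<in> A" "d \<in> A" and t: "\<gamma> t \<in> dom_of c" "\<gamma> t \<in> dom_of d"
    and eq: "\<And>s. \<gamma> s \<in> dom_of c \<Longrightarrow> \<gamma> s \<in> dom_of d \<Longrightarrow> f s = orient \<gamma> c d s * h s"
    and f: "(f has_real_derivative f') (at t)" and h: "(h has_real_derivative h') (at t)"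
  shows "f' = orient \<gamma> c d t * h'"
proof -
  define q where "q s = dtransition_det c d (map_of_chart c (\<gamma> s))" for s
  define T where "T = {s. \<gamma> s \<in> dom_of c} \<inter> {s. \<gamma> s \<in> dom_of d}"
  have T: "open T" unfolding T_def by (intro open_Int open_times \<gamma> c)
  have tT: "t \<in> T" using t by (simp add: T_def)
  have "continuous_on (overlap c d) (dtransition_det c d)"
    unfolding dtransition_det_def[abs_def] using diff_upto_continuous[OF diff_upto_dtransition[OF c, of "Suc 0"]] by (intro continuous_intros)
  moreover have "continuous_on T (\<lambda>s. map_of_chart c (\<gamma> s))"
    by (rule continuous_on_compose2[OF continuous_map[OF c(1)] continuous_on_subset[OF geodesic_continuous[OF \<gamma>]]])
      (auto simp: T_def)
  ultimately have qc: "continuous_on T q" unfolding q_def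
    by (rule continuous_on_compose2) (auto simp: T_def)
  define B where "B = T \<inter> (\<lambda>s. q t * q s) -` {0<..}"
  have oB: "open B" unfolding B_def
    using qc T by (intro continuous_open_preimage continuous_intros) auto
  have "q t \<noteq> 0" using det_change(2)[OF c t] by (simp add: q_def)
  then have "q t * q t > 0" by (metis not_real_square_gt_zero)
  then have tB: "t \<in> B" using tT by (simp add: B_def)
  have fh: "f s = orient \<gamma> c d t * h s" if "s \<in> B" for s
  proof -
    have "sgn (q s) = sgn (q t)" using that by (auto simp: B_def zero_less_mult_iff)
    then show ?thesis using eq[of s] that by (simp add: B_def T_def orient_def q_def)
  qed
  have "((\<lambda>s. orient \<gamma> c d t * h s) has_real_derivative f') (at t)"
    by (rule has_field_derivative_transform_within_open[OF f oB tB fh])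
  moreover have "((\<lambda>s. orient \<gamma> c d t * h s) has_real_derivative orient \<gamma> c d t * h') (at t)"
    by (rule DERIV_cmult[OF h])
  ultimately show ?thesis by (rule DERIV_unique)
qed

lemma J'_change:
  assumes v: "is_variation \<gamma> \<gamma>n" and c: "c \<in> A" "d \<in> A" and t: "\<gamma> t \<in> dom_of c" "\<gamma> t \<in> dom_of d"
  shows "J' \<gamma> \<gamma>n d t = orient \<gamma> c d t * J' \<gamma> \<gamma>n c t"
  by (rule orient_derivative[OF is_variation_geodesic(1)[OF v] c t J_change[OF v c]
      J_derivative(1)[OF v c(2) t(2)] J_derivative(1)[OF v c(1) t(1)]])

text \<open>Invariance of the curvature comes from the Jacobi equation in both charts: the normal
  components agree up to a locally constant sign, hence so do their second derivatives - \<kappa> J,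
  and J can be divided out. No transformation law for the curvature tensor is computed.\<close>

lemma curv_change:
  assumes v: "is_variation \<gamma> \<gamma>n" and c: "c \<in> A" "d \<in> A" and t: "\<gamma> t \<in> dom_of c" "\<gamma> t \<in> dom_of d"
    and nz: "J \<gamma> \<gamma>n c t \<noteq> 0"
  shows "curv d (map_of_chart d (\<gamma> t)) = curv c (map_of_chart c (\<gamma> t))"
proof -
  have "- curv d (map_of_chart d (\<gamma> t)) * J \<gamma> \<gamma>n d t = orient \<gamma> c d t * (- curv c (map_of_chart c (\<gamma> t)) * J \<gamma> \<gamma>n c t)"
    by (rule orient_derivative[OF is_variation_geodesic(1)[OF v] c t J'_change[OF v c]
      J_derivative(2)[OF v c(2) t(2)] J_derivative(2)[OF v c(1) t(1)]])
  then have "(curv d (map_of_chart d (\<gamma> t)) - curv c (map_of_chart c (\<gamma> t))) * (orient \<gamma> c d t * J \<gamma> \<gamma>n c t) = 0"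
    unfolding J_change[OF v c t] by (simp add: algebra_simps)
  moreover have "orient \<gamma> c d t \<noteq> 0" using orient_square[of c d \<gamma> t, OF c t] by auto
  ultimately show ?thesis using nz by simp
qed

text \<open>J and J' change by the same sign for both variations, so the products do not depend on
  the chart. The Wronskian is thus a function on the whole line, and the Jacobi equation makes its
  derivative 0.\<close>

lemma wronskian:
  assumes v: "is_variation \<gamma> \<gamma>1" "is_variation \<gamma> \<gamma>2"
    and c: "c \<in> A" "\<gamma> t \<in> dom_of c" and d: "d \<in> A" "\<gamma> s \<in> dom_of d"
  shows "J \<gamma> \<gamma>1 c t * J' \<gamma> \<gamma>2 c t - J \<gamma> \<gamma>2 c t * J' \<gamma> \<gamma>1 c t =
    J \<gamma> \<gamma>1 d s * J' \<gamma> \<gamma>2 d s - J \<gamma> \<gamma>2 d s * J' \<gamma> \<gamma>1 d s"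
proof -
  define Wr where "Wr c t = J \<gamma> \<gamma>1 c t * J' \<gamma> \<gamma>2 c t - J \<gamma> \<gamma>2 c t * J' \<gamma> \<gamma>1 c t" for c t
  have ch: "Wr d t = Wr c t" if c: "c \<in> A" "d \<in> A" and t: "\<gamma> t \<in> dom_of c" "\<gamma> t \<in> dom_of d" for c d t
  proof -
    have "Wr d t = (orient \<gamma> c d t * orient \<gamma> c d t) * Wr c t"
      unfolding Wr_def J_change[OF v(1) c t] J_change[OF v(2) c t] J'_change[OF v(1) c t] J'_change[OF v(2) c t]
      by (simp add: algebra_simps)
    then show ?thesis by (simp add: orient_square[of c d \<gamma> t, OF c t])
  qed
  define wr where "wr t = Wr (chart_at A (\<gamma> t)) t" for t
  have wr: "wr t = Wr c t" if "c \<in> A" "\<gamma> t \<in> dom_of c" for c t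
    unfolding wr_def by (rule ch[OF that(1) chart_at(1) that(2) chart_at(2)])
  have "(wr has_real_derivative 0) (at t)" for t
  proof -
    obtain c where c: "c \<in> A" "\<gamma> t \<in> dom_of c" using chart_ex by blast
    have "(Wr c has_real_derivative 0) (at t)"
      unfolding Wr_def[abs_def]
      by (rule DERIV_cong, (rule DERIV_diff DERIV_mult J_derivative v c)+) (simp add: algebra_simps)
    then show ?thesis
      by (rule has_field_derivative_transform_within_open[OF _ open_times[OF is_variation_geodesic(1)[OF v(1)] c(1)]])
        (use c wr in auto)
  qed
  then have "wr t = wr s" using DERIV_isconst_all by blast
  then show ?thesis using wr[OF c] wr[OF d] by (simp add: Wr_def)
qed

text \<open>The initial data x0 + s e, v + s k are normalized to unit speed at s = 1/n. As q is the
  squared length and q 0 = 1, normalizing changes the velocity derivative by - (q'/2) v. This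
  multiple of v is not controlled, but \<open>djac\<close> does not see it.\<close>

lemma family_exists:
  fixes e k v :: "real^2"
  assumes comp: "complete_metric A g" and c: "c \<in> A" and us: "unit_speed_geodesic A g \<gamma>"
    and x: "\<gamma> 0 \<in> dom_of c" and v: "snd (state c \<gamma> 0) = v"
  shows "\<exists>\<gamma>n l. is_variation \<gamma> \<gamma>n \<and> var_field \<gamma> \<gamma>n c 0 = (e, k - l *\<^sub>R v)"
proof -
  interpret C: chart_metric "g c" "\<Omega> c" by (rule chart_metric_chart[OF c])
  define x0 where "x0 = fst (state c \<gamma> 0)"
  have st: "state c \<gamma> 0 = (x0, v)" using v by (simp add: x0_def prod_eq_iff)
  have x0: "x0 \<in> \<Omega> c" unfolding x0_def by (rule state_\<Omega>[of \<gamma> 0 c, OF x])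
  define q where "q s = (v + s *\<^sub>R k) \<bullet> (g c (x0 + s *\<^sub>R e) *v (v + s *\<^sub>R k))" for s
  have q0: "q 0 = 1" using unit_state[OF us c x] by (simp add: q_def st)
  define f where "f s = (x0 + s *\<^sub>R e, (1 / sqrt (q s)) *\<^sub>R (v + s *\<^sub>R k))" for s
  have "\<exists>q'. (q has_real_derivative q') (at 0)"
  proof -
    have dg: "((\<lambda>s. g c (x0 + s *\<^sub>R e) $ i $ j) has_real_derivative (\<Sum>l\<in>UNIV. e $ l * partial l (\<lambda>x. g c x $ i $ j) x0)) (at 0)" for i j
    proof -
      have d: "((\<lambda>x. g c x $ i $ j) has_derivative (\<lambda>v. \<Sum>l\<in>UNIV. v $ l * partial l (\<lambda>x. g c x $ i $ j) x0)) (at (x0 + 0 *\<^sub>R e))"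
        using differentiable_has_derivative_partial[OF C.G_diff[OF x0]] by simp
      have l: "((\<lambda>s. x0 + s *\<^sub>R e) has_vector_derivative e) (at 0)" by (auto intro!: derivative_eq_intros)
      show ?thesis
        using vector_derivative_diff_chain_within[OF l has_derivative_at_withinI[OF d]]
        by (simp add: comp_def has_real_derivative_iff_has_vector_derivative)
    qed
    have dv: "((\<lambda>s. v $ i + s * k $ i) has_real_derivative k $ i) (at 0)" for i
      by (auto intro!: derivative_eq_intros)
    show ?thesis unfolding q_def[abs_def] C.quad vector_add_component vector_scaleR_component real_scaleR_def
      by (rule exI) (rule dv dg DERIV_add DERIV_mult)+
  qed
  then obtain q' where q': "(q has_real_derivative q') (at 0)" ..
  have "((\<lambda>s. 1 / sqrt (q s)) has_real_derivative - (q' / 2)) (at 0)"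
    using q' q0 by (auto intro!: derivative_eq_intros simp: field_simps)
  moreover have "((\<lambda>s. v + s *\<^sub>R k) has_vector_derivative k) (at 0)"
    by (auto intro!: derivative_eq_intros)
  ultimately have "((\<lambda>s. (1 / sqrt (q s)) *\<^sub>R (v + s *\<^sub>R k)) has_vector_derivative k - (q' / 2) *\<^sub>R v) (at 0)"
    by (rule has_vector_derivative_scaleR[THEN has_vector_derivative_eq_rhs]) (simp add: q0)
  moreover have "((\<lambda>s. x0 + s *\<^sub>R e) has_vector_derivative e) (at 0)" by (auto intro!: derivative_eq_intros)
  ultimately have "(f has_vector_derivative (e, k - (q' / 2) *\<^sub>R v)) (at 0)"
    unfolding f_def by (intro has_vector_derivative_Pair)
  then have fd: "(f has_derivative (\<lambda>h. h *\<^sub>R (e, k - (q' / 2) *\<^sub>R v))) (at 0)"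
    by (simp add: has_vector_derivative_def)
  have "\<forall>\<^sub>F n in sequentially. 1 = real n *\<^sub>R (1 / real n - 0)"
    using eventually_gt_at_top[of 0] by eventually_elim simp
  with tendsto_const[of "1::real"] have l1: "(\<lambda>n. real n *\<^sub>R (1 / real n - 0)) \<longlonglongrightarrow> 1"
    by (rule Lim_transform_eventually)
  have f0: "f 0 = state c \<gamma> 0" by (simp add: f_def st q0)
  have lim: "(\<lambda>n. real n *\<^sub>R (f (1 / real n) - state c \<gamma> 0)) \<longlonglongrightarrow> (e, k - (q' / 2) *\<^sub>R v)"
    using scaled_difference_tendsto(2)[OF fd l1] by (simp add: f0)
  define good where "good n \<longleftrightarrow> x0 + (1 / real n) *\<^sub>R e \<in> \<Omega> c \<and> q (1 / real n) > 0" for n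
  have lim0: "(\<lambda>n. 1 / real n) \<longlonglongrightarrow> 0" by (rule lim_1_over_n)
  have ev: "\<forall>\<^sub>F n in sequentially. good n"
  proof -
    have "(\<lambda>n. x0 + (1 / real n) *\<^sub>R e) \<longlonglongrightarrow> x0 + 0 *\<^sub>R e" by (intro tendsto_intros lim0)
    then have "\<forall>\<^sub>F n in sequentially. x0 + (1 / real n) *\<^sub>R e \<in> \<Omega> c"
      by (rule topological_tendstoD[OF _ C.open_\<Omega>]) (use x0 in simp)
    moreover have "(\<lambda>n. q (1 / real n)) \<longlonglongrightarrow> q 0"
      by (rule isCont_tendsto_compose[OF DERIV_isCont[OF q'] lim0])
    then have "\<forall>\<^sub>F n in sequentially. q (1 / real n) > 0" by (rule order_tendstoD) (simp add: q0)
    ultimately show ?thesis unfolding good_def by (rule eventually_conj)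
  qed
  \<comment> \<open>For the finitely many n whose initial data leave the chart or cannot be
    normalized, \<gamma> itself serves as a placeholder, so that every member of the sequence has
    unit speed.\<close>
  have "\<forall>n. \<exists>\<delta>. unit_speed_geodesic A g \<delta> \<and> (good n \<longrightarrow> \<delta> 0 \<in> dom_of c \<and> state c \<delta> 0 = f (1 / real n))"
  proof
    fix n
    show "\<exists>\<delta>. unit_speed_geodesic A g \<delta> \<and> (good n \<longrightarrow> \<delta> 0 \<in> dom_of c \<and> state c \<delta> 0 = f (1 / real n))"
    proof (cases "good n")
      case True
      then have gn: "x0 + (1 / real n) *\<^sub>R e \<in> \<Omega> c" "q (1 / real n) > 0" by (simp_all add: good_def)
      from geodesic_from[OF comp c gn(1), of "snd (f (1 / real n))"] obtain \<delta> where
        \<delta>: "geodesic A g \<delta>" "\<delta> 0 \<in> dom_of c" "state c \<delta> 0 = (x0 + (1 / real n) *\<^sub>R e, snd (f (1 / real n)))"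
        by (elim exE conjE)
      have "snd (state c \<delta> 0) \<bullet> (g c (fst (state c \<delta> 0)) *v snd (state c \<delta> 0)) = 1"
      proof -
        define r where "r = 1 / sqrt (q (1 / real n))"
        have "r * r * q (1 / real n) = 1" using gn(2) by (simp add: r_def)
        moreover have "snd (state c \<delta> 0) \<bullet> (g c (fst (state c \<delta> 0)) *v snd (state c \<delta> 0)) = r * r * q (1 / real n)"
          unfolding \<delta>(3) fst_conv snd_conv f_def q_def r_def
          by (simp add: matrix_vector_mult_scaleR)
        ultimately show ?thesis by simp
      qed
      then have "unit_speed_geodesic A g \<delta>" by (rule unit_speedI[OF \<delta>(1) c \<delta>(2)])
      moreover have "state c \<delta> 0 = f (1 / real n)" using \<delta>(3) by (simp add: f_def)
      ultimately show ?thesis using \<delta>(2) by blast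
    next
      case False then show ?thesis using us by blast
    qed
  qed
  from choice[OF this] obtain \<gamma>n where \<gamma>n: "\<forall>n. unit_speed_geodesic A g (\<gamma>n n) \<and>
    (good n \<longrightarrow> \<gamma>n n 0 \<in> dom_of c \<and> state c (\<gamma>n n) 0 = f (1 / real n))" ..
  have "\<forall>\<^sub>F n in sequentially. real n *\<^sub>R (f (1 / real n) - state c \<gamma> 0) = var_quot c \<gamma> \<gamma>n n 0"
    using ev by eventually_elim (simp add: var_quot_def \<gamma>n)
  with lim have "(\<lambda>n. var_quot c \<gamma> \<gamma>n n 0) \<longlonglongrightarrow> (e, k - (q' / 2) *\<^sub>R v)" by (rule Lim_transform_eventually)
  moreover have "\<forall>\<^sub>F n in sequentially. \<gamma>n n 0 \<in> dom_of c" using ev by eventually_elim (simp add: \<gamma>n)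
  ultimately have va: "var_at c \<gamma> \<gamma>n 0 (e, k - (q' / 2) *\<^sub>R v)" by (simp add: var_at_def)
  then have "is_variation \<gamma> \<gamma>n" unfolding is_variation_def using us \<gamma>n c x by blast
  then show ?thesis using var_at_var_field_eq[OF va] by blast
qed

text \<open>N is v rotated in the coordinate plane and scaled to have area 1 with v; since only this
  area matters, N need not be orthogonal to v for g. The first variation starts with position
  derivative N and covariant derivative 0 up to a multiple of v, the second with 0 and N.\<close>

lemma jacobi_basis:
  assumes comp: "complete_metric A g" and c: "c \<in> A" and us: "unit_speed_geodesic A g \<gamma>" and x: "\<gamma> 0 \<in> dom_of c"
  shows "\<exists>\<gamma>1 \<gamma>2. is_variation \<gamma> \<gamma>1 \<and> is_variation \<gamma> \<gamma>2 \<and> J \<gamma> \<gamma>1 c 0 = 1 \<and> J' \<gamma> \<gamma>1 c 0 = 0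
    \<and> J \<gamma> \<gamma>2 c 0 = 0 \<and> J' \<gamma> \<gamma>2 c 0 = 1"
proof -
  interpret C: chart_metric "g c" "\<Omega> c" by (rule chart_metric_chart[OF c])
  define x0 v where "x0 = fst (state c \<gamma> 0)" and "v = snd (state c \<gamma> 0)"
  have st: "state c \<gamma> 0 = (x0, v)" by (simp add: x0_def v_def)
  have x0: "x0 \<in> \<Omega> c" unfolding x0_def by (rule state_\<Omega>[of \<gamma> 0 c, OF x])
  define s where "s = sqrt (det (g c x0))"
  have s: "s > 0" using C.det_pos[OF x0] by (simp add: s_def)
  have "v \<noteq> 0" using unit_state[OF us c x] by (auto simp: v_def)
  then have vv: "v $ 1 * v $ 1 + v $ 2 * v $ 2 \<noteq> 0"
    by (simp add: vec_eq_iff forall_2 sum_squares_eq_zero_iff)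
  define n where "n = s * (v $ 1 * v $ 1 + v $ 2 * v $ 2)"
  have n: "n \<noteq> 0" using s vv by (simp add: n_def)
  define N :: "real^2" where "N = vector [- v $ 2 / n, v $ 1 / n]"
  have N: "s * (v $ 1 * N $ 2 - v $ 2 * N $ 1) = 1"
  proof -
    have "s * (v $ 1 * N $ 2 - v $ 2 * N $ 1) = s * (v $ 1 * v $ 1 + v $ 2 * v $ 2) / n"
      by (simp add: N_def algebra_simps add_divide_distrib)
    then show ?thesis using n by (simp add: n_def[symmetric])
  qed
  \<comment> \<open>This cancels the Christoffel term in \<open>djac\<close>, so that the covariant
    derivative of the field vanishes at time 0.\<close>
  define k1 :: "real^2" where "k1 = (\<chi> k. - (\<Sum>i\<in>UNIV. \<Sum>j\<in>UNIV. christoffel (g c) k i j x0 * v $ i * N $ j))"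
  from family_exists[OF comp c us x v_def[symmetric], of N k1] obtain \<gamma>1 l1 where
    1: "is_variation \<gamma> \<gamma>1" "var_field \<gamma> \<gamma>1 c 0 = (N, k1 - l1 *\<^sub>R v)" by (elim exE conjE)
  from family_exists[OF comp c us x v_def[symmetric], of 0 N] obtain \<gamma>2 l2 where
    2: "is_variation \<gamma> \<gamma>2" "var_field \<gamma> \<gamma>2 c 0 = (0, N - l2 *\<^sub>R v)" by (elim exE conjE)
  have "J \<gamma> \<gamma>1 c 0 = 1" using N by (simp add: J_def C.jac_def 1 st s_def)
  moreover have "J' \<gamma> \<gamma>1 c 0 = 0"
    by (simp add: J'_def C.djac_def 1 st k1_def algebra_simps)
  moreover have "J \<gamma> \<gamma>2 c 0 = 0" by (simp add: J_def C.jac_def 2 st)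
  moreover have "J' \<gamma> \<gamma>2 c 0 = 1"
    using N by (simp add: J'_def C.djac_def 2 st s_def algebra_simps)
  ultimately show ?thesis using 1(1) 2(1) by blast
qed

text \<open>Frees the curvature from the chart chosen by \<open>chart_at\<close>.
  \<open>curv_change\<close> needs a variation with nonzero J through p, and
  \<open>jacobi_basis\<close> supplies one along any unit speed geodesic.\<close>

lemma gauss_curvature_eq:
  assumes comp: "complete_metric A g" and c: "c \<in> A" "p \<in> dom_of c"
  shows "gauss_curvature A g p = curv c (map_of_chart c p)"
proof -
  define d where "d = chart_at A p"
  have d: "d \<in> A" "p \<in> dom_of d" using chart_at by (simp_all add: d_def)
  interpret C: chart_metric "g c" "\<Omega> c" by (rule chart_metric_chart[OF c(1)])
  interpret D: chart_metric "g d" "\<Omega> d" by (rule chart_metric_chart[OF d(1)])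
  define x where "x = map_of_chart c p"
  have x: "x \<in> \<Omega> c" using c by (simp add: x_def)
  \<comment> \<open>Any unit vector would do; the normalized first coordinate vector is
    explicit.\<close>
  define v :: "real^2" where "v = (1 / sqrt (g c x $ 1 $ 1)) *\<^sub>R axis 1 1"
  have v: "v \<bullet> (g c x *v v) = 1" using C.G11_pos[OF x] unfolding C.quad by (simp add: v_def axis_def)
  from geodesic_from[OF comp c(1) x, of v] obtain \<gamma> where
    \<gamma>: "geodesic A g \<gamma>" "\<gamma> 0 \<in> dom_of c" "state c \<gamma> 0 = (x, v)" by (elim exE conjE)
  have us: "unit_speed_geodesic A g \<gamma>" by (rule unit_speedI[OF \<gamma>(1) c(1) \<gamma>(2)]) (simp add: \<gamma>(3) v)
  have "map_of_chart c (\<gamma> 0) = map_of_chart c p" using \<gamma>(3) by (simp add: state_def x_def)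
  then have g0: "\<gamma> 0 = p" using inv_map[OF c(1) c(2)] inv_map[OF c(1) \<gamma>(2)] by simp
  from jacobi_basis[OF comp c(1) us \<gamma>(2)] obtain \<gamma>1 \<gamma>2 where
    "is_variation \<gamma> \<gamma>1" "J \<gamma> \<gamma>1 c 0 = 1" by (elim exE conjE)
  then have "curv d (map_of_chart d (\<gamma> 0)) = curv c (map_of_chart c (\<gamma> 0))"
    using d g0 \<gamma>(2) by (intro curv_change[OF _ c(1) d(1)]) auto
  then show ?thesis by (simp add: gauss_curvature_def Let_def d_def[symmetric] D.\<kappa>_def g0)
qed

end

section \<open>Variations of the leaves of the tangent tube\<close>

text \<open>The chain rule for sequences again, now uniform in a parameter z, since a limit of
  holomorphic functions needs locally uniform convergence. The error splits into the linearization
  error of \<Theta> and \<Theta>' applied to the error of the quotient, each at most e / 3.\<close>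

lemma uniform_scaled_difference:
  fixes \<Theta> :: "'a::euclidean_space \<Rightarrow> 'b::real_normed_vector"
  assumes \<rho>: "0 < \<rho>" and d: "\<And>x. x \<in> cball a0 \<rho> \<Longrightarrow> (\<Theta> has_derivative \<Theta>' x) (at x)"
    and c: "\<And>v. continuous_on (cball a0 \<rho>) (\<lambda>x. \<Theta>' x v)"
    and a: "\<And>z. z \<in> Z \<Longrightarrow> a z \<in> cball a0 (\<rho> / 2)"
    and lim: "uniform_limit Z (\<lambda>n z. real n *\<^sub>R (b n z - a z)) w sequentially"
    and bd: "\<And>z. z \<in> Z \<Longrightarrow> norm (w z) \<le> B"
  shows "\<forall>\<^sub>F n in sequentially. \<forall>z\<in>Z. b n z \<in> cball a0 \<rho>"
    and "uniform_limit Z (\<lambda>n z. real n *\<^sub>R (\<Theta> (b n z) - \<Theta> (a z))) (\<lambda>z. \<Theta>' (a z) (w z)) sequentially"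
proof -
  have aK: "a z \<in> cball a0 \<rho>" if "z \<in> Z" for z using a[OF that] \<rho> by auto
  define M where "M = \<bar>B\<bar> + 1"
  have M: "M > 0" by (simp add: M_def)
  have bnd: "\<forall>\<^sub>F n in sequentially. \<forall>z\<in>Z. norm (real n *\<^sub>R (b n z - a z)) \<le> M"
    using uniform_limitD[OF lim zero_less_one]
  proof eventually_elim
    case (elim n)
    show ?case
    proof
      fix z assume z: "z \<in> Z"
      have "norm (real n *\<^sub>R (b n z - a z)) \<le> norm (real n *\<^sub>R (b n z - a z) - w z) + norm (w z)"
        by (rule norm_triangle_sub[of _ "w z", THEN order_trans]) simp
      then show "norm (real n *\<^sub>R (b n z - a z)) \<le> M"
        using bspec[OF elim z] bd[OF z] unfolding M_def dist_norm by linarith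
    qed
  qed
  have close: "\<forall>\<^sub>F n in sequentially. \<forall>z\<in>Z. norm (b n z - a z) < e" if e: "e > 0" for e
  proof -
    have "\<forall>\<^sub>F n in sequentially. real n > M / e"
      using eventually_gt_at_top[of "nat \<lceil>M / e\<rceil>"] by eventually_elim linarith
    with bnd show ?thesis
    proof eventually_elim
      case (elim n)
      have n: "real n > 0" using elim(2) M e by (meson divide_pos_pos less_trans)
      show ?case
      proof
        fix z assume z: "z \<in> Z"
        have "norm (b n z - a z) * real n \<le> M" using bspec[OF elim(1) z] by (simp add: mult.commute)
        also have "M < e * real n" using elim(2) e by (simp add: field_simps)
        finally show "norm (b n z - a z) < e" using n by simp
      qed
    qed
  qed
  show bK: "\<forall>\<^sub>F n in sequentially. \<forall>z\<in>Z. b n z \<in> cball a0 \<rho>"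
    using close[OF half_gt_zero[OF \<rho>]]
  proof eventually_elim
    case (elim n)
    show ?case
    proof
      fix z assume z: "z \<in> Z"
      have "dist a0 (b n z) \<le> dist a0 (a z) + dist (a z) (b n z)" by (rule dist_triangle)
      also have "\<dots> \<le> \<rho> / 2 + \<rho> / 2"
        using a[OF z] bspec[OF elim z] by (intro add_mono) (auto simp: dist_norm norm_minus_commute)
      finally show "b n z \<in> cball a0 \<rho>" by simp
    qed
  qed
  have "\<exists>L\<ge>0. (\<forall>x\<in>cball a0 \<rho>. \<forall>w. norm (\<Theta>' x w) \<le> L * norm w) \<and>
      (\<forall>a\<in>cball a0 \<rho>. \<forall>b\<in>cball a0 \<rho>. norm (\<Theta> a - \<Theta> b) \<le> L * norm (a - b))"
    by (rule uniform_derivative_bound[OF compact_cball convex_cball d c])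
  then obtain L where L: "0 \<le> L" "\<forall>x\<in>cball a0 \<rho>. \<forall>w. norm (\<Theta>' x w) \<le> L * norm w" by (elim exE conjE)
  show "uniform_limit Z (\<lambda>n z. real n *\<^sub>R (\<Theta> (b n z) - \<Theta> (a z))) (\<lambda>z. \<Theta>' (a z) (w z)) sequentially"
  proof (rule uniform_limitI)
    fix e :: real assume e: "e > 0"
    have "\<exists>\<delta>>0. \<forall>x\<in>cball a0 \<rho>. \<forall>y\<in>cball a0 \<rho>. norm (x - y) < \<delta> \<longrightarrow>
        norm (\<Theta> x - \<Theta> y - \<Theta>' y (x - y)) \<le> (e / (3 * M)) * norm (x - y)"
      by (rule uniform_linearization[OF compact_cball convex_cball d c]) (use e M in simp_all)
    then obtain \<delta> where \<delta>: "\<delta> > 0" "\<forall>x\<in>cball a0 \<rho>. \<forall>y\<in>cball a0 \<rho>. norm (x - y) < \<delta> \<longrightarrow>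
        norm (\<Theta> x - \<Theta> y - \<Theta>' y (x - y)) \<le> (e / (3 * M)) * norm (x - y)" by (elim exE conjE)
    have "e / (3 * (L + 1)) > 0" using e L by simp
    from uniform_limitD[OF lim this] bnd bK close[OF \<delta>(1)]
    show "\<forall>\<^sub>F n in sequentially. \<forall>z\<in>Z. dist (real n *\<^sub>R (\<Theta> (b n z) - \<Theta> (a z))) (\<Theta>' (a z) (w z)) < e"
    proof eventually_elim
      case (elim n)
      show ?case
      proof
        fix z assume z: "z \<in> Z"
        define D where "D = b n z - a z"
        note lin = has_derivative_linear[OF d[OF aK[OF z]]]
        have 1: "norm (\<Theta> (b n z) - \<Theta> (a z) - \<Theta>' (a z) D) \<le> (e / (3 * M)) * norm D"
          using \<delta>(2) bspec[OF elim(3) z] aK[OF z] bspec[OF elim(4) z] unfolding D_def by blast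
        have "norm (real n *\<^sub>R (\<Theta> (b n z) - \<Theta> (a z) - \<Theta>' (a z) D)) \<le> real n * ((e / (3 * M)) * norm D)"
          using mult_left_mono[OF 1, of "real n"] by simp
        also have "\<dots> = (e / (3 * M)) * norm (real n *\<^sub>R D)" by simp
        also have "\<dots> \<le> (e / (3 * M)) * M"
          using bspec[OF elim(2) z] e M by (intro mult_left_mono) (auto simp: D_def)
        finally have 2: "norm (real n *\<^sub>R (\<Theta> (b n z) - \<Theta> (a z) - \<Theta>' (a z) D)) \<le> e / 3" using M by simp
        have "norm (\<Theta>' (a z) (real n *\<^sub>R D - w z)) \<le> L * norm (real n *\<^sub>R D - w z)"
          using L(2) aK[OF z] by blast
        also have "\<dots> \<le> (L + 1) * (e / (3 * (L + 1)))"
          using bspec[OF elim(1) z] L(1) by (intro mult_mono) (auto simp: dist_norm D_def)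
        also have "\<dots> = e / 3" using L(1) by (simp add: divide_simps)
        finally have 3: "norm (\<Theta>' (a z) (real n *\<^sub>R D - w z)) \<le> e / 3" .
        have "real n *\<^sub>R (\<Theta> (b n z) - \<Theta> (a z)) - \<Theta>' (a z) (w z) =
            real n *\<^sub>R (\<Theta> (b n z) - \<Theta> (a z) - \<Theta>' (a z) D) + \<Theta>' (a z) (real n *\<^sub>R D - w z)"
          using linear_diff[OF lin, of "real n *\<^sub>R D" "w z"] linear_cmul[OF lin, of "real n" D]
          by (simp add: scaleR_diff_right)
        then have "norm (real n *\<^sub>R (\<Theta> (b n z) - \<Theta> (a z)) - \<Theta>' (a z) (w z)) \<le> e / 3 + e / 3"
          using norm_triangle_mono[OF 2 3] by simp
        then show "dist (real n *\<^sub>R (\<Theta> (b n z) - \<Theta> (a z))) (\<Theta>' (a z) (w z)) < e"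
          using e by (simp add: dist_norm)
      qed
    qed
  qed
qed

text \<open>Coordinate form of \<open>tscale\<close> on the tangent bundle.\<close>

definition fibre_scale :: "real \<Rightarrow> (real^2) \<times> (real^2) \<Rightarrow> (real^2) \<times> (real^2)"
  where "fibre_scale y a = (fst a, y *\<^sub>R snd a)"

lemma fibre_scale_linear: "fibre_scale y (r *\<^sub>R (a - b)) = r *\<^sub>R (fibre_scale y a - fibre_scale y b)"
  by (simp add: fibre_scale_def scaleR_diff_right mult.commute)

lemma norm_fibre_scale_le: "norm (fibre_scale y a) \<le> (1 + \<bar>y\<bar>) * norm a"
proof -
  have "norm (fibre_scale y a) \<le> norm (fst a) + norm (y *\<^sub>R snd a)"
    using norm_Pair_le[of "fst a" "y *\<^sub>R snd a"] by (simp add: fibre_scale_def)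
  also have "\<dots> \<le> norm a + \<bar>y\<bar> * norm a"
    using norm_fst_le[of "fst a" "snd a"] norm_snd_le[of "snd a" "fst a"] by (auto intro!: add_mono mult_left_mono)
  finally show ?thesis by (simp add: algebra_simps)
qed

locale adapted = surface A g for A :: "('a::{t2_space, second_countable_topology}, 2) chart set" and g +
  fixes R :: ereal and \<C> :: "('a, 2) cchart set"
  assumes acs: "adapted_complex_structure A g R \<C>"
begin

section \<open>Leaves and complex charts in bundle coordinates\<close>

definition leaf :: "(real \<Rightarrow> 'a) \<Rightarrow> complex \<Rightarrow> ('a, 2) tvec"
  where "leaf \<gamma> z = tscale (Im z) (velocity A \<gamma> (Re z))"

definition tube_strip :: "complex set" where "tube_strip = {z. ereal \<bar>Im z\<bar> < R}"

lemma catlas: "complex_atlas A (tangent_tube A g R) \<C>"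
  using acs by (simp add: adapted_complex_structure_def)

lemma leaf_holomorphic:
  assumes "unit_speed_geodesic A g \<gamma>"
  shows "z \<in> tube_strip \<Longrightarrow> leaf \<gamma> z \<in> tangent_tube A g R"
    "(W, \<Phi>) \<in> \<C> \<Longrightarrow> open (tube_strip \<inter> leaf \<gamma> -` W)"
    "(W, \<Phi>) \<in> \<C> \<Longrightarrow> (\<lambda>z. \<Phi> (leaf \<gamma> z) $ i) holomorphic_on (tube_strip \<inter> leaf \<gamma> -` W)"
proof -
  have "holomorphic_curve (tangent_tube A g R) \<C> (leaf \<gamma>) tube_strip"
    using acs assms unfolding adapted_complex_structure_def leaf_def[abs_def] tube_strip_def by blast
  then show "z \<in> tube_strip \<Longrightarrow> leaf \<gamma> z \<in> tangent_tube A g R"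
    "(W, \<Phi>) \<in> \<C> \<Longrightarrow> open (tube_strip \<inter> leaf \<gamma> -` W)"
    "(W, \<Phi>) \<in> \<C> \<Longrightarrow> (\<lambda>z. \<Phi> (leaf \<gamma> z) $ i) holomorphic_on (tube_strip \<inter> leaf \<gamma> -` W)"
    unfolding holomorphic_curve_def by blast+
qed

lemma leaf_tangent: "unit_speed_geodesic A g \<gamma> \<Longrightarrow> z \<in> tube_strip \<Longrightarrow> leaf \<gamma> z \<in> tangent_bundle A"
  using leaf_holomorphic(1) by (auto simp: tangent_tube_def)

lemma cchart_ex:
  assumes "unit_speed_geodesic A g \<gamma>" "z \<in> tube_strip"
  shows "\<exists>W \<Phi>. (W, \<Phi>) \<in> \<C> \<and> leaf \<gamma> z \<in> W"
proof -
  have "leaf \<gamma> z \<in> (\<Union>(W, \<Phi>)\<in>\<C>. W)"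
    using leaf_holomorphic(1)[OF assms] catlas unfolding complex_atlas_def by simp
  then show ?thesis by blast
qed

text \<open>One component at the base point determines all the others through the transition
  derivatives, and the remaining entries are 0 by the convention in
  \<open>tangent_bundle\<close>.\<close>

lemma tchart_inj: assumes c: "c \<in> A" shows "inj_on (tchart_map c) (tchart_dom A c)"
proof (rule inj_onI)
  fix v w assume v: "v \<in> tchart_dom A c" and w: "w \<in> tchart_dom A c" and eq: "tchart_map c v = tchart_map c w"
  obtain p f where vp: "v = (p, f)" by (cases v)
  obtain q h where wq: "w = (q, h)" by (cases w)
  have dom: "p \<in> dom_of c" "q \<in> dom_of c" and tb: "(p, f) \<in> tangent_bundle A" "(q, h) \<in> tangent_bundle A"
    using v w by (simp_all add: tchart_dom_def vp wq)
  have "(map_of_chart c p, f c) = (map_of_chart c q, h c)"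
    using eq unfolding vp wq tchart_map_def fst_conv snd_conv .
  then have mm: "map_of_chart c p = map_of_chart c q" and fh: "f c = h c" by (simp_all only: prod.inject)
  have pq: "p = q" using inv_map[OF c dom(1)] inv_map[OF c dom(2)] unfolding mm by (rule trans[OF sym])
  have "f d = h d" for d
  proof (cases "d \<in> A \<and> p \<in> dom_of d")
    case True
    then have "f d = deriv_at (transition c d) (map_of_chart c p) (f c)"
      "h d = deriv_at (transition c d) (map_of_chart c p) (h c)"
      using tb c dom pq unfolding tangent_bundle_def by blast+
    then show ?thesis by (simp add: fh)
  next
    case False
    then have "f d = 0" using tb(1) unfolding tangent_bundle_def mem_Collect_eq prod.case by blast
    moreover have "h d = 0" using False tb(2) pq unfolding tangent_bundle_def mem_Collect_eq prod.case by blast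
    ultimately show ?thesis by simp
  qed
  then show "v = w" by (simp add: vp wq pq fun_eq_iff)
qed

definition cchart_map :: "('a, 2) chart \<Rightarrow> (('a, 2) tvec \<Rightarrow> complex^2) \<Rightarrow> (real^2) \<times> (real^2) \<Rightarrow> complex^2"
  where "cchart_map c \<Phi> = \<Phi> \<circ> inv_into (tchart_dom A c) (tchart_map c)"

definition cchart_dom :: "('a, 2) chart \<Rightarrow> ('a, 2) tvec set \<Rightarrow> ((real^2) \<times> (real^2)) set"
  where "cchart_dom c W = tchart_map c ` (W \<inter> tchart_dom A c)"

lemma cchart_map_tchart: "c \<in> A \<Longrightarrow> v \<in> tchart_dom A c \<Longrightarrow> cchart_map c \<Phi> (tchart_map c v) = \<Phi> v"
  by (simp add: cchart_map_def inv_into_f_f[OF tchart_inj])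

lemma cchart_dom_mem: "c \<in> A \<Longrightarrow> v \<in> tchart_dom A c \<Longrightarrow> tchart_map c v \<in> cchart_dom c W \<longleftrightarrow> v \<in> W"
  unfolding cchart_dom_def using tchart_inj[of c] by (auto dest: inj_onD)

text \<open>The last part says that a complex chart is an immersion: its smooth inverse X is a left
  inverse of \<open>cchart_map\<close>, so by the chain rule the derivative of X is a left inverse
  of the derivative.\<close>

lemma cchart_map_props:
  assumes "(W, \<Phi>) \<in> \<C>" "c \<in> A"
  shows "open (cchart_dom c W)"
    "\<And>x. x \<in> cchart_dom c W \<Longrightarrow> (cchart_map c \<Phi> has_derivative deriv_at (cchart_map c \<Phi>) x) (at x)"
    "\<And>v. continuous_on (cchart_dom c W) (\<lambda>x. deriv_at (cchart_map c \<Phi>) x v)"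
    "\<And>x v. x \<in> cchart_dom c W \<Longrightarrow> deriv_at (cchart_map c \<Phi>) x v = 0 \<Longrightarrow> v = 0"
proof -
  have W: "open_in_tangent A W" "inj_on \<Phi> W"
    and s1: "smooth_on (cchart_map c \<Phi>) (cchart_dom c W)"
    and s2: "smooth_on (tchart_map c \<circ> inv_into W \<Phi>) (\<Phi> ` (W \<inter> tchart_dom A c))"
    using catlas assms unfolding complex_atlas_def cchart_map_def cchart_dom_def by blast+
  show op: "open (cchart_dom c W)" using s1 by (simp add: smooth_on_def)
  have "Ck_on (Suc 0) (cchart_map c \<Phi>) (cchart_dom c W)" using s1 unfolding smooth_on_def by blast
  then have d: "\<forall>x\<in>cchart_dom c W. cchart_map c \<Phi> differentiable (at x)"
    and cont: "\<And>v. continuous_on (cchart_dom c W) (\<lambda>x. deriv_at (cchart_map c \<Phi>) x v)"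
    unfolding Ck_on.simps by blast+
  show "continuous_on (cchart_dom c W) (\<lambda>x. deriv_at (cchart_map c \<Phi>) x v)" for v by (rule cont)
  show dd: "(cchart_map c \<Phi> has_derivative deriv_at (cchart_map c \<Phi>) x) (at x)" if "x \<in> cchart_dom c W" for x
    using bspec[OF d that] by (simp add: frechet_derivative_works)
  show "v = 0" if x: "x \<in> cchart_dom c W" and 0: "deriv_at (cchart_map c \<Phi>) x v = 0" for x v
  proof -
    define X where "X = tchart_map c \<circ> inv_into W \<Phi>"
    have inv: "X (cchart_map c \<Phi> y) = y" if yN: "y \<in> cchart_dom c W" for y
    proof -
      obtain u where u: "u \<in> W" "u \<in> tchart_dom A c" "y = tchart_map c u" using yN unfolding cchart_dom_def by (elim imageE IntE)
      show ?thesis unfolding u(3) cchart_map_tchart[OF assms(2) u(2)] X_def by (simp add: inv_into_f_f[OF W(2) u(1)])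
    qed
    have "cchart_map c \<Phi> x \<in> \<Phi> ` (W \<inter> tchart_dom A c)"
    proof -
      obtain u where u: "u \<in> W" "u \<in> tchart_dom A c" "x = tchart_map c u" using x unfolding cchart_dom_def by (elim imageE IntE)
      show ?thesis unfolding u(3) cchart_map_tchart[OF assms(2) u(2)] using u by blast
    qed
    moreover have "Ck_on (Suc 0) X (\<Phi> ` (W \<inter> tchart_dom A c))" using s2 unfolding smooth_on_def X_def by blast
    ultimately have "X differentiable (at (cchart_map c \<Phi> x))" unfolding Ck_on.simps by blast
    then have "(X has_derivative deriv_at X (cchart_map c \<Phi> x)) (at (cchart_map c \<Phi> x))" by (simp add: frechet_derivative_works)
    from has_derivative_compose[OF dd[OF x] this]
    have "((\<lambda>y. y) has_derivative (\<lambda>v. deriv_at X (cchart_map c \<Phi> x) (deriv_at (cchart_map c \<Phi>) x v))) (at x)"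
      by (rule has_derivative_transform_within_open[OF _ op x]) (simp add: inv)
    then have "(\<lambda>v. deriv_at X (cchart_map c \<Phi> x) (deriv_at (cchart_map c \<Phi>) x v)) = (\<lambda>v. v)"
      using has_derivative_ident has_derivative_unique by blast
    from fun_cong[OF this, of v] have "v = deriv_at X (cchart_map c \<Phi> x) (deriv_at (cchart_map c \<Phi>) x v)" by (rule sym)
    also have "\<dots> = 0" unfolding 0
      using \<open>(X has_derivative _) _\<close> by (simp add: linear_0 has_derivative_linear)
    finally show ?thesis .
  qed
qed

lemma leaf_chart:
  assumes "c \<in> A" "\<gamma> (Re z) \<in> dom_of c"
  shows "tchart_map c (leaf \<gamma> z) = fibre_scale (Im z) (state c \<gamma> (Re z))"
  using assms by (simp add: leaf_def tscale_def velocity_def tchart_map_def fibre_scale_def state_def)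

lemma leaf_tchart_dom:
  assumes "unit_speed_geodesic A g \<gamma>" "z \<in> tube_strip" "\<gamma> (Re z) \<in> dom_of c"
  shows "leaf \<gamma> z \<in> tchart_dom A c"
  using leaf_tangent[OF assms(1,2)] assms(3) by (simp add: tchart_dom_def leaf_def tscale_def velocity_def)

definition leaf_coord :: "('a, 2) chart \<Rightarrow> (real \<Rightarrow> 'a) \<Rightarrow> complex \<Rightarrow> (real^2) \<times> (real^2)"
  where "leaf_coord c \<gamma> z = fibre_scale (Im z) (state c \<gamma> (Re z))"

lemma leaf_cchart_map:
  assumes "unit_speed_geodesic A g \<gamma>" "z \<in> tube_strip" "c \<in> A" "\<gamma> (Re z) \<in> dom_of c"
  shows "\<Phi> (leaf \<gamma> z) = cchart_map c \<Phi> (leaf_coord c \<gamma> z)" "leaf_coord c \<gamma> z \<in> cchart_dom c W \<longleftrightarrow> leaf \<gamma> z \<in> W"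
  using cchart_map_tchart[OF assms(3) leaf_tchart_dom[OF assms(1,2,4)], of \<Phi>]
    cchart_dom_mem[OF assms(3) leaf_tchart_dom[OF assms(1,2,4)], of W]
  by (simp_all add: leaf_chart[of c \<gamma> z, OF assms(3,4)] leaf_coord_def)

text \<open>The derivative of the leaves in the direction of the variation, at a fixed z and read in
  the complex chart \<Phi>.\<close>

definition \<xi> :: "(('a, 2) tvec \<Rightarrow> complex^2) \<Rightarrow> (real \<Rightarrow> 'a) \<Rightarrow> (nat \<Rightarrow> real \<Rightarrow> 'a) \<Rightarrow> complex \<Rightarrow> complex^2"
  where "\<xi> \<Phi> \<gamma> \<gamma>n z = lim (\<lambda>n. real n *\<^sub>R (\<Phi> (leaf (\<gamma>n n) z) - \<Phi> (leaf \<gamma> z)))"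

lemma \<xi>_pointwise:
  assumes v: "is_variation \<gamma> \<gamma>n" and z: "z \<in> tube_strip" and W: "(W, \<Phi>) \<in> \<C>" "leaf \<gamma> z \<in> W"
    and c: "c \<in> A" "\<gamma> (Re z) \<in> dom_of c"
  shows "\<forall>\<^sub>F n in sequentially. leaf (\<gamma>n n) z \<in> W"
    "(\<lambda>n. real n *\<^sub>R (\<Phi> (leaf (\<gamma>n n) z) - \<Phi> (leaf \<gamma> z))) \<longlonglongrightarrow>
      deriv_at (cchart_map c \<Phi>) (leaf_coord c \<gamma> z) (fibre_scale (Im z) (var_field \<gamma> \<gamma>n c (Re z)))"
    "\<xi> \<Phi> \<gamma> \<gamma>n z = deriv_at (cchart_map c \<Phi>) (leaf_coord c \<gamma> z) (fibre_scale (Im z) (var_field \<gamma> \<gamma>n c (Re z)))"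
proof -
  have us: "unit_speed_geodesic A g \<gamma>" and usn: "\<And>n. unit_speed_geodesic A g (\<gamma>n n)"
    using v by (simp_all add: is_variation_def)
  have va: "\<forall>\<^sub>F n in sequentially. \<gamma>n n (Re z) \<in> dom_of c" "(\<lambda>n. var_quot c \<gamma> \<gamma>n n (Re z)) \<longlonglongrightarrow> var_field \<gamma> \<gamma>n c (Re z)"
    using var_at_var_field[OF v c] by (simp_all add: var_at_def)
  have aN: "leaf_coord c \<gamma> z \<in> cchart_dom c W" using leaf_cchart_map(2)[OF us z c] W(2) by simp
  have "bounded_linear (fibre_scale (Im z))"
    unfolding fibre_scale_def[abs_def] by (intro bounded_linear_Pair bounded_linear_fst bounded_linear_const_scaleR bounded_linear_snd)
  from bounded_linear.tendsto[OF this va(2)]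
  have "(\<lambda>n. real n *\<^sub>R (leaf_coord c (\<gamma>n n) z - leaf_coord c \<gamma> z)) \<longlonglongrightarrow> fibre_scale (Im z) (var_field \<gamma> \<gamma>n c (Re z))"
    by (simp add: var_quot_def fibre_scale_linear leaf_coord_def)
  note sd = scaled_difference_tendsto[OF cchart_map_props(2)[OF W(1) c(1) aN] this]
  have "\<forall>\<^sub>F n in sequentially. leaf_coord c (\<gamma>n n) z \<in> cchart_dom c W"
    by (rule topological_tendstoD[OF sd(1) cchart_map_props(1)[OF W(1) c(1)] aN])
  with va(1) show ev: "\<forall>\<^sub>F n in sequentially. leaf (\<gamma>n n) z \<in> W"
    by eventually_elim (use leaf_cchart_map(2)[OF usn z c(1)] in blast)
  have "\<forall>\<^sub>F n in sequentially. real n *\<^sub>R (cchart_map c \<Phi> (leaf_coord c (\<gamma>n n) z) - cchart_map c \<Phi> (leaf_coord c \<gamma> z)) =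
      real n *\<^sub>R (\<Phi> (leaf (\<gamma>n n) z) - \<Phi> (leaf \<gamma> z))"
    using va(1) by eventually_elim (simp add: leaf_cchart_map(1)[OF us z c, symmetric] leaf_cchart_map(1)[OF usn z c(1), symmetric])
  with sd(2) show "(\<lambda>n. real n *\<^sub>R (\<Phi> (leaf (\<gamma>n n) z) - \<Phi> (leaf \<gamma> z))) \<longlonglongrightarrow>
      deriv_at (cchart_map c \<Phi>) (leaf_coord c \<gamma> z) (fibre_scale (Im z) (var_field \<gamma> \<gamma>n c (Re z)))"
    by (rule Lim_transform_eventually)
  then show "\<xi> \<Phi> \<gamma> \<gamma>n z = deriv_at (cchart_map c \<Phi>) (leaf_coord c \<gamma> z) (fibre_scale (Im z) (var_field \<gamma> \<gamma>n c (Re z)))"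
    unfolding \<xi>_def by (rule limI)
qed

lemma open_tube_strip: "open tube_strip"
  unfolding tube_strip_def by (intro open_Collect_less continuous_on_ereal continuous_intros)

lemma leaf_coord_continuous:
  assumes "geodesic A g \<gamma>" "c \<in> A" "\<gamma> (Re z) \<in> dom_of c"
  shows "isCont (leaf_coord c \<gamma>) z"
proof -
  have "isCont (state c \<gamma>) (Re z)"
    using state_derivative[OF assms] has_derivative_continuous unfolding has_vector_derivative_def by blast
  moreover have "isCont (\<lambda>z. Re z) z" by (intro isCont_Re continuous_ident)
  ultimately have 1: "isCont (\<lambda>z. state c \<gamma> (Re z)) z" by (rule isCont_o2[rotated])
  have 2: "isCont (\<lambda>z. Im z) z" by (intro isCont_Im continuous_ident)
  show ?thesis unfolding leaf_coord_def[abs_def] fibre_scale_def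
    by (intro continuous_Pair continuous_fst continuous_snd continuous_scaleR 1 2)
qed

text \<open>Each difference quotient is holomorphic in z because all leaves are.
  \<open>var_field_local\<close> gives uniform convergence in time, and
  \<open>uniform_scaled_difference\<close> carries it through the complex chart, so the limit is
  holomorphic too.\<close>

lemma \<xi>_holomorphic:
  assumes v: "is_variation \<gamma> \<gamma>n" and z0: "z0 \<in> tube_strip" and W: "(W, \<Phi>) \<in> \<C>" "leaf \<gamma> z0 \<in> W"
  shows "\<exists>r>0. (\<lambda>z. \<xi> \<Phi> \<gamma> \<gamma>n z $ i) holomorphic_on ball z0 r"
proof -
  have us: "unit_speed_geodesic A g \<gamma>" and usn: "\<And>n. unit_speed_geodesic A g (\<gamma>n n)"
    using v by (simp_all add: is_variation_def)
  note geo = is_variation_geodesic[OF v]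
  obtain c where c: "c \<in> A" "\<gamma> (Re z0) \<in> dom_of c" using chart_ex by blast
  define a0 where "a0 = leaf_coord c \<gamma> z0"
  have "a0 \<in> cchart_dom c W" using leaf_cchart_map(2)[OF us z0 c] W(2) by (simp add: a0_def)
  then obtain \<rho> where \<rho>: "0 < \<rho>" "cball a0 \<rho> \<subseteq> cchart_dom c W"
    using cchart_map_props(1)[OF W(1) c(1)] open_contains_cball by blast
  from var_field_local[OF v c] obtain \<epsilon> where e: "\<epsilon> > 0" "\<forall>t. \<bar>t - Re z0\<bar> \<le> \<epsilon> \<longrightarrow> \<gamma> t \<in> dom_of c"
      "\<forall>\<^sub>F n in sequentially. \<forall>t. \<bar>t - Re z0\<bar> \<le> \<epsilon> \<longrightarrow> \<gamma>n n t \<in> dom_of c"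
      "uniform_limit {t. \<bar>t - Re z0\<bar> \<le> \<epsilon>} (\<lambda>n t. var_quot c \<gamma> \<gamma>n n t) (var_field \<gamma> \<gamma>n c) sequentially"
      "\<forall>t. \<bar>t - Re z0\<bar> < \<epsilon> \<longrightarrow>
        (var_field \<gamma> \<gamma>n c has_vector_derivative chart_metric.dspray (g c) (state c \<gamma> t) (var_field \<gamma> \<gamma>n c t)) (at t)"
    by (elim exE conjE)
  have "\<forall>\<^sub>F z in at z0. leaf_coord c \<gamma> z \<in> ball a0 (\<rho> / 2)"
    by (rule topological_tendstoD[OF leaf_coord_continuous[OF geo(1) c, unfolded isCont_def] open_ball])
      (use \<rho> in \<open>simp add: a0_def\<close>)
  then obtain r1 where r1: "r1 > 0" "\<forall>z. z \<noteq> z0 \<and> dist z z0 < r1 \<longrightarrow> leaf_coord c \<gamma> z \<in> ball a0 (\<rho> / 2)"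
    unfolding eventually_at by auto
  obtain r2 where r2: "r2 > 0" "ball z0 r2 \<subseteq> tube_strip \<inter> leaf \<gamma> -` W"
    using leaf_holomorphic(2)[OF us W(1)] z0 W(2) open_contains_ball by blast
  define r where "r = min (\<epsilon> / 2) (min r1 r2)"
  have r: "r > 0" "r \<le> \<epsilon> / 2" "r \<le> r1" "r \<le> r2" using e(1) r1(1) r2(1) by (auto simp: r_def)
  define Z where "Z = ball z0 r"
  have ZRe: "\<bar>Re z - Re z0\<bar> \<le> \<epsilon> / 2" "\<bar>Im z\<bar> \<le> \<bar>Im z0\<bar> + \<epsilon>" if "z \<in> Z" for z
  proof -
    have "norm (z - z0) < \<epsilon> / 2" using that r(2) by (simp add: Z_def dist_norm norm_minus_commute)
    moreover have "\<bar>Re z - Re z0\<bar> \<le> norm (z - z0)" "\<bar>Im z - Im z0\<bar> \<le> norm (z - z0)"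
      using abs_Re_le_cmod[of "z - z0"] abs_Im_le_cmod[of "z - z0"] by simp_all
    ultimately show "\<bar>Re z - Re z0\<bar> \<le> \<epsilon> / 2" "\<bar>Im z\<bar> \<le> \<bar>Im z0\<bar> + \<epsilon>" using e(1) by linarith+
  qed
  have Zs: "z \<in> tube_strip" "leaf \<gamma> z \<in> W" "\<gamma> (Re z) \<in> dom_of c" if "z \<in> Z" for z
  proof -
    have "z \<in> ball z0 r2" using that r(4) by (simp add: Z_def)
    then show "z \<in> tube_strip" "leaf \<gamma> z \<in> W" using r2(2) by auto
    show "\<gamma> (Re z) \<in> dom_of c" using e(1,2) ZRe(1)[OF that] by simp
  qed
  have aZ: "leaf_coord c \<gamma> z \<in> cball a0 (\<rho> / 2)" if "z \<in> Z" for z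
  proof (cases "z = z0")
    case True then show ?thesis using \<rho>(1) by (simp add: a0_def)
  next
    case False
    then have "leaf_coord c \<gamma> z \<in> ball a0 (\<rho> / 2)" using r1(2) that r(3) by (simp add: Z_def dist_commute)
    then show ?thesis by simp
  qed
  \<comment> \<open>\<open>var_field\<close> is known to be continuous on the open interval of
    radius \<epsilon>. Half of that radius gives a compact interval, hence a bound, and it covers
    all real parts of points of Z.\<close>
  have "compact {Re z0 - \<epsilon> / 2 .. Re z0 + \<epsilon> / 2}" by simp
  moreover have "continuous_on {Re z0 - \<epsilon> / 2 .. Re z0 + \<epsilon> / 2} (var_field \<gamma> \<gamma>n c)"
  proof (intro continuous_at_imp_continuous_on ballI)
    fix t assume "t \<in> {Re z0 - \<epsilon> / 2 .. Re z0 + \<epsilon> / 2}"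
    then have "\<bar>t - Re z0\<bar> < \<epsilon>" using e(1) by (auto simp: abs_le_iff)
    from e(5)[rule_format, OF this] show "isCont (var_field \<gamma> \<gamma>n c) t"
      unfolding has_vector_derivative_def by (rule has_derivative_continuous)
  qed
  ultimately have "bounded (var_field \<gamma> \<gamma>n c ` {Re z0 - \<epsilon> / 2 .. Re z0 + \<epsilon> / 2})"
    by (intro compact_imp_bounded compact_continuous_image)
  then obtain B0 where B0: "\<forall>x\<in>var_field \<gamma> \<gamma>n c ` {Re z0 - \<epsilon> / 2 .. Re z0 + \<epsilon> / 2}. norm x \<le> B0" unfolding bounded_iff ..
  define Y where "Y = 1 + (\<bar>Im z0\<bar> + \<epsilon>)"
  have Y: "Y > 0" using e(1) by (simp add: Y_def add_pos_nonneg)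
  have mscY: "norm (fibre_scale (Im z) u) \<le> Y * norm u" if "z \<in> Z" for z u
  proof -
    have "(1 + \<bar>Im z\<bar>) * norm u \<le> Y * norm u" using ZRe(2)[OF that] by (intro mult_right_mono) (auto simp: Y_def)
    then show ?thesis using norm_fibre_scale_le[of "Im z" u] by linarith
  qed
  have bd: "norm (fibre_scale (Im z) (var_field \<gamma> \<gamma>n c (Re z))) \<le> Y * B0" if "z \<in> Z" for z
  proof -
    have "Re z \<in> {Re z0 - \<epsilon> / 2 .. Re z0 + \<epsilon> / 2}" using ZRe(1)[OF that] unfolding atLeastAtMost_iff by linarith
    then have "norm (var_field \<gamma> \<gamma>n c (Re z)) \<le> B0" using B0 by blast
    then show ?thesis using mscY[OF that, of "var_field \<gamma> \<gamma>n c (Re z)"] Y by (meson mult_left_mono less_imp_le order_trans)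
  qed
  have ul: "uniform_limit Z (\<lambda>n z. real n *\<^sub>R (leaf_coord c (\<gamma>n n) z - leaf_coord c \<gamma> z)) (\<lambda>z. fibre_scale (Im z) (var_field \<gamma> \<gamma>n c (Re z))) sequentially"
  proof (rule uniform_limitI)
    fix e' :: real assume "e' > 0"
    then have "e' / Y > 0" using Y by simp
    from uniform_limitD[OF e(4) this]
    show "\<forall>\<^sub>F n in sequentially. \<forall>z\<in>Z. dist (real n *\<^sub>R (leaf_coord c (\<gamma>n n) z - leaf_coord c \<gamma> z)) (fibre_scale (Im z) (var_field \<gamma> \<gamma>n c (Re z))) < e'"
    proof eventually_elim
      case (elim n)
      show ?case
      proof
        fix z assume z: "z \<in> Z"
        have "Re z \<in> {t. \<bar>t - Re z0\<bar> \<le> \<epsilon>}" using ZRe(1)[OF z] e(1) by simp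
        from bspec[OF elim this] have l: "norm (var_quot c \<gamma> \<gamma>n n (Re z) - var_field \<gamma> \<gamma>n c (Re z)) < e' / Y" by (simp add: dist_norm)
        have "real n *\<^sub>R (leaf_coord c (\<gamma>n n) z - leaf_coord c \<gamma> z) - fibre_scale (Im z) (var_field \<gamma> \<gamma>n c (Re z)) =
            fibre_scale (Im z) (var_quot c \<gamma> \<gamma>n n (Re z) - var_field \<gamma> \<gamma>n c (Re z))"
          by (simp add: leaf_coord_def var_quot_def fibre_scale_def scaleR_diff_right mult.commute)
        then have "dist (real n *\<^sub>R (leaf_coord c (\<gamma>n n) z - leaf_coord c \<gamma> z)) (fibre_scale (Im z) (var_field \<gamma> \<gamma>n c (Re z))) \<le>
            Y * norm (var_quot c \<gamma> \<gamma>n n (Re z) - var_field \<gamma> \<gamma>n c (Re z))"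
          using mscY[OF z] by (simp add: dist_norm)
        also have "\<dots> < e'" using l Y by (simp add: field_simps)
        finally show "dist (real n *\<^sub>R (leaf_coord c (\<gamma>n n) z - leaf_coord c \<gamma> z)) (fibre_scale (Im z) (var_field \<gamma> \<gamma>n c (Re z))) < e'" .
      qed
    qed
  qed
  have usd: "\<forall>\<^sub>F n in sequentially. \<forall>z\<in>Z. leaf_coord c (\<gamma>n n) z \<in> cball a0 \<rho>"
    "uniform_limit Z (\<lambda>n z. real n *\<^sub>R (cchart_map c \<Phi> (leaf_coord c (\<gamma>n n) z) - cchart_map c \<Phi> (leaf_coord c \<gamma> z)))
      (\<lambda>z. deriv_at (cchart_map c \<Phi>) (leaf_coord c \<gamma> z) (fibre_scale (Im z) (var_field \<gamma> \<gamma>n c (Re z)))) sequentially"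
    using uniform_scaled_difference[of \<rho> a0 "cchart_map c \<Phi>" "deriv_at (cchart_map c \<Phi>)" Z "leaf_coord c \<gamma>" "\<lambda>n. leaf_coord c (\<gamma>n n)",
      OF \<rho>(1) cchart_map_props(2)[OF W(1) c(1) subsetD[OF \<rho>(2)]] continuous_on_subset[OF cchart_map_props(3)[OF W(1) c(1)] \<rho>(2)] aZ ul bd]
    by auto
  have "\<forall>\<^sub>F n in sequentially. \<forall>z\<in>Z. leaf (\<gamma>n n) z \<in> W \<and> \<gamma>n n (Re z) \<in> dom_of c"
    using usd(1) e(3)
  proof eventually_elim
    case (elim n)
    show ?case
    proof
      fix z assume z: "z \<in> Z"
      have d: "\<gamma>n n (Re z) \<in> dom_of c" using elim(2) ZRe(1)[OF z] e(1) by simp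
      have "leaf_coord c (\<gamma>n n) z \<in> cchart_dom c W" using bspec[OF elim(1) z] \<rho>(2) by blast
      then show "leaf (\<gamma>n n) z \<in> W \<and> \<gamma>n n (Re z) \<in> dom_of c"
        using leaf_cchart_map(2)[OF usn Zs(1)[OF z] c(1) d] d by blast
    qed
  qed
  \<comment> \<open>From index M on, all leaves over the ball Z lie in the domain W of the complex
    chart; the sequence starts there to be holomorphic throughout.\<close>
  then obtain M where M: "\<forall>n\<ge>M. \<forall>z\<in>Z. leaf (\<gamma>n n) z \<in> W \<and> \<gamma>n n (Re z) \<in> dom_of c"
    unfolding eventually_sequentially ..
  define f where "f n z = (real (n + M) *\<^sub>R (\<Phi> (leaf (\<gamma>n (n + M)) z) - \<Phi> (leaf \<gamma> z))) $ i" for n z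
  have "(\<lambda>z. \<xi> \<Phi> \<gamma> \<gamma>n z $ i) holomorphic_on Z"
  proof (rule holomorphic_uniform_sequence[where f = f])
    show "open Z" by (simp add: Z_def)
    show "f n holomorphic_on Z" for n
    proof -
      have 1: "(\<lambda>z. \<Phi> (leaf (\<gamma>n (n + M)) z) $ i) holomorphic_on Z"
        by (rule holomorphic_on_subset[OF leaf_holomorphic(3)[OF usn W(1)]]) (use M Zs(1) in auto)
      have 2: "(\<lambda>z. \<Phi> (leaf \<gamma> z) $ i) holomorphic_on Z"
        by (rule holomorphic_on_subset[OF leaf_holomorphic(3)[OF us W(1)]]) (use Zs in auto)
      have "(\<lambda>z. of_real (real (n + M)) * (\<Phi> (leaf (\<gamma>n (n + M)) z) $ i - \<Phi> (leaf \<gamma> z) $ i)) holomorphic_on Z"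
        by (intro holomorphic_intros 1 2)
      moreover have "f n z = of_real (real (n + M)) * (\<Phi> (leaf (\<gamma>n (n + M)) z) $ i - \<Phi> (leaf \<gamma> z) $ i)" for z
        unfolding f_def vector_scaleR_component vector_minus_component by (rule scaleR_conv_of_real)
      ultimately show ?thesis by (rule holomorphic_transform[OF _ sym])
    qed
    show "\<exists>d>0. cball z d \<subseteq> Z \<and> uniform_limit (cball z d) f (\<lambda>z. \<xi> \<Phi> \<gamma> \<gamma>n z $ i) sequentially" if zZ: "z \<in> Z" for z
    proof -
      have "open Z" by (simp add: Z_def)
      then obtain d where d: "d > 0" "cball z d \<subseteq> Z" using zZ open_contains_cball by blast
      have "uniform_limit Z f (\<lambda>z. \<xi> \<Phi> \<gamma> \<gamma>n z $ i) sequentially"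
      proof (rule uniform_limitI)
        fix e' :: real assume "e' > 0"
        from sequentially_offset[OF uniform_limitD[OF usd(2) this], of M]
        show "\<forall>\<^sub>F n in sequentially. \<forall>z\<in>Z. dist (f n z) (\<xi> \<Phi> \<gamma> \<gamma>n z $ i) < e'"
        proof eventually_elim
          case (elim n)
          show ?case
          proof
            fix z assume z: "z \<in> Z"
            have g1: "\<gamma>n (n + M) (Re z) \<in> dom_of c" using M z by simp
            have "dist (f n z) (\<xi> \<Phi> \<gamma> \<gamma>n z $ i) \<le>
              dist (real (n + M) *\<^sub>R (\<Phi> (leaf (\<gamma>n (n + M)) z) - \<Phi> (leaf \<gamma> z))) (\<xi> \<Phi> \<gamma> \<gamma>n z)"
              unfolding f_def by (rule dist_vec_nth_le)
            also have "\<dots> < e'"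
              using bspec[OF elim z]
              unfolding \<xi>_pointwise(3)[OF v Zs(1)[OF z] W(1) Zs(2)[OF z] c(1) Zs(3)[OF z]]
                leaf_cchart_map(1)[OF us Zs(1)[OF z] c(1) Zs(3)[OF z]] leaf_cchart_map(1)[OF usn Zs(1)[OF z] c(1) g1] .
            finally show "dist (f n z) (\<xi> \<Phi> \<gamma> \<gamma>n z $ i) < e'" .
          qed
        qed
      qed
      then show ?thesis using d uniform_limit_on_subset by blast
    qed
  qed
  then show ?thesis using r(1) unfolding Z_def by blast
qed

end

text \<open>Fields tangent to the leaf have no normal part: p times the direction of the geodesic
  flow and r times a change of the velocity along itself. In \<open>djac\<close> the Christoffel
  term of p a cancels the acceleration of the flow direction.\<close>

lemma (in chart_metric) jac_dependent:
  assumes "\<alpha> *\<^sub>R fst b1 + \<beta> *\<^sub>R fst b2 = p *\<^sub>R snd a"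
  shows "\<alpha> * jac a b1 + \<beta> * jac a b2 = 0"
    "\<alpha> *\<^sub>R snd b1 + \<beta> *\<^sub>R snd b2 = p *\<^sub>R snd (spray a) + r *\<^sub>R snd a \<Longrightarrow> \<alpha> * djac a b1 + \<beta> * djac a b2 = 0"
proof -
  have f: "\<alpha> * fst b1 $ i + \<beta> * fst b2 $ i = p * snd a $ i" for i
    using arg_cong[OF assms, of "\<lambda>x. x $ i"] by simp
  define s where "s = sqrt (det (G (fst a)))"
  have "\<alpha> * jac a b1 + \<beta> * jac a b2 =
      s * (snd a $ 1 * (\<alpha> * fst b1 $ 2 + \<beta> * fst b2 $ 2) - snd a $ 2 * (\<alpha> * fst b1 $ 1 + \<beta> * fst b2 $ 1))"
    by (simp add: jac_def s_def algebra_simps)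
  also have "\<dots> = 0" unfolding f by (simp add: algebra_simps)
  finally show "\<alpha> * jac a b1 + \<beta> * jac a b2 = 0" .
  assume "\<alpha> *\<^sub>R snd b1 + \<beta> *\<^sub>R snd b2 = p *\<^sub>R snd (spray a) + r *\<^sub>R snd a"
  then have z: "\<alpha> * snd b1 $ i + \<beta> * snd b2 $ i = p * snd (spray a) $ i + r * snd a $ i" for i
    by (metis vector_add_component vector_scaleR_component real_scaleR_def)
  define Q where "Q k b = (\<Sum>i\<in>UNIV. \<Sum>j\<in>UNIV. \<Gamma> k i j (fst a) * snd a $ i * fst b $ j)" for k :: 2 and b :: "(real^2) \<times> (real^2)"
  have Q: "\<alpha> * Q k b1 + \<beta> * Q k b2 = - p * snd (spray a) $ k" for k
  proof -
    have "\<alpha> * Q k b1 + \<beta> * Q k b2 = (\<Sum>i\<in>UNIV. \<Sum>j\<in>UNIV. \<Gamma> k i j (fst a) * snd a $ i * (\<alpha> * fst b1 $ j + \<beta> * fst b2 $ j))"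
      by (simp add: Q_def sum_2 algebra_simps)
    also have "\<dots> = - p * snd (spray a) $ k" unfolding f by (simp add: spray_def sum_2 algebra_simps)
    finally show ?thesis .
  qed
  have "\<alpha> * djac a b1 + \<beta> * djac a b2 =
      s * (snd a $ 1 * ((\<alpha> * snd b1 $ 2 + \<beta> * snd b2 $ 2) + (\<alpha> * Q 2 b1 + \<beta> * Q 2 b2))
         - snd a $ 2 * ((\<alpha> * snd b1 $ 1 + \<beta> * snd b2 $ 1) + (\<alpha> * Q 1 b1 + \<beta> * Q 1 b2)))"
    unfolding djac_def Q_def[symmetric] s_def[symmetric] by (simp add: algebra_simps)
  also have "\<dots> = 0" unfolding z Q by (simp add: algebra_simps)
  finally show "\<alpha> * djac a b1 + \<beta> * djac a b2 = 0" .
qed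

context adapted
begin

section \<open>The tangent of a leaf and determinants with it\<close>

definition leaf_deriv :: "(('a, 2) tvec \<Rightarrow> complex^2) \<Rightarrow> (real \<Rightarrow> 'a) \<Rightarrow> complex \<Rightarrow> complex^2"
  where "leaf_deriv \<Phi> \<gamma> z = (\<chi> i. deriv (\<lambda>z. \<Phi> (leaf \<gamma> z) $ i) z)"

lemma leaf_vector_derivative:
  assumes us: "unit_speed_geodesic A g \<gamma>" and z: "z \<in> tube_strip" and W: "(W, \<Phi>) \<in> \<C>" "leaf \<gamma> z \<in> W"
  shows "((\<lambda>t::real. \<Phi> (leaf \<gamma> (z + \<omega> * of_real t))) has_vector_derivative (\<chi> i. \<omega> * leaf_deriv \<Phi> \<gamma> z $ i)) (at 0)"
proof -
  have "((\<lambda>t::real. \<Phi> (leaf \<gamma> (z + \<omega> * of_real t)) $ i) has_vector_derivative \<omega> * leaf_deriv \<Phi> \<gamma> z $ i) (at 0)" for i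
  proof -
    have "((\<lambda>z. \<Phi> (leaf \<gamma> z) $ i) has_field_derivative leaf_deriv \<Phi> \<gamma> z $ i) (at (z + \<omega> * of_real 0))"
      using holomorphic_derivI[OF leaf_holomorphic(3)[OF us W(1), of i] leaf_holomorphic(2)[OF us W(1)], of z] z W(2)
      by (simp add: leaf_deriv_def)
    moreover have "((\<lambda>t. z + \<omega> * of_real t) has_vector_derivative \<omega>) (at (0::real))"
    proof -
      have "((\<lambda>t. z + t *\<^sub>R \<omega>) has_vector_derivative \<omega>) (at (0::real))" by (auto intro!: derivative_eq_intros)
      then show ?thesis by (simp add: scaleR_conv_of_real mult.commute)
    qed
    ultimately show ?thesis
      using field_vector_diff_chain_at[of "\<lambda>t. z + \<omega> * of_real t" \<omega> 0 "\<lambda>z. \<Phi> (leaf \<gamma> z) $ i"] by (simp add: comp_def)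
  qed
  then have "((\<lambda>t. \<Phi> (leaf \<gamma> (z + \<omega> * of_real t)) $ i \<bullet> b) has_derivative (\<lambda>h. h * ((\<omega> * leaf_deriv \<Phi> \<gamma> z $ i) \<bullet> b))) (at 0)" for i b
    using has_derivative_inner_left unfolding has_vector_derivative_def by fastforce
  then show ?thesis
    unfolding has_vector_derivative_def
    by (subst has_derivative_componentwise_within) (auto simp: Basis_vec_def inner_axis)
qed

text \<open>Computes the derivative of the leaf in a real direction \<omega> of the z-plane twice:
  through real coordinates it is the image of P, through holomorphy it is \<omega> times the complex
  derivative.\<close>

lemma leaf_derivative_pos:
  assumes us: "unit_speed_geodesic A g \<gamma>" and z: "z \<in> tube_strip" and W: "(W, \<Phi>) \<in> \<C>" "leaf \<gamma> z \<in> W"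
    and c: "c \<in> A" "\<gamma> (Re z) \<in> dom_of c"
    and P: "((\<lambda>t::real. leaf_coord c \<gamma> (z + \<omega> * of_real t)) has_vector_derivative P) (at 0)"
  shows "deriv_at (cchart_map c \<Phi>) (leaf_coord c \<gamma> z) P = (\<chi> i. \<omega> * leaf_deriv \<Phi> \<gamma> z $ i)"
proof -
  have "leaf_coord c \<gamma> (z + \<omega> * of_real 0) \<in> cchart_dom c W" using leaf_cchart_map(2)[OF us z c] W(2) by simp
  from vector_derivative_diff_chain_within[OF P has_derivative_at_withinI[OF cchart_map_props(2)[OF W(1) c(1) this]]]
  have 1: "((\<lambda>t. cchart_map c \<Phi> (leaf_coord c \<gamma> (z + \<omega> * of_real t))) has_vector_derivative deriv_at (cchart_map c \<Phi>) (leaf_coord c \<gamma> z) P) (at 0)"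
    by (simp add: comp_def)
  define T where "T = {t::real. z + \<omega> * of_real t \<in> tube_strip \<and> \<gamma> (Re (z + \<omega> * of_real t)) \<in> dom_of c}"
  have geo: "geodesic A g \<gamma>" using us by (simp add: unit_speed_geodesic_def)
  have "open ((\<lambda>t::real. z + \<omega> * of_real t) -` tube_strip)"
    by (intro open_vimage open_tube_strip continuous_intros)
  moreover have "open ((\<lambda>t::real. Re (z + \<omega> * of_real t)) -` {t. \<gamma> t \<in> dom_of c})"
    by (intro open_vimage open_times geo c continuous_intros)
  ultimately have oT: "open T" unfolding T_def by (auto simp: vimage_def Collect_conj_eq)
  have 2: "((\<lambda>t. \<Phi> (leaf \<gamma> (z + \<omega> * of_real t))) has_vector_derivative deriv_at (cchart_map c \<Phi>) (leaf_coord c \<gamma> z) P) (at 0)"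
  proof (rule has_vector_derivative_transform_within_open[OF 1 oT])
    show "0 \<in> T" using z c by (simp add: T_def)
    show "cchart_map c \<Phi> (leaf_coord c \<gamma> (z + \<omega> * of_real t)) = \<Phi> (leaf \<gamma> (z + \<omega> * of_real t))" if "t \<in> T" for t
    proof -
      have "z + \<omega> * of_real t \<in> tube_strip" "\<gamma> (Re (z + \<omega> * of_real t)) \<in> dom_of c" using that by (auto simp: T_def)
      from leaf_cchart_map(1)[OF us this(1) c(1) this(2)] show ?thesis by (rule sym)
    qed
  qed
  show ?thesis by (rule vector_derivative_unique_at[OF 2 leaf_vector_derivative[OF us z W]])
qed

text \<open>The directions 1 and \<i> of the z-plane. Together they identify the complex line
  spanned by the tangent of the leaf with the real plane spanned by the scaled flow direction and
  the vertical vector (0, u'), which links the complex structure with the geometry.\<close>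

lemma leaf_deriv_eq:
  assumes us: "unit_speed_geodesic A g \<gamma>" and z: "z \<in> tube_strip" and W: "(W, \<Phi>) \<in> \<C>" "leaf \<gamma> z \<in> W"
    and c: "c \<in> A" "\<gamma> (Re z) \<in> dom_of c"
  shows "deriv_at (cchart_map c \<Phi>) (leaf_coord c \<gamma> z) (fibre_scale (Im z) (chart_metric.spray (g c) (state c \<gamma> (Re z)))) = leaf_deriv \<Phi> \<gamma> z"
    and "deriv_at (cchart_map c \<Phi>) (leaf_coord c \<gamma> z) (0, snd (state c \<gamma> (Re z))) = (\<chi> i. \<i> * leaf_deriv \<Phi> \<gamma> z $ i)"
proof -
  have geo: "geodesic A g \<gamma>" using us by (simp add: unit_speed_geodesic_def)
  define S where "S = chart_metric.spray (g c) (state c \<gamma> (Re z))"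
  have "((\<lambda>t. Re z + t) has_vector_derivative 1) (at (0::real))" by (auto intro!: derivative_eq_intros)
  moreover have "(state c \<gamma> has_vector_derivative S) (at (Re z + 0))"
    using state_derivative[OF geo c] by (simp add: S_def)
  ultimately have "((\<lambda>t. state c \<gamma> (Re z + t)) has_vector_derivative S) (at 0)"
    using vector_diff_chain_at[of "\<lambda>t. Re z + t" 1 0 "state c \<gamma>" S] by (simp add: comp_def)
  moreover have "bounded_linear (fibre_scale (Im z))"
    unfolding fibre_scale_def[abs_def] by (intro bounded_linear_Pair bounded_linear_fst bounded_linear_const_scaleR bounded_linear_snd)
  ultimately have "((\<lambda>t. fibre_scale (Im z) (state c \<gamma> (Re z + t))) has_vector_derivative fibre_scale (Im z) S) (at 0)"
    by (rule bounded_linear.has_vector_derivative[rotated])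
  then have "((\<lambda>t::real. leaf_coord c \<gamma> (z + 1 * of_real t)) has_vector_derivative fibre_scale (Im z) S) (at 0)"
    by (simp add: leaf_coord_def)
  from leaf_derivative_pos[OF us z W c this]
  show "deriv_at (cchart_map c \<Phi>) (leaf_coord c \<gamma> z) (fibre_scale (Im z) (chart_metric.spray (g c) (state c \<gamma> (Re z)))) = leaf_deriv \<Phi> \<gamma> z"
    by (simp add: S_def)
  have "((\<lambda>t. (fst (state c \<gamma> (Re z)), (Im z + t) *\<^sub>R snd (state c \<gamma> (Re z)))) has_vector_derivative (0, snd (state c \<gamma> (Re z)))) (at 0)"
    by (intro has_vector_derivative_Pair) (auto intro!: derivative_eq_intros)
  then have "((\<lambda>t::real. leaf_coord c \<gamma> (z + \<i> * of_real t)) has_vector_derivative (0, snd (state c \<gamma> (Re z)))) (at 0)"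
    by (simp add: leaf_coord_def fibre_scale_def)
  from leaf_derivative_pos[OF us z W c this]
  show "deriv_at (cchart_map c \<Phi>) (leaf_coord c \<gamma> z) (0, snd (state c \<gamma> (Re z))) = (\<chi> i. \<i> * leaf_deriv \<Phi> \<gamma> z $ i)" .
qed

text \<open>The quotient for two variations does not depend on the complex chart \<open>\<Phi>\<close>; on the real axis it
  is the quotient of the normal components \<open>J\<close>.\<close>

definition leaf_det :: "(('a, 2) tvec \<Rightarrow> complex^2) \<Rightarrow> (real \<Rightarrow> 'a) \<Rightarrow> (nat \<Rightarrow> real \<Rightarrow> 'a) \<Rightarrow> complex \<Rightarrow> complex"
  where "leaf_det \<Phi> \<gamma> \<gamma>n z = \<xi> \<Phi> \<gamma> \<gamma>n z $ 1 * leaf_deriv \<Phi> \<gamma> z $ 2 - \<xi> \<Phi> \<gamma> \<gamma>n z $ 2 * leaf_deriv \<Phi> \<gamma> z $ 1"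

text \<open>A vanishing determinant makes the real combination of the two \<xi> a complex multiple
  of the tangent of the leaf. The real derivative L of the chart is injective, so in real
  coordinates the combined variation is tangent to the leaf, and \<open>jac_dependent\<close>
  applies.\<close>

lemma leaf_det_dependent:
  assumes v: "is_variation \<gamma> \<gamma>1" "is_variation \<gamma> \<gamma>2" and z: "z \<in> tube_strip" and W: "(W, \<Phi>) \<in> \<C>" "leaf \<gamma> z \<in> W"
    and c: "c \<in> A" "\<gamma> (Re z) \<in> dom_of c"
    and dep: "of_real \<alpha> * leaf_det \<Phi> \<gamma> \<gamma>1 z + of_real \<beta> * leaf_det \<Phi> \<gamma> \<gamma>2 z = 0"
  shows "\<alpha> * J \<gamma> \<gamma>1 c (Re z) + \<beta> * J \<gamma> \<gamma>2 c (Re z) = 0"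
    "Im z \<noteq> 0 \<Longrightarrow> \<alpha> * J' \<gamma> \<gamma>1 c (Re z) + \<beta> * J' \<gamma> \<gamma>2 c (Re z) = 0"
proof -
  interpret C: chart_metric "g c" "\<Omega> c" by (rule chart_metric_chart[OF c(1)])
  have us: "unit_speed_geodesic A g \<gamma>" using v(1) by (simp add: is_variation_def)
  define L where "L = deriv_at (cchart_map c \<Phi>) (leaf_coord c \<gamma> z)"
  define a where "a = state c \<gamma> (Re z)"
  have aN: "leaf_coord c \<gamma> z \<in> cchart_dom c W" using leaf_cchart_map(2)[OF us z c] W(2) by simp
  have lin: "linear L" unfolding L_def by (rule has_derivative_linear[OF cchart_map_props(2)[OF W(1) c(1) aN]])
  have inj: "u = 0" if "L u = 0" for u using cchart_map_props(4)[OF W(1) c(1) aN] that unfolding L_def by blast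
  have dl1: "L (fibre_scale (Im z) (C.spray a)) = leaf_deriv \<Phi> \<gamma> z" and dl2: "L (0, snd a) = (\<chi> i. \<i> * leaf_deriv \<Phi> \<gamma> z $ i)"
    using leaf_deriv_eq[OF us z W c] by (simp_all add: L_def a_def)
  have x1: "\<xi> \<Phi> \<gamma> \<gamma>1 z = L (fibre_scale (Im z) (var_field \<gamma> \<gamma>1 c (Re z)))" and x2: "\<xi> \<Phi> \<gamma> \<gamma>2 z = L (fibre_scale (Im z) (var_field \<gamma> \<gamma>2 c (Re z)))"
    unfolding L_def using \<xi>_pointwise(3)[OF v(1) z W c] \<xi>_pointwise(3)[OF v(2) z W c] by auto
  have a0: "snd a \<noteq> 0" using unit_state[OF us c] by (auto simp: a_def)
  have dl0: "leaf_deriv \<Phi> \<gamma> z \<noteq> 0"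
  proof
    assume "leaf_deriv \<Phi> \<gamma> z = 0"
    then have "L (0, snd a) = 0" unfolding dl2 by (simp add: vec_eq_iff)
    from inj[OF this] a0 show False by (simp add: zero_prod_def)
  qed
  define u where "u = \<alpha> *\<^sub>R \<xi> \<Phi> \<gamma> \<gamma>1 z + \<beta> *\<^sub>R \<xi> \<Phi> \<gamma> \<gamma>2 z"
  define e where "e = leaf_deriv \<Phi> \<gamma> z"
  have "u $ i = \<alpha> *\<^sub>R \<xi> \<Phi> \<gamma> \<gamma>1 z $ i + \<beta> *\<^sub>R \<xi> \<Phi> \<gamma> \<gamma>2 z $ i" for i
    by (simp only: u_def vector_add_component vector_scaleR_component)
  then have ui: "u $ i = of_real \<alpha> * \<xi> \<Phi> \<gamma> \<gamma>1 z $ i + of_real \<beta> * \<xi> \<Phi> \<gamma> \<gamma>2 z $ i" for i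
    by (simp only: scaleR_conv_of_real)
  have ue: "u $ 1 * e $ 2 = u $ 2 * e $ 1"
    unfolding ui using dep by (simp add: e_def leaf_det_def algebra_simps)
  \<comment> \<open>The tangent e is nonzero, so a vanishing 2 by 2 determinant means
    proportionality, with the factor read from a nonzero component of e.\<close>
  have "\<exists>l. \<forall>i. u $ i = l * e $ i"
  proof (cases "e $ 1 = 0")
    case True
    then have "e $ 2 \<noteq> 0" using dl0 by (auto simp: e_def vec_eq_iff forall_2)
    then show ?thesis using ue True by (intro exI[of _ "u $ 2 / e $ 2"]) (simp add: forall_2)
  next
    case False
    then show ?thesis using ue by (intro exI[of _ "u $ 1 / e $ 1"]) (simp add: forall_2 field_simps)
  qed
  then obtain l where l: "\<forall>i. u $ i = l * e $ i" ..
  \<comment> \<open>The complex factor splits into real coefficients of e and \<i> e, the images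
    under L of the flow direction and the vertical vector.\<close>
  define p q where "p = Re l" and "q = Im l"
  have "u = p *\<^sub>R e + q *\<^sub>R (\<chi> i. \<i> * e $ i)"
  proof (rule vec_eq_iff[THEN iffD2], rule allI)
    fix i
    have "l = of_real p + of_real q * \<i>" unfolding p_def q_def using complex_eq[of l] by (simp add: mult.commute)
    then have "u $ i = p *\<^sub>R e $ i + q *\<^sub>R (\<i> * e $ i)"
      using l by (simp add: scaleR_conv_of_real algebra_simps)
    then show "u $ i = (p *\<^sub>R e + q *\<^sub>R (\<chi> i. \<i> * e $ i)) $ i"
      by (simp only: vector_add_component vector_scaleR_component vec_lambda_beta)
  qed
  then have "L (\<alpha> *\<^sub>R fibre_scale (Im z) (var_field \<gamma> \<gamma>1 c (Re z)) + \<beta> *\<^sub>R fibre_scale (Im z) (var_field \<gamma> \<gamma>2 c (Re z))) =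
     L (p *\<^sub>R fibre_scale (Im z) (C.spray a) + q *\<^sub>R (0, snd a))"
    unfolding linear_add[OF lin] linear_cmul[OF lin] dl1 dl2 x1[symmetric] x2[symmetric] u_def e_def .
  then have "L ((\<alpha> *\<^sub>R fibre_scale (Im z) (var_field \<gamma> \<gamma>1 c (Re z)) + \<beta> *\<^sub>R fibre_scale (Im z) (var_field \<gamma> \<gamma>2 c (Re z))) -
     (p *\<^sub>R fibre_scale (Im z) (C.spray a) + q *\<^sub>R (0, snd a))) = 0"
    unfolding linear_diff[OF lin] by (simp only: diff_self)
  from inj[OF this]
  have "\<alpha> *\<^sub>R fibre_scale (Im z) (var_field \<gamma> \<gamma>1 c (Re z)) + \<beta> *\<^sub>R fibre_scale (Im z) (var_field \<gamma> \<gamma>2 c (Re z)) =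
     p *\<^sub>R fibre_scale (Im z) (C.spray a) + q *\<^sub>R (0, snd a)"
    by (simp only: right_minus_eq)
  then have e1: "\<alpha> *\<^sub>R fst (var_field \<gamma> \<gamma>1 c (Re z)) + \<beta> *\<^sub>R fst (var_field \<gamma> \<gamma>2 c (Re z)) = p *\<^sub>R snd a"
    and e2: "\<alpha> *\<^sub>R (Im z *\<^sub>R snd (var_field \<gamma> \<gamma>1 c (Re z))) + \<beta> *\<^sub>R (Im z *\<^sub>R snd (var_field \<gamma> \<gamma>2 c (Re z))) =
       p *\<^sub>R (Im z *\<^sub>R snd (C.spray a)) + q *\<^sub>R snd a"
    by (simp_all add: fibre_scale_def prod_eq_iff C.spray_def)
  show "\<alpha> * J \<gamma> \<gamma>1 c (Re z) + \<beta> * J \<gamma> \<gamma>2 c (Re z) = 0"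
    using C.jac_dependent(1)[OF e1] by (simp add: J_def a_def)
  \<comment> \<open>Velocities enter scaled by Im z; only off the real axis can this factor be
    divided out to recover a relation for J'.\<close>
  assume y: "Im z \<noteq> 0"
  have "\<alpha> *\<^sub>R snd (var_field \<gamma> \<gamma>1 c (Re z)) + \<beta> *\<^sub>R snd (var_field \<gamma> \<gamma>2 c (Re z)) =
      p *\<^sub>R snd (C.spray a) + (q / Im z) *\<^sub>R snd a"
  proof (rule vec_eq_iff[THEN iffD2], rule allI)
    fix i
    have "Im z * (\<alpha> * snd (var_field \<gamma> \<gamma>1 c (Re z)) $ i + \<beta> * snd (var_field \<gamma> \<gamma>2 c (Re z)) $ i) =
        Im z * (p * snd (C.spray a) $ i + (q / Im z) * snd a $ i)"
      using arg_cong[OF e2, of "\<lambda>x. x $ i"] y by (simp add: algebra_simps)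
    then show "(\<alpha> *\<^sub>R snd (var_field \<gamma> \<gamma>1 c (Re z)) + \<beta> *\<^sub>R snd (var_field \<gamma> \<gamma>2 c (Re z))) $ i =
        (p *\<^sub>R snd (C.spray a) + (q / Im z) *\<^sub>R snd a) $ i" using y by simp
  qed
  from C.jac_dependent(2)[OF e1 this]
  show "\<alpha> * J' \<gamma> \<gamma>1 c (Re z) + \<beta> * J' \<gamma> \<gamma>2 c (Re z) = 0" by (simp add: J'_def a_def)
qed

text \<open>On the real axis \<open>fibre_scale\<close> by 0 discards the velocity parts. A relation
  between the J alone then makes the combined position parts proportional to u', hence the combined
  \<xi> proportional to the tangent of the leaf.\<close>

lemma leaf_det_real_axis:
  assumes v: "is_variation \<gamma> \<gamma>1" "is_variation \<gamma> \<gamma>2" and z: "z \<in> tube_strip" and W: "(W, \<Phi>) \<in> \<C>" "leaf \<gamma> z \<in> W"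
    and c: "c \<in> A" "\<gamma> (Re z) \<in> dom_of c" and y: "Im z = 0"
    and dep: "\<alpha> * J \<gamma> \<gamma>1 c (Re z) + \<beta> * J \<gamma> \<gamma>2 c (Re z) = 0"
  shows "of_real \<alpha> * leaf_det \<Phi> \<gamma> \<gamma>1 z + of_real \<beta> * leaf_det \<Phi> \<gamma> \<gamma>2 z = 0"
proof -
  interpret C: chart_metric "g c" "\<Omega> c" by (rule chart_metric_chart[OF c(1)])
  have us: "unit_speed_geodesic A g \<gamma>" using v(1) by (simp add: is_variation_def)
  define L where "L = deriv_at (cchart_map c \<Phi>) (leaf_coord c \<gamma> z)"
  define a where "a = state c \<gamma> (Re z)"
  have aN: "leaf_coord c \<gamma> z \<in> cchart_dom c W" using leaf_cchart_map(2)[OF us z c] W(2) by simp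
  have lin: "linear L" unfolding L_def by (rule has_derivative_linear[OF cchart_map_props(2)[OF W(1) c(1) aN]])
  have dl1: "L (fibre_scale (Im z) (C.spray a)) = leaf_deriv \<Phi> \<gamma> z" using leaf_deriv_eq(1)[OF us z W c] by (simp add: L_def a_def)
  have x1: "\<xi> \<Phi> \<gamma> \<gamma>1 z = L (fibre_scale (Im z) (var_field \<gamma> \<gamma>1 c (Re z)))" and x2: "\<xi> \<Phi> \<gamma> \<gamma>2 z = L (fibre_scale (Im z) (var_field \<gamma> \<gamma>2 c (Re z)))"
    unfolding L_def using \<xi>_pointwise(3)[OF v(1) z W c] \<xi>_pointwise(3)[OF v(2) z W c] by auto
  have a0: "snd a \<noteq> 0" using unit_state[OF us c] by (auto simp: a_def)
  define w where "w = \<alpha> *\<^sub>R fst (var_field \<gamma> \<gamma>1 c (Re z)) + \<beta> *\<^sub>R fst (var_field \<gamma> \<gamma>2 c (Re z))"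
  have s0: "sqrt (det (g c (fst a))) \<noteq> 0" using C.det_pos[OF state_\<Omega>[of \<gamma> "Re z" c, OF c(2)]] by (simp add: a_def)
  have "sqrt (det (g c (fst a))) * (snd a $ 1 * w $ 2 - snd a $ 2 * w $ 1) = 0"
    using dep by (simp add: J_def C.jac_def a_def w_def algebra_simps)
  then have we: "snd a $ 1 * w $ 2 = snd a $ 2 * w $ 1" using s0 by simp
  have "\<exists>p. w = p *\<^sub>R snd a"
  proof (cases "snd a $ 1 = 0")
    case True
    then have "snd a $ 2 \<noteq> 0" using a0 by (auto simp: vec_eq_iff forall_2)
    then show ?thesis using we True by (intro exI[of _ "w $ 2 / snd a $ 2"]) (simp add: vec_eq_iff forall_2)
  next
    case False
    then show ?thesis using we by (intro exI[of _ "w $ 1 / snd a $ 1"]) (simp add: vec_eq_iff forall_2 field_simps)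
  qed
  then obtain p where p: "w = p *\<^sub>R snd a" ..
  have "\<alpha> *\<^sub>R fibre_scale (Im z) (var_field \<gamma> \<gamma>1 c (Re z)) + \<beta> *\<^sub>R fibre_scale (Im z) (var_field \<gamma> \<gamma>2 c (Re z)) = p *\<^sub>R fibre_scale (Im z) (C.spray a)"
    using p by (simp add: fibre_scale_def y w_def C.spray_def prod_eq_iff)
  then have "L (\<alpha> *\<^sub>R fibre_scale (Im z) (var_field \<gamma> \<gamma>1 c (Re z)) + \<beta> *\<^sub>R fibre_scale (Im z) (var_field \<gamma> \<gamma>2 c (Re z))) = L (p *\<^sub>R fibre_scale (Im z) (C.spray a))"
    by (rule arg_cong)
  then have u: "\<alpha> *\<^sub>R \<xi> \<Phi> \<gamma> \<gamma>1 z + \<beta> *\<^sub>R \<xi> \<Phi> \<gamma> \<gamma>2 z = p *\<^sub>R leaf_deriv \<Phi> \<gamma> z"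
    unfolding linear_add[OF lin] linear_cmul[OF lin] dl1 x1[symmetric] x2[symmetric] .
  have "\<alpha> *\<^sub>R \<xi> \<Phi> \<gamma> \<gamma>1 z $ i + \<beta> *\<^sub>R \<xi> \<Phi> \<gamma> \<gamma>2 z $ i = p *\<^sub>R leaf_deriv \<Phi> \<gamma> z $ i" for i
    using arg_cong[OF u, of "\<lambda>x. x $ i"] by (simp only: vector_add_component vector_scaleR_component)
  then have ui: "of_real \<alpha> * \<xi> \<Phi> \<gamma> \<gamma>1 z $ i + of_real \<beta> * \<xi> \<Phi> \<gamma> \<gamma>2 z $ i = of_real p * leaf_deriv \<Phi> \<gamma> z $ i" for i
    by (simp only: scaleR_conv_of_real)
  have "of_real \<alpha> * leaf_det \<Phi> \<gamma> \<gamma>1 z + of_real \<beta> * leaf_det \<Phi> \<gamma> \<gamma>2 z =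
     (of_real \<alpha> * \<xi> \<Phi> \<gamma> \<gamma>1 z $ 1 + of_real \<beta> * \<xi> \<Phi> \<gamma> \<gamma>2 z $ 1) * leaf_deriv \<Phi> \<gamma> z $ 2
     - (of_real \<alpha> * \<xi> \<Phi> \<gamma> \<gamma>1 z $ 2 + of_real \<beta> * \<xi> \<Phi> \<gamma> \<gamma>2 z $ 2) * leaf_deriv \<Phi> \<gamma> z $ 1"
    by (simp add: leaf_det_def algebra_simps)
  also have "\<dots> = 0" unfolding ui by (simp add: algebra_simps)
  finally show ?thesis .
qed

text \<open>A holomorphic change of chart acts on both columns of the determinant by the same
  complex linear D, so it multiplies the determinant by det D. This factor is the same for all
  variations and cancels in quotients.\<close>

lemma leaf_det_change:
  assumes us: "unit_speed_geodesic A g \<gamma>" and z: "z \<in> tube_strip"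
    and W: "(W, \<Phi>) \<in> \<C>" "leaf \<gamma> z \<in> W" and V: "(V, \<Psi>) \<in> \<C>" "leaf \<gamma> z \<in> V"
  shows "\<exists>\<delta>. \<forall>\<gamma>n. is_variation \<gamma> \<gamma>n \<longrightarrow> leaf_det \<Psi> \<gamma> \<gamma>n z = \<delta> * leaf_det \<Phi> \<gamma> \<gamma>n z"
proof -
  obtain c where c: "c \<in> A" "\<gamma> (Re z) \<in> dom_of c" using chart_ex by blast
  define T where "T = \<Psi> \<circ> inv_into W \<Phi>"
  have injW: "inj_on \<Phi> W" using catlas W(1) unfolding complex_atlas_def by blast
  have Tinv: "T (\<Phi> u) = \<Psi> u" if "u \<in> W" for u using inv_into_f_f[OF injW that] by (simp add: T_def)
  have "\<forall>(W, \<Phi>)\<in>\<C>. \<forall>(V, \<Psi>)\<in>\<C>. \<forall>z\<in>\<Phi> ` (W \<inter> V). complex_differentiable_at (\<Psi> \<circ> inv_into W \<Phi>) z"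
    using catlas unfolding complex_atlas_def by (elim conjE)
  from bspec[OF bspec[OF this W(1), unfolded prod.case] V(1), unfolded prod.case]
  have "\<forall>z\<in>\<Phi> ` (W \<inter> V). complex_differentiable_at T z" unfolding T_def .
  then have "complex_differentiable_at T (\<Phi> (leaf \<gamma> z))" using W(2) V(2) by blast
  then obtain D where D: "(T has_derivative D) (at (\<Phi> (leaf \<gamma> z)))" "\<forall>c v. D (c *s v) = c *s D v"
    unfolding complex_differentiable_at_def by (elim exE conjE)
  note Dlin = has_derivative_linear[OF D(1)]
  \<comment> \<open>Here complex linearity enters: D is determined by its values on the complex
    basis, so \<delta> is a complex 2 by 2 determinant.\<close>
  have Dv: "D v $ i = v $ 1 * D (axis 1 1) $ i + v $ 2 * D (axis 2 1) $ i" for v i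
  proof -
    have "v = v $ 1 *s axis 1 1 + v $ 2 *s axis 2 1" by (simp add: vec_eq_iff forall_2 axis_def)
    then have "D v = v $ 1 *s D (axis 1 1) + v $ 2 *s D (axis 2 1)"
      using linear_add[OF Dlin, of "v $ 1 *s axis 1 1" "v $ 2 *s axis 2 1"] D(2) by simp
    then show ?thesis by simp
  qed
  have leaf_deriv: "leaf_deriv \<Psi> \<gamma> z = D (leaf_deriv \<Phi> \<gamma> z)"
  proof -
    have 1: "((\<lambda>t::real. \<Phi> (leaf \<gamma> (z + 1 * of_real t))) has_vector_derivative leaf_deriv \<Phi> \<gamma> z) (at 0)"
      using leaf_vector_derivative[OF us z W, of 1] by simp
    have "(T has_derivative D) (at (\<Phi> (leaf \<gamma> (z + 1 * of_real 0))))" using D(1) by simp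
    from vector_derivative_diff_chain_within[OF 1 has_derivative_at_withinI[OF this]]
    have 2: "((\<lambda>t::real. T (\<Phi> (leaf \<gamma> (z + 1 * of_real t)))) has_vector_derivative D (leaf_deriv \<Phi> \<gamma> z)) (at 0)"
      by (simp add: comp_def)
    have "open ((\<lambda>t::real. z + 1 * of_real t) -` (tube_strip \<inter> leaf \<gamma> -` W))"
      by (intro open_vimage leaf_holomorphic(2)[OF us W(1)] continuous_intros)
    then have 3: "((\<lambda>t::real. \<Psi> (leaf \<gamma> (z + 1 * of_real t))) has_vector_derivative D (leaf_deriv \<Phi> \<gamma> z)) (at 0)"
      by (rule has_vector_derivative_transform_within_open[OF 2]) (use z W(2) Tinv in auto)
    show ?thesis using vector_derivative_unique_at[OF leaf_vector_derivative[OF us z V, of 1] 3] by simp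
  qed
  define \<delta> where "\<delta> = D (axis 1 1) $ 1 * D (axis 2 1) $ 2 - D (axis 1 1) $ 2 * D (axis 2 1) $ 1"
  have "leaf_det \<Psi> \<gamma> \<gamma>n z = \<delta> * leaf_det \<Phi> \<gamma> \<gamma>n z" if v: "is_variation \<gamma> \<gamma>n" for \<gamma>n
  proof -
    have lim: "(\<lambda>n. real n *\<^sub>R (\<Phi> (leaf (\<gamma>n n) z) - \<Phi> (leaf \<gamma> z))) \<longlonglongrightarrow> \<xi> \<Phi> \<gamma> \<gamma>n z"
      using \<xi>_pointwise(2)[OF v z W c] unfolding \<xi>_pointwise(3)[OF v z W c] .
    from scaled_difference_tendsto(2)[OF D(1) lim]
    have "(\<lambda>n. real n *\<^sub>R (T (\<Phi> (leaf (\<gamma>n n) z)) - T (\<Phi> (leaf \<gamma> z)))) \<longlonglongrightarrow> D (\<xi> \<Phi> \<gamma> \<gamma>n z)" .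
    moreover have "\<forall>\<^sub>F n in sequentially. real n *\<^sub>R (T (\<Phi> (leaf (\<gamma>n n) z)) - T (\<Phi> (leaf \<gamma> z))) =
        real n *\<^sub>R (\<Psi> (leaf (\<gamma>n n) z) - \<Psi> (leaf \<gamma> z))"
      using \<xi>_pointwise(1)[OF v z W c] by eventually_elim (simp add: Tinv W(2))
    ultimately have "(\<lambda>n. real n *\<^sub>R (\<Psi> (leaf (\<gamma>n n) z) - \<Psi> (leaf \<gamma> z))) \<longlonglongrightarrow> D (\<xi> \<Phi> \<gamma> \<gamma>n z)"
      by (rule Lim_transform_eventually)
    then have xi: "\<xi> \<Psi> \<gamma> \<gamma>n z = D (\<xi> \<Phi> \<gamma> \<gamma>n z)" unfolding \<xi>_def by (rule limI)
    show ?thesis unfolding leaf_det_def xi leaf_deriv Dv[of "\<xi> \<Phi> \<gamma> \<gamma>n z"] Dv[of "leaf_deriv \<Phi> \<gamma> z"] \<delta>_def by (simp add: algebra_simps)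
  qed
  then show ?thesis by blast
qed

lemma leaf_det_holomorphic:
  assumes v: "is_variation \<gamma> \<gamma>n" and z: "z \<in> tube_strip" and W: "(W, \<Phi>) \<in> \<C>" "leaf \<gamma> z \<in> W"
  shows "\<exists>r>0. ball z r \<subseteq> tube_strip \<inter> leaf \<gamma> -` W \<and> leaf_det \<Phi> \<gamma> \<gamma>n holomorphic_on ball z r"
proof -
  have us: "unit_speed_geodesic A g \<gamma>" using v by (simp add: is_variation_def)
  obtain r1 where r1: "r1 > 0" "(\<lambda>z. \<xi> \<Phi> \<gamma> \<gamma>n z $ 1) holomorphic_on ball z r1" using \<xi>_holomorphic[OF v z W] by blast
  obtain r2 where r2: "r2 > 0" "(\<lambda>z. \<xi> \<Phi> \<gamma> \<gamma>n z $ 2) holomorphic_on ball z r2" using \<xi>_holomorphic[OF v z W] by blast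
  note oL = leaf_holomorphic(2)[OF us W(1)]
  obtain r3 where r3: "r3 > 0" "ball z r3 \<subseteq> tube_strip \<inter> leaf \<gamma> -` W"
    using oL z W(2) open_contains_ball by blast
  define r where "r = min r1 (min r2 r3)"
  have r: "r > 0" "ball z r \<subseteq> ball z r1" "ball z r \<subseteq> ball z r2" "ball z r \<subseteq> ball z r3"
    using r1(1) r2(1) r3(1) by (auto simp: r_def)
  have dlh: "(\<lambda>z. leaf_deriv \<Phi> \<gamma> z $ i) holomorphic_on ball z r" for i
    using holomorphic_on_subset[OF holomorphic_deriv[OF leaf_holomorphic(3)[OF us W(1), of i] oL] order_trans[OF r(4) r3(2)]]
    by (simp add: leaf_deriv_def)
  have "leaf_det \<Phi> \<gamma> \<gamma>n holomorphic_on ball z r"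
    unfolding leaf_det_def[abs_def]
    by (intro holomorphic_intros dlh holomorphic_on_subset[OF r1(2) r(2)] holomorphic_on_subset[OF r2(2) r(3)])
  then show ?thesis using r(1) order_trans[OF r(4) r3(2)] by blast
qed

text \<open>Dividing two determinants with the tangent of the leaf compares the variations modulo
  that tangent, so no complement to it has to be chosen. The Wronskian, equal to 1, turns any real
  relation between the determinants off the real axis into a trivial one.\<close>

lemma jacobi_quotient_extension:
  assumes v: "is_variation \<gamma> \<gamma>1" "is_variation \<gamma> \<gamma>2" and c0: "c0 \<in> A" "\<gamma> 0 \<in> dom_of c0"
    and init: "J \<gamma> \<gamma>1 c0 0 = 1" "J' \<gamma> \<gamma>1 c0 0 = 0" "J \<gamma> \<gamma>2 c0 0 = 0" "J' \<gamma> \<gamma>2 c0 0 = 1" and R: "0 < R"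
  shows "\<exists>H r. 0 < r \<and> H holomorphic_on (tube_strip \<inter> {z. Im z > 0}) \<union> ball 0 r \<and>
    (\<forall>z\<in>tube_strip \<inter> {z. Im z > 0}. Im (H z) \<noteq> 0) \<and>
    (\<forall>x::real. \<bar>x\<bar> < r \<longrightarrow> \<gamma> x \<in> dom_of c0 \<and> J \<gamma> \<gamma>1 c0 x \<noteq> 0 \<and> H (of_real x) = of_real (J \<gamma> \<gamma>2 c0 x / J \<gamma> \<gamma>1 c0 x))"
proof -
  have us: "unit_speed_geodesic A g \<gamma>" using v(1) by (simp add: is_variation_def)
  \<comment> \<open>The points at which the denominator is certain not to vanish: all points off the
    real axis, and those real points where J of the first variation is nonzero in every
    chart.\<close>
  define adm where "adm z \<longleftrightarrow> z \<in> tube_strip \<and> (Im z \<noteq> 0 \<or> (\<forall>c\<in>A. \<gamma> (Re z) \<in> dom_of c \<longrightarrow> J \<gamma> \<gamma>1 c (Re z) \<noteq> 0))" for z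
  have indep: "\<alpha> = 0 \<and> \<beta> = 0" if "z \<in> tube_strip" "Im z \<noteq> 0" "(W, \<Phi>) \<in> \<C>" "leaf \<gamma> z \<in> W"
     "of_real \<alpha> * leaf_det \<Phi> \<gamma> \<gamma>1 z + of_real \<beta> * leaf_det \<Phi> \<gamma> \<gamma>2 z = 0" for \<alpha> \<beta> z W \<Phi>
  proof -
    obtain c where c: "c \<in> A" "\<gamma> (Re z) \<in> dom_of c" using chart_ex by blast
    define a1 a2 b1 b2 where "a1 = J \<gamma> \<gamma>1 c (Re z)" and "a2 = J' \<gamma> \<gamma>1 c (Re z)"
      and "b1 = J \<gamma> \<gamma>2 c (Re z)" and "b2 = J' \<gamma> \<gamma>2 c (Re z)"
    have 1: "\<alpha> * a1 + \<beta> * b1 = 0" and 2: "\<alpha> * a2 + \<beta> * b2 = 0"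
      using leaf_det_dependent[OF v that(1,3,4) c that(5)] that(2) by (auto simp: a1_def a2_def b1_def b2_def)
    \<comment> \<open>The Wronskian is the determinant of the linear system 1, 2 for \<alpha> and
      \<beta>, so both are 0.\<close>
    have w: "a1 * b2 - b1 * a2 = 1"
      using wronskian[OF v c c0] init by (simp add: a1_def a2_def b1_def b2_def)
    have "\<alpha> * (a1 * b2 - b1 * a2) = (\<alpha> * a1 + \<beta> * b1) * b2 - (\<alpha> * a2 + \<beta> * b2) * b1" by (simp add: algebra_simps)
    moreover have "\<beta> * (a1 * b2 - b1 * a2) = (\<alpha> * a2 + \<beta> * b2) * a1 - (\<alpha> * a1 + \<beta> * b1) * a2" by (simp add: algebra_simps)
    ultimately show ?thesis unfolding 1 2 w by simp
  qed
  have D1: "leaf_det \<Phi> \<gamma> \<gamma>1 z \<noteq> 0" if "adm z" "(W, \<Phi>) \<in> \<C>" "leaf \<gamma> z \<in> W" for z W \<Phi>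
  proof
    assume 0: "leaf_det \<Phi> \<gamma> \<gamma>1 z = 0"
    obtain c where c: "c \<in> A" "\<gamma> (Re z) \<in> dom_of c" using chart_ex by blast
    have z: "z \<in> tube_strip" using that(1) by (simp add: adm_def)
    have dep: "of_real 1 * leaf_det \<Phi> \<gamma> \<gamma>1 z + of_real 0 * leaf_det \<Phi> \<gamma> \<gamma>2 z = 0" using 0 by simp
    show False
    proof (cases "Im z = 0")
      case True
      then have "J \<gamma> \<gamma>1 c (Re z) \<noteq> 0" using that(1) c by (simp add: adm_def)
      then show False using leaf_det_dependent(1)[OF v z that(2,3) c dep] by simp
    next
      case False then show False using indep[OF z False that(2,3) dep] by simp
    qed
  qed
  \<comment> \<open>An arbitrary complex chart for each point. By \<open>leaf_det_change\<close> the
    quotient equals the one in any other chart around the point, so near a point one fixed chart may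
    be used to see that H is holomorphic.\<close>
  define ch where "ch z = (SOME P. P \<in> \<C> \<and> leaf \<gamma> z \<in> fst P)" for z
  have ch: "(fst (ch z), snd (ch z)) \<in> \<C>" "leaf \<gamma> z \<in> fst (ch z)" if z: "z \<in> tube_strip" for z
  proof -
    have "\<exists>P. P \<in> \<C> \<and> leaf \<gamma> z \<in> fst P" using cchart_ex[OF us z] by auto
    from someI_ex[OF this] show "(fst (ch z), snd (ch z)) \<in> \<C>" "leaf \<gamma> z \<in> fst (ch z)" by (simp_all add: ch_def)
  qed
  define H where "H z = leaf_det (snd (ch z)) \<gamma> \<gamma>2 z / leaf_det (snd (ch z)) \<gamma> \<gamma>1 z" for z
  have H: "H z = leaf_det \<Phi> \<gamma> \<gamma>2 z / leaf_det \<Phi> \<gamma> \<gamma>1 z" if a: "adm z" and W: "(W, \<Phi>) \<in> \<C>" "leaf \<gamma> z \<in> W" for z W \<Phi>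
  proof -
    have z: "z \<in> tube_strip" using a by (simp add: adm_def)
    obtain \<delta> where "\<forall>\<gamma>n. is_variation \<gamma> \<gamma>n \<longrightarrow> leaf_det (snd (ch z)) \<gamma> \<gamma>n z = \<delta> * leaf_det \<Phi> \<gamma> \<gamma>n z"
      using leaf_det_change[OF us z W ch[OF z]] by (elim exE)
    then have d: "leaf_det (snd (ch z)) \<gamma> \<gamma>1 z = \<delta> * leaf_det \<Phi> \<gamma> \<gamma>1 z" "leaf_det (snd (ch z)) \<gamma> \<gamma>2 z = \<delta> * leaf_det \<Phi> \<gamma> \<gamma>2 z"
      using v by simp_all
    have "\<delta> \<noteq> 0" using D1[OF a ch[OF z]] d(1) by auto
    then show ?thesis unfolding H_def d by simp
  qed
  have Hdiff: "H field_differentiable (at z)" if a: "\<forall>w\<in>ball z e. adm w" "e > 0" for z e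
  proof -
    have z: "z \<in> tube_strip" using a by (auto simp: adm_def)
    note W = ch[OF z]
    obtain r1 where r1: "r1 > 0" "ball z r1 \<subseteq> tube_strip \<inter> leaf \<gamma> -` fst (ch z)" "leaf_det (snd (ch z)) \<gamma> \<gamma>1 holomorphic_on ball z r1"
      using leaf_det_holomorphic[OF v(1) z W] by (elim exE conjE)
    obtain r2 where r2: "r2 > 0" "ball z r2 \<subseteq> tube_strip \<inter> leaf \<gamma> -` fst (ch z)" "leaf_det (snd (ch z)) \<gamma> \<gamma>2 holomorphic_on ball z r2"
      using leaf_det_holomorphic[OF v(2) z W] by (elim exE conjE)
    define r where "r = min e (min r1 r2)"
    have r: "r > 0" "ball z r \<subseteq> ball z e" "ball z r \<subseteq> ball z r1" "ball z r \<subseteq> ball z r2"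
      using a(2) r1(1) r2(1) by (auto simp: r_def)
    have nz: "leaf_det (snd (ch z)) \<gamma> \<gamma>1 w \<noteq> 0" and Hw: "H w = leaf_det (snd (ch z)) \<gamma> \<gamma>2 w / leaf_det (snd (ch z)) \<gamma> \<gamma>1 w" if "w \<in> ball z r" for w
    proof -
      have aw: "adm w" using a(1) r(2) that by blast
      have Lw: "leaf \<gamma> w \<in> fst (ch z)" using r1(2) r(3) that by blast
      show "leaf_det (snd (ch z)) \<gamma> \<gamma>1 w \<noteq> 0" by (rule D1[OF aw W(1) Lw])
      show "H w = leaf_det (snd (ch z)) \<gamma> \<gamma>2 w / leaf_det (snd (ch z)) \<gamma> \<gamma>1 w" by (rule H[OF aw W(1) Lw])
    qed
    have "(\<lambda>w. leaf_det (snd (ch z)) \<gamma> \<gamma>2 w / leaf_det (snd (ch z)) \<gamma> \<gamma>1 w) holomorphic_on ball z r"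
      by (intro holomorphic_intros holomorphic_on_subset[OF r1(3) r(3)] holomorphic_on_subset[OF r2(3) r(4)] nz)
    then have "H holomorphic_on ball z r" by (rule holomorphic_transform) (simp add: Hw)
    then show ?thesis using r(1) by (simp add: holomorphic_on_imp_differentiable_at)
  qed
  have geo: "geodesic A g \<gamma>" by (rule is_variation_geodesic(1)[OF v(1)])
  have "\<exists>r>0. \<forall>x. \<bar>x\<bar> < r \<longrightarrow> \<gamma> x \<in> dom_of c0 \<and> J \<gamma> \<gamma>1 c0 x \<noteq> 0"
  proof -
    have "isCont (J \<gamma> \<gamma>1 c0) 0" by (rule DERIV_isCont[OF J_derivative(1)[OF v(1) c0]])
    from continuous_at_avoid[OF this, of 0] init(1) obtain r1 where r1: "r1 > 0" "\<And>y. dist 0 y < r1 \<Longrightarrow> J \<gamma> \<gamma>1 c0 y \<noteq> 0" by auto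
    have "0 \<in> {t. \<gamma> t \<in> dom_of c0}" using c0(2) by simp
    then obtain r2 where r2: "r2 > 0" "ball 0 r2 \<subseteq> {t. \<gamma> t \<in> dom_of c0}"
      using open_times[OF geo c0(1)] open_contains_ball by blast
    show ?thesis using r1 r2 by (intro exI[of _ "min r1 r2"]) (auto simp: subset_eq)
  qed
  then obtain r0 where r0: "r0 > 0" "\<forall>x. \<bar>x\<bar> < r0 \<longrightarrow> \<gamma> x \<in> dom_of c0 \<and> J \<gamma> \<gamma>1 c0 x \<noteq> 0" by (elim exE conjE)
  have "0 \<in> tube_strip" using R by (simp add: tube_strip_def zero_ereal_def)
  then obtain r1 where r1: "r1 > 0" "ball 0 r1 \<subseteq> tube_strip" using open_tube_strip open_contains_ball by blast
  define r where "r = min r0 r1"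
  have r: "r > 0" "r \<le> r0" "r \<le> r1" using r0(1) r1(1) by (auto simp: r_def)
  have adm_ball: "adm z" if "z \<in> ball 0 r" for z
  proof -
    have "norm z < r" using that by simp
    then have x: "\<bar>Re z\<bar> < r0" using abs_Re_le_cmod[of z] r(2) by linarith
    have "z \<in> ball 0 r1" using that r(3) by simp
    then have "z \<in> tube_strip" using r1(2) by blast
    moreover have "J \<gamma> \<gamma>1 c (Re z) \<noteq> 0" if c: "c \<in> A" "\<gamma> (Re z) \<in> dom_of c" for c
    proof -
      have d: "\<gamma> (Re z) \<in> dom_of c0" "J \<gamma> \<gamma>1 c0 (Re z) \<noteq> 0" using r0(2) x by auto
      show ?thesis using J_change[OF v(1) c(1) c0(1) c(2) d(1)] d(2) by auto
    qed
    ultimately show ?thesis by (simp add: adm_def)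
  qed
  define Up where "Up = tube_strip \<inter> {z. Im z > 0}"
  have oUp: "open Up" unfolding Up_def by (intro open_Int open_tube_strip open_halfspace_Im_gt)
  have "H holomorphic_on Up \<union> ball 0 r"
  proof (rule holomorphic_onI)
    fix z assume z: "z \<in> Up \<union> ball 0 r"
    have "open (Up \<union> ball 0 r)" using oUp by blast
    then obtain e where e: "e > 0" "ball z e \<subseteq> Up \<union> ball 0 r" using z open_contains_ball by blast
    have "\<forall>w\<in>ball z e. adm w"
    proof
      fix w assume "w \<in> ball z e"
      then have "w \<in> Up \<or> w \<in> ball 0 r" using e(2) by blast
      then show "adm w" using adm_ball by (auto simp: Up_def adm_def)
    qed
    from Hdiff[OF this e(1)] show "H field_differentiable at z within Up \<union> ball 0 r"
      by (rule field_differentiable_at_within)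
  qed
  moreover have "Im (H z) \<noteq> 0" if z: "z \<in> Up" for z
  proof
    assume im: "Im (H z) = 0"
    have a: "adm z" and zs: "z \<in> tube_strip" and y: "Im z \<noteq> 0" using z by (auto simp: Up_def adm_def)
    note W = ch[OF zs]
    define h where "h = Re (H z)"
    have "H z = of_real h" using im by (simp add: h_def complex_eq_iff)
    then have "leaf_det (snd (ch z)) \<gamma> \<gamma>2 z = of_real h * leaf_det (snd (ch z)) \<gamma> \<gamma>1 z"
      using D1[OF a W] unfolding H_def by (simp add: field_simps)
    then have "of_real (- h) * leaf_det (snd (ch z)) \<gamma> \<gamma>1 z + of_real 1 * leaf_det (snd (ch z)) \<gamma> \<gamma>2 z = 0" by simp
    from indep[OF zs y W this] show False by simp
  qed
  moreover have "\<gamma> x \<in> dom_of c0 \<and> J \<gamma> \<gamma>1 c0 x \<noteq> 0 \<and> H (of_real x) = of_real (J \<gamma> \<gamma>2 c0 x / J \<gamma> \<gamma>1 c0 x)" if x: "\<bar>x\<bar> < r" for x :: real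
  proof -
    have d: "\<gamma> x \<in> dom_of c0" "J \<gamma> \<gamma>1 c0 x \<noteq> 0" using r0(2) x r(2) by auto
    define z where "z = complex_of_real x"
    have a: "adm z" by (rule adm_ball) (use x in \<open>simp add: z_def\<close>)
    have zs: "z \<in> tube_strip" using a by (simp add: adm_def)
    note W = ch[OF zs]
    define h where "h = J \<gamma> \<gamma>2 c0 x / J \<gamma> \<gamma>1 c0 x"
    have d': "\<gamma> (Re z) \<in> dom_of c0" using d by (simp add: z_def)
    have "(- h) * J \<gamma> \<gamma>1 c0 (Re z) + 1 * J \<gamma> \<gamma>2 c0 (Re z) = 0" using d(2) by (simp add: h_def z_def)
    from leaf_det_real_axis[OF v zs W c0(1) d' _ this]
    have "of_real (- h) * leaf_det (snd (ch z)) \<gamma> \<gamma>1 z + of_real 1 * leaf_det (snd (ch z)) \<gamma> \<gamma>2 z = 0" by (simp add: z_def)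
    then have "leaf_det (snd (ch z)) \<gamma> \<gamma>2 z = of_real h * leaf_det (snd (ch z)) \<gamma> \<gamma>1 z" by (simp add: algebra_simps)
    then have "H z = of_real h" using D1[OF a W] unfolding H_def by simp
    then show ?thesis using d by (simp add: z_def h_def)
  qed
  ultimately show ?thesis using r(1) unfolding Up_def by blast
qed

end

section \<open>The curvature inequality\<close>

text \<open>A complex derivative can be computed along the real axis. Applied repeatedly, it turns
  real formulas valid on an interval into the higher complex derivatives at 0.\<close>

lemma deriv_on_real_axis:
  assumes F: "F holomorphic_on ball 0 r" and eq: "\<And>x::real. \<bar>x\<bar> < r \<Longrightarrow> F (of_real x) = of_real (f x)"
    and x: "\<bar>x\<bar> < r" and f: "(f has_real_derivative d) (at x)"
  shows "deriv F (of_real x) = of_real d"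
proof -
  have "of_real x \<in> ball (0::complex) r" using x by simp
  then have "(F has_field_derivative deriv F (of_real x)) (at (of_real x))"
    by (rule holomorphic_derivI[OF F open_ball])
  moreover have "((\<lambda>t. complex_of_real t) has_vector_derivative 1) (at x)"
    using has_vector_derivative_of_real[of "\<lambda>t. t" 1 "at x"] by simp
  ultimately have 1: "((\<lambda>t. F (of_real t)) has_vector_derivative deriv F (of_real x)) (at x)"
    using field_vector_diff_chain_at[of complex_of_real 1 x F] by (simp add: comp_def)
  have "((\<lambda>t. complex_of_real (f t)) has_vector_derivative of_real d) (at x)"
    by (rule has_vector_derivative_of_real[OF f])
  moreover have "open {t. \<bar>t\<bar> < r}" by (intro open_Collect_less continuous_intros)
  ultimately have "((\<lambda>t. F (of_real t)) has_vector_derivative of_real d) (at x)"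
    by (rule has_vector_derivative_transform_within_open) (use x eq in auto)
  with 1 show ?thesis by (rule vector_derivative_unique_at)
qed

text \<open>By the Wronskian identity the derivative of the quotient is \<open>1 / j\<^sup>2\<close>.\<close>

lemma jacobi_quotient_taylor:
  fixes j j' j2 j2' k k1 :: "real \<Rightarrow> real" and k2 r :: real
  assumes r: "0 < r"
    and j: "\<And>x. \<bar>x\<bar> < r \<Longrightarrow> (j has_real_derivative j' x) (at x)" "\<And>x. \<bar>x\<bar> < r \<Longrightarrow> (j' has_real_derivative - k x * j x) (at x)"
    and j2: "\<And>x. \<bar>x\<bar> < r \<Longrightarrow> (j2 has_real_derivative j2' x) (at x)"
    and wr: "\<And>x. \<bar>x\<bar> < r \<Longrightarrow> j x * j2' x - j2 x * j' x = 1"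
    and nz: "\<And>x. \<bar>x\<bar> < r \<Longrightarrow> j x \<noteq> 0"
    and k: "\<And>x. \<bar>x\<bar> < r \<Longrightarrow> (k has_real_derivative k1 x) (at x)" and k1: "(k1 has_real_derivative k2) (at 0)"
    and init: "j 0 = 1" "j' 0 = 0" "j2 0 = 0"
    and H: "H holomorphic_on ball 0 r" "\<And>x::real. \<bar>x\<bar> < r \<Longrightarrow> H (of_real x) = of_real (j2 x / j x)"
  shows "H 0 = 0" "deriv H 0 = 1" "(deriv ^^ 2) H 0 = 0" "(deriv ^^ 3) H 0 = of_real (2 * k 0)"
    "(deriv ^^ 4) H 0 = of_real (2 * k1 0)" "(deriv ^^ 5) H 0 = of_real (16 * (k 0)\<^sup>2 + 2 * k2)"
proof -
  note D = deriv_on_real_axis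
  have hol: "(deriv ^^ n) H holomorphic_on ball 0 r" for n
    by (rule holomorphic_higher_deriv[OF H(1) open_ball])
  \<comment> \<open>The first four derivatives of j2 / j, with j'' replaced by - k j after each
    differentiation.\<close>
  define h1 h2 h3 h4 where "h1 x = 1 / j x ^ 2" and "h2 x = - 2 * j' x / j x ^ 3"
    and "h3 x = 6 * j' x ^ 2 / j x ^ 4 + 2 * k x / j x ^ 2"
    and "h4 x = - 24 * j' x ^ 3 / j x ^ 5 - 16 * (k x * j' x) / j x ^ 3 + 2 * k1 x / j x ^ 2" for x
  have d1: "((\<lambda>x. j2 x / j x) has_real_derivative h1 x) (at x)" if x: "\<bar>x\<bar> < r" for x
  proof -
    have "((\<lambda>x. j2 x / j x) has_real_derivative (j2' x * j x - j2 x * j' x) / (j x * j x)) (at x)"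
      by (rule DERIV_divide[OF j2[OF x] j(1)[OF x] nz[OF x]])
    moreover have "j2' x * j x - j2 x * j' x = 1" using wr[OF x] by (simp add: mult.commute)
    ultimately show ?thesis by (simp add: h1_def power2_eq_square)
  qed
  have d2: "(h1 has_real_derivative h2 x) (at x)" if x: "\<bar>x\<bar> < r" for x
    unfolding h1_def[abs_def] h2_def
    by (rule derivative_eq_intros refl j(1)[OF x] | use nz[OF x] in \<open>simp add: field_simps eval_nat_numeral\<close>)+
  have d3: "(h2 has_real_derivative h3 x) (at x)" if x: "\<bar>x\<bar> < r" for x
    unfolding h2_def[abs_def] h3_def
    by (rule derivative_eq_intros refl j[OF x] | use nz[OF x] in \<open>simp add: field_simps eval_nat_numeral\<close>)+
  have d4: "(h3 has_real_derivative h4 x) (at x)" if x: "\<bar>x\<bar> < r" for x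
    unfolding h3_def[abs_def] h4_def
    by (rule derivative_eq_intros refl j[OF x] k[OF x] | use nz[OF x] in \<open>simp add: field_simps eval_nat_numeral\<close>)+
  \<comment> \<open>At 0, where j = 1 and j' = 0, only the derivative of j' in the middle term and
    that of k1 in the last survive: - 16 k (- k) + 2 k2.\<close>
  have d5: "(h4 has_real_derivative 16 * (k 0)\<^sup>2 + 2 * k2) (at 0)"
  proof -
    have 0: "\<bar>0::real\<bar> < r" using r by simp
    show ?thesis unfolding h4_def[abs_def]
      by (rule derivative_eq_intros refl j[OF 0] k[OF 0] k1 | simp add: init power2_eq_square)+
  qed
  have e1: "(deriv ^^ 1) H (of_real x) = of_real (h1 x)" if "\<bar>x\<bar> < r" for x
    using D[OF H that d1[OF that]] by simp
  have e2: "(deriv ^^ 2) H (of_real x) = of_real (h2 x)" if "\<bar>x\<bar> < r" for x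
    using D[OF hol e1 that d2[OF that]] by (simp add: eval_nat_numeral)
  have e3: "(deriv ^^ 3) H (of_real x) = of_real (h3 x)" if "\<bar>x\<bar> < r" for x
    using D[OF hol e2 that d3[OF that]] by (simp add: eval_nat_numeral)
  have e4: "(deriv ^^ 4) H (of_real x) = of_real (h4 x)" if "\<bar>x\<bar> < r" for x
    using D[OF hol e3 that d4[OF that]] by (simp add: eval_nat_numeral)
  have 0: "\<bar>0::real\<bar> < r" using r by simp
  have e5: "(deriv ^^ 5) H 0 = of_real (16 * (k 0)\<^sup>2 + 2 * k2)"
    using D[OF hol e4 0 d5] by (simp add: eval_nat_numeral)
  show "H 0 = 0" using H(2)[OF 0] init by simp
  show "deriv H 0 = 1" using e1[OF 0] init by (simp add: h1_def)
  show "(deriv ^^ 2) H 0 = 0" using e2[OF 0] init by (simp add: h2_def)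
  show "(deriv ^^ 3) H 0 = of_real (2 * k 0)" using e3[OF 0] init by (simp add: h3_def)
  show "(deriv ^^ 4) H 0 = of_real (2 * k1 0)" using e4[OF 0] init by (simp add: h4_def)
  show "(deriv ^^ 5) H 0 = of_real (16 * (k 0)\<^sup>2 + 2 * k2)" by (rule e5)
qed

text \<open>Im H has no zero on the connected strip, hence one sign. Since H z / z tends to 1 at 0,
  that sign is positive at points \<i> x with x > 0 small.\<close>

lemma Im_positive_on_strip:
  assumes p: "0 < p" and r: "0 < r" and H: "H holomorphic_on strip p \<union> ball 0 r"
    and nz: "\<And>z. z \<in> strip p \<Longrightarrow> Im (H z) \<noteq> 0" and H0: "H 0 = 0" "deriv H 0 = 1" and z: "z \<in> strip p"
  shows "Im (H z) > 0"
proof (rule ccontr)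
  assume "\<not> Im (H z) > 0"
  then have neg: "Im (H z) < 0" using nz[OF z] by linarith
  have "(H has_field_derivative 1) (at 0)"
    using holomorphic_derivI[OF H, of 0] open_strip r H0 by auto
  then have "((\<lambda>w. H w / w) \<longlongrightarrow> 1) (at 0)" using H0 by (simp add: has_field_derivative_iff)
  moreover have "filterlim (\<lambda>x::real. \<i> * complex_of_real x) (at 0) (at_right 0)"
    unfolding filterlim_at by (auto simp: eventually_at_filter intro!: tendsto_eq_intros)
  ultimately have "((\<lambda>x::real. H (\<i> * of_real x) / (\<i> * of_real x)) \<longlongrightarrow> 1) (at_right 0)"
    by (rule filterlim_compose)
  then have "((\<lambda>x::real. Re (H (\<i> * of_real x) / (\<i> * of_real x))) \<longlongrightarrow> Re 1) (at_right 0)"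
    by (rule tendsto_Re)
  then have "\<forall>\<^sub>F x in at_right 0. Re (H (\<i> * of_real x) / (\<i> * of_real x)) > 0"
    by (rule order_tendstoD) simp
  moreover have "\<forall>\<^sub>F x in at_right 0. x \<in> {0<..<pi / p}"
    by (rule eventually_at_right_real) (use p in simp)
  ultimately have "\<forall>\<^sub>F x in at_right 0. Re (H (\<i> * of_real x) / (\<i> * of_real x)) > 0 \<and> x \<in> {0<..<pi / p}"
    by (rule eventually_conj)
  from eventually_happens'[OF trivial_limit_at_right_real this]
  obtain x where x: "Re (H (\<i> * of_real x) / (\<i> * of_real x)) > 0" "0 < x" "x < pi / p" by auto
  define w where "w = \<i> * complex_of_real x"
  have w: "w \<in> strip p" using x by (simp add: w_def strip_def)
  have "H w / w = - \<i> * H w / of_real x" using x(2) by (simp add: w_def field_simps)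
  then have pos: "Im (H w) > 0" using x(1,2) by (simp add: w_def[symmetric] zero_less_divide_iff)
  have "continuous_on (strip p) (\<lambda>z. Im (H z))"
    by (intro continuous_intros holomorphic_on_imp_continuous_on holomorphic_on_subset[OF H]) auto
  then have "connected ((\<lambda>z. Im (H z)) ` strip p)" by (rule connected_continuous_image[OF _ connected_strip])
  then have "0 \<in> (\<lambda>z. Im (H z)) ` strip p"
    by (rule connectedD_interval[of _ "Im (H z)" "Im (H w)"]) (use z w neg pos in auto)
  then show False using nz by auto
qed

text \<open>The last part is the completeness relation of an orthonormal frame. It turns traces with
  the inverse metric, such as the Laplacian and the squared gradient, into sums over two unit
  directions.\<close>

lemma (in chart_metric) orthonormal_frame:
  assumes x: "x \<in> \<Omega>"
  shows "\<exists>v w. v \<bullet> (G x *v v) = 1 \<and> w \<bullet> (G x *v w) = 1 \<and>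
    (\<forall>i j. matrix_inv (G x) $ i $ j = v $ i * v $ j + w $ i * w $ j)"
proof -
  define e f h d where "e = G x $ 1 $ 1" and "f = G x $ 1 $ 2" and "h = G x $ 2 $ 2" and "d = det (G x)"
  have g21: "G x $ 2 $ 1 = f" using G_sym[OF x, of 2 1] by (simp add: f_def)
  have e: "e > 0" and d: "d > 0" using G11_pos[OF x] det_pos[OF x] by (simp_all add: e_def d_def)
  have dd: "d = e * h - f * f" using det_eq[of x] g21 by (simp add: d_def e_def f_def h_def)
  define s t where "s = sqrt e" and "t = sqrt (e * d)"
  have s: "s > 0" "s * s = e" and t: "t > 0" "t * t = e * d" using e d by (simp_all add: s_def t_def)
  \<comment> \<open>Gram-Schmidt on the coordinate vectors: (- f, e) is orthogonal to the first one
    and has squared length e d.\<close>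
  define v w :: "real^2" where "v = vector [1 / s, 0]" and "w = vector [- f / t, e / t]"
  have "v \<bullet> (G x *v v) = e / (s * s)" unfolding quad by (simp add: v_def e_def)
  then have v: "v \<bullet> (G x *v v) = 1" using e by (simp add: s)
  have "w \<bullet> (G x *v w) = e * d / (t * t)"
    unfolding quad g21 e_def[symmetric] f_def[symmetric] h_def[symmetric] dd using t(1) by (simp add: w_def field_simps)
  then have w: "w \<bullet> (G x *v w) = 1" using e d by (simp add: t)
  have vv: "v $ 1 * v $ 1 = 1 / e" "v $ 2 = 0" and ww: "w $ 1 * w $ 1 = f * f / (e * d)" "w $ 1 * w $ 2 = - f / d"
    "w $ 2 * w $ 1 = - f / d" "w $ 2 * w $ 2 = e / d"
    using e d by (simp_all add: v_def w_def s t)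
  have "1 / e + f * f / (e * d) = h / d" using e d by (simp add: field_simps) (simp add: dd algebra_simps)
  then have "\<forall>i j. matrix_inv (G x) $ i $ j = v $ i * v $ j + w $ i * w $ j"
    unfolding forall_2 inv_G[OF x] e_def[symmetric] f_def[symmetric] h_def[symmetric] d_def[symmetric]
    by (simp add: vv ww)
  with v w show ?thesis by (intro exI conjI)
qed

context adapted
begin

text \<open>\<open>pick_taylor_inequality\<close> for the Jacobi quotient, multiplied by 2160 to
  clear denominators. Only pi / p \<le> R is required, not equality, so that infinite R is covered
  for every p.\<close>

lemma geodesic_inequality:
  fixes k1 :: "real \<Rightarrow> real"
  assumes comp: "complete_metric A g" and c: "c \<in> A" "\<gamma> 0 \<in> dom_of c" and us: "unit_speed_geodesic A g \<gamma>"
    and p: "0 < p" "ereal (pi / p) \<le> R"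
    and k: "\<And>t. \<gamma> t \<in> dom_of c \<Longrightarrow> ((\<lambda>t. curv c (map_of_chart c (\<gamma> t))) has_real_derivative k1 t) (at t)"
    and k2: "(k1 has_real_derivative k2) (at 0)"
    and K: "K = curv c (map_of_chart c (\<gamma> 0))"
  shows "16 * K ^ 3 + 12 * K * k2 - 15 * (k1 0)\<^sup>2 + (3 * k2 + 24 * K\<^sup>2) * p\<^sup>2 + 9 * K * p ^ 4 + p ^ 6 \<ge> 0"
proof -
  from jacobi_basis[OF comp c(1) us c(2)] obtain \<gamma>1 \<gamma>2 where v: "is_variation \<gamma> \<gamma>1" "is_variation \<gamma> \<gamma>2"
    and init: "J \<gamma> \<gamma>1 c 0 = 1" "J' \<gamma> \<gamma>1 c 0 = 0" "J \<gamma> \<gamma>2 c 0 = 0" "J' \<gamma> \<gamma>2 c 0 = 1" by (elim exE conjE)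
  have "0 < ereal (pi / p)" using p(1) by simp
  then have R: "0 < R" using p(2) by (rule less_le_trans)
  from jacobi_quotient_extension[OF v c init R] obtain H r where r: "0 < r"
    and hol: "H holomorphic_on (tube_strip \<inter> {z. Im z > 0}) \<union> ball 0 r"
    and nz: "\<forall>z\<in>tube_strip \<inter> {z. Im z > 0}. Im (H z) \<noteq> 0"
    and re: "\<forall>x::real. \<bar>x\<bar> < r \<longrightarrow> \<gamma> x \<in> dom_of c \<and> J \<gamma> \<gamma>1 c x \<noteq> 0 \<and> H (of_real x) = of_real (J \<gamma> \<gamma>2 c x / J \<gamma> \<gamma>1 c x)"
    by (elim exE conjE)
  have sub: "strip p \<subseteq> tube_strip \<inter> {z. Im z > 0}"
  proof
    fix z assume z: "z \<in> strip p"
    then have "ereal \<bar>Im z\<bar> < ereal (pi / p)" by (simp add: strip_def)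
    then have "ereal \<bar>Im z\<bar> < R" using p(2) by (rule less_le_trans)
    then show "z \<in> tube_strip \<inter> {z. Im z > 0}" using z by (simp add: tube_strip_def strip_def)
  qed
  have holp: "H holomorphic_on strip p \<union> ball 0 r" by (rule holomorphic_on_subset[OF hol]) (use sub in blast)
  have holb: "H holomorphic_on ball 0 r" by (rule holomorphic_on_subset[OF holp]) blast
  have d: "\<gamma> x \<in> dom_of c" "J \<gamma> \<gamma>1 c x \<noteq> 0" "H (of_real x) = of_real (J \<gamma> \<gamma>2 c x / J \<gamma> \<gamma>1 c x)" if "\<bar>x\<bar> < r" for x :: real
    using re that by blast+
  have wr: "J \<gamma> \<gamma>1 c x * J' \<gamma> \<gamma>2 c x - J \<gamma> \<gamma>2 c x * J' \<gamma> \<gamma>1 c x = 1" if "\<bar>x\<bar> < r" for x :: real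
    using wronskian[OF v c(1) d(1)[OF that] c] init by simp
  note T = jacobi_quotient_taylor[of r "J \<gamma> \<gamma>1 c" "J' \<gamma> \<gamma>1 c" "\<lambda>t. curv c (map_of_chart c (\<gamma> t))" "J \<gamma> \<gamma>2 c" "J' \<gamma> \<gamma>2 c" k1 k2 H,
      OF r J_derivative(1)[OF v(1) c(1) d(1)] J_derivative(2)[OF v(1) c(1) d(1)] J_derivative(1)[OF v(2) c(1) d(1)]
        wr d(2) k[OF d(1)] k2 init(1,2,3) holb d(3)]
  have pos: "Im (H z) > 0" if "z \<in> strip p" for z
    by (rule Im_positive_on_strip[OF p(1) r holp _ T(1,2) that]) (use nz sub in blast)
  have real: "Im (H (of_real x)) = 0" if "\<bar>x\<bar> < r" for x :: real
    unfolding d(3)[OF that] by (rule Im_complex_of_real)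
  \<comment> \<open>The derivatives 2 K, 2 k1 and 16 K^2 + 2 k2 from
    \<open>jacobi_quotient_taylor\<close>, divided by 3!, 4! and 5!.\<close>
  define f3 f4 f5 where "f3 = K / 3" and "f4 = k1 0 / 12" and "f5 = (k2 + 8 * K\<^sup>2) / 60"
  have "(f3 + p\<^sup>2 / 12) * (f5 - f3\<^sup>2 - p^4 / 720) - f4\<^sup>2 + (f3 + p\<^sup>2 / 12)\<^sup>2 * p\<^sup>2 / 12 \<ge> 0"
  proof (rule pick_taylor_inequality[OF p(1) r holp pos real T(1,2,3)])
    show "(deriv ^^ 3) H 0 = of_real (6 * f3)" using T(4) by (simp add: f3_def K)
    show "(deriv ^^ 4) H 0 = of_real (24 * f4)" using T(5) by (simp add: f4_def)
    have "16 * K\<^sup>2 + 2 * k2 = 120 * f5" by (simp add: f5_def)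
    then show "(deriv ^^ 5) H 0 = of_real (120 * f5)" using T(6)[folded K] by simp
  qed
  then have "2160 * ((f3 + p\<^sup>2 / 12) * (f5 - f3\<^sup>2 - p^4 / 720) - f4\<^sup>2 + (f3 + p\<^sup>2 / 12)\<^sup>2 * p\<^sup>2 / 12) \<ge> 0" by (rule mult_nonneg_nonneg[rotated]) simp
  also have "2160 * ((f3 + p\<^sup>2 / 12) * (f5 - f3\<^sup>2 - p^4 / 720) - f4\<^sup>2 + (f3 + p\<^sup>2 / 12)\<^sup>2 * p\<^sup>2 / 12) =
      16 * K ^ 3 + 12 * K * k2 - 15 * (k1 0)\<^sup>2 + (3 * k2 + 24 * K\<^sup>2) * p\<^sup>2 + 9 * K * p ^ 4 + p ^ 6"
    by (simp add: f3_def f4_def f5_def field_simps eval_nat_numeral)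
  finally show ?thesis .
qed

text \<open>Along a geodesic the second derivative of a function is its Hessian in the direction of
  the velocity: the acceleration supplies exactly the Christoffel term of
  \<open>hessian\<close>.\<close>

lemma direction_inequality:
  assumes comp: "complete_metric A g" and c: "c \<in> A" and x: "x \<in> \<Omega> c" and v: "v \<bullet> (g c x *v v) = 1"
    and p: "0 < p" "ereal (pi / p) \<le> R"
  defines "K \<equiv> curv c x" and "k1 \<equiv> \<Sum>j\<in>UNIV. v $ j * partial j (curv c) x"
    and "k2 \<equiv> \<Sum>i\<in>UNIV. \<Sum>j\<in>UNIV. v $ i * v $ j * hessian (g c) (curv c) i j x"
  shows "16 * K ^ 3 + 12 * K * k2 - 15 * k1\<^sup>2 + (3 * k2 + 24 * K\<^sup>2) * p\<^sup>2 + 9 * K * p ^ 4 + p ^ 6 \<ge> 0"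
proof -
  interpret C: chart_metric "g c" "\<Omega> c" by (rule chart_metric_chart[OF c])
  from geodesic_from[OF comp c x, of v] obtain \<gamma> where
    \<gamma>: "geodesic A g \<gamma>" "\<gamma> 0 \<in> dom_of c" "state c \<gamma> 0 = (x, v)" by (elim exE conjE)
  have us: "unit_speed_geodesic A g \<gamma>" by (rule unit_speedI[OF \<gamma>(1) c \<gamma>(2)]) (simp add: \<gamma>(3) v)
  have x0: "map_of_chart c (\<gamma> 0) = x" using \<gamma>(3) by (simp add: state_def)
  define q where "q t = (\<Sum>j\<in>UNIV. snd (state c \<gamma> t) $ j * partial j (curv c) (map_of_chart c (\<gamma> t)))" for t
  have du: "((\<lambda>t. map_of_chart c (\<gamma> t)) has_vector_derivative snd (state c \<gamma> t)) (at t)" if "\<gamma> t \<in> dom_of c" for t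
    using geodesic_differentiable[OF \<gamma>(1) c that] by (simp add: comp_def)
  have dfun: "((\<lambda>t. f (map_of_chart c (\<gamma> t))) has_real_derivative (\<Sum>l\<in>UNIV. snd (state c \<gamma> t) $ l * partial l f (map_of_chart c (\<gamma> t)))) (at t)"
    if "\<gamma> t \<in> dom_of c" "f differentiable (at (map_of_chart c (\<gamma> t)))" for f :: "real^2 \<Rightarrow> real" and t
    using vector_derivative_diff_chain_within[OF du[OF that(1)] has_derivative_at_withinI[OF differentiable_has_derivative_partial[OF that(2)]]]
    by (simp add: comp_def has_real_derivative_iff_has_vector_derivative)
  have diff_upto: "diff_upto 2 (curv c) (\<Omega> c)" by (rule C.diff_upto_\<kappa>)
  have kd: "((\<lambda>t. curv c (map_of_chart c (\<gamma> t))) has_real_derivative q t) (at t)" if t: "\<gamma> t \<in> dom_of c" for t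
  proof -
    have "map_of_chart c (\<gamma> t) \<in> \<Omega> c" using t by blast
    then have "curv c differentiable (at (map_of_chart c (\<gamma> t)))" using diff_upto by (auto simp: eval_nat_numeral simp del: image_iff)
    from dfun[OF t this] show ?thesis by (simp add: q_def)
  qed
  have pd: "((\<lambda>t. partial j (curv c) (map_of_chart c (\<gamma> t))) has_real_derivative (\<Sum>i\<in>UNIV. v $ i * partial i (partial j (curv c)) x)) (at 0)" for j
  proof -
    have "diff_upto 1 (partial j (curv c)) (\<Omega> c)" using diff_upto by (simp add: eval_nat_numeral)
    then have "\<forall>x\<in>\<Omega> c. partial j (curv c) differentiable (at x)" by simp
    then have "partial j (curv c) differentiable (at (map_of_chart c (\<gamma> 0)))" using \<gamma>(2) by blast
    from dfun[OF \<gamma>(2) this] show ?thesis by (simp add: \<gamma>(3) x0)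
  qed
  have sd: "((\<lambda>t. snd (state c \<gamma> t) $ k) has_real_derivative - (\<Sum>i\<in>UNIV. \<Sum>j\<in>UNIV. christoffel (g c) k i j x * v $ i * v $ j)) (at 0)" for k
    using bounded_linear.has_vector_derivative[OF bounded_linear_vec_nth
        bounded_linear.has_vector_derivative[OF bounded_linear_snd state_derivative[OF \<gamma>(1) c \<gamma>(2)]], of k]
    by (simp add: \<gamma>(3) C.spray_def has_real_derivative_iff_has_vector_derivative)
  have q2: "(q has_real_derivative k2) (at 0)"
    unfolding q_def[abs_def] sum_2
    by (rule DERIV_cong, (rule DERIV_add DERIV_mult pd sd)+)
      (simp add: k2_def hessian_def \<gamma>(3) x0 sum_2 algebra_simps)
  have q0: "q 0 = k1" by (simp add: q_def k1_def \<gamma>(3) x0)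
  show ?thesis
    using geodesic_inequality[where ?k1.0 = q and K = K, OF comp c \<gamma>(2) us p kd q2] q0 by (simp add: K_def x0)
qed

text \<open>Adds the inequalities for the two vectors of an orthonormal frame: the Hessians sum to
  the Laplacian, the squared directional derivatives to the squared gradient, and the remaining
  terms double.\<close>

lemma frame_inequality:
  assumes comp: "complete_metric A g" and c: "c \<in> A" and x: "x \<in> \<Omega> c" and p: "0 < p" "ereal (pi / p) \<le> R"
  defines "K \<equiv> curv c x"
    and "L \<equiv> \<Sum>i\<in>UNIV. \<Sum>j\<in>UNIV. matrix_inv (g c x) $ i $ j * hessian (g c) (curv c) i j x"
    and "N \<equiv> \<Sum>i\<in>UNIV. \<Sum>j\<in>UNIV. matrix_inv (g c x) $ i $ j * (partial i (curv c) x * partial j (curv c) x)"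
  shows "32 * K ^ 3 + 12 * K * L - 15 * N + (3 * L + 48 * K\<^sup>2) * p\<^sup>2 + 18 * K * p ^ 4 + 2 * p ^ 6 \<ge> 0"
proof -
  interpret C: chart_metric "g c" "\<Omega> c" by (rule chart_metric_chart[OF c])
  from C.orthonormal_frame[OF x] obtain v w where v: "v \<bullet> (g c x *v v) = 1" and w: "w \<bullet> (g c x *v w) = 1"
    and vw: "\<forall>i j. matrix_inv (g c x) $ i $ j = v $ i * v $ j + w $ i * w $ j" by (elim exE conjE)
  have inv: "matrix_inv (g c x) $ i $ j = v $ i * v $ j + w $ i * w $ j" for i j using vw by blast
  define H where "H u = (\<Sum>i\<in>UNIV. \<Sum>j\<in>UNIV. u $ i * u $ j * hessian (g c) (curv c) i j x)" for u :: "real^2"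
  define D where "D u = (\<Sum>j\<in>UNIV. u $ j * partial j (curv c) x)" for u :: "real^2"
  have L: "L = H v + H w" unfolding L_def H_def inv sum_2 by (simp add: algebra_simps)
  have N: "N = (D v)\<^sup>2 + (D w)\<^sup>2" unfolding N_def D_def inv sum_2 by (simp add: algebra_simps power2_eq_square)
  have "16 * K ^ 3 + 12 * K * H u - 15 * (D u)\<^sup>2 + (3 * H u + 24 * K\<^sup>2) * p\<^sup>2 + 9 * K * p ^ 4 + p ^ 6 \<ge> 0"
    if "u \<bullet> (g c x *v u) = 1" for u
    using direction_inequality[OF comp c x that p] by (simp add: H_def D_def K_def)
  from this[OF v] this[OF w] show ?thesis unfolding L N by (simp add: algebra_simps)
qed

section \<open>Laplacian and gradient of the curvature in a chart\<close>

lemma curvature_chart: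
  assumes "complete_metric A g" "c \<in> A" "x \<in> \<Omega> c"
  shows "(gauss_curvature A g \<circ> inv_chart c) x = curv c x"
  using gauss_curvature_eq[OF assms(1,2) inv_dom[OF assms(2,3)]] map_inv[OF assms(2,3)] by simp

lemma partial_curvature_chart:
  assumes "complete_metric A g" "c \<in> A" "x \<in> \<Omega> c"
  shows "partial j (gauss_curvature A g \<circ> inv_chart c) x = partial j (curv c) x"
  by (rule partial_cong(2)[OF open_\<Omega>[OF assms(2)] assms(3) curvature_chart[OF assms(1,2)]])

lemma hessian_cong:
  assumes "open S" "x \<in> S" "\<And>y. y \<in> S \<Longrightarrow> f y = f' y"
  shows "hessian G f i j x = hessian G f' i j x"
  unfolding hessian_def
  using partial_cong(2)[OF assms] partial_cong(2)[OF assms(1,2) partial_cong(2)[OF assms(1) _ assms(3)]] by simp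

lemma laplacian_curvature:
  fixes q :: 'a
  assumes comp: "complete_metric A g"
  defines "c \<equiv> chart_at A q" and "x \<equiv> map_of_chart (chart_at A q) q"
  shows "laplacian A g (gauss_curvature A g) q =
    (\<Sum>i\<in>UNIV. \<Sum>j\<in>UNIV. matrix_inv (g c x) $ i $ j * hessian (g c) (curv c) i j x)"
proof -
  have c: "c \<in> A" "x \<in> \<Omega> c" using chart_at by (simp_all add: c_def x_def)
  have "hessian (g c) (gauss_curvature A g \<circ> inv_chart c) i j x = hessian (g c) (curv c) i j x" for i j
    by (rule hessian_cong[OF open_\<Omega>[OF c(1)] c(2)]) (rule curvature_chart[OF comp c(1)])
  then show ?thesis
    unfolding laplacian_def Let_def c_def[symmetric] x_def[symmetric, folded c_def] by simp
qed

text \<open>Leibniz rule: the Hessian of the square is twice the function times its Hessian plus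
  twice the product of first derivatives, whose trace is the squared gradient.\<close>

lemma laplacian_curvature_square:
  fixes q :: 'a
  assumes comp: "complete_metric A g"
  defines "c \<equiv> chart_at A q" and "x \<equiv> map_of_chart (chart_at A q) q"
  shows "laplacian A g (\<lambda>q. (gauss_curvature A g q)\<^sup>2) q =
    2 * curv c x * laplacian A g (gauss_curvature A g) q +
    2 * (\<Sum>i\<in>UNIV. \<Sum>j\<in>UNIV. matrix_inv (g c x) $ i $ j * (partial i (curv c) x * partial j (curv c) x))"
proof -
  have c: "c \<in> A" "x \<in> \<Omega> c" using chart_at by (simp_all add: c_def x_def)
  interpret C: chart_metric "g c" "\<Omega> c" by (rule chart_metric_chart[OF c(1)])
  have diff_upto: "diff_upto 2 (curv c) (\<Omega> c)" by (rule C.diff_upto_\<kappa>)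
  have d1: "curv c differentiable (at y)" if "y \<in> \<Omega> c" for y
    using diff_upto that by (auto simp: eval_nat_numeral simp del: image_iff)
  have d2: "partial j (curv c) differentiable (at y)" if "y \<in> \<Omega> c" for j y
  proof -
    have "diff_upto 1 (partial j (curv c)) (\<Omega> c)" using diff_upto by (simp add: eval_nat_numeral)
    then show ?thesis using that by auto
  qed
  have p1: "partial j (\<lambda>y. curv c y * curv c y) y = 2 * (curv c y * partial j (curv c) y)" if "y \<in> \<Omega> c" for j y
    using partial_mult[OF d1[OF that] d1[OF that]] by simp
  have p2: "partial i (partial j (\<lambda>y. curv c y * curv c y)) x =
      2 * (curv c x * partial i (partial j (curv c)) x + partial i (curv c) x * partial j (curv c) x)" for i j
  proof -
    have "partial i (partial j (\<lambda>y. curv c y * curv c y)) x =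
        partial i (\<lambda>y. curv c y * (2 * partial j (curv c) y)) x"
      by (rule partial_cong(2)[OF C.open_\<Omega> c(2)]) (simp add: p1)
    also have "\<dots> = curv c x * partial i (\<lambda>y. 2 * partial j (curv c) y) x + partial i (curv c) x * (2 * partial j (curv c) x)"
      using d1[OF c(2)] d2[OF c(2)] by (intro partial_mult) auto
    also have "partial i (\<lambda>y. 2 * partial j (curv c) y) x = 2 * partial i (partial j (curv c)) x"
      using partial_mult[OF _ d2[OF c(2)], of "\<lambda>_. 2" i j] by (simp add: partial_def)
    finally show ?thesis by (simp add: algebra_simps)
  qed
  have "hessian (g c) ((\<lambda>q. (gauss_curvature A g q)\<^sup>2) \<circ> inv_chart c) i j x =
      hessian (g c) (\<lambda>y. curv c y * curv c y) i j x" for i j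
    by (rule hessian_cong[OF C.open_\<Omega> c(2)])
      (use curvature_chart[OF comp c(1)] in \<open>simp add: power2_eq_square\<close>)
  also have "hessian (g c) (\<lambda>y. curv c y * curv c y) i j x =
      2 * curv c x * hessian (g c) (curv c) i j x + 2 * (partial i (curv c) x * partial j (curv c) x)" for i j
    unfolding hessian_def p2 p1[OF c(2)] by (simp add: sum_distrib_left algebra_simps)
  finally have h: "hessian (g c) ((\<lambda>q. (gauss_curvature A g q)\<^sup>2) \<circ> inv_chart c) i j x =
      2 * curv c x * hessian (g c) (curv c) i j x + 2 * (partial i (curv c) x * partial j (curv c) x)" for i j .
  show ?thesis
    unfolding laplacian_curvature[OF comp] c_def[symmetric] x_def[symmetric, folded c_def]
    unfolding laplacian_def Let_def c_def[symmetric] x_def[symmetric, folded c_def] h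
    by (simp add: sum_2 algebra_simps)
qed

text \<open>The gradient is w = G^(-1) d with d the differential, so its squared length w . G w is w
  . d. Positivity of G makes the square of the square root harmless.\<close>

lemma tnorm_grad_curvature:
  fixes q :: 'a
  assumes comp: "complete_metric A g"
  defines "c \<equiv> chart_at A q" and "x \<equiv> map_of_chart (chart_at A q) q"
  shows "(tnorm A g (grad A g (gauss_curvature A g) q))\<^sup>2 =
    (\<Sum>i\<in>UNIV. \<Sum>j\<in>UNIV. matrix_inv (g c x) $ i $ j * (partial i (curv c) x * partial j (curv c) x))"
proof -
  have c: "c \<in> A" "q \<in> dom_of c" "x \<in> \<Omega> c" using chart_at by (simp_all add: c_def x_def)
  interpret C: chart_metric "g c" "\<Omega> c" by (rule chart_metric_chart[OF c(1)])
  define d :: "real^2" where "d = (\<chi> j. partial j (curv c) x)"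
  define w where "w = matrix_inv (g c x) *v d"
  have w: "metric_inner A g (grad A g (gauss_curvature A g) q) (grad A g (gauss_curvature A g) q) = w \<bullet> (g c x *v w)"
    using c partial_curvature_chart[OF comp c(1,3)]
    by (simp add: metric_inner_def grad_def Let_def c_def[symmetric] x_def[symmetric, folded c_def] w_def d_def)
  have "w \<bullet> (g c x *v w) \<ge> 0" using C.pos[OF c(3), of w] by (cases "w = 0") auto
  moreover have "g c x *v w = d"
  proof -
    have "det (g c x) \<noteq> 0" using C.det_pos[OF c(3)] by simp
    then obtain B where "g c x ** B = mat 1" by (auto simp: invertible_det_nz[symmetric] invertible_def)
    then have "g c x ** matrix_inv (g c x) = mat 1" using matrix_inv_eqI[of "g c x" B] by simp
    then show ?thesis by (simp add: w_def matrix_vector_mul_assoc)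
  qed
  moreover have "w \<bullet> d = (\<Sum>i\<in>UNIV. \<Sum>j\<in>UNIV. matrix_inv (g c x) $ i $ j * (partial i (curv c) x * partial j (curv c) x))"
    by (simp add: w_def d_def inner_vec_def matrix_vector_mult_def sum_2 algebra_simps)
  ultimately show ?thesis by (simp add: tnorm_def w)
qed

text \<open>With \<open>laplacian_curvature_square\<close>, 12 K L - 15 N equals 6 (2 K L + 2 N) -
  27 N. This is the source of the constant 27 and of the Laplacian of the square.\<close>

lemma curvature_inequality:
  fixes q :: 'a
  assumes comp: "complete_metric A g" and p: "0 < p" "ereal (pi / p) \<le> R"
  shows "27 * (tnorm A g (grad A g (gauss_curvature A g) q))\<^sup>2 \<le>
    32 * gauss_curvature A g q ^ 3 + 6 * laplacian A g (\<lambda>q. (gauss_curvature A g q)\<^sup>2) q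
    + (3 * laplacian A g (gauss_curvature A g) q + 48 * (gauss_curvature A g q)\<^sup>2) * p\<^sup>2
    + 18 * gauss_curvature A g q * p ^ 4 + 2 * p ^ 6"
proof -
  have c: "chart_at A q \<in> A" "map_of_chart (chart_at A q) q \<in> \<Omega> (chart_at A q)" using chart_at by simp_all
  define K L N where "K = gauss_curvature A g q" and "L = laplacian A g (gauss_curvature A g) q"
    and "N = (tnorm A g (grad A g (gauss_curvature A g) q))\<^sup>2"
  have "32 * K ^ 3 + 12 * K * L - 15 * N + (3 * L + 48 * K\<^sup>2) * p\<^sup>2 + 18 * K * p ^ 4 + 2 * p ^ 6 \<ge> 0"
    using frame_inequality[OF comp c p]
    unfolding K_def L_def N_def tnorm_grad_curvature[OF comp] laplacian_curvature[OF comp]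
      gauss_curvature_eq[OF comp chart_at, of q] .
  moreover have "laplacian A g (\<lambda>q. (gauss_curvature A g q)\<^sup>2) q = 2 * K * L + 2 * N"
    unfolding K_def L_def N_def tnorm_grad_curvature[OF comp] laplacian_curvature_square[OF comp]
      gauss_curvature_eq[OF comp chart_at, of q] ..
  ultimately show ?thesis unfolding K_def[symmetric] L_def[symmetric] N_def[symmetric]
    by (simp add: algebra_simps)
qed

end

theorem proposition9p2:
  fixes A :: "('a::{t2_space, second_countable_topology}, 2) chart set"
    and g :: "('a, 2) metric"
    and R :: ereal
    and \<sigma> :: "'a \<Rightarrow> real"
  assumes "analytic_atlas A"
    and "analytic_metric A g"
    and "complete_metric A g"
    and "\<sigma> = gauss_curvature A g"
    and "0 < R"
    and "\<exists>\<C>. adapted_complex_structure A g R \<C>"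
  shows "\<forall>p. 32 * \<sigma> p ^ 3 + 6 * laplacian A g (\<lambda>q. \<sigma> q ^ 2) p
           + (3 * laplacian A g \<sigma> p + 48 * \<sigma> p ^ 2) * pi_over R ^ 2
           + 18 * \<sigma> p * pi_over R ^ 4 + 2 * pi_over R ^ 6
         \<ge> 27 * (tnorm A g (grad A g \<sigma> p)) ^ 2"
proof
  fix q :: 'a
  from assms(6) obtain \<C> where \<C>: "adapted_complex_structure A g R \<C>" ..
  interpret adapted A g R \<C>
    by unfold_locales (use assms(1,2) \<C> in auto)
  have *: "27 * (tnorm A g (grad A g \<sigma> q)) ^ 2 \<le> 32 * \<sigma> q ^ 3 + 6 * laplacian A g (\<lambda>q. \<sigma> q ^ 2) q
           + (3 * laplacian A g \<sigma> q + 48 * \<sigma> q ^ 2) * p ^ 2 + 18 * \<sigma> q * p ^ 4 + 2 * p ^ 6"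
    if "0 < p" "ereal (pi / p) \<le> R" for p
    unfolding assms(4) by (rule curvature_inequality[OF assms(3) that])
  show "27 * (tnorm A g (grad A g \<sigma> q)) ^ 2 \<le> 32 * \<sigma> q ^ 3 + 6 * laplacian A g (\<lambda>q. \<sigma> q ^ 2) q
           + (3 * laplacian A g \<sigma> q + 48 * \<sigma> q ^ 2) * pi_over R ^ 2
           + 18 * \<sigma> q * pi_over R ^ 4 + 2 * pi_over R ^ 6"
  proof (cases R)
    case (real r)
    \<comment> \<open>For finite R the choice p = pi / R gives pi / p = R.\<close>
    then show ?thesis using assms(5) by (intro *) (simp_all add: pi_over_def)
  next
    case PInf
    let ?f = "\<lambda>p. 32 * \<sigma> q ^ 3 + 6 * laplacian A g (\<lambda>q. \<sigma> q ^ 2) q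
           + (3 * laplacian A g \<sigma> q + 48 * \<sigma> q ^ 2) * p ^ 2 + 18 * \<sigma> q * p ^ 4 + 2 * p ^ 6"
    \<comment> \<open>For infinite R every p > 0 is admissible, and the inequality is polynomial in
      p, so it passes to the limit p = 0.\<close>
    have "(?f \<longlongrightarrow> ?f 0) (at_right 0)" by (intro tendsto_intros)
    moreover have "\<forall>\<^sub>F p in at_right 0. 27 * (tnorm A g (grad A g \<sigma> q)) ^ 2 \<le> ?f p"
      using eventually_at_right_less[of 0] by eventually_elim (rule *, simp_all add: PInf)
    ultimately have "27 * (tnorm A g (grad A g \<sigma> q)) ^ 2 \<le> ?f 0"
      by (rule tendsto_lowerbound) simp
    then show ?thesis by (simp add: PInf pi_over_def)
  qed (use assms(5) in simp)
qed

end
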